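(* Let $X$ be a symplectic variety over $\mathbb{C}$ and let $G$ be a finite group acting on $X$ by symplectic automorphisms. For $g\in G$ let $\lambda_g=\det(1-g|_{N_{X^g}})^{1/2}\in\mathbb{C}^{\pi_0(X^g)}$ be the positive square root of the determinant of $1-g$ acting on $N_{X^g}$. Then: (1) for all $g,h\in G$, $(\lambda_g\lambda_h)^{-1}|_Y\,(\lambda_{gh}|_Y)=a(g,h)|_Y$ on shared components $Y$ between $X^{gh}$ and $X^g\cap X^h$; (2) for all $g,h\in G$ and every component $Z\subseteq X^g$, $\lambda_g|_Z=\lambda_{hgh^{-1}}|_{h(Z)}$.
   Context: A symplectic variety is a smooth quasi-projective variety with an algebraic symplectic form $\omega$; $\pi=\omega^{-1}\in\Gamma(X,\bigwedge^2T_X)$. $X^g$ is the (smooth, symplectic) fixed locus of $g$, and $N_{X^g}$ its normal bundle, identified with $(1-g)T_X|_{X^g}$ through the canonical splitting $T_X|_{X^g}=T_{X^g}\oplus N_{X^g}$ ($T_{X^g}$ being the $g$-invariants). $\mathbb{C}^{\pi_0(X^g)}$ denotes the global sections of the constant sheaf $\mathbb{C}$ on $X^g$; $\det(1-g|_{N_{X^g}})$ is a section of it with positive real values. Let $\pi_g^\perp\in\Gamma(X^g,\bigwedge^2N_{X^g})$ be the component of $\pi|_{X^g}$ along $N_{X^g}$, $d_g=\frac12\operatorname{codim}(X^g)$, and $\psi_g=\frac1{d_g!}(\pi_g^\perp)^{d_g}$, a global generator of the line bundle $\det(N_{X^g})$ (top exterior power). A shared component between $X^{gh}$ and $X^g\cap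 X^h$ is a component $Y$ of $X^g\cap X^h$ that is also a component of $X^{gh}$. The sum $\bigoplus_{g\in G}\det(N_{X^g})$ is a $G$-graded subalgebra, under cup product, of the local Hochschild cohomology $\bigoplus_{g\in G}\bigwedge^\bullet T_{X^g}\otimes\det(N_{X^g})$ of $[X/G]$. Its product $\det(N_{X^g})\otimes_{\mathscr{O}_X}\det(N_{X^h})\to\det(N_{X^{gh}})$ is nonvanishing only on those shared components $Y$ along which $X^g$ and $X^h$ intersect transversely, and there it equals $\det(\kappa)$, with $\kappa:N_{X^g}|_Y\oplus N_{X^h}|_Y\to N_{X^{gh}}|_Y$ the canonical isomorphism (include each summand in $T_X|_Y$ via the splitting and project to $N_{X^{gh}}|_Y$). The coefficient $a(g,h)$, a locally constant function on the disjoint union of the shared components $Y$, is defined by $\psi_g\cdot\psi_h|_Y=a(g,h)|_Y\,\psi_{gh}|_Y$ for this product.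
   Formalization: Part (1) is stated only for shared components Y along which X^g and X^h intersect transversely; on the other shared components the product, hence a(g,h), is zero while the left side is positive, so the identity fails there (e.g. g = h = diag(i,-i) on C^2). *)

theory Defs
  imports
    "HOL-Analysis.Analysis"
    "HOL-Combinatorics.Permutations"
    "HOL-Algebra.Group_Action"
    "HOL-Library.Function_Algebras"
begin

section \<open>Quasi-projective varieties over the complex numbers\<close>

text \<open>
  Varieties are classical (reduced, not necessarily irreducible or connected) varieties, given by
  their closed points. \<open>'n proj\<close> is the projective space of lines in \<open>complex ^ 'n\<close>, of dimension
  \<open>CARD('n) - 1\<close>.
\<close>

typedef ('n::finite) proj = "{L :: (complex ^ 'n) set. vec.subspace L \<and> vec.dim L = 1}"
  morphisms line Abs_proj
proof -
  obtain i :: 'n where True by simp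
  have "vec.dim (vec.span {axis i (1::complex)}) = 1"
    using vec.dim_eq_card_independent[of "{axis i (1::complex)}"]
    by (simp add: vec.dim_span axis_eq_0_iff)
  then show ?thesis by (blast intro: vec.subspace_span)
qed

definition hcoords :: "('n::finite) proj \<Rightarrow> (complex ^ 'n) set" where
  "hcoords p = line p - {0}"

inductive homogeneous :: "nat \<Rightarrow> (complex ^ 'n \<Rightarrow> complex) \<Rightarrow> bool" where
  const: "homogeneous 0 (\<lambda>_. c)"
| coord: "homogeneous 1 (\<lambda>v. v $ i)"
| add: "homogeneous d F \<Longrightarrow> homogeneous d H \<Longrightarrow> homogeneous d (\<lambda>v. F v + H v)"
| mult: "homogeneous d F \<Longrightarrow> homogeneous e H \<Longrightarrow> homogeneous (d + e) (\<lambda>v. F v * H v)"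

definition zariski :: "('n::finite) proj topology" where
  "zariski = topology_generated_by
     {{p. \<forall>v\<in>hcoords p. F v \<noteq> 0} | F. \<exists>d. homogeneous d F}"

abbreviation zariski_on :: "('n::finite) proj set \<Rightarrow> 'n proj topology" where
  "zariski_on S \<equiv> subtopology zariski S"

definition quasi_projective :: "('n::finite) proj set \<Rightarrow> bool" where
  "quasi_projective X \<longleftrightarrow> (\<exists>U C. openin zariski U \<and> closedin zariski C \<and> X = U \<inter> C)"

text \<open>
  The Jacobian criterion: near each of its points, \<open>X\<close> is the common zero locus of homogeneous
  polynomials whose differentials are linearly independent at that point. The differentials are
  taken on the affine cone; by Euler's formula they vanish on the line of the point, so that their
  independence is the independence of the differentials on projective space.
\<close>

definition partial :: "'n \<Rightarrow> (complex ^ ('n::finite) \<Rightarrow> complex) \<Rightarrow> complex ^ 'n \<Rightarrow> complex" where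
  "partial i F v = deriv (\<lambda>t. F (v + t *s axis i 1)) 0"

definition smooth :: "('n::finite) proj set \<Rightarrow> bool" where
  "smooth X \<longleftrightarrow> (\<forall>p\<in>X. \<exists>U Fs. openin zariski U \<and> p \<in> U \<and>
     (\<forall>F\<in>set Fs. \<exists>d. homogeneous d F) \<and>
     X \<inter> U = {q \<in> U. \<forall>F\<in>set Fs. \<forall>v\<in>hcoords q. F v = 0} \<and>
     (\<forall>v\<in>hcoords p. \<forall>c. (\<forall>i. (\<Sum>j<length Fs. c j * partial i (Fs ! j) v) = 0) \<longrightarrow>
        (\<forall>j<length Fs. c j = 0)))"

text \<open>Regular functions on a locally closed set; values outside that set are irrelevant.\<close>

definition regular_on :: "('n::finite) proj set \<Rightarrow> ('n proj \<Rightarrow> complex) \<Rightarrow> bool" where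
  "regular_on S f \<longleftrightarrow> (\<forall>p\<in>S. \<exists>V d F H. openin zariski V \<and> p \<in> V \<and>
     homogeneous d F \<and> homogeneous d H \<and>
     (\<forall>q\<in>V \<inter> S. \<forall>v\<in>hcoords q. H v \<noteq> 0 \<and> f q = F v / H v))"

definition regular_at :: "('n::finite) proj set \<Rightarrow> 'n proj \<Rightarrow> ('n proj \<Rightarrow> complex) \<Rightarrow> bool" where
  "regular_at X p f \<longleftrightarrow> (\<exists>U. openin (zariski_on X) U \<and> p \<in> U \<and> regular_on U f)"

definition same_germ ::
    "('n::finite) proj set \<Rightarrow> 'n proj \<Rightarrow> ('n proj \<Rightarrow> complex) \<Rightarrow> ('n proj \<Rightarrow> complex) \<Rightarrow> bool" where
  "same_germ X p f h \<longleftrightarrow> (\<exists>U. openin (zariski_on X) U \<and> p \<in> U \<and> (\<forall>q\<in>U. f q = h q))"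

definition regular_map :: "('n::finite) proj set \<Rightarrow> ('n proj \<Rightarrow> 'n proj) \<Rightarrow> bool" where
  "regular_map X s \<longleftrightarrow> continuous_map (zariski_on X) (zariski_on X) s \<and>
     (\<forall>U f. openin (zariski_on X) U \<and> regular_on U f \<longrightarrow> regular_on {p \<in> X. s p \<in> U} (f \<circ> s))"

definition algebraic_automorphism :: "('n::finite) proj set \<Rightarrow> ('n proj \<Rightarrow> 'n proj) \<Rightarrow> bool" where
  "algebraic_automorphism X s \<longleftrightarrow>
     bij_betw s X X \<and> regular_map X s \<and> regular_map X (inv_into X s)"


section \<open>Vector spaces of complex functions\<close>

text \<open>
  All vector spaces below are subspaces of a space of complex valued functions, with pointwise
  operations.
\<close>

interpretation cfun: vector_space "\<lambda>(c::complex) (v :: 'a \<Rightarrow> complex) x. c * v x"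
  by unfold_locales (auto simp: fun_eq_iff algebra_simps)

type_synonym 'a cvec = "'a \<Rightarrow> complex"

text \<open>Linear functionals on \<open>V\<close>, normalised to be 0 outside \<open>V\<close>.\<close>

definition dual :: "'a cvec set \<Rightarrow> ('a cvec \<Rightarrow> complex) set" where
  "dual V = {\<xi>. (\<forall>v\<in>V. \<forall>w\<in>V. \<xi> (\<lambda>x. v x + w x) = \<xi> v + \<xi> w) \<and>
     (\<forall>c. \<forall>v\<in>V. \<xi> (\<lambda>x. c * v x) = c * \<xi> v) \<and> (\<forall>v. v \<notin> V \<longrightarrow> \<xi> v = 0)}"

text \<open>
  The exterior power of a finite-dimensional \<open>V\<close> is modelled as the space of alternating
  \<open>k\<close>-linear forms on the dual of \<open>V\<close>, where the product of vectors \<open>v\<^sub>1, \<dots>, v\<^sub>k\<close> is the form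
  sending \<open>\<xi>\<^sub>1, \<dots>, \<xi>\<^sub>k\<close> to the determinant of the matrix of the \<open>\<xi>\<^sub>i(v\<^sub>j)\<close>. Elements of exterior
  powers of all degrees are functions on lists, and an element of degree \<open>k\<close> is 0 on lists which do
  not consist of \<open>k\<close> elements of the dual.
\<close>

type_synonym 'a multivector = "('a cvec \<Rightarrow> complex) list \<Rightarrow> complex"

definition ext_power :: "nat \<Rightarrow> 'a cvec set \<Rightarrow> 'a multivector set" where
  "ext_power k V = {\<alpha>.
     (\<forall>\<xi>s. \<not> (length \<xi>s = k \<and> set \<xi>s \<subseteq> dual V) \<longrightarrow> \<alpha> \<xi>s = 0) \<and>
     (\<forall>\<xi>s \<eta>s \<xi> \<eta>. Suc (length \<xi>s + length \<eta>s) = k \<and>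
         set \<xi>s \<subseteq> dual V \<and> set \<eta>s \<subseteq> dual V \<and> \<xi> \<in> dual V \<and> \<eta> \<in> dual V \<longrightarrow>
         \<alpha> (\<xi>s @ (\<lambda>v. \<xi> v + \<eta> v) # \<eta>s) = \<alpha> (\<xi>s @ \<xi> # \<eta>s) + \<alpha> (\<xi>s @ \<eta> # \<eta>s)) \<and>
     (\<forall>\<xi>s \<eta>s \<xi> c. Suc (length \<xi>s + length \<eta>s) = k \<and>
         set \<xi>s \<subseteq> dual V \<and> set \<eta>s \<subseteq> dual V \<and> \<xi> \<in> dual V \<longrightarrow>
         \<alpha> (\<xi>s @ (\<lambda>v. c * \<xi> v) # \<eta>s) = c * \<alpha> (\<xi>s @ \<xi> # \<eta>s)) \<and>
     (\<forall>\<xi>s. \<not> distinct \<xi>s \<longrightarrow> \<alpha> \<xi>s = 0)}"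

text \<open>The map of exterior powers induced by a linear map \<open>f\<close> from \<open>V\<close> to \<open>W\<close>.\<close>

definition ext_map ::
    "'a cvec set \<Rightarrow> 'a cvec set \<Rightarrow> ('a cvec \<Rightarrow> 'a cvec) \<Rightarrow> 'a multivector \<Rightarrow> 'a multivector" where
  "ext_map V W f \<alpha> = (\<lambda>\<xi>s. if set \<xi>s \<subseteq> dual W
     then \<alpha> (map (\<lambda>\<xi> v. if v \<in> V then \<xi> (f v) else 0) \<xi>s) else 0)"

definition ext_one :: "'a multivector" where
  "ext_one = (\<lambda>\<xi>s. if \<xi>s = [] then 1 else 0)"

text \<open>
  For \<open>\<alpha>\<close> and \<open>\<beta>\<close> of degrees \<open>k\<close> and \<open>l\<close>, only the term for \<open>k\<close> contributes, and only on lists of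
  length \<open>k + l\<close>; the factor \<open>1 / (k! l!)\<close> turns the sum over permutations into a sum over shuffles.
\<close>

definition wedge :: "'a multivector \<Rightarrow> 'a multivector \<Rightarrow> 'a multivector" where
  "wedge \<alpha> \<beta> = (\<lambda>\<xi>s. \<Sum>k\<le>length \<xi>s.
     (\<Sum>\<sigma> | \<sigma> permutes {..<length \<xi>s}. of_int (sign \<sigma>) *
        \<alpha> (take k (permute_list \<sigma> \<xi>s)) * \<beta> (drop k (permute_list \<sigma> \<xi>s)))
     / (fact k * fact (length \<xi>s - k)))"

text \<open>The scalar by which the endomorphism \<open>f\<close> of \<open>V\<close> acts on the top exterior power of \<open>V\<close>.\<close>

definition endo_det :: "'a cvec set \<Rightarrow> ('a cvec \<Rightarrow> 'a cvec) \<Rightarrow> complex" where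
  "endo_det V f = (THE c. \<forall>\<alpha>\<in>ext_power (cfun.dim V) V. ext_map V V f \<alpha> = (\<lambda>\<xi>s. c * \<alpha> \<xi>s))"


section \<open>Tangent spaces and symplectic varieties\<close>

text \<open>
  Tangent vectors are derivations on germs of regular functions. A derivation is a functional on
  all functions which depends only on the germ and is normalised to be 0 on functions which are not
  regular at the point.
\<close>

type_synonym 'n tangent = "('n proj \<Rightarrow> complex) cvec"

definition tangent_space :: "('n::finite) proj set \<Rightarrow> 'n proj \<Rightarrow> 'n tangent set" where
  "tangent_space X p = {D.
     (\<forall>f. \<not> regular_at X p f \<longrightarrow> D f = 0) \<and>
     (\<forall>f h. regular_at X p f \<and> regular_at X p h \<and> same_germ X p f h \<longrightarrow> D f = D h) \<and>
     (\<forall>f h. regular_at X p f \<and> regular_at X p h \<longrightarrow>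
        D (\<lambda>q. f q + h q) = D f + D h \<and>
        D (\<lambda>q. f q * h q) = f p * D h + h p * D f) \<and>
     (\<forall>f c. regular_at X p f \<longrightarrow> D (\<lambda>q. c * f q) = c * D f)}"

text \<open>The differential of an automorphism \<open>s\<close>, from the tangent space at \<open>p\<close> to the one at \<open>s p\<close>.\<close>

definition differential :: "(('n::finite) proj \<Rightarrow> 'n proj) \<Rightarrow> 'n tangent \<Rightarrow> 'n tangent" where
  "differential s D = (\<lambda>f. D (f \<circ> s))"

type_synonym 'n two_form = "'n proj \<Rightarrow> 'n tangent \<Rightarrow> 'n tangent \<Rightarrow> complex"

text \<open>
  Locally \<open>\<omega> = \<Sum> f dg \<and> dh\<close> with regular \<open>f, g, h\<close>, where \<open>dg(D) = D g\<close>, and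
  \<open>d\<omega> = \<Sum> df \<and> dg \<and> dh\<close> is 0. As \<open>d\<omega>\<close> does not depend on the local expression for \<open>\<omega>\<close>, it is
  enough to ask for one such expression near each point.
\<close>

definition closed_algebraic_form :: "('n::finite) proj set \<Rightarrow> 'n two_form \<Rightarrow> bool" where
  "closed_algebraic_form X \<omega> \<longleftrightarrow> (\<forall>p\<in>X. \<exists>U fgh. openin (zariski_on X) U \<and> p \<in> U \<and>
     (\<forall>(f, g, h)\<in>set fgh. regular_on U f \<and> regular_on U g \<and> regular_on U h) \<and>
     (\<forall>q\<in>U. \<forall>D\<in>tangent_space X q. \<forall>E\<in>tangent_space X q.
        \<omega> q D E = (\<Sum>(f, g, h)\<leftarrow>fgh. f q * (D g * E h - D h * E g))) \<and>
     (\<forall>q\<in>U. \<forall>A\<in>tangent_space X q. \<forall>B\<in>tangent_space X q. \<forall>C\<in>tangent_space X q.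
        (\<Sum>(f, g, h)\<leftarrow>fgh. A f * (B g * C h - B h * C g) - B f * (A g * C h - A h * C g)
           + C f * (A g * B h - A h * B g)) = 0))"

definition nondegenerate :: "('n::finite) proj set \<Rightarrow> 'n two_form \<Rightarrow> bool" where
  "nondegenerate X \<omega> \<longleftrightarrow> (\<forall>p\<in>X. \<forall>D\<in>tangent_space X p.
     (\<forall>E\<in>tangent_space X p. \<omega> p D E = 0) \<longrightarrow> D = 0)"

definition symplectic_variety :: "('n::finite) proj set \<Rightarrow> 'n two_form \<Rightarrow> bool" where
  "symplectic_variety X \<omega> \<longleftrightarrow>
     quasi_projective X \<and> smooth X \<and> closed_algebraic_form X \<omega> \<and> nondegenerate X \<omega>"

definition symplectic_automorphism ::
    "('n::finite) proj set \<Rightarrow> 'n two_form \<Rightarrow> ('n proj \<Rightarrow> 'n proj) \<Rightarrow> bool" where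
  "symplectic_automorphism X \<omega> s \<longleftrightarrow> algebraic_automorphism X s \<and>
     (\<forall>p\<in>X. \<forall>D\<in>tangent_space X p. \<forall>E\<in>tangent_space X p.
        \<omega> (s p) (differential s D) (differential s E) = \<omega> p D E)"

text \<open>
  The Poisson bivector \<open>\<omega>\<^sup>-\<^sup>1\<close> at \<open>p\<close>: it sends \<open>\<xi>, \<eta>\<close> to \<open>\<eta>(v)\<close> where \<open>\<omega>(v, -) = \<xi>\<close>. The
  opposite sign convention multiplies \<open>psi\<close> below by the power of \<open>-1\<close> with exponent half the
  codimension, which does not affect \<open>cup_coeff\<close>.
\<close>

definition poisson :: "('n::finite) proj set \<Rightarrow> 'n two_form \<Rightarrow> 'n proj
    \<Rightarrow> ('n proj \<Rightarrow> complex) multivector" where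
  "poisson X \<omega> p = (\<lambda>\<xi>s. case \<xi>s of
     [\<xi>, \<eta>] \<Rightarrow>
       if \<xi> \<in> dual (tangent_space X p) \<and> \<eta> \<in> dual (tangent_space X p)
       then \<eta> (THE v. v \<in> tangent_space X p \<and> (\<forall>w\<in>tangent_space X p. \<omega> p v w = \<xi> w))
       else 0
   | _ \<Rightarrow> 0)"


section \<open>Fixed loci\<close>

definition fixed_locus :: "('n::finite) proj set \<Rightarrow> ('n proj \<Rightarrow> 'n proj) \<Rightarrow> 'n proj set" where
  "fixed_locus X s = {p \<in> X. s p = p}"

definition zariski_components :: "('n::finite) proj set \<Rightarrow> 'n proj set set" where
  "zariski_components S = connected_components_of (zariski_on S)"

text \<open>
  At \<open>p \<in> X\<^sup>s\<close> the tangent space of \<open>X\<close> is the direct sum of the tangent space of \<open>X\<^sup>s\<close>, consisting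
  of the invariant vectors, and of the fibre \<open>(1 - s) T\<^sub>pX\<close> of the normal bundle.
\<close>

definition fixed_tangent ::
    "('n::finite) proj set \<Rightarrow> ('n proj \<Rightarrow> 'n proj) \<Rightarrow> 'n proj \<Rightarrow> 'n tangent set" where
  "fixed_tangent X s p = {D \<in> tangent_space X p. differential s D = D}"

definition normal_space ::
    "('n::finite) proj set \<Rightarrow> ('n proj \<Rightarrow> 'n proj) \<Rightarrow> 'n proj \<Rightarrow> 'n tangent set" where
  "normal_space X s p = (\<lambda>D. D - differential s D) ` tangent_space X p"

definition normal_proj :: "('n::finite) proj set \<Rightarrow> ('n proj \<Rightarrow> 'n proj) \<Rightarrow> 'n proj
    \<Rightarrow> 'n tangent \<Rightarrow> 'n tangent" where
  "normal_proj X s p D = (THE E. E \<in> normal_space X s p \<and> D - E \<in> fixed_tangent X s p)"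

definition normal_det ::
    "('n::finite) proj set \<Rightarrow> ('n proj \<Rightarrow> 'n proj) \<Rightarrow> 'n proj \<Rightarrow> complex" where
  "normal_det X s p = endo_det (normal_space X s p) (\<lambda>D. D - differential s D)"

text \<open>
  Sections of the constant sheaf on \<open>S\<close> are functions on the set of components of \<open>S\<close>; the
  restriction to a nonempty connected subset is the value on the component containing it.
\<close>

definition restrict_section ::
    "('n::finite) proj set \<Rightarrow> ('n proj set \<Rightarrow> complex) \<Rightarrow> 'n proj set \<Rightarrow> complex" where
  "restrict_section S c Y = c (THE Z. Z \<in> zariski_components S \<and> Y \<subseteq> Z)"

definition lam ::
    "('n::finite) proj set \<Rightarrow> ('n proj \<Rightarrow> 'n proj) \<Rightarrow> 'n proj set \<Rightarrow> complex" where
  "lam X s Z = complex_of_real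
     (THE r. 0 < r \<and> (\<forall>p\<in>Z. (complex_of_real r)\<^sup>2 = normal_det X s p))"

definition normal_poisson :: "('n::finite) proj set \<Rightarrow> 'n two_form \<Rightarrow> ('n proj \<Rightarrow> 'n proj)
    \<Rightarrow> 'n proj \<Rightarrow> ('n proj \<Rightarrow> complex) multivector" where
  "normal_poisson X \<omega> s p =
     ext_map (tangent_space X p) (normal_space X s p) (normal_proj X s p) (poisson X \<omega> p)"

definition half_codim :: "('n::finite) proj set \<Rightarrow> ('n proj \<Rightarrow> 'n proj) \<Rightarrow> 'n proj \<Rightarrow> nat" where
  "half_codim X s p = (cfun.dim (tangent_space X p) - cfun.dim (fixed_tangent X s p)) div 2"

definition psi :: "('n::finite) proj set \<Rightarrow> 'n two_form \<Rightarrow> ('n proj \<Rightarrow> 'n proj)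
    \<Rightarrow> 'n proj \<Rightarrow> ('n proj \<Rightarrow> complex) multivector" where
  "psi X \<omega> s p = (\<lambda>\<xi>s.
     (wedge (normal_poisson X \<omega> s p) ^^ half_codim X s p) ext_one \<xi>s / fact (half_codim X s p))"


section \<open>The cup product on the determinants of the normal bundles\<close>

text \<open>
  A shared component need not be transverse: if \<open>g = h\<close> generates a cyclic group of order 4 acting on
  the symplectic plane with eigenvalues \<open>\<i>, -\<i>\<close>, then the origin is a shared component, but
  \<open>N\<^sub>g \<oplus> N\<^sub>h\<close> has dimension 4 while \<open>N\<^sub>g\<^sub>h\<close> has dimension 2, and the product is 0 there.
\<close>

definition transverse_along :: "('n::finite) proj set \<Rightarrow> ('n proj \<Rightarrow> 'n proj)
    \<Rightarrow> ('n proj \<Rightarrow> 'n proj) \<Rightarrow> 'n proj set \<Rightarrow> bool" where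
  "transverse_along X s t Y \<longleftrightarrow> (\<forall>p\<in>Y. tangent_space X p =
     {D + E | D E. D \<in> fixed_tangent X s p \<and> E \<in> fixed_tangent X t p})"

definition shared_components :: "('n::finite) proj set \<Rightarrow> ('g, 'm) monoid_scheme
    \<Rightarrow> ('g \<Rightarrow> 'n proj \<Rightarrow> 'n proj) \<Rightarrow> 'g \<Rightarrow> 'g \<Rightarrow> 'n proj set set" where
  "shared_components X G \<phi> g h =
     zariski_components (fixed_locus X (\<phi> g) \<inter> fixed_locus X (\<phi> h)) \<inter>
     zariski_components (fixed_locus X (\<phi> (g \<otimes>\<^bsub>G\<^esub> h)))"

text \<open>
  The product of sections \<open>\<alpha>\<close> and \<open>\<beta>\<close> of the determinants of the normal bundles of \<open>X\<^sup>g\<close> and \<open>X\<^sup>h\<close>.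
  Along a transverse shared component it is \<open>det \<kappa>\<close>, precomposed with the isomorphism
  \<open>det A \<otimes> det B \<rightarrow> det (A \<oplus> B)\<close> given by the exterior product: each factor is mapped by the
  restriction of \<open>\<kappa>\<close> to its summand, and the images are multiplied. All other values are 0.
\<close>

definition cup :: "('n::finite) proj set \<Rightarrow> ('g, 'm) monoid_scheme
    \<Rightarrow> ('g \<Rightarrow> 'n proj \<Rightarrow> 'n proj) \<Rightarrow> 'g \<Rightarrow> 'g
    \<Rightarrow> ('n proj \<Rightarrow> ('n proj \<Rightarrow> complex) multivector)
    \<Rightarrow> ('n proj \<Rightarrow> ('n proj \<Rightarrow> complex) multivector)
    \<Rightarrow> 'n proj \<Rightarrow> ('n proj \<Rightarrow> complex) multivector" where
  "cup X G \<phi> g h \<alpha> \<beta> p =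
     (let gh = g \<otimes>\<^bsub>G\<^esub> h;
          N = (\<lambda>k. normal_space X (\<phi> k) p);
          \<kappa> = normal_proj X (\<phi> gh) p
      in if \<exists>Y\<in>shared_components X G \<phi> g h. p \<in> Y \<and> transverse_along X (\<phi> g) (\<phi> h) Y
         then wedge (ext_map (N g) (N gh) \<kappa> (\<alpha> p)) (ext_map (N h) (N gh) \<kappa> (\<beta> p))
         else (\<lambda>_. 0))"

text \<open>The value on the shared component \<open>Y\<close> of the coefficient \<open>a(g, h)\<close>.\<close>

definition cup_coeff :: "('n::finite) proj set \<Rightarrow> 'n two_form \<Rightarrow> ('g, 'm) monoid_scheme
    \<Rightarrow> ('g \<Rightarrow> 'n proj \<Rightarrow> 'n proj) \<Rightarrow> 'g \<Rightarrow> 'g \<Rightarrow> 'n proj set \<Rightarrow> complex" where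
  "cup_coeff X \<omega> G \<phi> g h Y = (THE c. \<forall>p\<in>Y.
     cup X G \<phi> g h (psi X \<omega> (\<phi> g)) (psi X \<omega> (\<phi> h)) p =
       (\<lambda>\<xi>s. c * psi X \<omega> (\<phi> (g \<otimes>\<^bsub>G\<^esub> h)) p \<xi>s))"

end

theory Submission
  imports Defs "HOL-Computational_Algebra.Fundamental_Theorem_Algebra"
begin

text \<open>
  At a fixed point \<open>p\<close> the stabiliser acts on the tangent space by isometries of the symplectic form
  and, after averaging, of a hermitian form, so each of its elements \<open>g\<close> is diagonalisable and the
  normal space is the symplectic orthogonal complement \<open>N\<^sub>g\<close> of the fixed space. There \<open>\<psi>\<^sub>g\<close> is the
  volume element of the symplectic form. For transverse \<open>g\<close> and \<open>h\<close>, the space \<open>N\<^sub>g\<^sub>h\<close> is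
  \<open>N\<^sub>g \<oplus> N\<^sub>h\<close>, but not orthogonally. Correcting this decomposition to an orthogonal one by a linear map
  compares the volume elements: the product of \<open>\<psi>\<^sub>g\<close> and \<open>\<psi>\<^sub>h\<close> is a multiple \<open>r\<close> of \<open>\<psi>\<^sub>g\<^sub>h\<close> with
  \<open>r\<^sup>2 det (1 - g) det (1 - h) = det (1 - g h)\<close>, and positivity of \<open>r\<close> identifies it
  with the quotient of the square roots. The determinants are constant along the components, because
  the eigenvalues of \<open>g\<close> near \<open>p\<close> are those at \<open>p\<close>: averaging local coordinates over the powers of
  \<open>g\<close> makes them eigenfunctions of \<open>g\<close>.
\<close>

text \<open>The summands N_g and N_h of N_gh are not orthogonal for the symplectic form, so volume
  elements and determinants have to be compared through one and the same operator. This is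
  \<open>M\<close>, the sum of the projections onto N_g and N_h along the two fixed spaces. On the
  one hand it relates the given form to the form that makes the summands orthogonal, so that the
  factor \<open>r\<close> is the determinant of its positive square root. On the other hand, the
  identity 1 - gh = (1 - h) + (1 - g) h exhibits 1 - gh as \<open>M\<close>, followed by a unipotent
  map, followed by the block sum of 1 - g and 1 - h; hence det \<open>M\<close>, the square of
  \<open>r\<close>, is a factor of its determinant. The hermitian form is what makes
  \<open>M\<close> diagonalisable with positive eigenvalues. Determinants are scalars of the action
  on top exterior powers and are read off from volume elements. On the geometric side tangent
  vectors are derivations on germs; that there are enough of them is obtained analytically, by
  differentiating along real curves given by the inverse function theorem.\<close>

section \<open>Permutations of argument lists and the algebra of the exterior product\<close>

lemma sign_mult_permutes:
  assumes "\<sigma> permutes {..<n::nat}" "\<tau> permutes {..<n}"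
  shows "sign (\<sigma> \<circ> \<tau>) = sign \<sigma> * sign \<tau>"
  using assms by (meson finite_lessThan permutation_permutes sign_compose)

lemma take_permute_list:
  assumes "\<tau> permutes {..<m}" "m \<le> length xs"
  shows "take m (permute_list \<tau> xs) = permute_list \<tau> (take m xs)"
    and "drop m (permute_list \<tau> xs) = drop m xs"
proof -
  have lt: "\<tau> i < m" if "i < m" for i
    using permutes_in_image[OF assms(1), of i] that by simp
  have ge: "\<tau> i = i" if "i \<ge> m" for i
    using permutes_not_in[OF assms(1), of i] that by simp
  show "take m (permute_list \<tau> xs) = permute_list \<tau> (take m xs)"
    using assms(2) lt by (intro nth_equalityI) (auto simp: permute_list_def)
  show "drop m (permute_list \<tau> xs) = drop m xs"
    using assms(2) ge by (intro nth_equalityI) (auto simp: permute_list_def)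
qed

text \<open>The embedding of the symmetric group on \<open>n - m\<close> letters as the group
  permuting the last \<open>n - m\<close> of \<open>n\<close> positions.\<close>

definition shift_perm :: "nat \<Rightarrow> nat \<Rightarrow> (nat \<Rightarrow> nat) \<Rightarrow> nat \<Rightarrow> nat" where
  "shift_perm m n \<tau> = map_permutation {..<n - m} (\<lambda>i. i + m) \<tau>"

lemma shift_perm:
  assumes "\<tau> permutes {..<n - m}" "m \<le> n"
  shows "shift_perm m n \<tau> permutes {m..<n}" "shift_perm m n \<tau> permutes {..<n}"
    and "sign (shift_perm m n \<tau>) = sign \<tau>"
    and "i < n - m \<Longrightarrow> shift_perm m n \<tau> (i + m) = \<tau> i + m"
proof -
  have "bij_betw (\<lambda>i. i + m) {..<n - m} {m..<n}"
    using assms(2) by (intro bij_betwI[of _ _ _ "\<lambda>i. i - m"]) auto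
  then show 1: "shift_perm m n \<tau> permutes {m..<n}"
    unfolding shift_perm_def by (intro map_permutation_permutes assms(1))
  show "shift_perm m n \<tau> permutes {..<n}"
    by (rule permutes_subset[OF 1]) auto
  show "sign (shift_perm m n \<tau>) = sign \<tau>"
    unfolding shift_perm_def by (intro sign_map_permutation assms(1)) auto
  show "shift_perm m n \<tau> (i + m) = \<tau> i + m" if "i < n - m"
    unfolding shift_perm_def using that by (subst map_permutation_apply) auto
qed

lemma drop_permute_list_shift:
  assumes "\<tau> permutes {..<length xs - m}" "m \<le> length xs"
  shows "drop m (permute_list (shift_perm m (length xs) \<tau>) xs) = permute_list \<tau> (drop m xs)"
    and "take m (permute_list (shift_perm m (length xs) \<tau>) xs) = take m xs"
proof -
  let ?n = "length xs"
  have lt: "\<tau> i < ?n - m" if "i < ?n - m" for i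
    using permutes_in_image[OF assms(1), of i] that by simp
  have eq: "shift_perm m ?n \<tau> (m + i) = m + \<tau> i" if "i < ?n - m" for i
    using shift_perm(4)[OF assms that] by (simp add: add.commute)
  have id: "shift_perm m ?n \<tau> i = i" if "i < m" for i
    using permutes_not_in[OF shift_perm(1)[OF assms]] that by simp
  show "drop m (permute_list (shift_perm m ?n \<tau>) xs) = permute_list \<tau> (drop m xs)"
    using assms(2) lt eq by (intro nth_equalityI) (auto simp: permute_list_def)
  show "take m (permute_list (shift_perm m ?n \<tau>) xs) = take m xs"
    using assms(2) id by (intro nth_equalityI) (auto simp: permute_list_def)
qed

text \<open>One homogeneous piece of \<open>wedge\<close> before division by the factorials. Summing
  over all permutations instead of shuffles allows reindexing by any permutation; a general
  \<open>f\<close> in place of a product lets iterated products be treated as well.\<close>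

definition shuffle_sum :: "('b list \<Rightarrow> 'b list \<Rightarrow> complex) \<Rightarrow> nat \<Rightarrow> 'b list \<Rightarrow> complex" where
  "shuffle_sum f k xs = (\<Sum>\<sigma> | \<sigma> permutes {..<length xs}. of_int (sign \<sigma>) *
     f (take k (permute_list \<sigma> xs)) (drop k (permute_list \<sigma> xs)))"

lemma wedge_shuffle_sum:
  "wedge \<alpha> \<beta> \<xi>s = (\<Sum>k\<le>length \<xi>s. shuffle_sum (\<lambda>xs ys. \<alpha> xs * \<beta> ys) k \<xi>s
     / (fact k * fact (length \<xi>s - k)))"
  by (simp add: wedge_def shuffle_sum_def mult.assoc)

text \<open>Replacing \<open>\<sigma>\<close> by its composite with \<open>\<tau>\<close> changes
  every sign by that of \<open>\<tau>\<close>. This is how a permutation applied inside a summand is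
  absorbed into the outer sum.\<close>

lemma sum_reindex_permutes:
  fixes f :: "'b list \<Rightarrow> complex"
  assumes "\<tau> permutes {..<length xs}"
  shows "(\<Sum>\<sigma> | \<sigma> permutes {..<length xs}. of_int (sign \<sigma>) * f (permute_list \<tau> (permute_list \<sigma> xs)))
    = of_int (sign \<tau>) * (\<Sum>\<sigma> | \<sigma> permutes {..<length xs}. of_int (sign \<sigma>) * f (permute_list \<sigma> xs))"
proof -
  have "(\<Sum>\<sigma> | \<sigma> permutes {..<length xs}. of_int (sign \<sigma>) * f (permute_list \<sigma> xs)) =
    (\<Sum>\<sigma> | \<sigma> permutes {..<length xs}. of_int (sign (\<sigma> \<circ> \<tau>)) * f (permute_list (\<sigma> \<circ> \<tau>) xs))"
    by (rule sum_permutations_compose_right[OF assms])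
  also have "\<dots> = (\<Sum>\<sigma> | \<sigma> permutes {..<length xs}.
      of_int (sign \<tau>) * (of_int (sign \<sigma>) * f (permute_list \<tau> (permute_list \<sigma> xs))))"
    using assms by (intro sum.cong) (auto simp: sign_mult_permutes permute_list_compose)
  finally have "(\<Sum>\<sigma> | \<sigma> permutes {..<length xs}. of_int (sign \<sigma>) * f (permute_list \<sigma> xs)) =
    of_int (sign \<tau>) * (\<Sum>\<sigma> | \<sigma> permutes {..<length xs}.
      of_int (sign \<sigma>) * f (permute_list \<tau> (permute_list \<sigma> xs)))"
    by (simp only: sum_distrib_left)
  then show ?thesis
    by (simp only: mult.assoc[symmetric] of_int_mult[symmetric] sign_idempotent of_int_1 mult_1_left)
qed

text \<open>An inner antisymmetrisation of the first \<open>m\<close> entries is redundant inside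
  the outer one: each of its \<open>m!\<close> permutations extends to the whole list and
  contributes the same amount after reindexing.\<close>

lemma shuffle_sum_collapse_left:
  assumes "m \<le> length xs"
  shows "shuffle_sum (\<lambda>us vs. (\<Sum>\<tau> | \<tau> permutes {..<m}. of_int (sign \<tau>) * f (permute_list \<tau> us) vs)) m xs
    = fact m * shuffle_sum f m xs"
proof -
  have "shuffle_sum (\<lambda>us vs. (\<Sum>\<tau> | \<tau> permutes {..<m}. of_int (sign \<tau>) * f (permute_list \<tau> us) vs)) m xs
    = (\<Sum>\<tau> | \<tau> permutes {..<m}. of_int (sign \<tau>) * (\<Sum>\<sigma> | \<sigma> permutes {..<length xs}. of_int (sign \<sigma>) *
        (\<lambda>l. f (take m l) (drop m l)) (permute_list \<tau> (permute_list \<sigma> xs))))"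
    unfolding shuffle_sum_def sum_distrib_left
    by (subst sum.swap, intro sum.cong) (use assms in \<open>auto simp: take_permute_list\<close>)
  also have "\<dots> = (\<Sum>\<tau> | \<tau> permutes {..<m}. shuffle_sum f m xs)"
  proof (intro sum.cong refl)
    fix \<tau> assume "\<tau> \<in> {\<tau>. \<tau> permutes {..<m}}"
    then have "\<tau> permutes {..<length xs}"
      using assms by (auto intro: permutes_subset)
    from sum_reindex_permutes[OF this, of "\<lambda>l. f (take m l) (drop m l)"]
    show "of_int (sign \<tau>) * (\<Sum>\<sigma> | \<sigma> permutes {..<length xs}. of_int (sign \<sigma>) *
        (\<lambda>l. f (take m l) (drop m l)) (permute_list \<tau> (permute_list \<sigma> xs))) = shuffle_sum f m xs"
      by (simp add: shuffle_sum_def mult.assoc[symmetric] flip: of_int_mult)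
  qed
  finally show ?thesis
    by (simp add: card_permutations[OF refl])
qed

text \<open>The same absorption for the last entries, whose permutations are extended to the whole
  list by \<open>shift_perm\<close>.\<close>

lemma shuffle_sum_collapse_right:
  assumes "m \<le> length xs"
  shows "shuffle_sum (\<lambda>us vs. (\<Sum>\<tau> | \<tau> permutes {..<length xs - m}. of_int (sign \<tau>) * f us (permute_list \<tau> vs))) m xs
    = fact (length xs - m) * shuffle_sum f m xs"
proof -
  let ?s = "shift_perm m (length xs)"
  have "shuffle_sum (\<lambda>us vs. (\<Sum>\<tau> | \<tau> permutes {..<length xs - m}. of_int (sign \<tau>) * f us (permute_list \<tau> vs))) m xs
    = (\<Sum>\<tau> | \<tau> permutes {..<length xs - m}. of_int (sign (?s \<tau>)) * (\<Sum>\<sigma> | \<sigma> permutes {..<length xs}. of_int (sign \<sigma>) *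
        (\<lambda>l. f (take m l) (drop m l)) (permute_list (?s \<tau>) (permute_list \<sigma> xs))))"
    unfolding shuffle_sum_def sum_distrib_left
  proof (subst sum.swap, intro sum.cong refl)
    fix \<tau> \<sigma> assume "\<tau> \<in> {\<tau>. \<tau> permutes {..<length xs - m}}" "\<sigma> \<in> {\<sigma>. \<sigma> permutes {..<length xs}}"
    then show "of_int (sign \<sigma>) * (of_int (sign \<tau>) * f (take m (permute_list \<sigma> xs)) (permute_list \<tau> (drop m (permute_list \<sigma> xs))))
      = of_int (sign (?s \<tau>)) * (of_int (sign \<sigma>) * f (take m (permute_list (?s \<tau>) (permute_list \<sigma> xs)))
          (drop m (permute_list (?s \<tau>) (permute_list \<sigma> xs))))"
      using assms drop_permute_list_shift[of \<tau> "permute_list \<sigma> xs" m] by (simp add: shift_perm)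
  qed
  also have "\<dots> = (\<Sum>\<tau> | \<tau> permutes {..<length xs - m}. shuffle_sum f m xs)"
  proof (intro sum.cong refl)
    fix \<tau> assume "\<tau> \<in> {\<tau>. \<tau> permutes {..<length xs - m}}"
    then have "?s \<tau> permutes {..<length xs}"
      using assms by (intro shift_perm) auto
    from sum_reindex_permutes[OF this, of "\<lambda>l. f (take m l) (drop m l)"]
    show "of_int (sign (?s \<tau>)) * (\<Sum>\<sigma> | \<sigma> permutes {..<length xs}. of_int (sign \<sigma>) *
        (\<lambda>l. f (take m l) (drop m l)) (permute_list (?s \<tau>) (permute_list \<sigma> xs))) = shuffle_sum f m xs"
      by (simp add: shuffle_sum_def mult.assoc[symmetric] flip: of_int_mult)
  qed
  finally show ?thesis
    by (simp add: card_permutations[OF refl])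
qed

lemma shuffle_sum_cong:
  assumes "\<And>us vs. length us = k \<Longrightarrow> length vs = length xs - k \<Longrightarrow> f us vs = g us vs" "k \<le> length xs"
  shows "shuffle_sum f k xs = shuffle_sum g k xs"
  unfolding shuffle_sum_def using assms by (intro sum.cong) auto

lemma shuffle_sum_sum:
  "shuffle_sum (\<lambda>us vs. \<Sum>i\<in>I. c i * f i us vs) k xs = (\<Sum>i\<in>I. c i * shuffle_sum (f i) k xs)"
  unfolding shuffle_sum_def sum_distrib_left
  by (subst sum.swap) (simp add: algebra_simps)

text \<open>Both sides are sums over the ways to cut a permuted list into three blocks, weighted by
  the inverse factorials of the block lengths, once the inner antisymmetrisation has been
  collapsed.\<close>

theorem wedge_assoc: "wedge (wedge \<alpha> \<beta>) \<gamma> = wedge \<alpha> (wedge \<beta> \<gamma>)"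
proof
  fix xs :: "('a cvec \<Rightarrow> complex) list"
  define n where "n = length xs"
  \<comment> \<open>The contribution of the cuts at positions \<open>k\<close> and \<open>m\<close>;
    both bracketings are expressed through it.\<close>
  define T where "T k m = (\<Sum>\<sigma> | \<sigma> permutes {..<n}. of_int (sign \<sigma>) *
     (\<alpha> (take k (permute_list \<sigma> xs)) * \<beta> (drop k (take m (permute_list \<sigma> xs))) * \<gamma> (drop m (permute_list \<sigma> xs))))" for k m
  have T1: "T k m = shuffle_sum (\<lambda>us vs. \<alpha> (take k us) * \<beta> (drop k us) * \<gamma> vs) m xs"
    if "k \<le> m" "m \<le> n" for k m
    unfolding T_def shuffle_sum_def n_def using that by (intro sum.cong) (auto simp: min_def)
  have T2: "T k m = shuffle_sum (\<lambda>us vs. \<alpha> us * \<beta> (take (m - k) vs) * \<gamma> (drop (m - k) vs)) k xs"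
    if "k \<le> m" "m \<le> n" for k m
    unfolding T_def shuffle_sum_def n_def using that by (intro sum.cong) (auto simp: drop_take)
  have left: "shuffle_sum (\<lambda>us vs. wedge \<alpha> \<beta> us * \<gamma> vs) m xs
      = (\<Sum>k\<le>m. fact m / (fact k * fact (m - k)) * T k m)" if m: "m \<le> n" for m
  proof -
    have "shuffle_sum (\<lambda>us vs. wedge \<alpha> \<beta> us * \<gamma> vs) m xs = shuffle_sum (\<lambda>us vs. \<Sum>k\<le>m. 1 / (fact k * fact (m - k)) *
        (\<Sum>\<tau> | \<tau> permutes {..<m}. of_int (sign \<tau>) *
           (\<alpha> (take k (permute_list \<tau> us)) * \<beta> (drop k (permute_list \<tau> us)) * \<gamma> vs))) m xs"
      using m by (intro shuffle_sum_cong)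
        (auto simp: wedge_def n_def sum_distrib_right sum_distrib_left sum_divide_distrib intro!: sum.cong)
    also have "\<dots> = (\<Sum>k\<le>m. 1 / (fact k * fact (m - k)) * (fact m * T k m))"
    proof (subst shuffle_sum_sum, intro sum.cong refl)
      fix k assume "k \<in> {..m}"
      then show "1 / (fact k * fact (m - k)) * shuffle_sum (\<lambda>us vs. \<Sum>\<tau> | \<tau> permutes {..<m}. of_int (sign \<tau>) *
           (\<alpha> (take k (permute_list \<tau> us)) * \<beta> (drop k (permute_list \<tau> us)) * \<gamma> vs)) m xs
        = 1 / (fact k * fact (m - k)) * (fact m * T k m)"
        using m shuffle_sum_collapse_left[of m xs "\<lambda>us vs. \<alpha> (take k us) * \<beta> (drop k us) * \<gamma> vs"]
        by (simp add: T1 n_def)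
    qed
    finally show ?thesis by (simp add: algebra_simps)
  qed
  have right: "shuffle_sum (\<lambda>us vs. \<alpha> us * wedge \<beta> \<gamma> vs) k xs
      = (\<Sum>j\<le>n - k. fact (n - k) / (fact j * fact (n - k - j)) * T k (k + j))" if k: "k \<le> n" for k
  proof -
    have "shuffle_sum (\<lambda>us vs. \<alpha> us * wedge \<beta> \<gamma> vs) k xs = shuffle_sum (\<lambda>us vs. \<Sum>j\<le>n - k. 1 / (fact j * fact (n - k - j)) *
        (\<Sum>\<tau> | \<tau> permutes {..<n - k}. of_int (sign \<tau>) *
           (\<alpha> us * \<beta> (take j (permute_list \<tau> vs)) * \<gamma> (drop j (permute_list \<tau> vs))))) k xs"
      using k by (intro shuffle_sum_cong)
        (auto simp: wedge_def n_def sum_distrib_right sum_distrib_left sum_divide_distrib intro!: sum.cong)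
    also have "\<dots> = (\<Sum>j\<le>n - k. 1 / (fact j * fact (n - k - j)) * (fact (n - k) * T k (k + j)))"
    proof (subst shuffle_sum_sum, intro sum.cong refl)
      fix j assume "j \<in> {..n - k}"
      then show "1 / (fact j * fact (n - k - j)) * shuffle_sum (\<lambda>us vs. \<Sum>\<tau> | \<tau> permutes {..<n - k}. of_int (sign \<tau>) *
           (\<alpha> us * \<beta> (take j (permute_list \<tau> vs)) * \<gamma> (drop j (permute_list \<tau> vs)))) k xs
        = 1 / (fact j * fact (n - k - j)) * (fact (n - k) * T k (k + j))"
        using k shuffle_sum_collapse_right[of k xs "\<lambda>us vs. \<alpha> us * \<beta> (take j vs) * \<gamma> (drop j vs)"]
        by (simp add: T2 n_def)
    qed
    finally show ?thesis by (simp add: algebra_simps)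
  qed
  have "wedge (wedge \<alpha> \<beta>) \<gamma> xs = (\<Sum>m\<le>n. \<Sum>k\<le>m. T k m / (fact k * fact (m - k) * fact (n - m)))"
    unfolding wedge_shuffle_sum[of "wedge \<alpha> \<beta>"] n_def[symmetric]
    by (intro sum.cong refl) (subst left, simp, simp add: sum_divide_distrib algebra_simps)
  \<comment> \<open>The pair of cuts is traded for the lengths of the first two blocks,
    \<open>j = m - k\<close>.\<close>
  also have "\<dots> = (\<Sum>k\<le>n. \<Sum>j\<le>n - k. T k (k + j) / (fact k * fact j * fact (n - k - j)))"
    unfolding sum.Sigma[OF finite_atMost ballI[OF finite_atMost]]
    by (rule sum.reindex_bij_witness[of _ "\<lambda>(k, j). (k + j, k)" "\<lambda>(m, k). (k, m - k)"]) auto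
  also have "\<dots> = wedge \<alpha> (wedge \<beta> \<gamma>) xs"
    unfolding wedge_shuffle_sum[of \<alpha>] n_def[symmetric]
    by (intro sum.cong refl) (subst right, simp, simp add: sum_divide_distrib algebra_simps)
  finally show "wedge (wedge \<alpha> \<beta>) \<gamma> xs = wedge \<alpha> (wedge \<beta> \<gamma>) xs" .
qed

text \<open>The permutation behind \<open>rotate1\<close>. Its sign never has to be computed,
  because only its square is used.\<close>

definition rot_perm :: "nat \<Rightarrow> nat \<Rightarrow> nat" where
  "rot_perm n i = (if i < n then Suc i mod n else i)"

lemma rot_perm_permutes: "rot_perm n permutes {..<n}"
proof (rule inj_imp_permutes)
  show "inj_on (rot_perm n) {..<n}"
    by (auto simp: inj_on_def rot_perm_def mod_Suc split: if_splits)
qed (auto simp: rot_perm_def)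

lemma permute_list_rot_perm: "permute_list (rot_perm (length xs)) xs = rotate1 xs"
  by (intro nth_equalityI) (auto simp: permute_list_def rot_perm_def nth_rotate1)

text \<open>Only the degree is recorded, without a space and without multilinearity: this is all
  that commuting past another multivector depends on.\<close>

definition degree2 :: "'a multivector \<Rightarrow> bool" where
  "degree2 \<alpha> \<longleftrightarrow> (\<forall>xs. length xs \<noteq> 2 \<longrightarrow> \<alpha> xs = 0)"

lemma degree2_add: "degree2 \<alpha> \<Longrightarrow> degree2 \<beta> \<Longrightarrow> degree2 (\<alpha> + \<beta>)"
  by (simp add: degree2_def)

text \<open>Moving two covectors from the front to the back is the square of a cyclic permutation,
  hence even.\<close>

lemma wedge_commute_degree2:
  assumes "degree2 \<alpha>"
  shows "wedge \<alpha> \<beta> = wedge \<beta> \<alpha>"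
proof
  fix xs :: "('a cvec \<Rightarrow> complex) list"
  define n where "n = length xs"
  have deg: "\<alpha> us = 0" if "length us \<noteq> 2" for us
    using assms that by (auto simp: degree2_def)
  have L: "shuffle_sum (\<lambda>us vs. \<alpha> us * \<beta> vs) k xs = 0" if "k \<noteq> 2" "k \<le> n" for k
    unfolding shuffle_sum_def using that by (intro sum.neutral) (auto simp: n_def deg)
  have R: "shuffle_sum (\<lambda>us vs. \<beta> us * \<alpha> vs) k xs = 0" if "n - k \<noteq> 2" "k \<le> n" for k
    unfolding shuffle_sum_def using that by (intro sum.neutral) (auto simp: n_def deg)
  show "wedge \<alpha> \<beta> xs = wedge \<beta> \<alpha> xs"
  proof (cases "n < 2")
    case True
    then show ?thesis
      unfolding wedge_shuffle_sum n_def[symmetric] using L R by (simp add: sum.neutral)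
  next
    case False
    have "wedge \<alpha> \<beta> xs = (\<Sum>k\<in>{2}. shuffle_sum (\<lambda>us vs. \<alpha> us * \<beta> vs) k xs / (fact k * fact (n - k)))"
      unfolding wedge_shuffle_sum n_def[symmetric]
      using False L by (intro sum.mono_neutral_right) auto
    moreover have "wedge \<beta> \<alpha> xs = (\<Sum>k\<in>{n - 2}. shuffle_sum (\<lambda>us vs. \<beta> us * \<alpha> vs) k xs / (fact k * fact (n - k)))"
      unfolding wedge_shuffle_sum n_def[symmetric]
    proof (intro sum.mono_neutral_right ballI)
      fix k assume "k \<in> {..n} - {n - 2}"
      then have "n - k \<noteq> 2" "k \<le> n" by auto
      then show "shuffle_sum (\<lambda>us vs. \<beta> us * \<alpha> vs) k xs / (fact k * fact (n - k)) = 0"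
        by (simp add: R)
    qed auto
    moreover have "shuffle_sum (\<lambda>us vs. \<beta> us * \<alpha> vs) (n - 2) xs = shuffle_sum (\<lambda>us vs. \<alpha> us * \<beta> vs) 2 xs"
    proof -
      let ?r = "rot_perm n \<circ> rot_perm n"
      have r: "?r permutes {..<length xs}"
        unfolding n_def by (intro permutes_compose rot_perm_permutes)
      have s: "sign ?r = 1"
        by (simp add: sign_mult_permutes[OF rot_perm_permutes rot_perm_permutes])
      have rot: "permute_list ?r ys = drop 2 ys @ take 2 ys" if "length ys = n" for ys :: "('a cvec \<Rightarrow> complex) list"
      proof -
        have "permute_list ?r ys = rotate1 (rotate1 ys)"
          using that permute_list_rot_perm[of ys] permute_list_rot_perm[of "rotate1 ys"]
          by (simp add: permute_list_compose rot_perm_permutes)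
        moreover have "length ys = Suc (Suc (n - 2))"
          using that False by simp
        then obtain a b zs where "ys = a # b # zs"
          by (auto simp: length_Suc_conv)
        ultimately show ?thesis by simp
      qed
      show ?thesis
        unfolding shuffle_sum_def
        using sum_reindex_permutes[OF r, of "\<lambda>l. \<beta> (take (n - 2) l) * \<alpha> (drop (n - 2) l)"] s False
        by (simp add: rot n_def[symmetric] algebra_simps)
    qed
    ultimately show ?thesis using False by simp
  qed
qed

lemma wedge_add_left: "wedge (\<alpha> + \<beta>) \<gamma> = wedge \<alpha> \<gamma> + wedge \<beta> \<gamma>"
  by (rule ext) (simp add: wedge_def algebra_simps sum.distrib add_divide_distrib)

lemma wedge_add_right: "wedge \<gamma> (\<alpha> + \<beta>) = wedge \<gamma> \<alpha> + wedge \<gamma> \<beta>"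
  by (rule ext) (simp add: wedge_def algebra_simps sum.distrib add_divide_distrib)

lemma wedge_scale_left: "wedge (\<lambda>xs. c * \<alpha> xs) \<gamma> = (\<lambda>xs. c * wedge \<alpha> \<gamma> xs)"
  by (rule ext) (simp add: wedge_def algebra_simps sum_distrib_left)

lemma wedge_scale_right: "wedge \<gamma> (\<lambda>xs. c * \<alpha> xs) = (\<lambda>xs. c * wedge \<gamma> \<alpha> xs)"
  by (rule ext) (simp add: wedge_def algebra_simps sum_distrib_left)

lemma wedge_zero_left [simp]: "wedge 0 \<gamma> = 0"
  by (rule ext) (simp add: wedge_def)

lemma wedge_zero_right [simp]: "wedge \<gamma> 0 = 0"
  by (rule ext) (simp add: wedge_def)

definition wedge_power :: "'a multivector \<Rightarrow> nat \<Rightarrow> 'a multivector" where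
  "wedge_power \<pi> d = (wedge \<pi> ^^ d) ext_one"

lemma wedge_power_simps [simp]:
  "wedge_power \<pi> 0 = ext_one" "wedge_power \<pi> (Suc d) = wedge \<pi> (wedge_power \<pi> d)"
  by (simp_all add: wedge_power_def)

subsection \<open>Linear maps, duals and functoriality\<close>

text \<open>Maps are total functions on the ambient function space, so linearity is relative to
  \<open>V\<close> and values outside \<open>V\<close> are unconstrained.\<close>

definition lin :: "'a cvec set \<Rightarrow> 'b cvec set \<Rightarrow> ('a cvec \<Rightarrow> 'b cvec) \<Rightarrow> bool" where
  "lin V W f \<longleftrightarrow> (\<forall>v\<in>V. f v \<in> W) \<and> (\<forall>v\<in>V. \<forall>w\<in>V. f (\<lambda>x. v x + w x) = (\<lambda>x. f v x + f w x)) \<and>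
     (\<forall>c. \<forall>v\<in>V. f (\<lambda>x. c * v x) = (\<lambda>x. c * f v x))"

text \<open>The transpose of \<open>f\<close>, cut off outside \<open>V\<close> to respect the
  normalisation of \<open>dual\<close>; it is the map of covectors occurring in
  \<open>ext_map\<close>.\<close>

definition pull :: "'a cvec set \<Rightarrow> ('a cvec \<Rightarrow> 'a cvec) \<Rightarrow> ('a cvec \<Rightarrow> complex) \<Rightarrow> 'a cvec \<Rightarrow> complex" where
  "pull V f \<xi> = (\<lambda>v. if v \<in> V then \<xi> (f v) else 0)"

lemma ext_map_pull:
  "ext_map V W f \<alpha> \<xi>s = (if set \<xi>s \<subseteq> dual W then \<alpha> (map (pull V f) \<xi>s) else 0)"
  by (simp add: ext_map_def pull_def[abs_def])

lemma csubspaceD: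
  assumes "cfun.subspace V"
  shows "(\<lambda>x. 0) \<in> V" "v \<in> V \<Longrightarrow> w \<in> V \<Longrightarrow> (\<lambda>x. v x + w x) \<in> V" "v \<in> V \<Longrightarrow> (\<lambda>x. c * v x) \<in> V"
    "v \<in> V \<Longrightarrow> w \<in> V \<Longrightarrow> (\<lambda>x. v x - w x) \<in> V" "v \<in> V \<Longrightarrow> (\<lambda>x. - v x) \<in> V"
  using cfun.subspace_0[OF assms] cfun.subspace_add[OF assms, of v w]
    cfun.subspace_scale[OF assms, of v c] cfun.subspace_diff[OF assms, of v w] cfun.subspace_neg[OF assms, of v]
  by (auto simp: zero_fun_def plus_fun_def fun_diff_def fun_Compl_def)

lemma linD:
  assumes "lin V W f"
  shows "v \<in> V \<Longrightarrow> f v \<in> W" "v \<in> V \<Longrightarrow> w \<in> V \<Longrightarrow> f (\<lambda>x. v x + w x) = (\<lambda>x. f v x + f w x)"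
    "v \<in> V \<Longrightarrow> f (\<lambda>x. c * v x) = (\<lambda>x. c * f v x)"
  using assms unfolding lin_def by blast+

lemma dualD:
  assumes "\<xi> \<in> dual V"
  shows "v \<in> V \<Longrightarrow> w \<in> V \<Longrightarrow> \<xi> (\<lambda>x. v x + w x) = \<xi> v + \<xi> w"
    "v \<in> V \<Longrightarrow> \<xi> (\<lambda>x. c * v x) = c * \<xi> v" "v \<notin> V \<Longrightarrow> \<xi> v = 0"
  using assms unfolding dual_def by blast+

lemma dualI:
  assumes "\<And>v w. v \<in> V \<Longrightarrow> w \<in> V \<Longrightarrow> \<xi> (\<lambda>x. v x + w x) = \<xi> v + \<xi> w"
    "\<And>c v. v \<in> V \<Longrightarrow> \<xi> (\<lambda>x. c * v x) = c * \<xi> v" "\<And>v. v \<notin> V \<Longrightarrow> \<xi> v = 0"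
  shows "\<xi> \<in> dual V"
  using assms unfolding dual_def by blast

lemma pull_dual:
  assumes "lin V W f" "cfun.subspace V" "\<xi> \<in> dual W"
  shows "pull V f \<xi> \<in> dual V"
  by (rule dualI) (simp_all add: pull_def linD[OF assms(1)] dualD[OF assms(3)] csubspaceD[OF assms(2)])

lemma pull_pull:
  assumes "\<And>v. v \<in> U \<Longrightarrow> g v \<in> V"
  shows "pull U g (pull V f \<xi>) = pull U (f \<circ> g) \<xi>"
  using assms by (auto simp: pull_def)

lemma ext_map_ext_map:
  assumes "lin U V g" "lin V W f" "cfun.subspace V"
  shows "ext_map V W f (ext_map U V g \<alpha>) = ext_map U W (f \<circ> g) \<alpha>"
proof
  fix xs
  have "map (pull U g \<circ> pull V f) xs = map (pull U (f \<circ> g)) xs"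
    using assms(1) by (auto simp: pull_pull lin_def)
  moreover have "set (map (pull V f) xs) \<subseteq> dual V" if "set xs \<subseteq> dual W"
    using that pull_dual[OF assms(2,3)] by auto
  ultimately show "ext_map V W f (ext_map U V g \<alpha>) xs = ext_map U W (f \<circ> g) \<alpha> xs"
    by (auto simp only: ext_map_pull map_map if_True if_False split: if_split)
qed

lemma ext_map_cong:
  assumes "\<And>v. v \<in> V \<Longrightarrow> f v = g v"
  shows "ext_map V W f \<alpha> = ext_map V W g \<alpha>"
proof -
  have "pull V f = pull V g" by (rule ext) (simp only: pull_def assms cong: if_cong)
  then show ?thesis by (intro ext) (simp only: ext_map_pull)
qed

lemma ext_map_scale: "ext_map V W f (\<lambda>xs. c * \<alpha> xs) = (\<lambda>xs. c * ext_map V W f \<alpha> xs)"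
  by (auto simp: ext_map_pull)

lemma ext_map_one: "ext_map V W f ext_one = ext_one"
  by (auto simp: ext_map_pull ext_one_def)

lemma ext_map_degree2: "degree2 \<alpha> \<Longrightarrow> degree2 (ext_map V W f \<alpha>)"
  by (auto simp: degree2_def ext_map_pull)

text \<open>Pulling back covectors commutes with permuting and cutting a list, and the guard on
  \<open>dual W\<close> holds for a list exactly when it holds for both pieces.\<close>

lemma ext_map_wedge: "ext_map V W f (wedge \<alpha> \<beta>) = wedge (ext_map V W f \<alpha>) (ext_map V W f \<beta>)"
proof
  fix xs
  have *: "ext_map V W f \<alpha> us * ext_map V W f \<beta> vs = 
    (if set us \<union> set vs \<subseteq> dual W then \<alpha> (map (pull V f) us) * \<beta> (map (pull V f) vs) else 0)" for us vs
    by (simp add: ext_map_pull)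
  have "set (take k l) \<union> set (drop k l) = set l" for k and l :: "('a cvec \<Rightarrow> complex) list"
    by (metis append_take_drop_id set_append)
  then show "ext_map V W f (wedge \<alpha> \<beta>) xs = wedge (ext_map V W f \<alpha>) (ext_map V W f \<beta>) xs"
    unfolding wedge_def mult.assoc *
    by (auto simp: ext_map_pull permute_list_map take_map drop_map intro!: sum.cong)
qed

lemma ext_map_wedge_power: "ext_map V W f (wedge_power \<pi> d) = wedge_power (ext_map V W f \<pi>) d"
  by (induction d) (auto simp: ext_map_one ext_map_wedge)

subsection \<open>Exterior powers\<close>

lemma dual_lincomb: "\<xi> \<in> dual V \<Longrightarrow> \<eta> \<in> dual V \<Longrightarrow> (\<lambda>v. a * \<xi> v + b * \<eta> v) \<in> dual V"
  unfolding dual_def by (auto simp: algebra_simps)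

lemma dual_scale: "\<xi> \<in> dual V \<Longrightarrow> (\<lambda>v. a * \<xi> v) \<in> dual V"
  using dual_lincomb[of \<xi> V \<xi> a 0] by simp

lemma ext_powerD:
  assumes "\<alpha> \<in> ext_power k V"
  shows "length xs \<noteq> k \<Longrightarrow> \<alpha> xs = 0" "\<not> set xs \<subseteq> dual V \<Longrightarrow> \<alpha> xs = 0" "\<not> distinct xs \<Longrightarrow> \<alpha> xs = 0"
  using assms unfolding ext_power_def by auto

text \<open>Multilinearity in terms of \<open>list_update\<close>, which is easier to transport
  through permutations of the list than the form with \<open>@\<close> in the definition.\<close>

lemma ext_power_update:
  assumes "\<alpha> \<in> ext_power k V" "length xs = k" "set xs \<subseteq> dual V" "i < k" "\<xi> \<in> dual V" "\<eta> \<in> dual V"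
  shows "\<alpha> (xs[i := (\<lambda>v. a * \<xi> v + b * \<eta> v)]) = a * \<alpha> (xs[i := \<xi>]) + b * \<alpha> (xs[i := \<eta>])"
proof -
  have s: "set (take i xs) \<subseteq> dual V" "set (drop (Suc i) xs) \<subseteq> dual V" "Suc (length (take i xs) + length (drop (Suc i) xs)) = k"
    using assms(2-4) by (auto dest: in_set_takeD in_set_dropD)
  have u: "xs[i := z] = take i xs @ z # drop (Suc i) xs" for z
    using assms(2,4) by (simp add: upd_conv_take_nth_drop)
  have add: "\<alpha> (take i xs @ (\<lambda>v. x v + y v) # drop (Suc i) xs) = \<alpha> (take i xs @ x # drop (Suc i) xs) + \<alpha> (take i xs @ y # drop (Suc i) xs)"
    if "x \<in> dual V" "y \<in> dual V" for x y
    using assms(1) s that unfolding ext_power_def by blast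
  have sc: "\<alpha> (take i xs @ (\<lambda>v. c * x v) # drop (Suc i) xs) = c * \<alpha> (take i xs @ x # drop (Suc i) xs)"
    if "x \<in> dual V" for x c
    using assms(1) s that unfolding ext_power_def by blast
  show ?thesis
    unfolding u using assms(5,6) by (simp add: add sc dual_scale)
qed

lemma ext_powerI:
  assumes "\<And>xs. length xs \<noteq> k \<Longrightarrow> \<alpha> xs = 0" "\<And>xs. \<not> set xs \<subseteq> dual V \<Longrightarrow> \<alpha> xs = 0"
    and "\<And>xs i \<xi> \<eta> a b. length xs = k \<Longrightarrow> set xs \<subseteq> dual V \<Longrightarrow> i < k \<Longrightarrow> \<xi> \<in> dual V \<Longrightarrow> \<eta> \<in> dual V \<Longrightarrow>
      \<alpha> (xs[i := (\<lambda>v. a * \<xi> v + b * \<eta> v)]) = a * \<alpha> (xs[i := \<xi>]) + b * \<alpha> (xs[i := \<eta>])"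
    and "\<And>xs. length xs = k \<Longrightarrow> set xs \<subseteq> dual V \<Longrightarrow> \<not> distinct xs \<Longrightarrow> \<alpha> xs = 0"
  shows "\<alpha> \<in> ext_power k V"
proof -
  have lc: "\<alpha> (us @ (\<lambda>v. a * \<xi> v + b * \<eta> v) # vs) = a * \<alpha> (us @ \<xi> # vs) + b * \<alpha> (us @ \<eta> # vs)"
    if "Suc (length us + length vs) = k" "set us \<subseteq> dual V" "set vs \<subseteq> dual V" "\<xi> \<in> dual V" "\<eta> \<in> dual V" for us vs \<xi> \<eta> a b
    using assms(3)[of "us @ \<xi> # vs" "length us" \<xi> \<eta> a b] that by simp
  have "\<alpha> (us @ (\<lambda>v. \<xi> v + \<eta> v) # vs) = \<alpha> (us @ \<xi> # vs) + \<alpha> (us @ \<eta> # vs)"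
    if "Suc (length us + length vs) = k" "set us \<subseteq> dual V" "set vs \<subseteq> dual V" "\<xi> \<in> dual V" "\<eta> \<in> dual V" for us vs \<xi> \<eta>
    using lc[OF that, of 1 1] by simp
  moreover have "\<alpha> (us @ (\<lambda>v. c * \<xi> v) # vs) = c * \<alpha> (us @ \<xi> # vs)"
    if "Suc (length us + length vs) = k" "set us \<subseteq> dual V" "set vs \<subseteq> dual V" "\<xi> \<in> dual V" for us vs \<xi> c
    using lc[OF that that(4), of c 0] by simp
  moreover have "\<alpha> xs = 0" if "\<not> distinct xs" for xs
    using assms(1,2,4)[of xs] that by blast
  ultimately show ?thesis
    using assms(1,2) unfolding ext_power_def by blast
qed

lemma ext_power_lincomb:
  "\<alpha> \<in> ext_power k V \<Longrightarrow> \<beta> \<in> ext_power k V \<Longrightarrow> (\<lambda>xs. a * \<alpha> xs + b * \<beta> xs) \<in> ext_power k V"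
  by (rule ext_powerI) (auto simp: ext_powerD ext_power_update algebra_simps)

lemma ext_power_one: "ext_one \<in> ext_power 0 V"
  by (rule ext_powerI) (auto simp: ext_one_def)

lemma ext_map_ext_power:
  assumes "lin V W f" "cfun.subspace V" "\<alpha> \<in> ext_power k V"
  shows "ext_map V W f \<alpha> \<in> ext_power k W"
proof (rule ext_powerI)
  fix xs :: "('a cvec \<Rightarrow> complex) list" and i \<xi> \<eta> a b assume *: "length xs = k" "set xs \<subseteq> dual W" "i < k" "\<xi> \<in> dual W" "\<eta> \<in> dual W"
  have "pull V f (\<lambda>v. a * \<xi> v + b * \<eta> v) = (\<lambda>v. a * pull V f \<xi> v + b * pull V f \<eta> v)"
    by (auto simp: pull_def)
  moreover have "set (map (pull V f) xs) \<subseteq> dual V"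
    using * pull_dual[OF assms(1,2)] by auto
  moreover have "set (xs[i := z]) \<subseteq> dual W" if "z \<in> dual W" for z
    using * that set_update_subset_insert[of xs i z] by auto
  ultimately show "ext_map V W f \<alpha> (xs[i := \<lambda>v. a * \<xi> v + b * \<eta> v]) =
      a * ext_map V W f \<alpha> (xs[i := \<xi>]) + b * ext_map V W f \<alpha> (xs[i := \<eta>])"
    using * by (simp add: ext_map_pull map_update dual_lincomb ext_power_update[OF assms(3)] pull_dual[OF assms(1,2)])
next
  fix xs :: "('a cvec \<Rightarrow> complex) list" assume "length xs \<noteq> k" then show "ext_map V W f \<alpha> xs = 0"
    by (simp add: ext_map_pull ext_powerD(1)[OF assms(3)])
next
  fix xs :: "('a cvec \<Rightarrow> complex) list" assume "\<not> distinct xs" 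
  then have "\<not> distinct (map (pull V f) xs)" by (simp add: distinct_map)
  then show "ext_map V W f \<alpha> xs = 0"
    by (simp add: ext_map_pull ext_powerD(3)[OF assms(3)])
qed (simp add: ext_map_pull)

lemma permute_list_update:
  assumes "\<sigma> permutes {..<length xs}" "i < length xs"
  shows "permute_list \<sigma> (xs[i := z]) = (permute_list \<sigma> xs)[inv_into UNIV \<sigma> i := z]"
proof (rule nth_equalityI)
  fix j assume "j < length (permute_list \<sigma> (xs[i := z]))"
  then have "j < length xs" "\<sigma> j < length xs"
    using permutes_in_image[OF assms(1), of j] by auto
  then show "permute_list \<sigma> (xs[i := z]) ! j = (permute_list \<sigma> xs)[inv_into UNIV \<sigma> i := z] ! j"
    using assms permutes_inv_eq[OF assms(1), of i j]
    by (auto simp: permute_list_nth nth_list_update)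
qed simp

text \<open>Transposing two equal entries leaves the list unchanged and reverses all signs, so the
  sum equals its negative. Alternation of products is thus automatic, whatever \<open>f\<close>
  is.\<close>

lemma shuffle_sum_not_distinct:
  assumes "\<not> distinct xs"
  shows "shuffle_sum f k xs = 0"
proof -
  obtain i j where ij: "i < length xs" "j < length xs" "i \<noteq> j" "xs ! i = xs ! j"
    using assms by (auto simp: distinct_conv_nth)
  let ?t = "Transposition.transpose i j"
  have t: "?t permutes {..<length xs}"
    using ij by (intro permutes_swap_id) auto
  have xs: "permute_list ?t xs = xs"
    using ij t by (intro nth_equalityI) (auto simp: permute_list_nth Transposition.transpose_def)
  have "shuffle_sum f k xs = (\<Sum>\<sigma> | \<sigma> permutes {..<length xs}. of_int (sign (?t \<circ> \<sigma>)) *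
     f (take k (permute_list (?t \<circ> \<sigma>) xs)) (drop k (permute_list (?t \<circ> \<sigma>) xs)))"
    unfolding shuffle_sum_def by (rule setum_permutations_compose_left[OF t])
  also have "\<dots> = - shuffle_sum f k xs"
    unfolding shuffle_sum_def sum_negf[symmetric]
    using ij t by (intro sum.cong) (auto simp: permute_list_compose xs sign_mult_permutes sign_swap_id)
  finally show ?thesis by simp
qed

text \<open>Alternation comes from the antisymmetrisation. For multilinearity, each permutation
  sends a given entry to exactly one of the two factors, and that factor is linear in it.\<close>

lemma wedge_ext_power:
  assumes "\<alpha> \<in> ext_power k V" "\<beta> \<in> ext_power l V"
  shows "wedge \<alpha> \<beta> \<in> ext_power (k + l) V"
proof -
  \<comment> \<open>By degree, only the cut at \<open>k\<close> of a list of length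
    \<open>k + l\<close> survives.\<close>
  have zero: "shuffle_sum (\<lambda>us vs. \<alpha> us * \<beta> vs) j xs = 0" if "j \<le> length xs" "j \<noteq> k \<or> length xs \<noteq> k + l" for j xs
    unfolding shuffle_sum_def
  proof (rule sum.neutral, intro ballI)
    fix \<sigma>
    show "of_int (sign \<sigma>) * (\<alpha> (take j (permute_list \<sigma> xs)) * \<beta> (drop j (permute_list \<sigma> xs))) = 0"
      using that ext_powerD(1)[OF assms(1), of "take j (permute_list \<sigma> xs)"]
        ext_powerD(1)[OF assms(2), of "drop j (permute_list \<sigma> xs)"] by (cases "j = k") auto
  qed
  have val: "wedge \<alpha> \<beta> xs = shuffle_sum (\<lambda>us vs. \<alpha> us * \<beta> vs) k xs / (fact k * fact l)" if "length xs = k + l" for xs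
  proof -
    have "wedge \<alpha> \<beta> xs = (\<Sum>j\<in>{k}. shuffle_sum (\<lambda>us vs. \<alpha> us * \<beta> vs) j xs / (fact j * fact (length xs - j)))"
      unfolding wedge_shuffle_sum using that zero by (intro sum.mono_neutral_right) auto
    then show ?thesis using that by simp
  qed
  show ?thesis
  proof (rule ext_powerI)
    fix xs :: "('a cvec \<Rightarrow> complex) list" assume "length xs \<noteq> k + l" then show "wedge \<alpha> \<beta> xs = 0"
      unfolding wedge_shuffle_sum by (simp add: zero)
  next
    fix xs :: "('a cvec \<Rightarrow> complex) list" assume "\<not> set xs \<subseteq> dual V"
    have *: "\<alpha> us * \<beta> vs = 0" if "\<not> set (us @ vs) \<subseteq> dual V" for us vs
      using that ext_powerD(2)[OF assms(1), of us] ext_powerD(2)[OF assms(2), of vs] by auto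
    have **: "\<alpha> (take j (permute_list \<sigma> xs)) * \<beta> (drop j (permute_list \<sigma> xs)) = 0" if "\<sigma> permutes {..<length xs}" for j \<sigma>
    proof (rule *)
      show "\<not> set (take j (permute_list \<sigma> xs) @ drop j (permute_list \<sigma> xs)) \<subseteq> dual V"
        using \<open>\<not> set xs \<subseteq> dual V\<close> that by (simp only: append_take_drop_id set_permute_list) simp
    qed
    show "wedge \<alpha> \<beta> xs = 0"
      unfolding wedge_def mult.assoc using ** by (intro sum.neutral ballI) (auto intro!: sum.neutral)
  next
    fix xs :: "('a cvec \<Rightarrow> complex) list" and i \<xi> \<eta> a b
    assume xs: "length xs = k + l" "set xs \<subseteq> dual V" "i < k + l" and d: "\<xi> \<in> dual V" "\<eta> \<in> dual V"
    let ?f = "\<lambda>ys. \<alpha> (take k ys) * \<beta> (drop k ys)"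
    have *: "?f (ys[j := \<lambda>v. a * \<xi> v + b * \<eta> v]) = a * ?f (ys[j := \<xi>]) + b * ?f (ys[j := \<eta>])"
      if "length ys = k + l" "set ys \<subseteq> dual V" "j < k + l" for ys j
    proof -
      have "set (take k ys) \<subseteq> dual V" "set (drop k ys) \<subseteq> dual V"
        using that by (auto dest: in_set_takeD in_set_dropD)
      then show ?thesis
        using that d by (cases "j < k") (auto simp: list_update_beyond take_update_swap drop_update_swap ext_power_update[OF assms(1)]
            ext_power_update[OF assms(2)] algebra_simps)
    qed
    have "shuffle_sum (\<lambda>us vs. \<alpha> us * \<beta> vs) k (xs[i := \<lambda>v. a * \<xi> v + b * \<eta> v]) =
      a * shuffle_sum (\<lambda>us vs. \<alpha> us * \<beta> vs) k (xs[i := \<xi>]) + b * shuffle_sum (\<lambda>us vs. \<alpha> us * \<beta> vs) k (xs[i := \<eta>])"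
      unfolding shuffle_sum_def sum_distrib_left sum.distrib[symmetric] length_list_update
    proof (intro sum.cong refl)
      fix \<sigma> assume \<sigma>: "\<sigma> \<in> {\<sigma>. \<sigma> permutes {..<length xs}}"
      then have "inv_into UNIV \<sigma> i < k + l"
        using permutes_in_image[OF permutes_inv, of \<sigma> "{..<length xs}" i] xs by auto
      with \<sigma> have "?f (permute_list \<sigma> (xs[i := \<lambda>v. a * \<xi> v + b * \<eta> v])) =
          a * ?f (permute_list \<sigma> (xs[i := \<xi>])) + b * ?f (permute_list \<sigma> (xs[i := \<eta>]))"
        using xs * by (simp add: permute_list_update)
      then show "of_int (sign \<sigma>) * ?f (permute_list \<sigma> (xs[i := \<lambda>v. a * \<xi> v + b * \<eta> v])) =
          a * (of_int (sign \<sigma>) * ?f (permute_list \<sigma> (xs[i := \<xi>]))) + b * (of_int (sign \<sigma>) * ?f (permute_list \<sigma> (xs[i := \<eta>])))"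
        by (simp add: algebra_simps)
    qed
    then show "wedge \<alpha> \<beta> (xs[i := \<lambda>v. a * \<xi> v + b * \<eta> v]) = a * wedge \<alpha> \<beta> (xs[i := \<xi>]) + b * wedge \<alpha> \<beta> (xs[i := \<eta>])"
      using xs by (simp add: val add_divide_distrib)
  next
    fix xs :: "('a cvec \<Rightarrow> complex) list" assume "length xs = k + l" "\<not> distinct xs"
    then show "wedge \<alpha> \<beta> xs = 0"
      by (simp add: val shuffle_sum_not_distinct)
  qed
qed

lemma wedge_power_ext_power:
  "\<pi> \<in> ext_power 2 V \<Longrightarrow> wedge_power \<pi> d \<in> ext_power (2 * d) V"
  by (induction d) (auto simp: ext_power_one dest: wedge_ext_power)

lemma ext_power_swap:
  assumes "\<alpha> \<in> ext_power k V" "set xs \<subseteq> dual V" "i < length xs" "j < length xs" "i \<noteq> j"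
  shows "\<alpha> (permute_list (Transposition.transpose i j) xs) = - \<alpha> xs"
proof (cases "length xs = k")
  case True
  \<comment> \<open>Polarisation: the form vanishes when both slots contain \<open>x + y\<close>,
    and expanding leaves the two mixed terms.\<close>
  define x y s where "x = xs ! i" and "y = xs ! j" and "s = (\<lambda>v. 1 * x v + 1 * y v)"
  define g where "g u w = \<alpha> (xs[i := u, j := w])" for u w
  have d: "x \<in> dual V" "y \<in> dual V" "s \<in> dual V"
    using assms(2-4) dual_lincomb[of x V y 1 1] subsetD[OF assms(2) nth_mem, of i] subsetD[OF assms(2) nth_mem, of j] by (auto simp: x_def y_def s_def)
  have sub: "set (xs[i := u]) \<subseteq> dual V" if "u \<in> dual V" for u i
    using assms(2) that set_update_subset_insert[of xs i u] by auto
  have zero: "g u u = 0" for u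
  proof -
    have "\<not> distinct (xs[i := u, j := u])"
      using nth_eq_iff_index_eq[of "xs[i := u, j := u]" i j] assms(3-5) by (auto simp: nth_list_update)
    then show ?thesis by (simp add: g_def ext_powerD(3)[OF assms(1)])
  qed
  have a1: "g s w = g x w + g y w" if "w \<in> dual V" for w
    unfolding g_def s_def list_update_swap[OF assms(5)]
    using ext_power_update[OF assms(1) _ _ _ d(1,2), of "xs[j := w]" i 1 1] True assms(3) sub that by simp
  have a2: "g w s = g w x + g w y" if "w \<in> dual V" for w
    unfolding g_def s_def
    using ext_power_update[OF assms(1) _ _ _ d(1,2), of "xs[i := w]" j 1 1] True assms(4) sub that by simp
  have "g y x = - g x y"
    using zero[of s] zero[of x] zero[of y] a1[OF d(3)] a2[OF d(1)] a2[OF d(2)]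
    by (simp add: add_eq_0_iff2)
  moreover have "permute_list (Transposition.transpose i j) xs = xs[i := y, j := x]"
    using assms(3-5) permutes_swap_id[of i "{..<length xs}" j]
    by (intro nth_equalityI) (auto simp: permute_list_nth nth_list_update x_def y_def Transposition.transpose_def)
  ultimately show ?thesis by (simp only: g_def) (simp add: x_def y_def)
qed (simp add: ext_powerD(1)[OF assms(1)])

lemma ext_power_permute:
  assumes "\<alpha> \<in> ext_power k V" "set xs \<subseteq> dual V" "\<sigma> permutes {..<length xs}"
  shows "\<alpha> (permute_list \<sigma> xs) = of_int (sign \<sigma>) * \<alpha> xs"
proof -
  have "\<forall>xs. length xs = n \<longrightarrow> set xs \<subseteq> dual V \<longrightarrow> \<alpha> (permute_list \<sigma> xs) = of_int (sign \<sigma>) * \<alpha> xs"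
    if "\<sigma> permutes {..<n}" for n
    using that finite_lessThan[of n]
  proof (induction rule: permutes_induct)
    case (swap a b p)
    then have t: "Transposition.transpose a b permutes {..<n}"
      by (intro permutes_swap_id)
    show ?case
    proof (intro allI impI)
      fix xs :: "('a cvec \<Rightarrow> complex) list" assume xs: "length xs = n" "set xs \<subseteq> dual V"
      have "\<alpha> (permute_list (Transposition.transpose a b) xs) = of_int (sign (Transposition.transpose a b)) * \<alpha> xs"
        using swap xs ext_power_swap[OF assms(1) xs(2), of a b] by (cases "a = b") (auto simp: sign_swap_id)
      then show "\<alpha> (permute_list (Transposition.transpose a b \<circ> p) xs) = of_int (sign (Transposition.transpose a b \<circ> p)) * \<alpha> xs"
        using swap xs t by (simp add: permute_list_compose sign_mult_permutes)
    qed
  qed auto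
  then show ?thesis using assms by blast
qed

text \<open>\<open>wedge\<close> antisymmetrises even when one factor is a scalar, so membership in
  an exterior power is essential: all permutations then give equal terms and the factorial
  cancels.\<close>

lemma wedge_one_left:
  assumes "\<gamma> \<in> ext_power k V"
  shows "wedge ext_one \<gamma> = \<gamma>"
proof
  fix xs :: "('a cvec \<Rightarrow> complex) list"
  have 1: "wedge ext_one \<gamma> \<in> ext_power k V"
    using wedge_ext_power[OF ext_power_one assms] by simp
  show "wedge ext_one \<gamma> xs = \<gamma> xs"
  proof (cases "set xs \<subseteq> dual V")
    case True
    have "wedge ext_one \<gamma> xs = (\<Sum>j\<in>{0}. shuffle_sum (\<lambda>us vs. ext_one us * \<gamma> vs) j xs / (fact j * fact (length xs - j)))"
      unfolding wedge_shuffle_sum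
    proof (intro sum.mono_neutral_right ballI)
      fix j assume "j \<in> {..length xs} - {0}"
      then have "ext_one (take j (permute_list \<sigma> xs)) = 0" for \<sigma>
        by (auto simp: ext_one_def simp flip: length_0_conv)
      then show "shuffle_sum (\<lambda>us vs. ext_one us * \<gamma> vs) j xs / (fact j * fact (length xs - j)) = 0"
        by (simp add: shuffle_sum_def)
    qed auto
    moreover have "shuffle_sum (\<lambda>us vs. ext_one us * \<gamma> vs) 0 xs = (\<Sum>\<sigma> | \<sigma> permutes {..<length xs}. \<gamma> xs)"
      unfolding shuffle_sum_def
      by (intro sum.cong) (auto simp: ext_one_def ext_power_permute[OF assms True] simp flip: mult.assoc of_int_mult)
    ultimately show ?thesis by (simp add: card_permutations[OF refl])
  qed (simp add: ext_powerD(2)[OF 1] ext_powerD(2)[OF assms])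
qed

subsection \<open>Bases and dual bases\<close>

definition cbasis :: "'a cvec set \<Rightarrow> 'a cvec set \<Rightarrow> bool" where
  "cbasis B V \<longleftrightarrow> finite B \<and> cfun.independent B \<and> cfun.span B = V"

text \<open>\<open>cfun.representation\<close> is 0 off the span of \<open>B\<close>, which is
  exactly the normalisation in \<open>dual\<close>; thus \<open>crd B b\<close> itself is an element
  of the dual basis.\<close>

definition crd :: "'a cvec set \<Rightarrow> 'a cvec \<Rightarrow> 'a cvec \<Rightarrow> complex" where
  "crd B b v = cfun.representation B v b"

lemma sum_fun: "sum f I = (\<lambda>x. \<Sum>i\<in>I. (f i x :: complex))"
  by (induction I rule: infinite_finite_induct) (auto simp: fun_eq_iff)

lemma cbasisD:
  assumes "cbasis B V"
  shows "finite B" "cfun.independent B" "cfun.span B = V" "cfun.subspace V" "b \<in> B \<Longrightarrow> b \<in> V" "cfun.dim V = card B"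
  using assms cfun.dim_eq_card_independent[of B] unfolding cbasis_def by (auto simp: cfun.span_base)

lemma subspace_sum:
  assumes "cfun.subspace V" "\<And>i. i \<in> I \<Longrightarrow> f i \<in> V"
  shows "(\<lambda>x. \<Sum>i\<in>I. c i * f i x) \<in> V"
  using cfun.subspace_sum[OF assms(1), of I "\<lambda>i x. c i * f i x"] assms csubspaceD(3)[OF assms(1)]
  by (simp add: sum_fun)

lemma dual_sum:
  assumes "\<xi> \<in> dual V" "cfun.subspace V" "finite I" "\<And>i. i \<in> I \<Longrightarrow> f i \<in> V"
  shows "\<xi> (\<lambda>x. \<Sum>i\<in>I. c i * f i x) = (\<Sum>i\<in>I. c i * \<xi> (f i))"
  using assms(3,4)
proof (induction I rule: finite_induct)
  case empty
  show ?case
    using dualD(2)[OF assms(1) csubspaceD(1)[OF assms(2)], of 0] by simp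
next
  case (insert i I)
  have "\<xi> (\<lambda>x. c i * f i x + (\<Sum>j\<in>I. c j * f j x)) = \<xi> (\<lambda>x. c i * f i x) + \<xi> (\<lambda>x. \<Sum>j\<in>I. c j * f j x)"
    using insert by (intro dualD(1)[OF assms(1)] csubspaceD(3)[OF assms(2)] subspace_sum[OF assms(2)]) auto
  then show ?case
    using insert by (simp add: dualD(2)[OF assms(1)])
qed

lemma lin_sum:
  assumes "lin V W g" "cfun.subspace V" "finite I" "\<And>i. i \<in> I \<Longrightarrow> f i \<in> V"
  shows "g (\<lambda>x. \<Sum>i\<in>I. c i * f i x) = (\<lambda>x. \<Sum>i\<in>I. c i * g (f i) x)"
  using assms(3,4)
proof (induction I rule: finite_induct)
  case empty
  show ?case
    using linD(3)[OF assms(1) csubspaceD(1)[OF assms(2)], of 0] by simp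
next
  case (insert i I)
  have "g (\<lambda>x. c i * f i x + (\<Sum>j\<in>I. c j * f j x)) = (\<lambda>x. g (\<lambda>x. c i * f i x) x + g (\<lambda>x. \<Sum>j\<in>I. c j * f j x) x)"
    using insert by (intro linD(2)[OF assms(1)] csubspaceD(3)[OF assms(2)] subspace_sum[OF assms(2)]) auto
  then show ?case
    using insert by (simp add: linD(3)[OF assms(1)])
qed

lemma crd_expand:
  assumes "cbasis B V" "v \<in> V"
  shows "v = (\<lambda>x. \<Sum>b\<in>B. crd B b v * b x)"
  using cfun.sum_representation_eq[of B v B] cbasisD[OF assms(1)] assms(2)
  by (simp add: crd_def sum_fun)

lemma crd_basis:
  assumes "cbasis B V" "b \<in> B"
  shows "crd B c b = (if c = b then 1 else 0)"
  using cfun.representation_basis[of B b] cbasisD[OF assms(1)] assms(2)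
  by (simp add: crd_def)

lemma crd_dual:
  assumes "cbasis B V"
  shows "crd B b \<in> dual V"
proof (rule dualI)
  note B = cbasisD[OF assms]
  fix v w assume "v \<in> V" "w \<in> V"
  then show "crd B b (\<lambda>x. v x + w x) = crd B b v + crd B b w"
    using cfun.representation_add[of B w v] B by (simp add: crd_def plus_fun_def)
next
  note B = cbasisD[OF assms]
  fix c v assume "v \<in> V"
  then show "crd B b (\<lambda>x. c * v x) = c * crd B b v"
    using cfun.representation_scale[of B v c] B by (simp add: crd_def)
next
  note B = cbasisD[OF assms]
  fix v assume "v \<notin> V"
  then show "crd B b v = 0"
    using B by (simp add: crd_def cfun.representation_def)
qed

lemma dual_expand:
  assumes "cbasis B V" "\<xi> \<in> dual V"
  shows "\<xi> = (\<lambda>v. \<Sum>b\<in>B. \<xi> b * crd B b v)"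
proof
  fix v
  note B = cbasisD[OF assms(1)]
  show "\<xi> v = (\<Sum>b\<in>B. \<xi> b * crd B b v)"
  proof (cases "v \<in> V")
    case True
    have "\<xi> v = \<xi> (\<lambda>x. \<Sum>b\<in>B. crd B b v * b x)"
      using crd_expand[OF assms(1) True] by simp
    also have "\<dots> = (\<Sum>b\<in>B. crd B b v * \<xi> b)"
      using B by (intro dual_sum[OF assms(2)]) auto
    finally show ?thesis by (simp add: mult.commute)
  next
    case False
    then show ?thesis
      using dualD(3)[OF assms(2)] dualD(3)[OF crd_dual[OF assms(1)]] by simp
  qed
qed

lemma dual_subspace: "cfun.subspace (dual V)"
  unfolding cfun.subspace_def dual_def by (auto simp: algebra_simps)

lemma cbasisI:
  assumes "finite I" "inj_on b I" "\<And>c i. (\<lambda>x. \<Sum>j\<in>I. c j * b j x) = (\<lambda>x. 0) \<Longrightarrow> i \<in> I \<Longrightarrow> c i = 0"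
    and "\<And>v. v \<in> V \<Longrightarrow> \<exists>c. v = (\<lambda>x. \<Sum>j\<in>I. c j * b j x)"
    and "cfun.subspace V" "\<And>i. i \<in> I \<Longrightarrow> b i \<in> V"
  shows "cbasis (b ` I) V"
  unfolding cbasis_def
proof (intro conjI)
  show "finite (b ` I)" using assms(1) by simp
  show "cfun.independent (b ` I)"
  proof (rule cfun.independent_if_scalars_zero)
    fix f x assume *: "(\<Sum>x\<in>b ` I. (\<lambda>y. f x * x y)) = 0" "x \<in> b ` I"
    then obtain i where i: "i \<in> I" "x = b i" by auto
    have "(\<lambda>x. \<Sum>j\<in>I. f (b j) * b j x) = (\<lambda>x. 0)"
      using *(1) assms(2) by (simp add: sum.reindex sum_fun zero_fun_def)
    from assms(3)[OF this i(1)] i show "f x = 0" by simp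
  qed (use assms(1) in simp)
  show "cfun.span (b ` I) = V"
  proof
    show "cfun.span (b ` I) \<subseteq> V"
      using assms(5,6) by (intro cfun.span_minimal) auto
    show "V \<subseteq> cfun.span (b ` I)"
    proof
      fix v assume "v \<in> V"
      then obtain c where "v = (\<lambda>x. \<Sum>j\<in>I. c j * b j x)" using assms(4) by blast
      then show "v \<in> cfun.span (b ` I)"
        by (simp add: subspace_sum[OF cfun.subspace_span] cfun.span_base)
    qed
  qed
qed

lemma cbasis_coeff_zero:
  assumes "cbasis B V" "(\<lambda>x. \<Sum>b\<in>B. c b * b x) = (\<lambda>x. 0)" "b \<in> B"
  shows "c b = 0"
proof -
  note B = cbasisD[OF assms(1)]
  have "crd B b (\<lambda>x. \<Sum>b\<in>B. c b * b x) = (\<Sum>b'\<in>B. c b' * crd B b b')"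
    using B by (intro dual_sum[OF crd_dual[OF assms(1)]]) auto
  also have "\<dots> = (\<Sum>b'\<in>B. if b' = b then c b else 0)"
    using crd_basis[OF assms(1)] by (intro sum.cong) auto
  also have "\<dots> = c b" using assms(3) B by simp
  finally show ?thesis
    using dualD(2)[OF crd_dual[OF assms(1)] csubspaceD(1)[OF B(4)], of b 0] assms(2) by simp
qed

lemma cbasis_dual:
  assumes "cbasis B V"
  shows "cbasis (crd B ` B) (dual V)" "card (crd B ` B) = card B"
proof -
  note B = cbasisD[OF assms]
  have inj: "inj_on (crd B) B"
  proof (rule inj_onI)
    fix b c assume *: "b \<in> B" "c \<in> B" "crd B b = crd B c"
    have "(if c = b then 1 else 0) = crd B b b"
      unfolding *(3) by (rule crd_basis[OF assms *(1), symmetric])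
    also have "\<dots> = 1" by (simp add: crd_basis[OF assms *(1)])
    finally show "b = c" by (simp split: if_splits)
  qed
  then show "card (crd B ` B) = card B" by (rule card_image)
  show "cbasis (crd B ` B) (dual V)"
  proof (rule cbasisI[OF B(1) inj])
    fix c i assume *: "(\<lambda>x. \<Sum>j\<in>B. c j * crd B j x) = (\<lambda>x. 0)" "i \<in> B"
    have "0 = (\<Sum>j\<in>B. c j * crd B j i)" using fun_cong[OF *(1), of i] by simp
    also have "\<dots> = (\<Sum>j\<in>B. if j = i then c i else 0)"
      using crd_basis[OF assms *(2)] by (intro sum.cong) auto
    finally show "c i = 0" using * B by simp
  next
    show "\<exists>c. \<xi> = (\<lambda>v. \<Sum>b\<in>B. c b * crd B b v)" if "\<xi> \<in> dual V" for \<xi>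
      using dual_expand[OF assms that] by blast
  qed (simp_all add: dual_subspace crd_dual[OF assms])
qed

lemma lin_zero:
  assumes "lin V W f" "cfun.subspace V"
  shows "f (\<lambda>x. 0) = (\<lambda>x. 0)"
  using linD(3)[OF assms(1) csubspaceD(1)[OF assms(2)], of 0] by simp

text \<open>The image of a basis under an injective map is independent and already as large as a
  basis of \<open>W\<close>; a vector of \<open>W\<close> outside its span would enlarge it beyond
  that bound.\<close>

lemma lin_inj_surj:
  assumes f: "lin V W f" "\<And>v. v \<in> V \<Longrightarrow> f v = (\<lambda>x. 0) \<Longrightarrow> v = (\<lambda>x. 0)"
    and B: "cbasis B V" and C: "cbasis C W" and card: "card C \<le> card B"
  shows "f ` V = W"
proof -
  note B' = cbasisD[OF B] note C' = cbasisD[OF C]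
  have inj: "inj_on f B"
  proof (rule inj_onI)
    fix b c assume *: "b \<in> B" "c \<in> B" "f b = f c"
    then have "f (\<lambda>x. b x + -1 * c x) = (\<lambda>x. f b x + f (\<lambda>x. -1 * c x) x)"
      using B' by (intro linD(2)[OF f(1)] csubspaceD(3)) auto
    then have "(\<lambda>x. b x + -1 * c x) = (\<lambda>x. 0)"
      using * B' csubspaceD(4)[OF B'(4), of b c] by (intro f(2)) (auto simp: linD(3)[OF f(1), of _ "-1", simplified])
    then show "b = c" by (simp add: fun_eq_iff)
  qed
  have ind: "cfun.independent (f ` B)"
  proof (rule cfun.independent_if_scalars_zero)
    fix g x assume *: "(\<Sum>x\<in>f ` B. (\<lambda>y. g x * x y)) = 0" "x \<in> f ` B"
    then obtain b where b: "b \<in> B" "x = f b" by auto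
    have "f (\<lambda>x. \<Sum>b\<in>B. g (f b) * b x) = (\<lambda>x. 0)"
      using *(1) inj B' by (subst lin_sum[OF f(1)]) (auto simp: sum.reindex sum_fun zero_fun_def)
    then have "(\<lambda>x. \<Sum>b\<in>B. g (f b) * b x) = (\<lambda>x. 0)"
      using B' by (intro f(2) subspace_sum) auto
    from cbasis_coeff_zero[OF B this b(1)] b show "g x = 0" by simp
  qed (use B' in simp)
  have "W \<subseteq> cfun.span (f ` B)"
  proof (rule ccontr)
    assume "\<not> W \<subseteq> cfun.span (f ` B)"
    then obtain w where w: "w \<in> W" "w \<notin> cfun.span (f ` B)" by auto
    have "cfun.independent (insert w (f ` B))"
      by (rule cfun.independent_insertI[OF w(2) ind])
    moreover have "insert w (f ` B) \<subseteq> cfun.span C"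
      using w C' linD(1)[OF f(1)] B' by auto
    ultimately have "card (insert w (f ` B)) \<le> card C"
      using cfun.independent_span_bound[OF C'(1)] by auto
    moreover have "w \<notin> f ` B" using w cfun.span_base by blast
    ultimately show False using card inj B' by (simp add: card_image)
  qed
  moreover have "cfun.span (f ` B) \<subseteq> f ` V"
  proof (rule cfun.span_minimal)
    show "f ` B \<subseteq> f ` V" using B' by auto
    show "cfun.subspace (f ` V)"
      unfolding cfun.subspace_def
    proof (intro conjI ballI allI)
      show "0 \<in> f ` V"
        using lin_zero[OF f(1) B'(4)] csubspaceD(1)[OF B'(4)] by (force simp: zero_fun_def)
      fix x y c assume "x \<in> f ` V" "y \<in> f ` V"
      then obtain v w where v: "v \<in> V" "w \<in> V" "x = f v" "y = f w" by auto
      then have "x + y = f (\<lambda>x. v x + w x)" "(\<lambda>z. c * x z) = f (\<lambda>z. c * v z)"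
        using linD(2,3)[OF f(1)] by (auto simp: plus_fun_def)
      then show "x + y \<in> f ` V" "(\<lambda>z. c * x z) \<in> f ` V"
        using v csubspaceD(2,3)[OF B'(4)] by auto
    qed
  qed
  ultimately show ?thesis using linD(1)[OF f(1)] by blast
qed

lemma cbasis_subspace:
  assumes "cbasis B V" "cfun.subspace U" "U \<subseteq> V"
  obtains C where "cbasis C U" "card C \<le> card B" "C \<subseteq> U"
proof -
  note B = cbasisD[OF assms(1)]
  obtain C where C: "C \<subseteq> U" "cfun.independent C" "U \<subseteq> cfun.span C"
    using cfun.maximal_independent_subset[of U] by auto
  moreover have "finite C \<and> card C \<le> card B"
    using B C assms by (intro cfun.independent_span_bound) auto
  moreover have "cfun.span C \<subseteq> U" using C assms(2) by (intro cfun.span_minimal) auto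
  ultimately show ?thesis using that[of C] by (auto simp: cbasis_def)
qed

lemma cbasis_card_less:
  assumes "cbasis B V" "cbasis C U" "U \<subseteq> V" "v \<in> V" "v \<notin> U"
  shows "card C < card B"
proof -
  note B = cbasisD[OF assms(1)] note C = cbasisD[OF assms(2)]
  have "cfun.independent (insert v C)" using assms C by (intro cfun.independent_insertI) auto
  moreover have "insert v C \<subseteq> cfun.span B" using assms B C by auto
  ultimately have "card (insert v C) \<le> card B"
    using cfun.independent_span_bound[OF B(1)] by auto
  moreover have "v \<notin> C" using C assms by auto
  ultimately show ?thesis using C by simp
qed

lemma cbasis_union:
  assumes "cbasis B1 V1" "cbasis B2 V2" "V1 \<inter> V2 \<subseteq> {\<lambda>x. 0}"
    and "V = {\<lambda>x. v x + w x | v w. v \<in> V1 \<and> w \<in> V2}"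
  shows "cbasis (B1 \<union> B2) V" "B1 \<inter> B2 = {}"
proof -
  note B1 = cbasisD[OF assms(1)] note B2 = cbasisD[OF assms(2)]
  have "0 \<notin> B1" using B1(2) cfun.dependent_zero by auto
  then show dis: "B1 \<inter> B2 = {}"
    using B1(5) B2(5) assms(3) by (auto simp: zero_fun_def)
  have "cfun.independent (B1 \<union> B2)"
  proof (rule cfun.independent_if_scalars_zero)
    fix f x assume *: "(\<Sum>x\<in>B1 \<union> B2. (\<lambda>y. f x * x y)) = 0" "x \<in> B1 \<union> B2"
    define v where "v = (\<lambda>y. \<Sum>x\<in>B1. f x * x y)"
    define w where "w = (\<lambda>y. \<Sum>x\<in>B2. f x * x y)"
    have "v y + w y = 0" for y
      using fun_cong[OF *(1), of y] dis B1 B2 by (simp add: v_def w_def sum_fun sum.union_disjoint)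
    then have vw: "v = (\<lambda>x. - w x)" by (auto simp: add_eq_0_iff2)
    have "v \<in> V1" "w \<in> V2"
      unfolding v_def w_def using B1 B2 by (auto intro!: subspace_sum)
    then have "v \<in> V1 \<inter> V2" using csubspaceD(5)[OF B2(4), of w] vw by simp
    then have v0: "v = (\<lambda>x. 0)" using assms(3) by blast
    then have w0: "w = (\<lambda>x. 0)" using vw by (simp add: fun_eq_iff)
    show "f x = 0"
      using *(2) cbasis_coeff_zero[OF assms(1), of f x] cbasis_coeff_zero[OF assms(2), of f x] v0 w0
      by (auto simp: v_def w_def)
  qed (use B1 B2 in simp)
  moreover have "cfun.span (B1 \<union> B2) = V"
    using B1 B2 assms(4) by (auto simp: cfun.span_Un plus_fun_def)
  ultimately show "cbasis (B1 \<union> B2) V" using B1 B2 by (simp add: cbasis_def)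
qed

subsection \<open>Top exterior powers\<close>

text \<open>The prefix \<open>us\<close> holds the entries already rescaled, so that the induction
  can run along \<open>bs\<close>.\<close>

lemma ext_power_scale_list:
  assumes "\<alpha> \<in> ext_power k V" "set (us @ map \<eta> bs) \<subseteq> dual V" "length us + length bs = k"
  shows "\<alpha> (us @ map (\<lambda>b v. c b * \<eta> b v) bs) = (\<Prod>b\<leftarrow>bs. c b) * \<alpha> (us @ map \<eta> bs)"
  using assms(2,3)
proof (induction bs arbitrary: us)
  case (Cons b bs)
  have d: "\<eta> b \<in> dual V" "set us \<subseteq> dual V" "set (map \<eta> bs) \<subseteq> dual V"
    using Cons.prems by auto
  have "\<alpha> ((us @ [\<lambda>v. c b * \<eta> b v]) @ map (\<lambda>b v. c b * \<eta> b v) bs) =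
      (\<Prod>b\<leftarrow>bs. c b) * \<alpha> ((us @ [\<lambda>v. c b * \<eta> b v]) @ map \<eta> bs)"
    using Cons.prems d dual_scale[OF d(1)] by (intro Cons.IH) auto
  moreover have "\<alpha> (us @ (\<lambda>v. c b * \<eta> b v) # map \<eta> bs) = c b * \<alpha> (us @ \<eta> b # map \<eta> bs)"
    using ext_power_update[OF assms(1), of "us @ \<eta> b # map \<eta> bs" "length us" "\<eta> b" "\<eta> b" "c b" 0] Cons.prems d
    by simp
  ultimately show ?case by simp
qed simp

lemma ext_power_update_sum:
  assumes "\<alpha> \<in> ext_power k V" "length us + Suc (length vs) = k" "set us \<subseteq> dual V" "set vs \<subseteq> dual V"
    and "finite I" "\<And>i. i \<in> I \<Longrightarrow> \<eta> i \<in> dual V"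
  shows "\<alpha> (us @ (\<lambda>v. \<Sum>i\<in>I. c i * \<eta> i v) # vs) = (\<Sum>i\<in>I. c i * \<alpha> (us @ \<eta> i # vs))"
  using assms(5,6)
proof (induction I rule: finite_induct)
  case empty
  have "(\<lambda>v. 0) \<in> dual V" by (auto intro: dualI)
  then show ?case
    using ext_power_update[OF assms(1), of "us @ (\<lambda>v. 0) # vs" "length us" "\<lambda>v. 0" "\<lambda>v. 0" 0 0] assms(2-4)
    by simp
next
  case (insert i I)
  have d: "\<eta> i \<in> dual V" "(\<lambda>v. \<Sum>i\<in>I. c i * \<eta> i v) \<in> dual V"
    using insert by (auto intro!: subspace_sum[OF dual_subspace])
  show ?case
    using ext_power_update[OF assms(1), of "us @ \<eta> i # vs" "length us" "\<eta> i" "\<lambda>v. \<Sum>i\<in>I. c i * \<eta> i v" "c i" 1] 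
      assms(2-4) d insert by simp
qed

text \<open>Multilinear expansion in the dual basis, one entry at a time from the right end of the
  list; lists with repetitions drop out by alternation.\<close>

lemma ext_power_eq_zero:
  assumes \<alpha>: "\<alpha> \<in> ext_power k V" and B: "cbasis B V"
    and zero: "\<And>bs. length bs = k \<Longrightarrow> set bs \<subseteq> B \<Longrightarrow> distinct bs \<Longrightarrow> \<alpha> (map (crd B) bs) = 0"
  shows "\<alpha> = 0"
proof -
  note B' = cbasisD[OF B]
  have *: "\<alpha> (xs @ map (crd B) bs) = 0"
    if "set xs \<subseteq> dual V" "set bs \<subseteq> B" "length xs + length bs = k" for xs bs
    using that
  proof (induction xs arbitrary: bs rule: rev_induct)
    case Nil
    show ?case
    proof (cases "distinct bs")
      case False
      then have "\<not> distinct (map (crd B) bs)" by (simp add: distinct_map)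
      then show ?thesis by (simp add: ext_powerD(3)[OF \<alpha>])
    qed (use Nil zero in simp)
  next
    case (snoc x xs)
    have x: "x \<in> dual V" using snoc.prems by simp
    have "\<alpha> (xs @ x # map (crd B) bs) = \<alpha> (xs @ (\<lambda>v. \<Sum>b\<in>B. x b * crd B b v) # map (crd B) bs)"
      using dual_expand[OF B x] by simp
    also have "\<dots> = (\<Sum>b\<in>B. x b * \<alpha> (xs @ crd B b # map (crd B) bs))"
      using snoc.prems B'(1) crd_dual[OF B] by (intro ext_power_update_sum[OF \<alpha>]) (auto simp only: set_append set_map list.set length_append length_map list.size)
    also have "\<dots> = 0"
    proof (intro sum.neutral ballI)
      fix b assume "b \<in> B"
      then show "x b * \<alpha> (xs @ crd B b # map (crd B) bs) = 0"
        using snoc.IH[of "b # bs"] snoc.prems by simp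
    qed
    finally show ?case by simp
  qed
  show ?thesis
  proof
    fix xs
    show "\<alpha> xs = 0 xs"
      using *[of xs "[]"] ext_powerD(1,2)[OF \<alpha>, of xs] by (cases "set xs \<subseteq> dual V \<and> length xs = k") auto
  qed
qed

lemma ext_power_above_dim:
  assumes "\<alpha> \<in> ext_power k V" "cbasis B V" "card B < k"
  shows "\<alpha> = 0"
proof (rule ext_power_eq_zero[OF assms(1,2)])
  fix bs assume "length bs = k" "set bs \<subseteq> B" "distinct bs"
  then have "k \<le> card B" using card_mono[OF cbasisD(1)[OF assms(2)]] by (metis distinct_card)
  then show "\<alpha> (map (crd B) bs) = 0" using assms(3) by simp
qed

text \<open>In top degree the distinct lists of basis vectors are the permutations of a single
  enumeration, on which the values agree up to sign.\<close>

lemma ext_power_top_eq_zero: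
  assumes \<alpha>: "\<alpha> \<in> ext_power (card B) V" and B: "cbasis B V" and bs: "set bs = B" "distinct bs"
    and zero: "\<alpha> (map (crd B) bs) = 0"
  shows "\<alpha> = 0"
proof (rule ext_power_eq_zero[OF \<alpha> B])
  fix cs assume cs: "length cs = card B" "set cs \<subseteq> B" "distinct cs"
  then have "set cs = B"
    using card_subset_eq[OF cbasisD(1)[OF B] cs(2)] distinct_card[OF cs(3)] by simp
  then have "mset cs = mset bs"
    using bs cs(3) set_eq_iff_mset_eq_distinct by blast
  then obtain p where p: "p permutes {..<length bs}" "permute_list p bs = cs"
    using mset_eq_permutation by metis
  have "\<alpha> (map (crd B) cs) = \<alpha> (permute_list p (map (crd B) bs))"
    using p by (simp add: permute_list_map)
  also have "\<dots> = of_int (sign p) * \<alpha> (map (crd B) bs)"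
    using p by (intro ext_power_permute[OF \<alpha>]) (auto simp: crd_dual[OF B])
  finally show "\<alpha> (map (crd B) cs) = 0" using zero by simp
qed

text \<open>The top power is at most one-dimensional: the scalar is the ratio of the values on one
  enumeration of the dual basis, where \<open>\<tau>\<close> cannot vanish.\<close>

lemma ext_power_top_multiple:
  assumes "\<alpha> \<in> ext_power (card B) V" "\<tau> \<in> ext_power (card B) V" "cbasis B V" "\<tau> \<noteq> 0"
  shows "\<exists>c. \<alpha> = (\<lambda>xs. c * \<tau> xs)"
proof -
  obtain bs where bs: "set bs = B" "distinct bs"
    using finite_distinct_list[OF cbasisD(1)[OF assms(3)]] by auto
  let ?t = "\<tau> (map (crd B) bs)" and ?a = "\<alpha> (map (crd B) bs)"
  have t: "?t \<noteq> 0" using ext_power_top_eq_zero[OF assms(2,3) bs] assms(4) by blast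
  define \<delta> where "\<delta> = (\<lambda>xs. 1 * \<alpha> xs + (- ?a / ?t) * \<tau> xs)"
  have "\<delta> \<in> ext_power (card B) V"
    unfolding \<delta>_def by (rule ext_power_lincomb[OF assms(1,2)])
  moreover have "\<delta> (map (crd B) bs) = 0" using t by (simp add: \<delta>_def divide_simps)
  ultimately have "\<delta> = 0"
    by (rule ext_power_top_eq_zero[where \<alpha> = \<delta>, OF _ assms(3) bs])
  then have "\<alpha> xs = (?a / ?t) * \<tau> xs" for xs
    using fun_cong[of \<delta> 0 xs] unfolding \<delta>_def by simp
  then show ?thesis by blast
qed

text \<open>Pulling back a dual basis vector along \<open>f\<close> multiplies it by its eigenvalue,
  and a full enumeration of the dual basis collects all of them.\<close>

lemma ext_map_diagonal:
  assumes \<alpha>: "\<alpha> \<in> ext_power (card B) V" and B: "cbasis B V" and f: "lin V V f"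
    and eig: "\<And>b. b \<in> B \<Longrightarrow> f b = (\<lambda>x. \<zeta> b * b x)"
  shows "ext_map V V f \<alpha> = (\<lambda>xs. (\<Prod>b\<in>B. \<zeta> b) * \<alpha> xs)"
proof -
  note B' = cbasisD[OF B]
  obtain bs where bs: "set bs = B" "distinct bs"
    using finite_distinct_list[OF B'(1)] by auto
  have pull: "pull V f (crd B b) = (\<lambda>v. \<zeta> b * crd B b v)" if "b \<in> B" for b
  proof -
    have "pull V f (crd B b) = (\<lambda>v. \<Sum>b'\<in>B. pull V f (crd B b) b' * crd B b' v)"
      by (rule dual_expand[OF B pull_dual[OF f B'(4) crd_dual[OF B]]])
    moreover have "pull V f (crd B b) b' = (if b' = b then \<zeta> b else 0)" if "b' \<in> B" for b'
      using that B' eig dualD(2)[OF crd_dual[OF B], of b' b] crd_basis[OF B that] by (auto simp: pull_def)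
    ultimately show ?thesis using that B' by (simp add: if_distrib[of "\<lambda>c. c * _"] cong: if_cong)
  qed
  have "ext_map V V f \<alpha> (map (crd B) bs) = \<alpha> ([] @ map (\<lambda>b v. \<zeta> b * crd B b v) bs)"
  proof -
    have "set (map (crd B) bs) \<subseteq> dual V" using crd_dual[OF B] by auto
    moreover have "map (pull V f) (map (crd B) bs) = map (\<lambda>b v. \<zeta> b * crd B b v) bs"
      unfolding map_map o_def using bs(1) pull by (intro map_cong refl) simp
    ultimately show ?thesis by (simp only: ext_map_pull if_True append_Nil)
  qed
  also have "\<dots> = (\<Prod>b\<leftarrow>bs. \<zeta> b) * \<alpha> ([] @ map (crd B) bs)"
    using bs distinct_card[OF bs(2)] crd_dual[OF B] by (intro ext_power_scale_list[OF \<alpha>]) (auto simp only: set_append set_map list.set length_append length_map list.size)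
  also have "(\<Prod>b\<leftarrow>bs. \<zeta> b) = (\<Prod>b\<in>B. \<zeta> b)"
    using prod.distinct_set_conv_list[OF bs(2), of \<zeta>] unfolding bs(1) by simp
  finally have val: "ext_map V V f \<alpha> (map (crd B) bs) = (\<Prod>b\<in>B. \<zeta> b) * \<alpha> (map (crd B) bs)"
    by simp
  define \<delta> where "\<delta> = (\<lambda>xs. 1 * ext_map V V f \<alpha> xs + - (\<Prod>b\<in>B. \<zeta> b) * \<alpha> xs)"
  have "\<delta> \<in> ext_power (card B) V"
    unfolding \<delta>_def by (rule ext_power_lincomb[OF ext_map_ext_power[OF f B'(4) \<alpha>] \<alpha>])
  moreover have "\<delta> (map (crd B) bs) = 0" by (simp add: \<delta>_def val)
  ultimately have "\<delta> = 0"
    by (rule ext_power_top_eq_zero[where \<alpha> = \<delta>, OF _ B bs])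
  then have "ext_map V V f \<alpha> xs = (\<Prod>b\<in>B. \<zeta> b) * \<alpha> xs" for xs
    using fun_cong[of \<delta> 0 xs] unfolding \<delta>_def by simp
  then show ?thesis by blast
qed

subsection \<open>Products of powers of bivectors\<close>

lemma wedge_lincomb_right:
  "wedge \<gamma> (\<lambda>xs. \<Sum>i\<in>I. c i * f i xs) = (\<lambda>xs. \<Sum>i\<in>I. c i * wedge \<gamma> (f i) xs)"
proof (induction I rule: infinite_finite_induct)
  case (insert i I)
  have "wedge \<gamma> (\<lambda>xs. \<Sum>j\<in>insert i I. c j * f j xs) = wedge \<gamma> ((\<lambda>xs. c i * f i xs) + (\<lambda>xs. \<Sum>j\<in>I. c j * f j xs))"
    using insert by (intro arg_cong[of _ _ "wedge \<gamma>"]) auto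
  then show ?case
    using insert by (simp only: wedge_add_right insert.IH wedge_scale_right) auto
qed (use wedge_zero_right[of \<gamma>] in \<open>simp_all add: zero_fun_def\<close>)

lemma binomial_sum_step:
  fixes a :: "nat \<Rightarrow> complex"
  shows "(\<Sum>i\<le>d. of_nat (d choose i) * (a (Suc i) + a i)) = (\<Sum>i\<le>Suc d. of_nat (Suc d choose i) * a i)"
proof -
  have "(\<Sum>i\<le>d. of_nat (d choose i) * a i) = (\<Sum>i\<le>Suc d. of_nat (d choose i) * a i)"
    by simp
  also have "\<dots> = a 0 + (\<Sum>i\<le>d. of_nat (d choose Suc i) * a (Suc i))"
    by (subst sum.atMost_Suc_shift) simp
  finally show ?thesis
    by (subst sum.atMost_Suc_shift) (simp add: algebra_simps sum.distrib)
qed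

text \<open>The binomial theorem, valid in this noncommutative product because a multivector of
  degree 2 commutes with everything; the induction step is Pascal's rule.\<close>

lemma wedge_power_add:
  assumes "degree2 \<alpha>" "degree2 \<beta>"
  shows "wedge_power (\<alpha> + \<beta>) d =
    (\<lambda>xs. \<Sum>i\<le>d. of_nat (d choose i) * wedge (wedge_power \<alpha> i) (wedge_power \<beta> (d - i)) xs)"
proof (induction d)
  case 0
  show ?case by (simp add: wedge_one_left[OF ext_power_one])
next
  case (Suc d)
  define T where "T i j = wedge (wedge_power \<alpha> i) (wedge_power \<beta> j)" for i j
  have a: "wedge \<alpha> (T i j) = T (Suc i) j" for i j
    by (simp add: T_def wedge_assoc)
  have b: "wedge \<beta> (T i j) = T i (Suc j)" for i j
  proof -
    have "wedge \<beta> (T i j) = wedge (wedge (wedge_power \<alpha> i) \<beta>) (wedge_power \<beta> j)"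
      unfolding T_def wedge_assoc[symmetric] wedge_commute_degree2[OF assms(2), of "wedge_power \<alpha> i"] ..
    then show ?thesis by (simp add: T_def wedge_assoc)
  qed
  have "wedge_power (\<alpha> + \<beta>) (Suc d) =
      (\<lambda>xs. \<Sum>i\<le>d. of_nat (d choose i) * (T (Suc i) (d - i) xs + T i (Suc (d - i)) xs))"
    unfolding wedge_power_simps Suc.IH T_def[symmetric] wedge_lincomb_right wedge_add_left a b by simp
  also have "\<dots> = (\<lambda>xs. \<Sum>i\<le>d. of_nat (d choose i) * (T (Suc i) (Suc d - Suc i) xs + T i (Suc d - i) xs))"
    by (intro ext sum.cong) (auto simp: Suc_diff_le)
  also have "\<dots> = (\<lambda>xs. \<Sum>i\<le>Suc d. of_nat (Suc d choose i) * T i (Suc d - i) xs)"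
    using binomial_sum_step[of d "\<lambda>i. T i (Suc d - i) _"] by (intro ext) simp
  finally show ?case by (simp only: T_def)
qed

text \<open>Exponents adding up to \<open>k + l\<close> and different from \<open>(k, l)\<close>
  exceed one of the two bounds, so only one binomial term is left.\<close>

lemma wedge_power_add_top:
  assumes "degree2 \<alpha>" "degree2 \<beta>" "\<And>i. i > k \<Longrightarrow> wedge_power \<alpha> i = 0" "\<And>j. j > l \<Longrightarrow> wedge_power \<beta> j = 0"
  shows "wedge_power (\<alpha> + \<beta>) (k + l) = 
    (\<lambda>xs. of_nat ((k + l) choose k) * wedge (wedge_power \<alpha> k) (wedge_power \<beta> l) xs)"
proof
  fix xs
  have "wedge (wedge_power \<alpha> i) (wedge_power \<beta> (k + l - i)) = 0" if "i \<le> k + l" "i \<noteq> k" for i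
    using assms(3)[of i] assms(4)[of "k + l - i"] that by (cases "i > k") auto
  then have "(\<Sum>i\<le>k + l. of_nat ((k + l) choose i) * wedge (wedge_power \<alpha> i) (wedge_power \<beta> (k + l - i)) xs)
    = (\<Sum>i\<in>{k}. of_nat ((k + l) choose i) * wedge (wedge_power \<alpha> i) (wedge_power \<beta> (k + l - i)) xs)"
    by (intro sum.mono_neutral_right) auto
  then show "wedge_power (\<alpha> + \<beta>) (k + l) xs = of_nat ((k + l) choose k) * wedge (wedge_power \<alpha> k) (wedge_power \<beta> l) xs"
    by (simp add: wedge_power_add[OF assms(1,2)])
qed

text \<open>An injective self-map of the finite lower block is onto it, so the upper block is
  preserved as well and the permutation is a product of two independent ones.\<close>

lemma block_permutation:
  assumes \<sigma>: "\<sigma> permutes {..<k + l}" "\<And>i. i < k \<Longrightarrow> \<sigma> i < k"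
  obtains \<tau> \<rho> where "\<tau> permutes {..<k}" "\<rho> permutes {..<l}" "\<sigma> = \<tau> \<circ> shift_perm k (k + l) \<rho>"
proof -
  have inj: "inj \<sigma>" using \<sigma>(1) permutes_inj by blast
  have img: "\<sigma> ` {..<k} = {..<k}"
    using \<sigma>(2) inj by (intro endo_inj_surj) (auto intro: inj_on_subset)
  have ge: "\<sigma> i \<ge> k" if "i \<ge> k" for i
  proof (rule ccontr)
    assume "\<not> \<sigma> i \<ge> k"
    then have "\<sigma> i \<in> \<sigma> ` {..<k}" using img by simp
    then show False using inj that by (auto simp: inj_image_mem_iff)
  qed
  have lt: "\<sigma> i < k + l" if "i < k + l" for i
    using permutes_in_image[OF \<sigma>(1), of i] that by simp
  define \<tau> where "\<tau> i = (if i < k then \<sigma> i else i)" for i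
  define \<rho> where "\<rho> i = (if i < l then \<sigma> (i + k) - k else i)" for i
  have t: "\<tau> permutes {..<k}"
    using \<sigma>(2) injD[OF inj] by (intro inj_imp_permutes) (auto simp: \<tau>_def inj_on_def)
  have "\<rho> i = \<rho> j \<Longrightarrow> i < l \<Longrightarrow> j < l \<Longrightarrow> i = j" for i j
    using injD[OF inj, of "i + k" "j + k"] ge[of "i + k"] ge[of "j + k"] by (simp add: \<rho>_def)
  moreover have "\<rho> i < l" if "i < l" for i
    using that lt[of "i + k"] ge[of "i + k"] by (simp add: \<rho>_def)
  ultimately have r: "\<rho> permutes {..<l}"
    by (intro inj_imp_permutes) (auto simp: inj_on_def, simp add: \<rho>_def)
  have r': "\<rho> permutes {..<k + l - k}" using r by simp
  note s = shift_perm[OF r' le_add1]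
  have "\<sigma> i = (\<tau> \<circ> shift_perm k (k + l) \<rho>) i" for i
  proof -
    consider "i < k" | "k \<le> i" "i < k + l" | "k + l \<le> i" by linarith
    then show ?thesis
    proof cases
      case 1
      then show ?thesis using permutes_not_in[OF s(1), of i] by (simp add: \<tau>_def)
    next
      case 2
      then show ?thesis using s(4)[of "i - k"] ge[of i] by (simp add: \<tau>_def \<rho>_def)
    next
      case 3
      then show ?thesis using permutes_not_in[OF s(1), of i] permutes_not_in[OF \<sigma>(1), of i] by (simp add: \<tau>_def)
    qed
  qed
  then show ?thesis using that[OF t r] by blast
qed

text \<open>Only the permutations preserving both blocks contribute to the value of the product on
  covectors adapted to a direct sum decomposition, and all of them contribute equally.\<close>

lemma wedge_direct_sum_eval:
  assumes \<alpha>: "\<alpha> \<in> ext_power k A" and \<beta>: "\<beta> \<in> ext_power l B"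
    and P: "lin W A P" "\<And>a. a \<in> A \<Longrightarrow> P a = a" "\<And>b. b \<in> B \<Longrightarrow> P b = (\<lambda>x. 0)"
    and Q: "lin W B Q" "\<And>b. b \<in> B \<Longrightarrow> Q b = b" "\<And>a. a \<in> A \<Longrightarrow> Q a = (\<lambda>x. 0)"
    and sub: "cfun.subspace W" "cfun.subspace A" "cfun.subspace B" "A \<subseteq> W" "B \<subseteq> W"
    and xs: "length xs = k" "set xs \<subseteq> dual A" and ys: "length ys = l" "set ys \<subseteq> dual B"
  shows "\<exists>c. c \<noteq> 0 \<and> wedge (ext_map A W id \<alpha>) (ext_map B W id \<beta>) (map (pull W P) xs @ map (pull W Q) ys)
    = c * (\<alpha> xs * \<beta> ys)"
proof -
  define Z where "Z = map (pull W P) xs @ map (pull W Q) ys"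
  let ?a = "ext_map A W id \<alpha>" and ?b = "ext_map B W id \<beta>"
  have linA: "lin A W id" and linB: "lin B W id" using sub by (auto simp: lin_def)
  have a: "?a \<in> ext_power k W" and b: "?b \<in> ext_power l W"
    using ext_map_ext_power[OF linA sub(2) \<alpha>] ext_map_ext_power[OF linB sub(3) \<beta>] by auto
  have len: "length Z = k + l" using xs ys by (simp add: Z_def)
  have Zdual: "set Z \<subseteq> dual W"
    using xs ys pull_dual[OF P(1) sub(1)] pull_dual[OF Q(1) sub(1)] by (auto simp: Z_def)
  have zero_dual: "(\<lambda>v. 0) \<in> dual A" by (auto intro: dualI)
  \<comment> \<open>The zero covector is a combination of itself with coefficients 0.\<close>
  have vanish: "\<alpha> us = 0" if "(\<lambda>v. 0) \<in> set us" for us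
  proof (cases "length us = k \<and> set us \<subseteq> dual A")
    case True
    from that obtain i where i: "i < length us" "us ! i = (\<lambda>v. 0)" by (auto simp: in_set_conv_nth)
    then show ?thesis
      using True ext_power_update[OF \<alpha>, of us i "\<lambda>v. 0" "\<lambda>v. 0" 0 0] zero_dual list_update_id[of us i] by auto
  qed (use ext_powerD[OF \<alpha>] in auto)
  have val_a: "?a (map (pull W P) xs) = \<alpha> xs"
  proof -
    have "pull A id (pull W P \<xi>) = \<xi>" if "\<xi> \<in> dual A" for \<xi>
      using that P(2) sub(4) dualD(3)[OF that] by (intro ext) (auto simp: pull_def)
    then have "map (pull A id) (map (pull W P) xs) = xs" using xs by (auto intro!: map_idI)
    then show ?thesis using Zdual by (simp add: ext_map_pull Z_def)
  qed
  have val_b: "?b (map (pull W Q) ys) = \<beta> ys"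
  proof -
    have "pull B id (pull W Q \<xi>) = \<xi>" if "\<xi> \<in> dual B" for \<xi>
      using that Q(2) sub(5) dualD(3)[OF that] by (intro ext) (auto simp: pull_def)
    then have "map (pull B id) (map (pull W Q) ys) = ys" using ys by (auto intro!: map_idI)
    then show ?thesis using Zdual by (simp add: ext_map_pull Z_def)
  qed
  define S where "S = {\<sigma>. \<sigma> permutes {..<k + l} \<and> (\<forall>i<k. \<sigma> i < k)}"
  have fin: "finite {\<sigma>. \<sigma> permutes {..<k + l}}" by (simp add: finite_permutations)
  \<comment> \<open>Such a permutation moves a covector pulled back from \<open>B\<close> into the
    first block, and its restriction to \<open>A\<close> is zero.\<close>
  have off: "?a (take k (permute_list \<sigma> Z)) = 0" if \<sigma>: "\<sigma> permutes {..<k + l}" "\<sigma> \<notin> S" for \<sigma>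
  proof -
    obtain i where i: "i < k" "\<sigma> i \<ge> k" using \<sigma> by (auto simp: S_def not_less)
    then have lt: "\<sigma> i - k < l" using permutes_in_image[OF \<sigma>(1), of i] by auto
    then have "permute_list \<sigma> Z ! i = pull W Q (ys ! (\<sigma> i - k))"
      using i \<sigma>(1) len xs(1) ys(1) by (simp add: permute_list_nth) (simp add: Z_def nth_append)
    moreover have "pull A id (pull W Q \<xi>) = (\<lambda>v. 0)" if "\<xi> \<in> dual B" for \<xi>
      using Q(3) dualD(2)[OF that csubspaceD(1)[OF sub(3)], of 0] by (auto simp: pull_def)
    moreover have "ys ! (\<sigma> i - k) \<in> dual B" using lt ys by auto
    ultimately have "map (pull A id) (take k (permute_list \<sigma> Z)) ! i = (\<lambda>v. 0)" 
      using i len by simp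
    then have "(\<lambda>v. 0) \<in> set (map (pull A id) (take k (permute_list \<sigma> Z)))"
      using i len by (metis length_map length_permute_list length_take min.absorb2 le_add1 nth_mem)
    then show ?thesis by (simp add: ext_map_pull vanish)
  qed
  have on: "of_int (sign \<sigma>) * (?a (take k (permute_list \<sigma> Z)) * ?b (drop k (permute_list \<sigma> Z))) = \<alpha> xs * \<beta> ys"
    if "\<sigma> \<in> S" for \<sigma>
  proof -
    have "\<sigma> permutes {..<k + l}" "\<And>i. i < k \<Longrightarrow> \<sigma> i < k" using that by (auto simp: S_def)
    from block_permutation[OF this] obtain \<tau> \<rho> where *: "\<tau> permutes {..<k}" "\<rho> permutes {..<l}" "\<sigma> = \<tau> \<circ> shift_perm k (k + l) \<rho>"
      by blast
    have r: "\<rho> permutes {..<k + l - k}" using *(2) by simp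
    note s = shift_perm[OF r le_add1]
    have t: "\<tau> permutes {..<k + l}" using *(1) by (rule permutes_subset) auto
    have pl: "permute_list \<sigma> Z = permute_list (shift_perm k (k + l) \<rho>) (permute_list \<tau> Z)"
      using s(2) len unfolding *(3) by (subst permute_list_compose) auto
    have "take k (permute_list \<sigma> Z) = permute_list \<tau> (map (pull W P) xs)"
      using drop_permute_list_shift(2)[of \<rho> "permute_list \<tau> Z" k] take_permute_list(1)[OF *(1), of Z] r len xs(1)
      unfolding pl by (simp add: Z_def)
    moreover have "drop k (permute_list \<sigma> Z) = permute_list \<rho> (map (pull W Q) ys)"
      using drop_permute_list_shift(1)[of \<rho> "permute_list \<tau> Z" k] take_permute_list(2)[OF *(1), of Z] r len xs(1)
      unfolding pl by (simp add: Z_def)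
    moreover have "?a (permute_list \<tau> (map (pull W P) xs)) = of_int (sign \<tau>) * \<alpha> xs"
      using *(1) xs Zdual by (subst ext_power_permute[OF a]) (auto simp: Z_def val_a)
    moreover have "?b (permute_list \<rho> (map (pull W Q) ys)) = of_int (sign \<rho>) * \<beta> ys"
      using *(2) ys Zdual by (subst ext_power_permute[OF b]) (auto simp: Z_def val_b)
    moreover have "sign \<sigma> = sign \<tau> * sign \<rho>"
      unfolding *(3) using sign_mult_permutes[OF t s(2)] s(3) by simp
    moreover have "of_int (sign \<tau>) * of_int (sign \<tau>) = (1 :: complex)" "of_int (sign \<rho>) * of_int (sign \<rho>) = (1 :: complex)"
      by (simp_all only: of_int_mult[symmetric] sign_idempotent of_int_1)
    ultimately show ?thesis by (simp add: algebra_simps)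
  qed
  have "wedge ?a ?b Z = (\<Sum>j\<in>{k}. shuffle_sum (\<lambda>us vs. ?a us * ?b vs) j Z / (fact j * fact (k + l - j)))"
    unfolding wedge_shuffle_sum len
    using ext_powerD(1)[OF a] len by (intro sum.mono_neutral_right) (auto simp: shuffle_sum_def intro!: sum.neutral)
  also have "\<dots> = shuffle_sum (\<lambda>us vs. ?a us * ?b vs) k Z / (fact k * fact l)" by simp
  also have "shuffle_sum (\<lambda>us vs. ?a us * ?b vs) k Z = (\<Sum>\<sigma>\<in>S. \<alpha> xs * \<beta> ys)"
    unfolding shuffle_sum_def len using fin off on
    by (intro sum.mono_neutral_cong_right) (auto simp: S_def)
  finally have "wedge ?a ?b Z = (of_nat (card S) / (fact k * fact l)) * (\<alpha> xs * \<beta> ys)" by (simp add: id_def)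
  \<comment> \<open>Only the nonvanishing of the factor is retained, and for this one element of
    \<open>S\<close> is enough.\<close>
  moreover have "id \<in> S" "finite S" using fin by (auto simp: S_def permutes_id)
  then have "of_nat (card S) / (fact k * fact l) \<noteq> (0 :: complex)" by (auto simp: card_gt_0_iff)
  ultimately show ?thesis unfolding Z_def by blast
qed

subsection \<open>Symplectic vector spaces\<close>

definition bilin :: "'a cvec set \<Rightarrow> ('a cvec \<Rightarrow> 'a cvec \<Rightarrow> complex) \<Rightarrow> bool" where
  "bilin W om \<longleftrightarrow> (\<forall>u\<in>W. \<forall>v\<in>W. \<forall>w\<in>W. om (\<lambda>x. u x + v x) w = om u w + om v w \<and>
       om w (\<lambda>x. u x + v x) = om w u + om w v) \<and>
     (\<forall>c. \<forall>v\<in>W. \<forall>w\<in>W. om (\<lambda>x. c * v x) w = c * om v w \<and> om v (\<lambda>x. c * w x) = c * om v w)"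

lemma bilinD:
  assumes "bilin W om"
  shows "u \<in> W \<Longrightarrow> v \<in> W \<Longrightarrow> w \<in> W \<Longrightarrow> om (\<lambda>x. u x + v x) w = om u w + om v w"
    "u \<in> W \<Longrightarrow> v \<in> W \<Longrightarrow> w \<in> W \<Longrightarrow> om w (\<lambda>x. u x + v x) = om w u + om w v"
    "v \<in> W \<Longrightarrow> w \<in> W \<Longrightarrow> om (\<lambda>x. c * v x) w = c * om v w"
    "v \<in> W \<Longrightarrow> w \<in> W \<Longrightarrow> om v (\<lambda>x. c * w x) = c * om v w"
  using assms unfolding bilin_def by blast+

lemma bilin_subset: "bilin W om \<Longrightarrow> A \<subseteq> W \<Longrightarrow> bilin A om"
  unfolding bilin_def by (meson subsetD)

definition symplectic :: "'a cvec set \<Rightarrow> ('a cvec \<Rightarrow> 'a cvec \<Rightarrow> complex) \<Rightarrow> bool" where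
  "symplectic W om \<longleftrightarrow> (\<exists>B. cbasis B W) \<and> bilin W om \<and> (\<forall>v\<in>W. om v v = 0) \<and>
     (\<forall>v\<in>W. (\<forall>w\<in>W. om v w = 0) \<longrightarrow> v = (\<lambda>x. 0))"

lemma symplecticD:
  assumes "symplectic W om"
  shows "cfun.subspace W" "bilin W om" "v \<in> W \<Longrightarrow> om v v = 0"
    "v \<in> W \<Longrightarrow> (\<And>w. w \<in> W \<Longrightarrow> om v w = 0) \<Longrightarrow> v = (\<lambda>x. 0)"
  using assms unfolding symplectic_def by (auto dest: cbasisD)

lemma symplectic_basis:
  assumes "symplectic W om" obtains B where "cbasis B W"
  using assms unfolding symplectic_def by blast

lemma symplectic_antisym:
  assumes "symplectic W om" "v \<in> W" "w \<in> W"
  shows "om v w = - om w v"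
proof -
  note W = symplecticD[OF assms(1)]
  have "om (\<lambda>x. v x + w x) (\<lambda>x. v x + w x) = 0"
    using assms csubspaceD(2)[OF W(1)] by (intro W(3)) auto
  then have "om v w + om w v = 0"
    using assms csubspaceD(2)[OF W(1), of v w] by (simp add: bilinD(1,2)[OF W(2)] W(3))
  then show ?thesis by (simp add: eq_neg_iff_add_eq_0)
qed

text \<open>The inverse of the isomorphism of \<open>W\<close> with its dual given by the form,
  written with the same definite description as in \<open>poisson\<close> so that
  \<open>poisson\<close> and \<open>poi\<close> agree by unfolding.\<close>

definition sharp :: "'a cvec set \<Rightarrow> ('a cvec \<Rightarrow> 'a cvec \<Rightarrow> complex) \<Rightarrow> ('a cvec \<Rightarrow> complex) \<Rightarrow> 'a cvec" where
  "sharp W om \<xi> = (THE v. v \<in> W \<and> (\<forall>w\<in>W. om v w = \<xi> w))"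

lemma sharp_eq:
  assumes "symplectic W om" "v \<in> W" "\<And>w. w \<in> W \<Longrightarrow> om v w = \<xi> w"
  shows "sharp W om \<xi> = v"
  unfolding sharp_def
proof (rule the_equality)
  fix u assume u: "u \<in> W \<and> (\<forall>w\<in>W. om u w = \<xi> w)"
  note W = symplecticD[OF assms(1)]
  have "(\<lambda>x. u x + -1 * v x) = (\<lambda>x. 0)"
    using u assms(2,3) csubspaceD(2)[OF W(1) _ csubspaceD(3)[OF W(1)]] csubspaceD(3)[OF W(1)]
    by (intro W(4)) (auto simp only: bilinD(1)[OF W(2)] bilinD(3)[OF W(2)], simp)
  then show "u = v" by (simp add: fun_eq_iff)
qed (use assms in simp)

lemma flat_lin:
  assumes "symplectic W om"
  shows "lin W (dual W) (\<lambda>v w. if w \<in> W then om v w else 0)"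
proof -
  note W = symplecticD[OF assms]
  show ?thesis
    unfolding lin_def
    using csubspaceD(2,3)[OF W(1)] by (auto simp: bilinD[OF W(2)] intro!: dualI)
qed

text \<open>Nondegeneracy makes the map from \<open>W\<close> to \<open>dual W\<close> injective,
  and the two spaces have bases of equal size, so it is onto.\<close>

lemma sharp:
  assumes "symplectic W om" "\<xi> \<in> dual W"
  shows "sharp W om \<xi> \<in> W" "w \<in> W \<Longrightarrow> om (sharp W om \<xi>) w = \<xi> w"
proof -
  note W = symplecticD[OF assms(1)]
  obtain B where B: "cbasis B W" using symplectic_basis[OF assms(1)] .
  have "(\<lambda>v w. if w \<in> W then om v w else 0) ` W = dual W"
  proof (rule lin_inj_surj[OF flat_lin[OF assms(1)] _ B cbasis_dual(1)[OF B]])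
    fix v assume v: "v \<in> W" "(\<lambda>w. if w \<in> W then om v w else 0) = (\<lambda>x. 0)"
    have "om v w = 0" if "w \<in> W" for w using fun_cong[OF v(2), of w] that by simp
    then show "v = (\<lambda>x. 0)" using W(4) v(1) by blast
  qed (simp add: cbasis_dual(2)[OF B])
  then obtain v where v: "v \<in> W" "\<xi> = (\<lambda>w. if w \<in> W then om v w else 0)"
    using assms(2) by blast
  have *: "sharp W om \<xi> = v"
    using v by (intro sharp_eq[OF assms(1)]) auto
  show "sharp W om \<xi> \<in> W" using * v by simp
  show "om (sharp W om \<xi>) w = \<xi> w" if "w \<in> W" using * v that by simp
qed

definition poi :: "'a cvec set \<Rightarrow> ('a cvec \<Rightarrow> 'a cvec \<Rightarrow> complex) \<Rightarrow> 'a multivector" where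
  "poi W om = (\<lambda>\<xi>s. case \<xi>s of [\<xi>, \<eta>] \<Rightarrow> if \<xi> \<in> dual W \<and> \<eta> \<in> dual W then \<eta> (sharp W om \<xi>) else 0 | _ \<Rightarrow> 0)"

lemma poi_simps:
  "poi W om [\<xi>, \<eta>] = (if \<xi> \<in> dual W \<and> \<eta> \<in> dual W then \<eta> (sharp W om \<xi>) else 0)"
  "length xs \<noteq> 2 \<Longrightarrow> poi W om xs = 0"
  by (auto simp: poi_def split: list.splits)

lemma poi_degree2: "degree2 (poi W om)"
  by (simp add: degree2_def poi_simps)

lemma multivector2_eqI:
  assumes "degree2 \<alpha>" "degree2 \<beta>" "\<And>\<xi> \<eta>. \<alpha> [\<xi>, \<eta>] = \<beta> [\<xi>, \<eta>]"
  shows "\<alpha> = \<beta>"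
proof
  fix xs :: "('a cvec \<Rightarrow> complex) list"
  show "\<alpha> xs = \<beta> xs"
  proof (cases "length xs = 2")
    case True
    then obtain \<xi> \<eta> where "xs = [\<xi>, \<eta>]"
      by (auto simp: numeral_2_eq_2 length_Suc_conv)
    then show ?thesis using assms(3) by simp
  qed (use assms(1,2) in \<open>simp add: degree2_def\<close>)
qed

lemma sharp_lincomb:
  assumes "symplectic W om" "\<xi> \<in> dual W" "\<eta> \<in> dual W"
  shows "sharp W om (\<lambda>v. a * \<xi> v + b * \<eta> v) = (\<lambda>x. a * sharp W om \<xi> x + b * sharp W om \<eta> x)"
proof -
  note W = symplecticD[OF assms(1)] note s = sharp[OF assms(1)]
  show ?thesis
    using s(1)[OF assms(2)] s(1)[OF assms(3)] csubspaceD(2,3)[OF W(1)] s(2)[OF assms(2)] s(2)[OF assms(3)]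
    by (intro sharp_eq[OF assms(1)]) (auto simp: bilinD[OF W(2)])
qed

lemma poi_ext_power:
  assumes "symplectic W om"
  shows "poi W om \<in> ext_power 2 W"
proof (rule ext_powerI)
  note W = symplecticD[OF assms(1)] note s = sharp[OF assms(1)]
  fix xs :: "('a cvec \<Rightarrow> complex) list"
  show "poi W om xs = 0" if "length xs \<noteq> 2" using that by (rule poi_simps)
  show "poi W om xs = 0" if "\<not> set xs \<subseteq> dual W"
    using that by (auto simp: poi_def split: list.splits)
  have xs: "\<exists>\<xi> \<eta>. xs = [\<xi>, \<eta>]" if "length xs = 2"
    using that by (auto simp: numeral_2_eq_2 length_Suc_conv)
  show "poi W om xs = 0" if len: "length xs = 2" and sub: "set xs \<subseteq> dual W" and nd: "\<not> distinct xs"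
  proof -
    obtain \<xi> where "xs = [\<xi>, \<xi>]" using xs[OF len] nd by auto
    moreover from this have "\<xi> \<in> dual W" using sub by simp
    moreover from this have "\<xi> (sharp W om \<xi>) = om (sharp W om \<xi>) (sharp W om \<xi>)"
      using s by simp
    ultimately show ?thesis using W(3) s(1) by (simp add: poi_simps)
  qed
  fix i :: nat and \<xi> \<eta> a b
  assume *: "length xs = 2" "set xs \<subseteq> dual W" "i < 2" "\<xi> \<in> dual W" "\<eta> \<in> dual W"
  obtain \<xi>' \<eta>' where e: "xs = [\<xi>', \<eta>']" using xs[OF *(1)] by auto
  consider "i = 0" | "i = 1" using *(3) by linarith
  then show "poi W om (xs[i := \<lambda>v. a * \<xi> v + b * \<eta> v]) = a * poi W om (xs[i := \<xi>]) + b * poi W om (xs[i := \<eta>])"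
  proof cases
    case 1
    have d: "\<xi>' \<in> dual W" "\<eta>' \<in> dual W" using * e by auto
    show ?thesis
      using 1 e * d s(1) csubspaceD(3)[OF W(1)]
      by (simp add: poi_simps dual_lincomb sharp_lincomb[OF assms] dualD(1,2)[OF d(2)])
  qed (use e * in \<open>simp add: poi_simps dual_lincomb\<close>)
qed

text \<open>Under a surjective isometry, the vector representing a covector is the image of the
  vector representing its pullback.\<close>

lemma ext_map_poi:
  assumes "symplectic W om" "symplectic W' om'" "lin W W' S" "S ` W = W'"
    and "\<And>v w. v \<in> W \<Longrightarrow> w \<in> W \<Longrightarrow> om' (S v) (S w) = om v w"
  shows "ext_map W W' S (poi W om) = poi W' om'"
proof (rule multivector2_eqI)
  note W = symplecticD[OF assms(1)]
  fix \<xi> \<eta>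
  show "ext_map W W' S (poi W om) [\<xi>, \<eta>] = poi W' om' [\<xi>, \<eta>]"
  proof (cases "\<xi> \<in> dual W' \<and> \<eta> \<in> dual W'")
    case True
    then have d: "pull W S \<xi> \<in> dual W" "pull W S \<eta> \<in> dual W"
      using pull_dual[OF assms(3) W(1)] by auto
    have "sharp W' om' \<xi> = S (sharp W om (pull W S \<xi>))"
    proof (rule sharp_eq[OF assms(2)])
      show "S (sharp W om (pull W S \<xi>)) \<in> W'" using sharp(1)[OF assms(1) d(1)] linD(1)[OF assms(3)] by blast
      fix w assume "w \<in> W'"
      then obtain u where "u \<in> W" "w = S u" using assms(4) by blast
      then show "om' (S (sharp W om (pull W S \<xi>))) w = \<xi> w"
        using sharp[OF assms(1) d(1)] assms(5) by (simp add: pull_def)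
    qed
    then show ?thesis
      using True d sharp(1)[OF assms(1) d(1)] by (simp add: ext_map_pull poi_simps) (simp add: pull_def)
  qed (auto simp: ext_map_pull poi_simps)
qed (simp_all add: ext_map_degree2 poi_degree2)

lemma symplectic_orthogonal_sum:
  assumes "cbasis B W" "bilin W om" "symplectic A om" "symplectic C om" "\<And>a c. a \<in> A \<Longrightarrow> c \<in> C \<Longrightarrow> om a c = 0 \<and> om c a = 0"
    and "W = {\<lambda>x. v x + w x | v w. v \<in> A \<and> w \<in> C}" "A \<subseteq> W" "C \<subseteq> W"
  shows "symplectic W om"
  unfolding symplectic_def
proof (intro conjI ballI impI)
  note b = bilinD[OF assms(2)]
  show "\<exists>B. cbasis B W" using assms(1) by blast
  show "bilin W om" by fact
  fix u assume "u \<in> W"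
  then obtain v w where u: "u = (\<lambda>x. v x + w x)" "v \<in> A" "w \<in> C" using assms(6) by auto
  then have uW: "v \<in> W" "w \<in> W" "u \<in> W" using assms(7,8) \<open>u \<in> W\<close> by auto
  have e1: "om u z = om v z + om w z" if "z \<in> W" for z
    unfolding u(1) using uW that by (intro b(1)) auto
  have e2: "om z u = om z v + om z w" if "z \<in> W" for z
    unfolding u(1) using uW that by (intro b(2)) auto
  show "om u u = 0"
    using e1[OF uW(3)] e2[OF uW(1)] e2[OF uW(2)] symplecticD(3)[OF assms(3) u(2)] symplecticD(3)[OF assms(4) u(3)] assms(5)[OF u(2,3)] by simp
  assume *: "\<forall>z\<in>W. om u z = 0"
  have "om v z = 0" if "z \<in> A" for z
    using * e1[of z] that assms(5,7) u by auto
  then have "v = (\<lambda>x. 0)" using symplecticD(4)[OF assms(3) u(2)] by blast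
  moreover have "om w z = 0" if "z \<in> C" for z
    using * e1[of z] that assms(5,8) u by auto
  then have "w = (\<lambda>x. 0)" using symplecticD(4)[OF assms(4) u(3)] by blast
  ultimately show "u = (\<lambda>x. 0)" using u by simp
qed

text \<open>In an orthogonal sum, the vector representing \<open>\<xi>\<close> is the sum of the
  vectors representing its restrictions to the two summands.\<close>

lemma poi_orthogonal_sum:
  assumes "symplectic W om" "symplectic A om" "symplectic C om" "\<And>a c. a \<in> A \<Longrightarrow> c \<in> C \<Longrightarrow> om a c = 0 \<and> om c a = 0"
    and "W = {\<lambda>x. v x + w x | v w. v \<in> A \<and> w \<in> C}" "A \<subseteq> W" "C \<subseteq> W"
  shows "poi W om = ext_map A W id (poi A om) + ext_map C W id (poi C om)"
proof (rule multivector2_eqI)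
  note W = symplecticD[OF assms(1)] note b = bilinD[OF W(2)]
  have linA: "lin A W id" and linC: "lin C W id" using assms(6,7) by (auto simp: lin_def)
  show "degree2 (ext_map A W id (poi A om) + ext_map C W id (poi C om))"
    by (intro degree2_add ext_map_degree2 poi_degree2)
  fix \<xi> \<eta>
  show "poi W om [\<xi>, \<eta>] = (ext_map A W id (poi A om) + ext_map C W id (poi C om)) [\<xi>, \<eta>]"
  proof (cases "\<xi> \<in> dual W \<and> \<eta> \<in> dual W")
    case True
    have dA: "pull A id \<xi> \<in> dual A" "pull A id \<eta> \<in> dual A"
      using True pull_dual[OF linA symplecticD(1)[OF assms(2)]] by auto
    have dC: "pull C id \<xi> \<in> dual C" "pull C id \<eta> \<in> dual C"
      using True pull_dual[OF linC symplecticD(1)[OF assms(3)]] by auto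
    define u where "u = sharp A om (pull A id \<xi>)"
    define v where "v = sharp C om (pull C id \<xi>)"
    have uv: "u \<in> A" "v \<in> C" "u \<in> W" "v \<in> W"
      using sharp(1)[OF assms(2) dA(1)] sharp(1)[OF assms(3) dC(1)] assms(6,7) by (auto simp: u_def v_def)
    have "sharp W om \<xi> = (\<lambda>x. u x + v x)"
    proof (rule sharp_eq[OF assms(1)])
      show "(\<lambda>x. u x + v x) \<in> W" using csubspaceD(2)[OF W(1)] uv by blast
      fix w assume "w \<in> W"
      then obtain a c where w: "w = (\<lambda>x. a x + c x)" "a \<in> A" "c \<in> C" using assms(5) by auto
      then have ac: "a \<in> W" "c \<in> W" using assms(6,7) by auto
      have "om (\<lambda>x. u x + v x) w = om u a + om v c"
        using b(1)[OF uv(3,4) \<open>w \<in> W\<close>] b(2)[OF ac uv(3)] b(2)[OF ac uv(4)] assms(4)[OF uv(1) w(3)] assms(4)[OF w(2) uv(2)] w(1) by simp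
      also have "\<dots> = \<xi> a + \<xi> c"
        using sharp(2)[OF assms(2) dA(1) w(2)] sharp(2)[OF assms(3) dC(1) w(3)] w by (simp add: u_def v_def pull_def)
      also have "\<dots> = \<xi> w" using True dualD(1)[of \<xi> W a c] ac w by simp
      finally show "om (\<lambda>x. u x + v x) w = \<xi> w" .
    qed
    moreover have "\<eta> (\<lambda>x. u x + v x) = \<eta> u + \<eta> v" using True dualD(1)[of \<eta> W u v] uv by simp
    ultimately have "poi W om [\<xi>, \<eta>] = \<eta> u + \<eta> v"
      using True by (simp only: poi_simps(1) if_True simp_thms)
    moreover have "ext_map A W id (poi A om) [\<xi>, \<eta>] = \<eta> u"
    proof -
      have "ext_map A W id (poi A om) [\<xi>, \<eta>] = poi A om [pull A id \<xi>, pull A id \<eta>]"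
        using True by (simp add: ext_map_pull)
      also have "\<dots> = pull A id \<eta> u"
        using dA by (simp only: poi_simps(1) u_def if_True simp_thms)
      finally show ?thesis using uv by (simp add: pull_def)
    qed
    moreover have "ext_map C W id (poi C om) [\<xi>, \<eta>] = \<eta> v"
    proof -
      have "ext_map C W id (poi C om) [\<xi>, \<eta>] = poi C om [pull C id \<xi>, pull C id \<eta>]"
        using True by (simp add: ext_map_pull)
      also have "\<dots> = pull C id \<eta> v"
        using dC by (simp only: poi_simps(1) v_def if_True simp_thms)
      finally show ?thesis using uv by (simp add: pull_def)
    qed
    ultimately show ?thesis by simp
  qed (auto simp: ext_map_pull poi_simps)
qed (rule poi_degree2)

text \<open>The divided power of the Poisson bivector of half the dimension. On a normal space with
  the restricted form this is \<open>psi\<close>.\<close>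

definition vol :: "'a cvec set \<Rightarrow> ('a cvec \<Rightarrow> 'a cvec \<Rightarrow> complex) \<Rightarrow> 'a multivector" where
  "vol W om = (\<lambda>xs. wedge_power (poi W om) (cfun.dim W div 2) xs / fact (cfun.dim W div 2))"

lemma vol_scale:
  "vol W om = (\<lambda>xs. (1 / fact (cfun.dim W div 2)) * wedge_power (poi W om) (cfun.dim W div 2) xs)"
  by (simp add: vol_def)

lemma ext_map_vol:
  assumes "symplectic W om" "symplectic W' om'" "lin W W' S" "S ` W = W'" "cfun.dim W = cfun.dim W'"
    and "\<And>v w. v \<in> W \<Longrightarrow> w \<in> W \<Longrightarrow> om' (S v) (S w) = om v w"
  shows "ext_map W W' S (vol W om) = vol W' om'"
  unfolding vol_scale ext_map_scale ext_map_wedge_power assms(5)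
  by (subst ext_map_poi[where S = S and om = om and om' = om', OF assms(1-4,6)]) auto

lemma ext_map_zero: "ext_map V W f 0 = 0"
  by (rule ext) (simp add: ext_map_pull)

lemma wedge_power_above_dim:
  assumes "symplectic A om" "cfun.dim A < 2 * i"
  shows "wedge_power (poi A om) i = 0"
proof -
  obtain B where B: "cbasis B A" using symplectic_basis[OF assms(1)] .
  show ?thesis
    using ext_power_above_dim[OF wedge_power_ext_power[OF poi_ext_power[OF assms(1)]] B] assms(2) cbasisD(6)[OF B]
    by simp
qed

text \<open>By \<open>wedge_power_add_top\<close> a single binomial term survives, and its
  coefficient is cancelled by passing to divided powers.\<close>

lemma vol_orthogonal_sum:
  assumes "symplectic W om" "symplectic A om" "symplectic C om" "\<And>a c. a \<in> A \<Longrightarrow> c \<in> C \<Longrightarrow> om a c = 0 \<and> om c a = 0"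
    and "W = {\<lambda>x. v x + w x | v w. v \<in> A \<and> w \<in> C}" "A \<subseteq> W" "C \<subseteq> W"
    and "cfun.dim A = 2 * k" "cfun.dim C = 2 * l" "cfun.dim W = 2 * (k + l)"
  shows "vol W om = wedge (ext_map A W id (vol A om)) (ext_map C W id (vol C om))"
proof -
  let ?a = "ext_map A W id (poi A om)" and ?c = "ext_map C W id (poi C om)"
  have "wedge_power (?a + ?c) (k + l) = (\<lambda>xs. of_nat ((k + l) choose k) * wedge (wedge_power ?a k) (wedge_power ?c l) xs)"
    using assms(8,9) wedge_power_above_dim[OF assms(2)] wedge_power_above_dim[OF assms(3)]
    by (intro wedge_power_add_top ext_map_degree2 poi_degree2) (simp_all add: ext_map_wedge_power[symmetric] ext_map_zero)
  moreover have "of_nat ((k + l) choose k) = (fact (k + l) / (fact k * fact l) :: complex)"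
    using binomial_fact[of k "k + l", where ?'a = complex] by simp
  ultimately have "vol W om = (\<lambda>xs. (1 / fact k) * ((1 / fact l) * wedge (wedge_power ?a k) (wedge_power ?c l) xs))"
    using assms(10) by (simp add: vol_def poi_orthogonal_sum[where om = om, OF assms(1-7)] field_simps)
  also have "\<dots> = wedge (\<lambda>xs. (1 / fact k) * wedge_power ?a k xs) (\<lambda>xs. (1 / fact l) * wedge_power ?c l xs)"
    unfolding wedge_scale_left wedge_scale_right ..
  also have "\<dots> = wedge (ext_map A W id (vol A om)) (ext_map C W id (vol C om))"
    unfolding ext_map_wedge_power[symmetric] ext_map_scale[symmetric] by (simp add: vol_def assms(8,9))
  finally show ?thesis .
qed

lemma ext_power_nonzero:
  assumes "\<alpha> \<in> ext_power k V" "\<alpha> \<noteq> 0"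
  obtains xs where "length xs = k" "set xs \<subseteq> dual V" "\<alpha> xs \<noteq> 0"
  using assms ext_powerD(1,2)[OF assms(1)] by (metis ext zero_fun_apply)

lemma scale_nonzero:
  assumes "c \<noteq> (0 :: complex)" "\<alpha> \<noteq> (0 :: 'b \<Rightarrow> complex)"
  shows "(\<lambda>xs. c * \<alpha> xs) \<noteq> 0"
proof
  assume *: "(\<lambda>xs. c * \<alpha> xs) = 0"
  have "\<alpha> xs = 0" for xs using fun_cong[OF *, of xs] assms(1) by simp
  then show False using assms(2) by (auto simp: fun_eq_iff)
qed

lemma ext_power_scale: "\<alpha> \<in> ext_power k V \<Longrightarrow> (\<lambda>xs. c * \<alpha> xs) \<in> ext_power k V"
  using ext_power_lincomb[of \<alpha> k V \<alpha> c 0] by simp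

lemma wedge_direct_sum_nonzero:
  assumes \<alpha>: "\<alpha> \<in> ext_power k A" "\<alpha> \<noteq> 0" and \<beta>: "\<beta> \<in> ext_power l B" "\<beta> \<noteq> 0"
    and P: "lin W A P" "\<And>a. a \<in> A \<Longrightarrow> P a = a" "\<And>b. b \<in> B \<Longrightarrow> P b = (\<lambda>x. 0)"
    and Q: "lin W B Q" "\<And>b. b \<in> B \<Longrightarrow> Q b = b" "\<And>a. a \<in> A \<Longrightarrow> Q a = (\<lambda>x. 0)"
    and sub: "cfun.subspace W" "cfun.subspace A" "cfun.subspace B" "A \<subseteq> W" "B \<subseteq> W"
  shows "wedge (ext_map A W id \<alpha>) (ext_map B W id \<beta>) \<noteq> 0"
proof -
  obtain xs where xs: "length xs = k" "set xs \<subseteq> dual A" "\<alpha> xs \<noteq> 0" using ext_power_nonzero[OF \<alpha>] .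
  obtain ys where ys: "length ys = l" "set ys \<subseteq> dual B" "\<beta> ys \<noteq> 0" using ext_power_nonzero[OF \<beta>] .
  obtain c where "c \<noteq> 0" "wedge (ext_map A W id \<alpha>) (ext_map B W id \<beta>) (map (pull W P) xs @ map (pull W Q) ys) = c * (\<alpha> xs * \<beta> ys)"
    using wedge_direct_sum_eval[where P = P and Q = Q, OF \<alpha>(1) \<beta>(1) P Q sub xs(1,2) ys(1,2)] by blast
  then have "wedge (ext_map A W id \<alpha>) (ext_map B W id \<beta>) (map (pull W P) xs @ map (pull W Q) ys) \<noteq> 0"
    using xs ys by simp
  then show ?thesis by (metis zero_fun_apply)
qed

text \<open>Evaluated at the covectors represented by \<open>e\<close> and \<open>f\<close>, the
  bivector gives \<open>om f e\<close>.\<close>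

lemma poi_nonzero:
  assumes "symplectic W om" "e \<in> W" "f \<in> W" "om e f \<noteq> 0"
  shows "poi W om \<noteq> 0"
proof
  assume 0: "poi W om = 0"
  define \<xi> where "\<xi> v = (\<lambda>w. if w \<in> W then om v w else 0)" for v
  have d: "\<xi> v \<in> dual W" if "v \<in> W" for v
    using linD(1)[OF flat_lin[OF assms(1)] that] by (simp add: \<xi>_def)
  have "sharp W om (\<xi> e) = e" using assms(2) by (intro sharp_eq[OF assms(1)]) (auto simp: \<xi>_def)
  then have "poi W om [\<xi> e, \<xi> f] = om f e" using d assms by (simp add: poi_simps) (simp add: \<xi>_def)
  then show False using 0 assms symplectic_antisym[OF assms(1-3)] by simp
qed

lemma cspan_pair: "cfun.span {e, f} = {\<lambda>x. a * e x + b * f x | a b. True}"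
proof -
  have "v \<in> cfun.span {e, f} \<longleftrightarrow> (\<exists>a b. v = (\<lambda>x. a * e x + b * f x))" for v
  proof -
    have "v \<in> cfun.span {e, f} \<longleftrightarrow> (\<exists>a b. v - (\<lambda>x. a * e x) = (\<lambda>x. b * f x))"
      by (auto simp: cfun.span_insert cfun.span_singleton)
    moreover have "v - (\<lambda>x. a * e x) = (\<lambda>x. b * f x) \<longleftrightarrow> v = (\<lambda>x. a * e x + b * f x)" for a b
      unfolding fun_eq_iff by (simp add: algebra_simps)
    ultimately show ?thesis by simp
  qed
  then show ?thesis by blast
qed

text \<open>The induction splits off hyperbolic planes.\<close>

lemma symplectic_even_vol:
  assumes "symplectic W om" "cbasis B W"
  shows "even (card B) \<and> wedge_power (poi W om) (card B div 2) \<noteq> 0"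
  using assms
proof (induction "card B" arbitrary: B W rule: less_induct)
  case less
  note W = symplecticD[OF less.prems(1)] note B = cbasisD[OF less.prems(2)]
  note b = bilinD[OF W(2)] note anti = symplectic_antisym[OF less.prems(1)]
  note sub = csubspaceD[OF W(1)]
  show ?case
  proof (cases "W \<subseteq> {\<lambda>x. 0}")
    case True
    then have "B = {}"
      using B(2,5) cfun.dependent_zero[of B] by (auto simp: zero_fun_def)
    moreover have "ext_one \<noteq> (0 :: 'a multivector)" by (metis ext_one_def zero_fun_apply zero_neq_one)
    ultimately show ?thesis by simp
  next
    case False
    then obtain e where e: "e \<in> W" "e \<noteq> (\<lambda>x. 0)" by blast
    then obtain f' where f': "f' \<in> W" "om e f' \<noteq> 0" using W(4) by blast
    \<comment> \<open>Rescaling so that \<open>e\<close> and \<open>f\<close> form a hyperbolic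
      pair, \<open>om e f = 1\<close>.\<close>
    define f where "f = (\<lambda>x. (1 / om e f') * f' x)"
    have f: "f \<in> W" "om e f = 1" using f' e sub(3)[OF f'(1), of "1 / om e f'"] b(4)[OF e(1) f'(1), of "1 / om e f'"] by (auto simp: f_def)
    have fe: "om f e = -1" using anti[OF f(1) e(1)] f by simp
    have ee: "om e e = 0" "om f f = 0" using W(3) e f by auto
    define C where "C = {w \<in> W. om e w = 0 \<and> om f w = 0}"
    define A where "A = cfun.span {e, f}"
    have A: "A = {\<lambda>x. s * e x + t * f x | s t. True}" unfolding A_def by (rule cspan_pair)
    have AW: "A \<subseteq> W" using e f W(1) unfolding A_def by (intro cfun.span_minimal) auto
    have CW: "C \<subseteq> W" by (auto simp: C_def)
    have Csub: "cfun.subspace C"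
      unfolding cfun.subspace_def
      using e f sub b(4)[OF e(1) sub(1), of 0] b(4)[OF f(1) sub(1), of 0] W(1)
      by (auto simp: C_def b zero_fun_def plus_fun_def)
    have omA: "om e (\<lambda>x. s * e x + t * f x) = t" "om f (\<lambda>x. s * e x + t * f x) = - s" for s t
      using e f sub ee fe by (simp_all add: b)
    \<comment> \<open>The projection onto the hyperbolic plane along its orthogonal complement; the
      coefficients are forced by pairing with \<open>e\<close> and \<open>f\<close>.\<close>
    define P where "P w = (\<lambda>x. - om f w * e x + om e w * f x)" for w
    define Q where "Q w = (\<lambda>x. w x - P w x)" for w
    have PA: "P w \<in> A" for w unfolding A P_def by blast
    have Plin: "lin W A P"
      using PA e f sub by (auto simp: lin_def P_def b algebra_simps)
    have PidA: "P a = a" if "a \<in> A" for a using that unfolding A P_def by (auto simp: omA)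
    have PC: "P c = (\<lambda>x. 0)" if "c \<in> C" for c using that by (auto simp: P_def C_def)
    have QC: "Q w \<in> C" if w: "w \<in> W" for w
    proof -
      have P: "P w \<in> W" using PA AW by blast
      then have QW: "Q w \<in> W" using sub(4)[OF w] by (simp add: Q_def)
      have "(\<lambda>x. Q w x + P w x) = w" by (simp add: Q_def)
      then have sum: "om z w = om z (Q w) + om z (P w)" if "z \<in> W" for z using b(2)[OF QW P that] by simp
      have "om e (P w) = om e w" "om f (P w) = om f w" by (simp_all only: P_def omA minus_minus)
      with sum[OF e(1)] sum[OF f(1)] have "om e (Q w) = 0" "om f (Q w) = 0" by simp_all
      then show ?thesis using QW by (simp add: C_def)
    qed
    have Qlin: "lin W C Q"
      using QC linD(2,3)[OF Plin] by (auto simp: lin_def Q_def algebra_simps)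
    have QidC: "Q c = c" if "c \<in> C" for c using PC[OF that] by (simp add: Q_def)
    have QA: "Q a = (\<lambda>x. 0)" if "a \<in> A" for a using PidA[OF that] by (simp add: Q_def)
    have dec: "W = {\<lambda>x. v x + w x | v w. v \<in> A \<and> w \<in> C}"
    proof (intro equalityI subsetI)
      fix w assume "w \<in> W"
      moreover have "w = (\<lambda>x. P w x + Q w x)" by (simp add: Q_def)
      ultimately show "w \<in> {\<lambda>x. v x + w x | v w. v \<in> A \<and> w \<in> C}" using PA QC by blast
    qed (use sub(2) AW CW in blast)
    have "x = (\<lambda>x. 0)" if "x \<in> A" "x \<in> C" for x
      using PidA[OF that(1)] PC[OF that(2)] by simp
    then have AC: "A \<inter> C \<subseteq> {\<lambda>x. 0}" by blast
    have "e \<notin> cfun.span {f}"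
    proof
      assume "e \<in> cfun.span {f}"
      then obtain k where "e = (\<lambda>x. k * f x)" by (auto simp: cfun.span_singleton)
      then have "om e f = k * om f f" using b(3)[OF f(1,1), of k] by simp
      then show False using f ee by simp
    qed
    moreover have "f \<noteq> (\<lambda>x. 0)" using f(2) b(4)[OF e(1) sub(1), of 0] by auto
    ultimately have indA: "cfun.independent {e, f}"
      by (intro cfun.independent_insertI) (auto simp: zero_fun_def cfun.independent_empty)
    have ne: "e \<noteq> f" using f ee by auto
    have BA: "cbasis {e, f} A" using indA by (simp add: cbasis_def A_def)
    obtain BC where BC: "cbasis BC C" using cbasis_subspace[OF less.prems(2) Csub CW] by blast
    have card: "card B = 2 + card BC"
    proof -
      have "cbasis ({e, f} \<union> BC) W" "{e, f} \<inter> BC = {}"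
        using cbasis_union[OF BA BC AC dec] by auto
      then have "cfun.dim W = card ({e, f} \<union> BC)" "{e, f} \<inter> BC = {}" using cbasisD(6) by auto
      then show ?thesis using B(6) ne cbasisD(1)[OF BC] by (subst (asm) card_Un_disjoint) auto
    qed
    have ac: "om a c = 0 \<and> om c a = 0" if "a \<in> A" "c \<in> C" for a c
    proof -
      obtain s t where a: "a = (\<lambda>x. s * e x + t * f x)" using \<open>a \<in> A\<close> unfolding A by blast
      have c: "c \<in> W" "om e c = 0" "om f c = 0" using that by (auto simp: C_def)
      have "om a c = 0" using c e f sub unfolding a by (simp add: b)
      then show ?thesis using anti[of c a] c that AW by auto
    qed
    have sA: "symplectic A om"
      unfolding symplectic_def
    proof (intro conjI ballI impI)
      show "\<exists>B. cbasis B A" using BA by blast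
      show "bilin A om" using bilin_subset[OF W(2) AW] .
      fix v assume v: "v \<in> A"
      then show "om v v = 0" using W(3) AW by blast
      assume *: "\<forall>w\<in>A. om v w = 0"
      have "e \<in> A" "f \<in> A" unfolding A_def by (auto intro: cfun.span_base)
      then have "om e v = 0" "om f v = 0" using * anti[of e v] anti[of f v] v AW by auto
      then show "v = (\<lambda>x. 0)" using PidA[OF v] by (simp add: P_def)
    qed
    have sC: "symplectic C om"
      unfolding symplectic_def
    proof (intro conjI ballI impI)
      show "\<exists>B. cbasis B C" using BC by blast
      show "bilin C om" using bilin_subset[OF W(2) CW] .
      fix v assume v: "v \<in> C"
      then show "om v v = 0" using W(3) CW by blast
      assume *: "\<forall>w\<in>C. om v w = 0"
      have "om v w = 0" if "w \<in> W" for w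
      proof -
        obtain a c where w: "w = (\<lambda>x. a x + c x)" "a \<in> A" "c \<in> C" using \<open>w \<in> W\<close> dec by auto
        then have "om v w = om v a + om v c" using b(2)[of a c v] AW CW v by auto
        then show ?thesis using * w ac[OF w(2) v] by simp
      qed
      then show "v = (\<lambda>x. 0)" using W(4) v CW by blast
    qed
    have IH: "even (card BC)" "wedge_power (poi C om) (card BC div 2) \<noteq> 0"
      using less.hyps[OF _ sC BC] card by auto
    define l where "l = card BC div 2"
    have dims: "cfun.dim A = 2 * 1" "cfun.dim C = 2 * l" "cfun.dim W = 2 * (1 + l)"
      using cbasisD(6)[OF BA] cbasisD(6)[OF BC] B(6) ne card IH by (auto simp: l_def)
    \<comment> \<open>In dimension 2 the divided power is the first power, and
      \<open>ext_one\<close> is neutral on the right because the bivector commutes with it.\<close>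
    have volA: "vol A om = poi A om"
      using wedge_commute_degree2[OF poi_degree2[of A om], of ext_one] wedge_one_left[OF poi_ext_power[OF sA]] dims(1)
      by (simp add: vol_def)
    have powC: "wedge_power (poi C om) l \<in> ext_power (2 * l) C"
      by (rule wedge_power_ext_power[OF poi_ext_power[OF sC]])
    have volC': "vol C om = (\<lambda>xs. (1 / fact l) * wedge_power (poi C om) l xs)"
      using dims(2) by (simp add: vol_def)
    have "vol C om \<noteq> 0"
      unfolding volC' by (rule scale_nonzero) (use IH(2) in \<open>simp_all add: l_def\<close>)
    moreover have "vol C om \<in> ext_power (2 * l) C"
      unfolding volC' by (rule ext_power_scale[OF powC])
    ultimately have volC: "vol C om \<noteq> 0" "vol C om \<in> ext_power (2 * l) C" by blast+
    have "vol W om = wedge (ext_map A W id (vol A om)) (ext_map C W id (vol C om))"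
      by (rule vol_orthogonal_sum[where om = om, OF less.prems(1) sA sC ac dec AW CW dims])
    moreover have "wedge (ext_map A W id (vol A om)) (ext_map C W id (vol C om)) \<noteq> 0"
    proof -
      have "e \<in> A" "f \<in> A" unfolding A_def by (simp_all add: cfun.span_base)
      then have "vol A om \<noteq> 0" "vol A om \<in> ext_power 2 A"
        unfolding volA using poi_nonzero[OF sA, of e f] poi_ext_power[OF sA] f(2) by simp_all
      then show ?thesis
        by (intro wedge_direct_sum_nonzero[where P = P and Q = Q, OF _ _ volC(2,1) Plin PidA PC Qlin QidC QA W(1) symplecticD(1)[OF sA] Csub AW CW, where k = 2])
    qed
    ultimately have "vol W om \<noteq> 0" by simp
    moreover have "vol W om = 0" if "wedge_power (poi W om) (card B div 2) = 0"
      using that B(6) by (simp add: vol_def zero_fun_def)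
    ultimately show ?thesis using card IH by auto
  qed
qed

lemma symplectic_dim_even: "symplectic W om \<Longrightarrow> even (cfun.dim W)"
  using symplectic_even_vol cbasisD(6) symplectic_basis by metis

lemma vol:
  assumes "symplectic W om"
  shows "vol W om \<noteq> 0" "vol W om \<in> ext_power (cfun.dim W) W"
proof -
  obtain B where B: "cbasis B W" using symplectic_basis[OF assms] .
  then have "wedge_power (poi W om) (cfun.dim W div 2) \<noteq> 0"
    using symplectic_even_vol[OF assms B] cbasisD(6)[OF B] by simp
  then show "vol W om \<noteq> 0" unfolding vol_scale by (intro scale_nonzero) simp
  have "wedge_power (poi W om) (cfun.dim W div 2) \<in> ext_power (cfun.dim W) W"
    using wedge_power_ext_power[OF poi_ext_power[OF assms], of "cfun.dim W div 2"] symplectic_dim_even[OF assms] by simp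
  then show "vol W om \<in> ext_power (cfun.dim W) W" unfolding vol_scale by (rule ext_power_scale)
qed

subsection \<open>Determinants of endomorphisms\<close>

text \<open>The definite description in \<open>endo_det\<close> needs existence, which follows from
  one nonzero top multivector by one-dimensionality, and uniqueness, which follows from its being
  nonzero.\<close>

lemma endo_det_eqI:
  assumes "symplectic W om" "lin W W f" "\<alpha> \<in> ext_power (cfun.dim W) W" "\<alpha> \<noteq> 0" "ext_map W W f \<alpha> = (\<lambda>xs. c * \<alpha> xs)"
  shows "endo_det W f = c"
  unfolding endo_det_def
proof (rule the_equality)
  obtain B where B: "cbasis B W" using symplectic_basis[OF assms(1)] .
  show "\<forall>\<beta>\<in>ext_power (cfun.dim W) W. ext_map W W f \<beta> = (\<lambda>xs. c * \<beta> xs)"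
  proof
    fix \<beta> assume "\<beta> \<in> ext_power (cfun.dim W) W"
    then obtain d where \<beta>: "\<beta> = (\<lambda>xs. d * \<alpha> xs)"
      using ext_power_top_multiple[OF _ _ B assms(4), of \<beta>] assms(3) cbasisD(6)[OF B] by auto
    show "ext_map W W f \<beta> = (\<lambda>xs. c * \<beta> xs)"
      unfolding \<beta> ext_map_scale assms(5) by (simp only: mult.left_commute)
  qed
  fix d assume "\<forall>\<beta>\<in>ext_power (cfun.dim W) W. ext_map W W f \<beta> = (\<lambda>xs. d * \<beta> xs)"
  then have "(\<lambda>xs. d * \<alpha> xs) = (\<lambda>xs. c * \<alpha> xs)" using assms(3,5) by metis
  moreover obtain xs where "\<alpha> xs \<noteq> 0" using assms(4) by (metis ext zero_fun_apply)
  ultimately show "d = c" by (metis mult_cancel_right)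
qed

text \<open>The symplectic structure supplies the nonzero top multivector \<open>vol W om\<close>,
  which serves as reference throughout the treatment of determinants.\<close>

lemma endo_det:
  assumes "symplectic W om" "lin W W f" "\<alpha> \<in> ext_power (cfun.dim W) W"
  shows "ext_map W W f \<alpha> = (\<lambda>xs. endo_det W f * \<alpha> xs)"
proof -
  obtain B where B: "cbasis B W" using symplectic_basis[OF assms(1)] .
  note v = vol[OF assms(1)]
  have "\<exists>c. ext_map W W f (vol W om) = (\<lambda>xs. c * vol W om xs)"
    using ext_power_top_multiple[OF _ _ B v(1)] ext_map_ext_power[OF assms(2) symplecticD(1)[OF assms(1)] v(2)] v(2) cbasisD(6)[OF B]
    by auto
  then obtain c where c: "ext_map W W f (vol W om) = (\<lambda>xs. c * vol W om xs)" by blast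
  have "endo_det W f = c" by (rule endo_det_eqI[OF assms(1,2) v(2,1) c])
  moreover obtain d where d: "\<alpha> = (\<lambda>xs. d * vol W om xs)"
    using ext_power_top_multiple[OF _ _ B v(1), of \<alpha>] assms(3) v(2) cbasisD(6)[OF B] by auto
  ultimately show ?thesis
    unfolding d ext_map_scale c by (simp only: mult.left_commute)
qed

lemma lin_comp: "lin U V g \<Longrightarrow> lin V W f \<Longrightarrow> lin U W (f \<circ> g)"
  by (auto simp: lin_def)

lemma endo_det_comp:
  assumes "symplectic W om" "lin W W f" "lin W W g"
  shows "endo_det W (f \<circ> g) = endo_det W f * endo_det W g"
proof (rule endo_det_eqI[OF assms(1) lin_comp[OF assms(3,2)] vol(2,1)[OF assms(1)]])
  show "ext_map W W (f \<circ> g) (vol W om) = (\<lambda>xs. endo_det W f * endo_det W g * vol W om xs)"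
    unfolding ext_map_ext_map[OF assms(3,2) symplecticD(1)[OF assms(1)], symmetric]
      endo_det[OF assms(1,3) vol(2)[OF assms(1)]] ext_map_scale endo_det[OF assms(1,2) vol(2)[OF assms(1)]]
    by (simp only: mult.assoc mult.left_commute)
qed

lemma endo_det_cong:
  assumes "\<And>v. v \<in> W \<Longrightarrow> f v = g v"
  shows "endo_det W f = endo_det W g"
  unfolding endo_det_def by (simp only: ext_map_cong[of W f g, OF assms])

lemma endo_det_diagonal:
  assumes "symplectic W om" "lin W W f" "cbasis B W" "\<And>b. b \<in> B \<Longrightarrow> f b = (\<lambda>x. \<zeta> b * b x)"
  shows "endo_det W f = (\<Prod>b\<in>B. \<zeta> b)"
  using endo_det_eqI[OF assms(1,2) vol(2,1)[OF assms(1)]] 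
    ext_map_diagonal[where \<alpha> = "vol W om" and f = f and \<zeta> = \<zeta>, OF _ assms(3,2,4)] vol(2)[OF assms(1)] cbasisD(6)[OF assms(3)] by simp

lemma endo_det_id:
  assumes "symplectic W om"
  shows "endo_det W id = 1"
proof -
  obtain B where B: "cbasis B W" using symplectic_basis[OF assms] .
  have "lin W W id" by (simp add: lin_def)
  from endo_det_diagonal[OF assms this B, of "\<lambda>_. 1"] show ?thesis by simp
qed

lemma endo_det_inverse:
  assumes "symplectic W om" "lin W W f" "lin W W g" "\<And>v. v \<in> W \<Longrightarrow> f (g v) = v"
  shows "endo_det W f * endo_det W g = 1"
  using endo_det_comp[OF assms(1-3)] endo_det_cong[of W "f \<circ> g" id] endo_det_id[OF assms(1)] assms(4) by simp

text \<open>The isometry \<open>D\<close> carries one volume element to the other and intertwines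
  the two endomorphisms, so they scale these elements by the same factor.\<close>

lemma endo_det_transport:
  fixes D :: "'a cvec \<Rightarrow> 'a cvec"
  assumes "symplectic V om" "symplectic V' om'" "lin V V' D" "D ` V = V'" "cfun.dim V = cfun.dim V'"
    and "\<And>v w. v \<in> V \<Longrightarrow> w \<in> V \<Longrightarrow> om' (D v) (D w) = om v w"
    and "lin V V f" "lin V' V' f'" "\<And>v. v \<in> V \<Longrightarrow> f' (D v) = D (f v)"
  shows "endo_det V' f' = endo_det V f"
proof (rule endo_det_eqI[OF assms(2,8) vol(2,1)[OF assms(2)]])
  have v: "vol V' om' = ext_map V V' D (vol V om)"
    by (rule ext_map_vol[symmetric]) (use assms in auto)
  have "ext_map V' V' f' (vol V' om') = ext_map V V' (f' \<circ> D) (vol V om)"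
    unfolding ext_map_ext_map[OF assms(3,8) symplecticD(1)[OF assms(2)], symmetric] v[symmetric] ..
  also have "\<dots> = ext_map V V' (D \<circ> f) (vol V om)" using assms(9) by (intro ext_map_cong) simp
  also have "\<dots> = ext_map V V' D (ext_map V V f (vol V om))"
    by (rule ext_map_ext_map[OF assms(7,3) symplecticD(1)[OF assms(1)], symmetric])
  also have "\<dots> = (\<lambda>xs. endo_det V f * vol V' om' xs)"
    unfolding endo_det[OF assms(1,7) vol(2)[OF assms(1)]] ext_map_scale v ..
  finally show "ext_map V' V' f' (vol V' om') = (\<lambda>xs. endo_det V f * vol V' om' xs)" .
qed

lemma symplectic_cong:
  assumes "symplectic W om" "\<And>v w. v \<in> W \<Longrightarrow> w \<in> W \<Longrightarrow> om' v w = om v w"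
  shows "symplectic W om'"
proof -
  note W = symplecticD[OF assms(1)]
  have "bilin W om'"
    using W(2) csubspaceD(2,3)[OF W(1)] assms(2) unfolding bilin_def by simp
  then show ?thesis
    using assms unfolding symplectic_def by simp
qed

lemma sharp_cong:
  assumes "\<And>v w. v \<in> W \<Longrightarrow> w \<in> W \<Longrightarrow> om' v w = om v w"
  shows "sharp W om' = sharp W om"
proof -
  have "(v \<in> W \<and> (\<forall>w\<in>W. om' v w = \<xi> w)) = (v \<in> W \<and> (\<forall>w\<in>W. om v w = \<xi> w))" for v \<xi>
    using assms by auto
  then show ?thesis by (intro ext) (simp only: sharp_def)
qed

lemma vol_cong:
  assumes "\<And>v w. v \<in> W \<Longrightarrow> w \<in> W \<Longrightarrow> om' v w = om v w"
  shows "vol W om' = vol W om"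
proof -
  have "sharp W om' = sharp W om" by (rule sharp_cong) (use assms in auto)
  then have "poi W om' = poi W om" by (simp only: poi_def)
  then show ?thesis by (simp add: vol_def)
qed

text \<open>The volume element is built from the form alone, so it is fixed by every symplectic
  map.\<close>

lemma endo_det_symplectic:
  assumes "symplectic W om" "lin W W U" "U ` W = W" "\<And>v w. v \<in> W \<Longrightarrow> w \<in> W \<Longrightarrow> om (U v) (U w) = om v w"
  shows "endo_det W U = 1"
proof (rule endo_det_eqI[OF assms(1,2) vol(2,1)[OF assms(1)]])
  have "ext_map W W U (vol W om) = vol W om"
    by (rule ext_map_vol) (use assms in auto)
  then show "ext_map W W U (vol W om) = (\<lambda>xs. 1 * vol W om xs)" by simp
qed

section \<open>Diagonal operators and comparison of bilinear forms on a basis\<close>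

definition diag :: "'a cvec set \<Rightarrow> ('a cvec \<Rightarrow> complex) \<Rightarrow> 'a cvec \<Rightarrow> 'a cvec" where
  "diag B s v = (\<lambda>x. \<Sum>b\<in>B. (s b * crd B b v) * b x)"

lemma crd_diag:
  assumes "cbasis B W" "v \<in> W" "b \<in> B"
  shows "crd B b (diag B s v) = s b * crd B b v"
proof -
  note B = cbasisD[OF assms(1)]
  have "crd B b (diag B s v) = (\<Sum>c\<in>B. s c * crd B c v * crd B b c)"
    unfolding diag_def using B by (intro dual_sum[OF crd_dual[OF assms(1)]]) auto
  also have "\<dots> = (\<Sum>c\<in>B. if c = b then s b * crd B b v else 0)"
    using crd_basis[OF assms(1)] by (intro sum.cong) auto
  finally show ?thesis using B assms(3) by simp
qed

lemma diag:
  assumes "cbasis B W"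
  shows "lin W W (diag B s)" "b \<in> B \<Longrightarrow> diag B s b = (\<lambda>x. s b * b x)"
    "(\<And>b. b \<in> B \<Longrightarrow> s b \<noteq> 0) \<Longrightarrow> diag B s ` W = W"
proof -
  note B = cbasisD[OF assms(1)]
  show lin: "lin W W (diag B s)" for s
    unfolding lin_def
  proof (intro conjI ballI allI)
    show "diag B s v \<in> W" for v unfolding diag_def using B(5) by (intro subspace_sum[OF B(4)])
  qed (simp_all add: diag_def dualD(1,2)[OF crd_dual[OF assms(1)]] algebra_simps sum.distrib sum_distrib_left)
  show "diag B s b = (\<lambda>x. s b * b x)" if "b \<in> B"
  proof
    fix x
    have "diag B s b x = (\<Sum>c\<in>B. if c = b then s b * b x else 0)"
      unfolding diag_def using crd_basis[OF assms(1) that] by (intro sum.cong) auto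
    then show "diag B s b x = s b * b x" using B that by simp
  qed
  show "diag B s ` W = W" if nz: "\<And>b. b \<in> B \<Longrightarrow> s b \<noteq> 0"
  proof
    show "diag B s ` W \<subseteq> W" using linD(1)[OF lin] by auto
    show "W \<subseteq> diag B s ` W"
    proof
      fix w assume w: "w \<in> W"
      have u: "diag B (\<lambda>b. 1 / s b) w \<in> W" using linD(1)[OF lin w] .
      have "diag B s (diag B (\<lambda>b. 1 / s b) w) = (\<lambda>x. \<Sum>b\<in>B. crd B b w * b x)"
        unfolding diag_def[of B s] using nz crd_diag[OF assms w] by (intro ext sum.cong) auto
      also have "\<dots> = w" using crd_expand[OF assms w] by simp
      finally show "w \<in> diag B s ` W" using u by (metis imageI)
    qed
  qed
qed

lemma bilin_sum_left:
  assumes "bilin W om" "cfun.subspace W" "finite I" "\<And>i. i \<in> I \<Longrightarrow> f i \<in> W" "w \<in> W"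
  shows "om (\<lambda>x. \<Sum>i\<in>I. c i * f i x) w = (\<Sum>i\<in>I. c i * om (f i) w)"
proof -
  have "(\<lambda>v. if v \<in> W then om v w else 0) \<in> dual W"
    using bilinD[OF assms(1)] csubspaceD[OF assms(2)] assms(5) by (intro dualI) auto
  from dual_sum[OF this assms(2-4), of "\<lambda>i. i" c]
  show ?thesis using assms(4) subspace_sum[OF assms(2), of I f c] by simp
qed

lemma bilin_swap: "bilin W om \<Longrightarrow> bilin W (\<lambda>v w. om w v)"
  unfolding bilin_def by blast

lemma bilin_eq_on_basis:
  assumes "bilin W om" "bilin W om'" "cbasis B W" "\<And>b c. b \<in> B \<Longrightarrow> c \<in> B \<Longrightarrow> om b c = om' b c" "v \<in> W" "w \<in> W"
  shows "om v w = om' v w"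
proof -
  note B = cbasisD[OF assms(3)]
  have *: "om b w = om' b w" if b: "b \<in> B" for b
  proof -
    have "om b w = om b (\<lambda>x. \<Sum>c\<in>B. crd B c w * c x)" using crd_expand[OF assms(3,6)] by simp
    also have "\<dots> = (\<Sum>c\<in>B. crd B c w * om b c)"
      using bilin_sum_left[OF bilin_swap[OF assms(1)] B(4,1), of "\<lambda>b. b" b] B(5) b by simp
    also have "\<dots> = (\<Sum>c\<in>B. crd B c w * om' b c)" using assms(4)[OF b] by simp
    also have "\<dots> = om' b (\<lambda>x. \<Sum>c\<in>B. crd B c w * c x)"
      using bilin_sum_left[OF bilin_swap[OF assms(2)] B(4,1), of "\<lambda>b. b" b] B(5) b by simp
    also have "\<dots> = om' b w" using crd_expand[OF assms(3,6)] by simp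
    finally show ?thesis .
  qed
  have "om v w = om (\<lambda>x. \<Sum>c\<in>B. crd B c v * c x) w" using crd_expand[OF assms(3,5)] by simp
  also have "\<dots> = (\<Sum>c\<in>B. crd B c v * om c w)"
    using bilin_sum_left[OF assms(1) B(4,1), of "\<lambda>b. b" w] B(5) assms(6) by simp
  also have "\<dots> = (\<Sum>c\<in>B. crd B c v * om' c w)" using * by simp
  also have "\<dots> = om' (\<lambda>x. \<Sum>c\<in>B. crd B c v * c x) w"
    using bilin_sum_left[OF assms(2) B(4,1), of "\<lambda>b. b" w] B(5) assms(6) by simp
  also have "\<dots> = om' v w" using crd_expand[OF assms(3,5)] by simp
  finally show ?thesis .
qed

lemma bilin_comp: "bilin W om \<Longrightarrow> lin V W S \<Longrightarrow> bilin V (\<lambda>v w. om (S v) (S w))"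
  unfolding bilin_def lin_def by simp

lemma diag_bilin:
  assumes "cbasis B W" "bilin W om" "bilin W om'" "\<And>b c. b \<in> B \<Longrightarrow> c \<in> B \<Longrightarrow> s b * s c * om' b c = om b c"
    and "v \<in> W" "w \<in> W"
  shows "om' (diag B s v) (diag B s w) = om v w"
proof (rule bilin_eq_on_basis[OF bilin_comp[OF assms(3) diag(1)[OF assms(1)]] assms(2,1) _ assms(5,6)])
  note B = cbasisD[OF assms(1)]
  fix b c assume bc: "b \<in> B" "c \<in> B"
  then have "b \<in> W" "c \<in> W" using B by auto
  then show "om' (diag B s b) (diag B s c) = om b c"
    using assms(4)[OF bc] csubspaceD(3)[OF B(4)] bc
    by (simp add: diag(2)[OF assms(1)] bilinD(3,4)[OF assms(3)] flip: mult.assoc)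
qed

subsection \<open>Eigenbases\<close>

text \<open>The vector obtained by applying the operator q(f) to \<open>v\<close>.\<close>

definition poly_orbit :: "('a cvec \<Rightarrow> 'a cvec) \<Rightarrow> 'a cvec \<Rightarrow> complex poly \<Rightarrow> 'a cvec" where
  "poly_orbit f v q = (\<lambda>x. \<Sum>i\<le>degree q. coeff q i * (f ^^ i) v x)"

lemma poly_orbit_bound:
  assumes "degree q \<le> n"
  shows "poly_orbit f v q = (\<lambda>x. \<Sum>i\<le>n. coeff q i * (f ^^ i) v x)"
  unfolding poly_orbit_def using assms
  by (intro ext sum.mono_neutral_left) (auto simp: coeff_eq_0)

lemma funpow_in:
  assumes "lin V V f" "v \<in> V" shows "(f ^^ i) v \<in> V"
  using assms(2) linD(1)[OF assms(1)] by (induction i) auto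

text \<open>Take a nonzero polynomial of least degree annihilating \<open>v\<close> and split off a
  linear factor: the cofactor applied to \<open>v\<close> is nonzero by minimality and is an
  eigenvector for the root.\<close>

lemma eigenvector_exists:
  assumes f: "lin V V f" and B: "cbasis B V" and ne: "v \<in> V" "v \<noteq> (\<lambda>x. 0)"
  shows "\<exists>w z. w \<in> V \<and> w \<noteq> (\<lambda>x. 0) \<and> f w = (\<lambda>x. z * w x)"
proof -
  note B' = cbasisD[OF B]
  define e where "e = poly_orbit f v"
  have eV: "e q \<in> V" for q
    unfolding e_def poly_orbit_def using funpow_in[OF f ne(1)] by (intro subspace_sum[OF B'(4)]) auto
  \<comment> \<open>Multiplying the polynomial by X - z amounts to applying f - z to the
    vector.\<close>
  have e_mult: "e ([:-z, 1:] * r) = (\<lambda>x. f (e r) x - z * e r x)" for z r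
  proof
    fix x
    define n where "n = degree r"
    have "degree ([:-z, 1:] * r) \<le> Suc n" unfolding n_def by (rule order.trans[OF degree_mult_le]) simp
    then have "e ([:-z, 1:] * r) x = (\<Sum>i\<le>Suc n. coeff ([:-z, 1:] * r) i * (f ^^ i) v x)"
      unfolding e_def by (simp only: poly_orbit_bound)
    also have "\<dots> = (\<Sum>i\<le>Suc n. coeff (pCons 0 r) i * (f ^^ i) v x) - z * (\<Sum>i\<le>Suc n. coeff r i * (f ^^ i) v x)"
      by (simp add: sum_distrib_left sum_subtractf algebra_simps)
    also have "(\<Sum>i\<le>Suc n. coeff r i * (f ^^ i) v x) = e r x"
      unfolding e_def by (subst poly_orbit_bound[of r "Suc n"]) (simp_all add: n_def)
    also have "(\<Sum>i\<le>Suc n. coeff (pCons 0 r) i * (f ^^ i) v x) = (\<Sum>i\<le>n. coeff r i * f ((f ^^ i) v) x)"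
      by (subst sum.atMost_Suc_shift) simp
    also have "\<dots> = f (e r) x"
      unfolding e_def poly_orbit_def n_def[symmetric]
      using funpow_in[OF f ne(1)] by (subst lin_sum[OF f B'(4)]) auto
    finally show "e ([:-z, 1:] * r) x = f (e r) x - z * e r x" .
  qed
  \<comment> \<open>The vectors \<open>?F i\<close> with \<open>i \<le> ?n\<close> are one more than
    the dimension: either two coincide, giving a difference of monomials, or they are distinct and
    linearly dependent.\<close>
  have "\<exists>q. q \<noteq> 0 \<and> e q = (\<lambda>x. 0)"
  proof -
    let ?n = "card B" and ?F = "\<lambda>i. (f ^^ i) v"
    show ?thesis
    proof (cases "inj_on ?F {..?n}")
      case False
      then obtain i j where ij: "i \<noteq> j" "?F i = ?F j" by (auto simp: inj_on_def)
      let ?q = "monom 1 i - monom 1 j :: complex poly"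
      have "?q \<noteq> 0" using ij(1) by (auto simp: poly_eq_iff)
      moreover have "degree ?q \<le> max i j" by (intro degree_diff_le) (auto intro: order.trans[OF degree_monom_le])
      then have "e ?q = (\<lambda>x. \<Sum>k\<le>max i j. coeff ?q k * ?F k x)" unfolding e_def by (rule poly_orbit_bound)
      then have "e ?q x = ?F i x - ?F j x" for x
        by (simp add: left_diff_distrib sum_subtractf if_distrib[of "\<lambda>c. c * _"] cong: if_cong)
      then have "e ?q = (\<lambda>x. 0)" using ij by auto
      ultimately show ?thesis by blast
    next
      case True
      have "cfun.dependent (?F ` {..?n})"
      proof (rule ccontr)
        assume "\<not> cfun.dependent (?F ` {..?n})"
        moreover have "?F ` {..?n} \<subseteq> cfun.span B" using funpow_in[OF f ne(1)] B' by auto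
        ultimately have "card (?F ` {..?n}) \<le> card B" using cfun.independent_span_bound[OF B'(1)] by blast
        then show False using True by (simp add: card_image)
      qed
      then have "\<exists>S\<subseteq>?F ` {..?n}. finite S \<and> (\<exists>u. (\<Sum>v\<in>S. (\<lambda>x. u v * v x)) = 0 \<and> (\<exists>v\<in>S. u v \<noteq> 0))"
        using cfun.independent_explicit_finite_subsets[of "?F ` {..?n}"] by blast
      then obtain S u where S: "S \<subseteq> ?F ` {..?n}" "finite S" "(\<Sum>v\<in>S. (\<lambda>x. u v * v x)) = 0" "\<exists>v\<in>S. u v \<noteq> 0"
        by blast
      define c where "c i = (if i \<le> ?n \<and> ?F i \<in> S then u (?F i) else 0)" for i
      define q where "q = (\<Sum>i\<le>?n. monom (c i) i)"
      have cq: "coeff q i = c i" for i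
        by (simp add: q_def coeff_sum) (simp add: c_def)
      have "degree q \<le> ?n" by (rule degree_le) (simp add: cq c_def)
      then have "e q = (\<lambda>x. \<Sum>i\<le>?n. c i * ?F i x)" unfolding e_def by (simp only: poly_orbit_bound cq)
      also have "\<dots> = (\<lambda>x. \<Sum>y\<in>?F ` {..?n}. (if y \<in> S then u y else 0) * y x)"
        by (simp add: sum.reindex[OF True] c_def)
      also have "\<dots> = (\<lambda>x. \<Sum>y\<in>S. u y * y x)"
        using S(1) by (intro ext sum.mono_neutral_cong_right) auto
      also have "\<dots> = (\<lambda>x. 0)" using S(3) by (simp add: sum_fun zero_fun_def)
      finally have "e q = (\<lambda>x. 0)" .
      moreover have "q \<noteq> 0"
      proof -
        obtain i where "i \<le> ?n" "?F i \<in> S" "u (?F i) \<noteq> 0" using S(1,4) by auto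
        then have "coeff q i \<noteq> 0" by (simp add: cq c_def)
        then show ?thesis by auto
      qed
      ultimately show ?thesis by blast
    qed
  qed
  then obtain q where q: "q \<noteq> 0" "e q = (\<lambda>x. 0)"
    and min: "\<And>r. r \<noteq> 0 \<Longrightarrow> e r = (\<lambda>x. 0) \<Longrightarrow> degree q \<le> degree r"
    using exists_least_iff[of "\<lambda>d. \<exists>q. q \<noteq> 0 \<and> e q = (\<lambda>x. 0) \<and> degree q = d"] by (metis not_le)
  have "degree q \<noteq> 0"
  proof
    assume "degree q = 0"
    then obtain a where a: "q = [:a:]" by (meson degree_eq_zeroE)
    then have "e q = (\<lambda>x. a * v x)" by (simp add: e_def poly_orbit_def)
    then show False using q a ne(2) by (auto simp: fun_eq_iff)
  qed
  then obtain z where "poly q z = 0"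
    using fundamental_theorem_of_algebra[of q] constant_degree[of q] by auto
  then have "[:-z, 1:] dvd q" by (simp only: poly_eq_0_iff_dvd)
  then obtain r where r: "q = [:-z, 1:] * r" by (rule dvdE)
  then have "r \<noteq> 0" using q(1) by auto
  then have "degree q = Suc (degree r)" unfolding r by (subst degree_mult_eq) auto
  then have "e r \<noteq> (\<lambda>x. 0)" using min[OF \<open>r \<noteq> 0\<close>] by auto
  moreover have "f (e r) = (\<lambda>x. z * e r x)"
    using e_mult[of z r] q(2) unfolding r by (simp add: fun_eq_iff)
  ultimately show ?thesis using eV by blast
qed

definition hermitian :: "'a cvec set \<Rightarrow> ('a cvec \<Rightarrow> 'a cvec \<Rightarrow> complex) \<Rightarrow> bool" where
  "hermitian V H \<longleftrightarrow> (\<forall>u\<in>V. \<forall>v\<in>V. \<forall>w\<in>V. H u (\<lambda>x. v x + w x) = H u v + H u w) \<and>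
     (\<forall>c. \<forall>v\<in>V. \<forall>w\<in>V. H v (\<lambda>x. c * w x) = c * H v w) \<and>
     (\<forall>v\<in>V. \<forall>w\<in>V. H w v = cnj (H v w)) \<and> (\<forall>v\<in>V. v \<noteq> (\<lambda>x. 0) \<longrightarrow> 0 < Re (H v v))"

lemma hermitianD:
  assumes "hermitian V H"
  shows "u \<in> V \<Longrightarrow> v \<in> V \<Longrightarrow> w \<in> V \<Longrightarrow> H u (\<lambda>x. v x + w x) = H u v + H u w"
    "v \<in> V \<Longrightarrow> w \<in> V \<Longrightarrow> H v (\<lambda>x. c * w x) = c * H v w"
    "v \<in> V \<Longrightarrow> w \<in> V \<Longrightarrow> H w v = cnj (H v w)"
    "v \<in> V \<Longrightarrow> v \<noteq> (\<lambda>x. 0) \<Longrightarrow> 0 < Re (H v v)"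
  using assms unfolding hermitian_def by blast+

lemma hermitian_scale_left:
  assumes "hermitian V H" "cfun.subspace V" "v \<in> V" "w \<in> V"
  shows "H (\<lambda>x. c * v x) w = cnj c * H v w"
  using hermitianD(3)[OF assms(1,4), of "\<lambda>x. c * v x"] hermitianD(2)[OF assms(1,4,3), of c] hermitianD(3)[OF assms(1,4,3)]
    csubspaceD(3)[OF assms(2,3)] by simp

text \<open>Spectral theorem for normal operators, in the form of the invariance of the orthogonal
  complement of every eigenvector.\<close>

lemma eigenbasis:
  assumes f: "lin V V f" and B: "cbasis B V" and H: "hermitian V H"
    and inv: "\<And>v w z. v \<in> V \<Longrightarrow> f v = (\<lambda>x. z * v x) \<Longrightarrow> v \<noteq> (\<lambda>x. 0) \<Longrightarrow> w \<in> V \<Longrightarrow> H v w = 0 \<Longrightarrow> H v (f w) = 0"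
  obtains C \<zeta> where "cbasis C V" "\<And>c. c \<in> C \<Longrightarrow> f c = (\<lambda>x. \<zeta> c * c x)"
proof -
  note B' = cbasisD[OF B]
  \<comment> \<open>The zero vector belongs to \<open>E U\<close>; this is harmless, since the basis
    is later chosen as an independent subset.\<close>
  define E where "E U = {v \<in> U. \<exists>z. f v = (\<lambda>x. z * v x)}" for U
  \<comment> \<open>The induction over invariant subspaces proves that eigenvectors span; a basis of
    eigenvectors is then extracted from this spanning set in one go.\<close>
  have main: "U \<subseteq> cfun.span (E U)" if "lin U U f" "cbasis D U" "U \<subseteq> V" for U D
    using that
  proof (induction "card D" arbitrary: U D rule: less_induct)
    case less
    note D = cbasisD[OF less.prems(2)] note sub = csubspaceD[OF D(4)]
    show ?case
    proof (cases "U \<subseteq> {\<lambda>x. 0}")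
      case True
      then show ?thesis using cfun.span_zero[of "E U"] by (auto simp: zero_fun_def)
    next
      case False
      then obtain u where "u \<in> U" "u \<noteq> (\<lambda>x. 0)" by blast
      then obtain v z where v: "v \<in> U" "v \<noteq> (\<lambda>x. 0)" "f v = (\<lambda>x. z * v x)"
        using eigenvector_exists[OF less.prems(1,2)] by blast
      have vV: "v \<in> V" using v less.prems by auto
      define U' where "U' = {w \<in> U. H v w = 0}"
      have U': "U' \<subseteq> U" by (auto simp: U'_def)
      have Hadd: "H v (\<lambda>x. a x + b x) = H v a + H v b" if "a \<in> U" "b \<in> U" for a b
        using hermitianD(1)[OF H vV] that less.prems(3) by blast
      have Hsc: "H v (\<lambda>x. c * a x) = c * H v a" if "a \<in> U" for a c
        using hermitianD(2)[OF H vV] that less.prems(3) by blast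
      have sub': "cfun.subspace U'"
        unfolding cfun.subspace_def using sub Hsc[OF sub(1), of 0]
        by (auto simp: U'_def Hadd Hsc zero_fun_def plus_fun_def)
      obtain D' where D': "cbasis D' U'" using cbasis_subspace[OF less.prems(2) sub' U'] by blast
      have Hvv: "H v v \<noteq> 0" using hermitianD(4)[OF H vV v(2)] by auto
      then have "v \<notin> U'" by (simp add: U'_def)
      then have "card D' < card D" using cbasis_card_less[OF less.prems(2) D' U' v(1)] by blast
      moreover have "lin U' U' f"
        using less.prems(1,3) inv[OF vV v(3,2)] linD(1)[OF less.prems(1)] unfolding lin_def by (auto simp: U'_def)
      ultimately have IH: "U' \<subseteq> cfun.span (E U')" using less.hyps D' U' less.prems(3) by blast
      have "E U' \<subseteq> E U" using U' by (auto simp: E_def)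
      then have IH': "U' \<subseteq> cfun.span (E U)" using IH cfun.span_mono by blast
      show ?thesis
      proof
        fix w assume w: "w \<in> U"
        \<comment> \<open>The coefficient of the orthogonal projection of \<open>w\<close> to the
          line of \<open>v\<close>.\<close>
        define c where "c = H v w / H v v"
        have cv: "(\<lambda>x. - c * v x) \<in> U" using sub(3)[OF v(1)] .
        have "(\<lambda>x. w x + - c * v x) \<in> U'"
          using sub(2)[OF w cv] Hadd[OF w cv] Hsc[OF v(1), of "- c"] Hvv by (simp add: U'_def c_def)
        then have 1: "(\<lambda>x. w x + - c * v x) \<in> cfun.span (E U)" using IH' by blast
        have "v \<in> E U" using v by (auto simp: E_def)
        then have 2: "(\<lambda>x. c * v x) \<in> cfun.span (E U)" by (intro csubspaceD(3)[OF cfun.subspace_span] cfun.span_base)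
        have "w = (\<lambda>x. (w x + - c * v x) + c * v x)" by simp
        then show "w \<in> cfun.span (E U)" using csubspaceD(2)[OF cfun.subspace_span 1 2] by simp
      qed
    qed
  qed
  obtain C where C: "C \<subseteq> E V" "cfun.independent C" "E V \<subseteq> cfun.span C"
    using cfun.maximal_independent_subset[of "E V"] by auto
  have "V \<subseteq> cfun.span C" 
    using main[OF f B order_refl] C(3) cfun.span_minimal[OF _ cfun.subspace_span] by blast
  moreover have "cfun.span C \<subseteq> V" using C(1) B'(4) by (intro cfun.span_minimal) (auto simp: E_def)
  moreover have "finite C"
    using cfun.independent_span_bound[OF B'(1) C(2)] C(1) B'(3) by (auto simp: E_def)
  ultimately have "cbasis C V" using C(2) by (simp add: cbasis_def)
  moreover have "\<exists>z. f c = (\<lambda>x. z * c x)" if "c \<in> C" for c using C(1) that by (auto simp: E_def)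
  then have "\<And>c. c \<in> C \<Longrightarrow> f c = (\<lambda>x. (SOME z. f c = (\<lambda>x. z * c x)) * c x)" by (rule someI_ex)
  ultimately show ?thesis by (rule that)
qed

subsection \<open>Isometries\<close>

text \<open>\<open>Fx\<close>, \<open>Nr\<close> and \<open>Pr\<close> are
  \<open>fixed_tangent\<close>, \<open>normal_space\<close> and \<open>normal_proj\<close> for an
  operator on an abstract space, so that the linear algebra can be separated from the
  geometry.\<close>

definition Fx :: "'a cvec set \<Rightarrow> ('a cvec \<Rightarrow> 'a cvec) \<Rightarrow> 'a cvec set" where
  "Fx V g = {v \<in> V. g v = v}"

definition Nr :: "'a cvec set \<Rightarrow> ('a cvec \<Rightarrow> 'a cvec) \<Rightarrow> 'a cvec set" where
  "Nr V g = (\<lambda>v. v - g v) ` V"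

definition Pr :: "'a cvec set \<Rightarrow> ('a cvec \<Rightarrow> 'a cvec) \<Rightarrow> 'a cvec \<Rightarrow> 'a cvec" where
  "Pr V g v = (THE w. w \<in> Nr V g \<and> v - w \<in> Fx V g)"

lemma Nr_alt: "Nr V g = {\<lambda>x. v x - g v x | v. v \<in> V}"
  by (auto simp: Nr_def fun_diff_def)

text \<open>The invariant hermitian form \<open>H\<close> stands in for the finite order of
  \<open>g\<close>: it provides diagonalisability and a positive definite notion of
  orthogonality.\<close>

locale isometry =
  fixes V :: "'a cvec set" and om H :: "'a cvec \<Rightarrow> 'a cvec \<Rightarrow> complex" and g :: "'a cvec \<Rightarrow> 'a cvec"
  assumes symplectic: "symplectic V om" and herm: "hermitian V H" and lin_g: "lin V V g"
    and om_g: "v \<in> V \<Longrightarrow> w \<in> V \<Longrightarrow> om (g v) (g w) = om v w"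
    and H_g: "v \<in> V \<Longrightarrow> w \<in> V \<Longrightarrow> H (g v) (g w) = H v w"
begin

lemmas V = symplecticD[OF symplectic]
lemmas sub = csubspaceD[OF V(1)]
lemmas om = bilinD[OF V(2)]
lemmas g = linD[OF lin_g]
lemmas H = hermitianD[OF herm]

lemma eigenvalue_norm:
  assumes "v \<in> V" "v \<noteq> (\<lambda>x. 0)" "g v = (\<lambda>x. z * v x)"
  shows "cnj z * z = 1"
proof -
  have "H v v = cnj z * (z * H v v)"
    using H_g[OF assms(1,1)] unfolding assms(3)
    using hermitian_scale_left[OF herm V(1) assms(1) sub(3)[OF assms(1)], of z z] H(2)[OF assms(1,1), of z] by simp
  then show ?thesis using H(4)[OF assms(1,2)] by auto
qed

text \<open>For an eigenvector \<open>v\<close> with eigenvalue \<open>z\<close>, invariance gives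
  \<open>cnj z * H v (g w) = H v w\<close>, and \<open>z\<close> is nonzero; so the orthogonal
  complement of \<open>v\<close> is stable.\<close>

lemma g_eigenbasis:
  obtains B \<zeta> where "cbasis B V" "\<And>b. b \<in> B \<Longrightarrow> g b = (\<lambda>x. \<zeta> b * b x)"
proof -
  obtain C where C: "cbasis C V" using symplectic_basis[OF symplectic] .
  show ?thesis
  proof (rule eigenbasis[OF lin_g C herm])
    fix v w z assume *: "v \<in> V" "g v = (\<lambda>x. z * v x)" "v \<noteq> (\<lambda>x. 0)" "w \<in> V" "H v w = 0"
    have "cnj z * H v (g w) = 0"
      using H_g[OF *(1,4)] *(5) hermitian_scale_left[OF herm V(1) *(1) g(1)[OF *(4)], of z] unfolding *(2) by simp
    then show "H v (g w) = 0" using eigenvalue_norm[OF *(1,3,2)] by auto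
  qed (rule that)
qed

lemma Fx_subspace: "cfun.subspace (Fx V g)"
  unfolding cfun.subspace_def using sub g(2,3) lin_zero[OF lin_g V(1)]
  by (auto simp: Fx_def zero_fun_def plus_fun_def)

lemma NrI: "v \<in> V \<Longrightarrow> (\<lambda>x. v x - g v x) \<in> Nr V g"
  unfolding Nr_alt by blast

lemma Nr_subspace: "cfun.subspace (Nr V g)"
proof -
  have "(\<lambda>x. 0) \<in> Nr V g"
    unfolding Nr_alt using sub(1) lin_zero[OF lin_g V(1)] by (intro CollectI exI[of _ "\<lambda>x. 0"]) simp
  moreover have "(\<lambda>x. a x + b x) \<in> Nr V g" if ab: "a \<in> Nr V g" "b \<in> Nr V g" for a b
  proof -
    obtain v w where vw: "v \<in> V" "a = (\<lambda>x. v x - g v x)" "w \<in> V" "b = (\<lambda>x. w x - g w x)"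
      using ab unfolding Nr_alt by blast
    then have "(\<lambda>x. a x + b x) = (\<lambda>x. (v x + w x) - g (\<lambda>x. v x + w x) x)"
      using g(2)[OF vw(1,3)] by (simp add: algebra_simps)
    then show ?thesis using NrI[OF sub(2)[OF vw(1,3)]] by simp
  qed
  moreover have "(\<lambda>x. c * a x) \<in> Nr V g" if a: "a \<in> Nr V g" for a c
  proof -
    obtain v where v: "v \<in> V" "a = (\<lambda>x. v x - g v x)" using a unfolding Nr_alt by blast
    then have "(\<lambda>x. c * a x) = (\<lambda>x. c * v x - g (\<lambda>x. c * v x) x)"
      using g(3)[OF v(1)] by (simp add: algebra_simps)
    then show ?thesis using NrI[OF sub(3)[OF v(1)]] by simp
  qed
  ultimately show ?thesis by (simp add: cfun.subspace_def zero_fun_def plus_fun_def)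
qed

lemma Fx_V: "Fx V g \<subseteq> V" by (auto simp: Fx_def)

lemma Nr_V: "Nr V g \<subseteq> V" unfolding Nr_alt using sub(4) g(1) by auto

text \<open>For fixed \<open>u\<close>, invariance of a form makes its pairings of \<open>u\<close>
  with \<open>v\<close> and with \<open>g v\<close> equal.\<close>

lemma orth:
  assumes "u \<in> Fx V g" "w \<in> Nr V g"
  shows "om u w = 0" "om w u = 0" "H u w = 0" "H w u = 0"
proof -
  have u: "u \<in> V" "g u = u" using assms(1) by (auto simp: Fx_def)
  obtain v where v: "v \<in> V" "w = (\<lambda>x. v x - g v x)" using assms(2) unfolding Nr_alt by blast
  have w: "w = (\<lambda>x. v x + -1 * g v x)" "w \<in> V" using v sub(4) g(1) by auto
  have gv: "(\<lambda>x. -1 * g v x) \<in> V" using sub(3)[OF g(1)[OF v(1)]] .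
  show 1: "om u w = 0"
    using om(2)[OF v(1) gv u(1)] om(4)[OF u(1) g(1)[OF v(1)], of "-1"] om_g[OF u(1) v(1)] u unfolding w(1) by simp
  show "om w u = 0" using 1 symplectic_antisym[OF symplectic u(1) w(2)] by simp
  show 2: "H u w = 0"
    using H(1)[OF u(1) v(1) gv] H(2)[OF u(1) g(1)[OF v(1)], of "-1"] H_g[OF u(1) v(1)] u unfolding w(1) by simp
  show "H w u = 0" using 2 H(3)[OF u(1) w(2)] by simp
qed

lemma Fx_Nr: "v \<in> Fx V g \<Longrightarrow> v \<in> Nr V g \<Longrightarrow> v = (\<lambda>x. 0)"
  using orth(3)[of v v] H(4)[of v] Fx_V by fastforce

text \<open>The eigenvectors with eigenvalue 1 lie in \<open>Fx\<close>, the others in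
  \<open>Nr\<close>. Together they span \<open>V\<close>, and since \<open>Fx\<close> and
  \<open>Nr\<close> meet only in 0, the two spans cannot be smaller than \<open>Fx\<close> and
  \<open>Nr\<close>.\<close>

lemma eigen_split:
  assumes B: "cbasis B V" and eig: "\<And>b. b \<in> B \<Longrightarrow> g b = (\<lambda>x. \<zeta> b * b x)"
  shows "cbasis {b \<in> B. \<zeta> b = 1} (Fx V g)" "cbasis {b \<in> B. \<zeta> b \<noteq> 1} (Nr V g)"
    and "V = {\<lambda>x. v x + w x | v w. v \<in> Fx V g \<and> w \<in> Nr V g}"
proof -
  note B' = cbasisD[OF B]
  let ?F = "{b \<in> B. \<zeta> b = 1}" and ?N = "{b \<in> B. \<zeta> b \<noteq> 1}"
  have bF: "b \<in> Fx V g" if "b \<in> ?F" for b using that eig B' by (simp add: Fx_def)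
  have bN: "b \<in> Nr V g" if b: "b \<in> ?N" for b
  proof -
    \<comment> \<open>On this eigenvector \<open>1 - g\<close> is multiplication by
      \<open>1 - \<zeta> b\<close>, so the multiple \<open>c * b\<close> is a preimage of
      \<open>b\<close>.\<close>
    define c where "c = 1 / (1 - \<zeta> b)"
    have bV: "b \<in> V" using b B'(5) by blast
    have c: "c * (1 - \<zeta> b) = 1" using b by (simp add: c_def)
    have "c * b x - g (\<lambda>x. c * b x) x = b x" for x
    proof -
      have "c * b x - g (\<lambda>x. c * b x) x = c * b x - c * (\<zeta> b * b x)"
        using g(3)[OF bV, of c] eig[of b] b by simp
      also have "\<dots> = (c * (1 - \<zeta> b)) * b x" by (simp add: algebra_simps)
      finally show ?thesis by (simp only: c mult_1_left)
    qed
    then have "(\<lambda>x. c * b x - g (\<lambda>x. c * b x) x) = b" by (rule ext)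
    then show ?thesis using NrI[OF sub(3)[OF bV, of c]] by simp
  qed
  have sF: "cfun.span ?F \<subseteq> Fx V g" using bF by (intro cfun.span_minimal Fx_subspace) auto
  have sN: "cfun.span ?N \<subseteq> Nr V g" using bN by (intro cfun.span_minimal Nr_subspace) auto
  have spl: "\<exists>a n. a \<in> cfun.span ?F \<and> n \<in> cfun.span ?N \<and> v = (\<lambda>x. a x + n x)" if "v \<in> V" for v
  proof -
    have "v \<in> cfun.span (?F \<union> ?N)" using that B'(3) by (simp add: Collect_disj_eq[symmetric] conj_disj_distribL[symmetric])
    then show ?thesis by (auto simp: cfun.span_Un plus_fun_def)
  qed
  show "V = {\<lambda>x. v x + w x | v w. v \<in> Fx V g \<and> w \<in> Nr V g}"
    using spl sF sN sub(2) Fx_V Nr_V by blast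
  have "Fx V g \<subseteq> cfun.span ?F"
  proof
    fix v assume v: "v \<in> Fx V g"
    then obtain a n where an: "a \<in> cfun.span ?F" "n \<in> cfun.span ?N" "v = (\<lambda>x. a x + n x)" using spl Fx_V by blast
    then have "(\<lambda>x. v x - a x) \<in> Fx V g" using csubspaceD(4)[OF Fx_subspace v] sF by blast
    then have "n \<in> Fx V g" using an by simp
    then have "n = (\<lambda>x. 0)" using Fx_Nr an sN by blast
    then show "v \<in> cfun.span ?F" using an by simp
  qed
  moreover have "Nr V g \<subseteq> cfun.span ?N"
  proof
    fix v assume v: "v \<in> Nr V g"
    then obtain a n where an: "a \<in> cfun.span ?F" "n \<in> cfun.span ?N" "v = (\<lambda>x. a x + n x)" using spl Nr_V by blast
    then have "(\<lambda>x. v x - n x) \<in> Nr V g" using csubspaceD(4)[OF Nr_subspace v] sN by blast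
    then have "a \<in> Nr V g" using an by simp
    then have "a = (\<lambda>x. 0)" using Fx_Nr an sF by blast
    then show "v \<in> cfun.span ?N" using an by simp
  qed
  ultimately show "cbasis ?F (Fx V g)" "cbasis ?N (Nr V g)"
    using B' sF sN cfun.independent_mono[OF B'(2)] by (auto simp: cbasis_def)
qed

lemma split: "V = {\<lambda>x. v x + w x | v w. v \<in> Fx V g \<and> w \<in> Nr V g}"
  using g_eigenbasis eigen_split(3) by metis

lemma dim_split: "cfun.dim V = cfun.dim (Fx V g) + cfun.dim (Nr V g)"
proof -
  obtain B \<zeta> where B: "cbasis B V" "\<And>b. b \<in> B \<Longrightarrow> g b = (\<lambda>x. \<zeta> b * b x)" using g_eigenbasis by metis
  note s = eigen_split[OF B]
  have "card B = card {b \<in> B. \<zeta> b = 1} + card {b \<in> B. \<zeta> b \<noteq> 1}"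
    using cbasisD(1)[OF B(1)] by (subst card_Un_disjoint[symmetric]) (auto intro: arg_cong[of _ _ card])
  then show ?thesis using cbasisD(6)[OF B(1)] cbasisD(6)[OF s(1)] cbasisD(6)[OF s(2)] by simp
qed

text \<open>A vector of \<open>Nr\<close> pairing trivially with \<open>Nr\<close> pairs trivially
  with \<open>Fx\<close> as well by \<open>orth\<close>, hence with all of \<open>V\<close>.\<close>

lemma symplectic_Nr: "symplectic (Nr V g) om"
  unfolding symplectic_def
proof (intro conjI ballI impI)
  obtain B \<zeta> where B: "cbasis B V" "\<And>b. b \<in> B \<Longrightarrow> g b = (\<lambda>x. \<zeta> b * b x)" using g_eigenbasis by metis
  show "\<exists>B. cbasis B (Nr V g)" using eigen_split(2)[OF B] by blast
  show "bilin (Nr V g) om" using bilin_subset[OF V(2) Nr_V] .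
  fix v assume v: "v \<in> Nr V g"
  then show "om v v = 0" using V(3) Nr_V by blast
  assume *: "\<forall>w\<in>Nr V g. om v w = 0"
  have "om v w = 0" if "w \<in> V" for w
  proof -
    obtain a n where w: "w = (\<lambda>x. a x + n x)" "a \<in> Fx V g" "n \<in> Nr V g" using split \<open>w \<in> V\<close> by blast
    then have "om v w = om v a + om v n" using om(2)[of a n v] Fx_V Nr_V v by auto
    then show ?thesis using * w orth(2)[OF w(2) v] by simp
  qed
  then show "v = (\<lambda>x. 0)" using V(4) v Nr_V by blast
qed

lemma Pr_eq:
  assumes "w \<in> Nr V g" "(\<lambda>x. v x - w x) \<in> Fx V g"
  shows "Pr V g v = w"
  unfolding Pr_def
proof (rule the_equality)
  show "w \<in> Nr V g \<and> v - w \<in> Fx V g" using assms by (simp add: fun_diff_def)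
  fix u assume u: "u \<in> Nr V g \<and> v - u \<in> Fx V g"
  have "(\<lambda>x. (v x - w x) - (v - u) x) \<in> Fx V g" using csubspaceD(4)[OF Fx_subspace assms(2)] u by blast
  then have "(\<lambda>x. u x - w x) \<in> Fx V g" by (simp add: algebra_simps)
  moreover have "(\<lambda>x. u x - w x) \<in> Nr V g" using csubspaceD(4)[OF Nr_subspace] u assms(1) by blast
  ultimately have "(\<lambda>x. u x - w x) = (\<lambda>x. 0)" by (rule Fx_Nr)
  then show "u = w" by (simp add: fun_eq_iff)
qed

lemma Pr:
  assumes "v \<in> V"
  shows "Pr V g v \<in> Nr V g" "(\<lambda>x. v x - Pr V g v x) \<in> Fx V g"
proof -
  obtain a n where v: "v = (\<lambda>x. a x + n x)" "a \<in> Fx V g" "n \<in> Nr V g" using split assms by blast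
  then have "Pr V g v = n" by (intro Pr_eq) auto
  then show "Pr V g v \<in> Nr V g" "(\<lambda>x. v x - Pr V g v x) \<in> Fx V g" using v by auto
qed

lemma Pr_Nr: "v \<in> Nr V g \<Longrightarrow> Pr V g v = v"
  using csubspaceD(1)[OF Fx_subspace] by (intro Pr_eq) auto

lemma lin_Pr: "lin V (Nr V g) (Pr V g)"
  unfolding lin_def
proof (intro conjI ballI allI)
  fix v assume v: "v \<in> V"
  show "Pr V g v \<in> Nr V g" using Pr(1)[OF v] .
  show "Pr V g (\<lambda>x. c * v x) = (\<lambda>x. c * Pr V g v x)" for c
    using csubspaceD(3)[OF Nr_subspace Pr(1)[OF v], of c] csubspaceD(3)[OF Fx_subspace Pr(2)[OF v], of c]
    by (intro Pr_eq) (auto simp: algebra_simps)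
  fix w assume w: "w \<in> V"
  show "Pr V g (\<lambda>x. v x + w x) = (\<lambda>x. Pr V g v x + Pr V g w x)"
    using csubspaceD(2)[OF Nr_subspace Pr(1)[OF v] Pr(1)[OF w]] csubspaceD(2)[OF Fx_subspace Pr(2)[OF v] Pr(2)[OF w]]
    by (intro Pr_eq) (auto simp: algebra_simps)
qed

text \<open>The difference of \<open>v\<close> and its projection is fixed and therefore orthogonal
  to \<open>w\<close> for both forms. These identities are what relates the sum of two projections
  to the block forms in \<open>vol_product\<close>.\<close>

lemma Pr_adjoint:
  assumes "v \<in> V" "w \<in> Nr V g"
  shows "om (Pr V g v) w = om v w" "om w (Pr V g v) = om w v" "H (Pr V g v) w = H v w"
proof -
  have p: "Pr V g v \<in> V" "(\<lambda>x. v x - Pr V g v x) \<in> V" "w \<in> V"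
    using Pr[OF assms(1)] Fx_V Nr_V assms(2) by auto
  have e: "(\<lambda>x. (v x - Pr V g v x) + Pr V g v x) = v" by simp
  show "om (Pr V g v) w = om v w" "om w (Pr V g v) = om w v"
    using om(1)[OF p(2,1,3)] om(2)[OF p(2,1,3)] orth(1,2)[OF Pr(2)[OF assms(1)] assms(2)] unfolding e by auto
  have "H w (Pr V g v) = H w v"
    using H(1)[OF p(3,2,1)] orth(4)[OF Pr(2)[OF assms(1)] assms(2)] unfolding e by simp
  then show "H (Pr V g v) w = H v w" using H(3)[OF p(3,1)] H(3)[OF p(3) assms(1)] by simp
qed

lemma lin_one_minus: "lin V (Nr V g) (\<lambda>v. v - g v)"
  unfolding lin_def Nr_def using g(2,3) by (auto simp: fun_diff_def algebra_simps)

lemma lin_Nr: "lin (Nr V g) (Nr V g) (\<lambda>v. v - g v)"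
  using lin_one_minus Nr_V unfolding lin_def by blast

lemma normal_det_eigenbasis:
  assumes B: "cbasis B V" and eig: "\<And>b. b \<in> B \<Longrightarrow> g b = (\<lambda>x. \<zeta> b * b x)"
  shows "endo_det (Nr V g) (\<lambda>v. v - g v) = (\<Prod>b\<in>{b \<in> B. \<zeta> b \<noteq> 1}. 1 - \<zeta> b)"
proof (rule endo_det_diagonal[OF symplectic_Nr lin_Nr eigen_split(2)[OF B eig]])
  show "b - g b = (\<lambda>x. (1 - \<zeta> b) * b x)" if "b \<in> {b \<in> B. \<zeta> b \<noteq> 1}" for b
    using that eig[of b] by (auto simp: fun_diff_def algebra_simps)
qed

text \<open>The diagonal map with entries the phases of \<open>csqrt (1 - \<zeta> b)\<close> preserves the form, because the
  form only pairs eigenvectors with inverse, hence conjugate, eigenvalues. Its determinant is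
  therefore 1, which makes the product of the \<open>1 - \<zeta> b\<close> positive.\<close>

lemma normal_det_positive:
  obtains r where "0 < r" "endo_det (Nr V g) (\<lambda>v. v - g v) = complex_of_real r"
proof -
  obtain B \<zeta> where B: "cbasis B V" and eig: "\<And>b. b \<in> B \<Longrightarrow> g b = (\<lambda>x. \<zeta> b * b x)" using g_eigenbasis by metis
  define N where "N = {b \<in> B. \<zeta> b \<noteq> 1}"
  have N: "cbasis N (Nr V g)" unfolding N_def by (rule eigen_split(2)[OF B eig])
  note N' = cbasisD[OF N]
  \<comment> \<open>The complex number of modulus 1 whose square is the phase of
    \<open>1 - \<zeta> b\<close>.\<close>
  define u where "u b = csqrt (1 - \<zeta> b) / complex_of_real (sqrt (cmod (1 - \<zeta> b)))" for b
  have norm1: "cnj (\<zeta> b) * \<zeta> b = 1" if "b \<in> B" for b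
  proof (rule eigenvalue_norm)
    show "b \<in> V" using that cbasisD(5)[OF B] by blast
    show "b \<noteq> (\<lambda>x. 0)" using that cbasisD(2)[OF B] cfun.dependent_zero by (auto simp: zero_fun_def)
  qed (rule eig[OF that])
  have unz: "u b \<noteq> 0" if "b \<in> N" for b using that by (auto simp: u_def N_def)
  have "u b * u c * om b c = om b c" if bc: "b \<in> N" "c \<in> N" for b c
  proof (cases "om b c = 0")
    case False
    have V: "b \<in> V" "c \<in> V" and "b \<in> B" "c \<in> B" using bc cbasisD(5)[OF B] by (auto simp: N_def)
    have "om b c = \<zeta> b * (\<zeta> c * om b c)"
      using om_g[OF V] om(3)[OF V(1) sub(3)[OF V(2)], of "\<zeta> b" "\<zeta> c"] om(4)[OF V, of "\<zeta> c"] eig[OF \<open>b \<in> B\<close>] eig[OF \<open>c \<in> B\<close>] by simp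
    then have "\<zeta> b * \<zeta> c = 1" using False by simp
    then have c: "\<zeta> c = cnj (\<zeta> b)" using norm1[OF \<open>b \<in> B\<close>] by (metis mult.assoc mult.commute mult_1_left)
    have nz: "1 - \<zeta> b \<noteq> 0" using bc by (simp add: N_def)
    have cm: "cmod (\<zeta> b) = 1" using norm1[OF \<open>b \<in> B\<close>]
      by (metis complex_mod_cnj mult.commute norm_mult norm_one real_sqrt_abs real_sqrt_mult_self real_sqrt_one abs_norm_cancel power2_eq_square)
    \<comment> \<open>\<open>csqrt\<close> commutes with conjugation only off its branch cut; a
      number of modulus 1 different from 1 has real part below 1, so the cut is avoided.\<close>
    have "1 - \<zeta> b \<notin> \<real>\<^sub>\<le>\<^sub>0"
    proof
      assume "1 - \<zeta> b \<in> \<real>\<^sub>\<le>\<^sub>0"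
      then have "Re (\<zeta> b) \<ge> 1" "Im (\<zeta> b) = 0" by (auto simp: complex_nonpos_Reals_iff)
      moreover have "Re (\<zeta> b) \<le> 1" using complex_Re_le_cmod[of "\<zeta> b"] cm by simp
      ultimately have "\<zeta> b = 1" by (simp add: complex_eq_iff)
      then show False using nz by simp
    qed
    then have "csqrt (1 - \<zeta> c) = cnj (csqrt (1 - \<zeta> b))" using cnj_csqrt[of "1 - \<zeta> b"] c by simp
    then have "csqrt (1 - \<zeta> b) * csqrt (1 - \<zeta> c) = complex_of_real (cmod (1 - \<zeta> b))"
      by (simp add: complex_norm_square[symmetric] flip: of_real_power)
    moreover have "cmod (1 - \<zeta> c) = cmod (1 - \<zeta> b)" using c by (metis complex_cnj_diff complex_cnj_one complex_mod_cnj)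
    moreover have "complex_of_real (sqrt (cmod (1 - \<zeta> b))) * complex_of_real (sqrt (cmod (1 - \<zeta> b))) = complex_of_real (cmod (1 - \<zeta> b))"
      by (simp flip: of_real_mult)
    ultimately have "u b * u c = 1" using nz by (simp add: u_def)
    then show ?thesis by simp
  qed simp
  note * = diag_bilin[OF N symplecticD(2)[OF symplectic_Nr] symplecticD(2)[OF symplectic_Nr], of u, OF this]
  have "endo_det (Nr V g) (diag N u) = 1"
    by (rule endo_det_symplectic[OF symplectic_Nr diag(1)[OF N] diag(3)[OF N]]) (use unz * in auto)
  moreover have "endo_det (Nr V g) (diag N u) = (\<Prod>b\<in>N. u b)"
    by (rule endo_det_diagonal[OF symplectic_Nr diag(1)[OF N] N diag(2)[OF N]])
  ultimately have 1: "(\<Prod>b\<in>N. u b) = 1" by simp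
  \<comment> \<open>Polar decomposition of the factors: the phases multiply to 1 by the previous
    step and the moduli remain.\<close>
  have "(u b)\<^sup>2 * complex_of_real (cmod (1 - \<zeta> b)) = 1 - \<zeta> b" if "b \<in> N" for b
    using that by (auto simp: u_def N_def power_divide simp flip: of_real_power)
  then have "(\<Prod>b\<in>N. 1 - \<zeta> b) = (\<Prod>b\<in>N. (u b)\<^sup>2 * complex_of_real (cmod (1 - \<zeta> b)))" by simp
  also have "\<dots> = (\<Prod>b\<in>N. u b)\<^sup>2 * (\<Prod>b\<in>N. complex_of_real (cmod (1 - \<zeta> b)))"
    by (simp add: prod.distrib prod_power_distrib)
  also have "\<dots> = complex_of_real (\<Prod>b\<in>N. cmod (1 - \<zeta> b))" using 1 by simp
  finally have "endo_det (Nr V g) (\<lambda>v. v - g v) = complex_of_real (\<Prod>b\<in>N. cmod (1 - \<zeta> b))"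
    using normal_det_eigenbasis[OF B eig] by (simp add: N_def)
  moreover have "0 < (\<Prod>b\<in>N. cmod (1 - \<zeta> b))" by (intro prod_pos) (auto simp: N_def)
  ultimately show ?thesis using that by blast
qed

end

subsection \<open>Transverse pairs of isometries\<close>

lemma direct_sum_projections:
  assumes A: "cfun.subspace A" and C: "cfun.subspace C" and W: "W = {\<lambda>x. v x + w x | v w. v \<in> A \<and> w \<in> C}"
    and AC: "\<And>v. v \<in> A \<Longrightarrow> v \<in> C \<Longrightarrow> v = (\<lambda>x. 0)"
  obtains P Q where "lin W A P" "lin W C Q" "\<And>a c. a \<in> A \<Longrightarrow> c \<in> C \<Longrightarrow> P (\<lambda>x. a x + c x) = a"
    "\<And>a c. a \<in> A \<Longrightarrow> c \<in> C \<Longrightarrow> Q (\<lambda>x. a x + c x) = c"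
proof -
  have unique: "a = a' \<and> c = c'" if "a \<in> A" "c \<in> C" "a' \<in> A" "c' \<in> C" "(\<lambda>x. a x + c x) = (\<lambda>x. a' x + c' x)" for a c a' c'
  proof -
    have e: "a x - a' x = c' x - c x" for x using fun_cong[OF that(5), of x] by (simp add: algebra_simps)
    have "(\<lambda>x. a x - a' x) \<in> A" using csubspaceD(4)[OF A] that by blast
    moreover have "(\<lambda>x. a x - a' x) \<in> C" using csubspaceD(4)[OF C that(4,2)] by (simp only: e)
    ultimately have "(\<lambda>x. a x - a' x) = (\<lambda>x. 0)" by (rule AC)
    then have "a x = a' x \<and> c x = c' x" for x using e[of x] by (metis right_minus_eq)
    then show ?thesis by auto
  qed
  define P where "P w = (SOME a. a \<in> A \<and> (\<exists>c\<in>C. w = (\<lambda>x. a x + c x)))" for w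
  define Q where "Q w = (SOME c. c \<in> C \<and> (\<exists>a\<in>A. w = (\<lambda>x. a x + c x)))" for w
  have P: "P (\<lambda>x. a x + c x) = a" if "a \<in> A" "c \<in> C" for a c
  proof -
    have "P (\<lambda>x. a x + c x) \<in> A \<and> (\<exists>c'\<in>C. (\<lambda>x. a x + c x) = (\<lambda>x. P (\<lambda>x. a x + c x) x + c' x))"
      unfolding P_def by (rule someI[of _ a]) (use that in blast)
    then show ?thesis using unique[OF that] by metis
  qed
  have Q: "Q (\<lambda>x. a x + c x) = c" if "a \<in> A" "c \<in> C" for a c
  proof -
    have "Q (\<lambda>x. a x + c x) \<in> C \<and> (\<exists>a'\<in>A. (\<lambda>x. a x + c x) = (\<lambda>x. a' x + Q (\<lambda>x. a x + c x) x))"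
      unfolding Q_def by (rule someI[of _ c]) (use that in blast)
    then show ?thesis using unique[OF that] by metis
  qed
  have add: "(\<lambda>x. (a x + c x) + (a' x + c' x)) = (\<lambda>x. (\<lambda>x. a x + a' x) x + (\<lambda>x. c x + c' x) x)"
    and scale: "(\<lambda>x. z * (a x + c x)) = (\<lambda>x. (\<lambda>x. z * a x) x + (\<lambda>x. z * c x) x)" for a c a' c' :: "'a cvec" and z
    by (simp_all add: algebra_simps)
  have "lin W A P"
    unfolding lin_def
  proof (intro conjI ballI allI)
    fix v assume "v \<in> W"
    then obtain a c where v: "v = (\<lambda>x. a x + c x)" "a \<in> A" "c \<in> C" using W by blast
    then show "P v \<in> A" by (simp add: P)
    show "P (\<lambda>x. z * v x) = (\<lambda>x. z * P v x)" for z
      unfolding v(1) scale P[OF v(2,3)] by (rule P) (use v csubspaceD(3)[OF A] csubspaceD(3)[OF C] in auto)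
    fix w assume "w \<in> W"
    then obtain a' c' where w: "w = (\<lambda>x. a' x + c' x)" "a' \<in> A" "c' \<in> C" using W by blast
    show "P (\<lambda>x. v x + w x) = (\<lambda>x. P v x + P w x)"
      unfolding v(1) w(1) add[of a c a' c'] P[OF v(2,3)] P[OF w(2,3)]
      by (rule P) (use v w csubspaceD(2)[OF A] csubspaceD(2)[OF C] in auto)
  qed
  moreover have "lin W C Q"
    unfolding lin_def
  proof (intro conjI ballI allI)
    fix v assume "v \<in> W"
    then obtain a c where v: "v = (\<lambda>x. a x + c x)" "a \<in> A" "c \<in> C" using W by blast
    then show "Q v \<in> C" by (simp add: Q)
    show "Q (\<lambda>x. z * v x) = (\<lambda>x. z * Q v x)" for z
      unfolding v(1) scale Q[OF v(2,3)] by (rule Q) (use v csubspaceD(3)[OF A] csubspaceD(3)[OF C] in auto)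
    fix w assume "w \<in> W"
    then obtain a' c' where w: "w = (\<lambda>x. a' x + c' x)" "a' \<in> A" "c' \<in> C" using W by blast
    show "Q (\<lambda>x. v x + w x) = (\<lambda>x. Q v x + Q w x)"
      unfolding v(1) w(1) add[of a c a' c'] Q[OF v(2,3)] Q[OF w(2,3)]
      by (rule Q) (use v w csubspaceD(2)[OF A] csubspaceD(2)[OF C] in auto)
  qed
  ultimately show ?thesis using P Q that by blast
qed

lemma bilin_add: "bilin W om1 \<Longrightarrow> bilin W om2 \<Longrightarrow> bilin W (\<lambda>v w. om1 v w + om2 v w)"
  unfolding bilin_def by (simp add: algebra_simps)

lemma lin_subset: "lin V W f \<Longrightarrow> U \<subseteq> V \<Longrightarrow> W \<subseteq> W' \<Longrightarrow> lin U W' f"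
  unfolding lin_def by blast

lemma lin_add:
  assumes "lin V W f" "lin V W h" "cfun.subspace W"
  shows "lin V W (\<lambda>v x. f v x + h v x)"
  unfolding lin_def
  by (intro conjI ballI allI) (simp_all add: linD[OF assms(1)] linD[OF assms(2)] csubspaceD(2)[OF assms(3)] algebra_simps)

lemma lin_scale:
  assumes "lin V W f" "cfun.subspace W"
  shows "lin V W (\<lambda>v x. c * f v x)"
  unfolding lin_def
proof (intro conjI ballI allI)
  fix v assume v: "v \<in> V"
  show "(\<lambda>x. c * f v x) \<in> W" by (rule csubspaceD(3)[OF assms(2) linD(1)[OF assms(1) v]])
  show "(\<lambda>x. c * f (\<lambda>x. d * v x) x) = (\<lambda>x. d * (c * f v x))" for d
    unfolding linD(3)[OF assms(1) v] by (simp only: mult.left_commute)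
  fix w assume w: "w \<in> V"
  show "(\<lambda>x. c * f (\<lambda>x. v x + w x) x) = (\<lambda>x. c * f v x + c * f w x)"
    unfolding linD(2)[OF assms(1) v w] by (simp only: distrib_left)
qed

text \<open>The part of \<open>v\<close> removed by the projection is fixed, so \<open>1 - g\<close>
  annihilates it.\<close>

lemma (in isometry) one_minus_Pr:
  assumes "v \<in> V"
  shows "(\<lambda>x. Pr V g v x - g (Pr V g v) x) = (\<lambda>x. v x - g v x)"
proof -
  have p: "Pr V g v \<in> V" "(\<lambda>x. v x - Pr V g v x) \<in> V" "g (\<lambda>x. v x - Pr V g v x) = (\<lambda>x. v x - Pr V g v x)"
    using Pr[OF assms] Nr_V by (auto simp: Fx_def)
  have "(\<lambda>x. (v x - Pr V g v x) + Pr V g v x) = v" by simp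
  then have "g v = (\<lambda>x. (v x - Pr V g v x) + g (Pr V g v) x)"
    using g(2)[OF p(2,1)] p(3) by simp
  then show ?thesis by (simp add: fun_eq_iff)
qed

text \<open>The product is asked to be the composite only on \<open>V\<close>: differentials of
  automorphisms of \<open>X\<close> compose correctly on tangent vectors, not on arbitrary
  functionals.\<close>

locale transverse_isometries =
  g: isometry V om H g + h: isometry V om H h + k: isometry V om H k for V om H g h k +
  assumes k: "v \<in> V \<Longrightarrow> k v = g (h v)"
    and transverse: "V = {\<lambda>x. v x + w x | v w. v \<in> Fx V g \<and> w \<in> Fx V h}"
begin

abbreviation "A \<equiv> Nr V g"
abbreviation "C \<equiv> Nr V h"
abbreviation "W \<equiv> Nr V k"

text \<open>The dual form of transversality: a vector in both normal spaces is
  \<open>om\<close>-orthogonal to both fixed spaces, which together span \<open>V\<close>.\<close>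

lemma A_C: "v \<in> A \<Longrightarrow> v \<in> C \<Longrightarrow> v = (\<lambda>x. 0)"
proof (rule g.V(4))
  fix w assume v: "v \<in> A" "v \<in> C" and "w \<in> V"
  then obtain a c where w: "w = (\<lambda>x. a x + c x)" "a \<in> Fx V g" "c \<in> Fx V h" using transverse by blast
  then show "om v w = 0"
    using g.om(2)[of a c v] g.Fx_V h.Fx_V g.Nr_V v g.orth(2)[OF w(2) v(1)] h.orth(2)[OF w(3) v(2)] by auto
qed (use g.Nr_V in auto)

text \<open>If g h v = v, then h v - v is both (1 - g)(h v) and -(1 - h) v, so it lies in both
  normal spaces and vanishes.\<close>

lemma Fx_k: "Fx V k \<subseteq> Fx V g \<inter> Fx V h"
proof
  fix v assume "v \<in> Fx V k"
  then have v: "v \<in> V" "g (h v) = v" using k by (auto simp: Fx_def)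
  have hv: "h v \<in> V" using h.g(1)[OF v(1)] .
  have "(\<lambda>x. h v x - v x) \<in> A" using g.NrI[OF hv] v by simp
  moreover have "(\<lambda>x. - (v x - h v x)) \<in> C" using csubspaceD(5)[OF h.Nr_subspace h.NrI[OF v(1)]] .
  then have "(\<lambda>x. h v x - v x) \<in> C" by simp
  ultimately have "(\<lambda>x. h v x - v x) = (\<lambda>x. 0)" by (rule A_C)
  then have "h v = v" by (simp add: fun_eq_iff)
  then show "v \<in> Fx V g \<inter> Fx V h" using v by (simp add: Fx_def)
qed

text \<open>\<open>Nr V k\<close> contains every vector that is \<open>H\<close>-orthogonal to
  \<open>Fx V k\<close>, and this smaller fixed space is orthogonal to both \<open>A\<close> and
  \<open>C\<close>.\<close>

lemma A_W: "A \<subseteq> W" and C_W: "C \<subseteq> W"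
proof -
  have *: "a \<in> W" if "a \<in> V" "\<And>f. f \<in> Fx V k \<Longrightarrow> H f a = 0" for a
  proof -
    obtain f n where a: "a = (\<lambda>x. f x + n x)" "f \<in> Fx V k" "n \<in> W" using k.split \<open>a \<in> V\<close> by blast
    then have fn: "f \<in> V" "n \<in> V" using k.Fx_V k.Nr_V by auto
    have "H f f = 0" using that(2)[OF a(2)] g.H(1)[OF fn(1) fn] k.orth(3)[OF a(2,3)] a(1) by simp
    then have "f = (\<lambda>x. 0)" using g.H(4)[OF fn(1)] by auto
    then show ?thesis using a by simp
  qed
  show "A \<subseteq> W" using * g.Nr_V g.orth(3) Fx_k by blast
  show "C \<subseteq> W" using * h.Nr_V h.orth(3) Fx_k by blast
qed

text \<open>The nontrivial inclusion is the identity 1 - gh = (1 - g) h + (1 - h).\<close>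

lemma W_sum: "W = {\<lambda>x. v x + w x | v w. v \<in> A \<and> w \<in> C}"
proof
  show "{\<lambda>x. v x + w x | v w. v \<in> A \<and> w \<in> C} \<subseteq> W"
    using csubspaceD(2)[OF k.Nr_subspace] A_W C_W by blast
  show "W \<subseteq> {\<lambda>x. v x + w x | v w. v \<in> A \<and> w \<in> C}"
  proof
    fix w assume "w \<in> W"
    then obtain v where v: "v \<in> V" "w = (\<lambda>x. v x - k v x)" unfolding Nr_alt by blast
    have "(\<lambda>x. h v x - g (h v) x) \<in> A" "(\<lambda>x. v x - h v x) \<in> C"
      using g.NrI[OF h.g(1)[OF v(1)]] h.NrI[OF v(1)] .
    moreover have "w = (\<lambda>x. (h v x - g (h v) x) + (v x - h v x))" using v k by simp
    ultimately show "w \<in> {\<lambda>x. v x + w x | v w. v \<in> A \<and> w \<in> C}"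
      by (intro CollectI exI[of _ "\<lambda>x. h v x - g (h v) x"] exI[of _ "\<lambda>x. v x - h v x"]) simp
  qed
qed

lemma dim_W: "cfun.dim W = cfun.dim A + cfun.dim C"
proof -
  obtain B1 where B1: "cbasis B1 A" using symplectic_basis[OF g.symplectic_Nr] .
  obtain B2 where B2: "cbasis B2 C" using symplectic_basis[OF h.symplectic_Nr] .
  have "A \<inter> C \<subseteq> {\<lambda>x. 0}" using A_C by blast
  note u = cbasis_union[OF B1 B2 this W_sum]
  show ?thesis
    using cbasisD(6)[OF u(1)] cbasisD(6)[OF B1] cbasisD(6)[OF B2] u(2) cbasisD(1)[OF B1] cbasisD(1)[OF B2]
    by (simp add: card_Un_disjoint)
qed

text \<open>The block form \<open>om'\<close> on \<open>W = A \<oplus> C\<close> makes the summands orthogonal. The operator \<open>M\<close>, the sum of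
  the projections to \<open>A\<close> and \<open>C\<close>, compares both \<open>om\<close> with \<open>om'\<close> and \<open>H\<close> with its block form, so that
  it is self-adjoint and positive, and its positive square root transforms \<open>om\<close> into \<open>om'\<close>.\<close>

theorem vol_product:
  obtains r where "0 < r"
    "wedge (ext_map A W id (vol A om)) (ext_map C W id (vol C om)) = (\<lambda>xs. complex_of_real r * vol W om xs)"
    "endo_det W (\<lambda>v. v - k v) = complex_of_real (r\<^sup>2) * endo_det A (\<lambda>v. v - g v) * endo_det C (\<lambda>v. v - h v)"
proof -
  note sW = csubspaceD[OF k.Nr_subspace] and sA = csubspaceD[OF g.Nr_subspace] and sC = csubspaceD[OF h.Nr_subspace]
  obtain P Q where PQ: "lin W A P" "lin W C Q"
    and P: "\<And>a c. a \<in> A \<Longrightarrow> c \<in> C \<Longrightarrow> P (\<lambda>x. a x + c x) = a"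
    and Q: "\<And>a c. a \<in> A \<Longrightarrow> c \<in> C \<Longrightarrow> Q (\<lambda>x. a x + c x) = c"
  proof (rule direct_sum_projections[OF g.Nr_subspace h.Nr_subspace W_sum])
    show "v = (\<lambda>x. 0)" if "v \<in> A" "v \<in> C" for v by (rule A_C[OF that])
  qed (rule that)
  have PA: "P a = a" "Q a = (\<lambda>x. 0)" if "a \<in> A" for a using P[OF that sC(1)] Q[OF that sC(1)] by simp_all
  have QC: "P c = (\<lambda>x. 0)" "Q c = c" if "c \<in> C" for c using P[OF sA(1) that] Q[OF sA(1) that] by simp_all
  have PW: "P w \<in> A" "Q w \<in> C" "P w \<in> V" "Q w \<in> V" "P w \<in> W" "Q w \<in> W" if "w \<in> W" for w
    using linD(1)[OF PQ(1) that] linD(1)[OF PQ(2) that] g.Nr_V h.Nr_V A_W C_W by auto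
  have WV: "w \<in> V" if "w \<in> W" for w using that k.Nr_V by blast
  have PQ_sum: "(\<lambda>x. P w x + Q w x) = w" if "w \<in> W" for w
  proof -
    obtain a c where w: "w = (\<lambda>x. a x + c x)" "a \<in> A" "c \<in> C" using W_sum \<open>w \<in> W\<close> by blast
    show ?thesis unfolding w(1) P[OF w(2,3)] Q[OF w(2,3)] ..
  qed
  define om' where "om' v w = om (P v) (P w) + om (Q v) (Q w)" for v w
  define H' where "H' v w = H (P v) (P w) + H (Q v) (Q w)" for v w
  have bil: "bilin W om'"
    unfolding om'_def
    by (intro bilin_add bilin_comp[OF g.V(2)] lin_subset[OF PQ(1) order_refl g.Nr_V] lin_subset[OF PQ(2) order_refl h.Nr_V])
  have om0: "om v (\<lambda>x. 0) = 0" "om (\<lambda>x. 0) v = 0" if "v \<in> V" for v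
    using g.om(3,4)[OF g.sub(1) that, of 0] g.om(4)[OF that g.sub(1), of 0] by simp_all
  have omA: "om' v w = om v w" if "v \<in> A" "w \<in> A" for v w
    using that PA om0(1)[OF g.sub(1)] by (simp add: om'_def)
  have omC: "om' v w = om v w" if "v \<in> C" "w \<in> C" for v w
    using that QC om0(1)[OF g.sub(1)] by (simp add: om'_def)
  have omAC: "om' a c = 0 \<and> om' c a = 0" if "a \<in> A" "c \<in> C" for a c
  proof -
    have "a \<in> V" "c \<in> V" using that g.Nr_V h.Nr_V by auto
    then show ?thesis using that PA QC om0 by (simp add: om'_def)
  qed
  have symA: "symplectic A om'" by (rule symplectic_cong[OF g.symplectic_Nr omA])
  have symC: "symplectic C om'" by (rule symplectic_cong[OF h.symplectic_Nr omC])
  obtain B0 where B0: "cbasis B0 W" using symplectic_basis[OF k.symplectic_Nr] .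
  have symW: "symplectic W om'"
    by (rule symplectic_orthogonal_sum[OF B0 bil symA symC _ W_sum A_W C_W]) (rule omAC)
  define M where "M v = (\<lambda>x. Pr V g v x + Pr V h v x)" for v
  have linM: "lin W W M"
    unfolding M_def
    by (intro lin_add k.Nr_subspace lin_subset[OF g.lin_Pr k.Nr_V A_W] lin_subset[OF h.lin_Pr k.Nr_V C_W])
  \<comment> \<open>The components of \<open>M v\<close> in the direct sum are the two orthogonal
    projections, not \<open>P v\<close> and \<open>Q v\<close>; the discrepancy measures the failure
    of orthogonality.\<close>
  have PM: "P (M v) = Pr V g v" "Q (M v) = Pr V h v" if "v \<in> W" for v
    unfolding M_def using P Q g.Pr(1)[OF WV[OF that]] h.Pr(1)[OF WV[OF that]] by auto
  have omM: "om' (M v) w = om v w" "om' w (M v) = om w v" if vw: "v \<in> W" "w \<in> W" for v w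
  proof -
    have "om' (M v) w = om v (P w) + om v (Q w)"
      using g.Pr_adjoint(1)[OF WV PW(1)] h.Pr_adjoint(1)[OF WV PW(2)] vw by (simp add: om'_def PM)
    also have "\<dots> = om v w"
      using g.om(2)[OF PW(3,4)[OF vw(2)] WV[OF vw(1)]] PQ_sum[OF vw(2)] by simp
    finally show "om' (M v) w = om v w" .
    have "om' w (M v) = om (P w) v + om (Q w) v"
      using g.Pr_adjoint(2)[OF WV PW(1)] h.Pr_adjoint(2)[OF WV PW(2)] vw by (simp add: om'_def PM)
    also have "\<dots> = om w v"
      using g.om(1)[OF PW(3,4)[OF vw(2)] WV[OF vw(1)]] PQ_sum[OF vw(2)] by simp
    finally show "om' w (M v) = om w v" .
  qed
  have HM: "H' (M v) w = H v w" if vw: "v \<in> W" "w \<in> W" for v w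
  proof -
    have "H' (M v) w = H v (P w) + H v (Q w)"
      using g.Pr_adjoint(3)[OF WV PW(1)] h.Pr_adjoint(3)[OF WV PW(2)] vw by (simp add: H'_def PM)
    also have "\<dots> = H v w"
      using g.H(1)[OF WV[OF vw(1)] PW(3,4)[OF vw(2)]] PQ_sum[OF vw(2)] by simp
    finally show ?thesis .
  qed
  have hermH': "hermitian W H'"
    unfolding hermitian_def
  proof (intro conjI ballI allI impI)
    fix v assume v: "v \<in> W"
    have H0: "H (\<lambda>x. 0) (\<lambda>x. 0) = 0" using g.H(2)[OF g.sub(1,1), of 0] by simp
    show "0 < Re (H' v v)" if "v \<noteq> (\<lambda>x. 0)"
    proof -
      have "P v \<noteq> (\<lambda>x. 0) \<or> Q v \<noteq> (\<lambda>x. 0)" using PQ_sum[OF v] that by auto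
      moreover have "0 \<le> Re (H u u)" if "u \<in> V" for u using g.H(4)[OF that] H0 by (cases "u = (\<lambda>x. 0)") auto
      ultimately show ?thesis
        using g.H(4)[OF PW(3)[OF v]] g.H(4)[OF PW(4)[OF v]] PW(3,4)[OF v] by (auto simp: H'_def intro: add_pos_nonneg add_nonneg_pos)
    qed
    fix w assume w: "w \<in> W"
    show "H' v (\<lambda>x. c * w x) = c * H' v w" for c
      using linD(3)[OF PQ(1) w, of c] linD(3)[OF PQ(2) w, of c] g.H(2)[OF PW(3)[OF v] PW(3)[OF w], of c]
        g.H(2)[OF PW(4)[OF v] PW(4)[OF w], of c] by (simp add: H'_def algebra_simps)
    show "H' w v = cnj (H' v w)"
      using g.H(3)[OF PW(3)[OF v] PW(3)[OF w]] g.H(3)[OF PW(4)[OF v] PW(4)[OF w]] by (simp add: H'_def)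
    fix u assume u: "u \<in> W"
    show "H' v (\<lambda>x. w x + u x) = H' v w + H' v u"
      using linD(2)[OF PQ(1) w u] linD(2)[OF PQ(2) w u] g.H(1)[OF PW(3)[OF v] PW(3)[OF w] PW(3)[OF u]]
        g.H(1)[OF PW(4)[OF v] PW(4)[OF w] PW(4)[OF u]] by (simp add: H'_def)
  qed
  note H' = hermitianD[OF hermH']
  \<comment> \<open>By \<open>HM\<close> both sides reduce to \<open>H v w\<close>, since
    \<open>H\<close> and \<open>H'\<close> are hermitian: \<open>M\<close> is self-adjoint for
    \<open>H'\<close>.\<close>
  have Hadj: "H' v (M w) = H' (M v) w" if "v \<in> W" "w \<in> W" for v w
    using H'(3)[OF linD(1)[OF linM that(2)] that(1)] HM[OF that] HM[OF that(2,1)] g.H(3)[OF WV WV, of v w] that by simp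
  obtain B \<mu> where B: "cbasis B W" and \<mu>: "\<And>b. b \<in> B \<Longrightarrow> M b = (\<lambda>x. \<mu> b * b x)"
  proof (rule eigenbasis[OF linM B0 hermH'])
    fix v w z assume *: "v \<in> W" "M v = (\<lambda>x. z * v x)" "w \<in> W" "H' v w = 0"
    then show "H' v (M w) = 0"
      using Hadj[OF *(1,3)] hermitian_scale_left[OF hermH' k.Nr_subspace *(1,3), of z] by simp
  qed (rule that)
  note B' = cbasisD[OF B]
  define s where "s b = sqrt (Re (\<mu> b))" for b
  \<comment> \<open>On an eigenvector, \<open>HM\<close> writes one positive number as the conjugate
    eigenvalue times another positive number.\<close>
  have \<mu>_pos: "0 < Re (\<mu> b)" "\<mu> b = complex_of_real (Re (\<mu> b))" if b: "b \<in> B" for b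
  proof -
    have bW: "b \<in> W" and nz: "b \<noteq> (\<lambda>x. 0)"
      using b B'(5) B'(2) cfun.dependent_zero by (auto simp: zero_fun_def)
    have real: "Im (H b b) = 0" "Im (H' b b) = 0"
      using g.H(3)[OF WV[OF bW] WV[OF bW]] H'(3)[OF bW bW] by (auto simp: complex_eq_iff)
    have pos: "0 < Re (H b b)" "0 < Re (H' b b)" using g.H(4)[OF WV[OF bW] nz] H'(4)[OF bW nz] .
    have "H b b = cnj (\<mu> b) * H' b b"
      using HM[OF bW bW] hermitian_scale_left[OF hermH' k.Nr_subspace bW bW, of "\<mu> b"] \<mu>[OF b] by simp
    then have e: "Re (H b b) = Re (\<mu> b) * Re (H' b b)" "Im (\<mu> b) * Re (H' b b) = 0"
      using real by (auto simp: complex_eq_iff)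
    show "0 < Re (\<mu> b)" using e(1) pos by (simp add: zero_less_mult_iff)
    show "\<mu> b = complex_of_real (Re (\<mu> b))" using e(2) pos by (simp add: complex_eq_iff)
  qed
  have s: "0 < s b" "complex_of_real (s b) * complex_of_real (s b) = \<mu> b" if "b \<in> B" for b
    using \<mu>_pos[OF that] by (simp_all add: s_def flip: of_real_mult)
  \<comment> \<open>Applying \<open>omM\<close> in either argument shows that eigenvectors with
    different eigenvalues are orthogonal for \<open>om'\<close>; otherwise the two square roots
    coincide and multiply to the eigenvalue.\<close>
  have sb: "complex_of_real (s b) * complex_of_real (s c) * om' b c = om b c" if bc: "b \<in> B" "c \<in> B" for b c
  proof -
    have W: "b \<in> W" "c \<in> W" using bc B'(5) by auto
    have 1: "om b c = \<mu> b * om' b c"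
      using omM(1)[OF W] bilinD(3)[OF bil W, of "\<mu> b"] \<mu>[OF bc(1)] by simp
    have 2: "om b c = \<mu> c * om' b c"
      using omM(2)[OF W(2,1)] bilinD(4)[OF bil W, of "\<mu> c"] \<mu>[OF bc(2)] by simp
    show ?thesis
    proof (cases "om' b c = 0")
      case False
      then have "\<mu> b = \<mu> c" using 1 2 by simp
      then have "s b = s c" by (simp add: s_def)
      then show ?thesis using 1 s(2)[OF bc(1)] by simp
    qed (use 1 in simp)
  qed
  define r where "r = (\<Prod>b\<in>B. s b)"
  have r: "0 < r" unfolding r_def using s(1) by (intro prod_pos) auto
  let ?S = "diag B (\<lambda>b. complex_of_real (s b))"
  have dS: "endo_det W ?S = complex_of_real r"
    using endo_det_diagonal[OF k.symplectic_Nr diag(1)[OF B] B diag(2)[OF B]] by (simp add: r_def)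
  have "vol W om' = ext_map W W ?S (vol W om)"
  proof (rule ext_map_vol[symmetric, OF k.symplectic_Nr symW diag(1)[OF B]])
    show "?S ` W = W" using s(1) by (intro diag(3)[OF B]) force
    show "om' (?S v) (?S w) = om v w" if "v \<in> W" "w \<in> W" for v w
      by (rule diag_bilin[OF B symplecticD(2)[OF k.symplectic_Nr] bil _ that]) (rule sb)
  qed simp
  also have "\<dots> = (\<lambda>xs. complex_of_real r * vol W om xs)"
    using endo_det[OF k.symplectic_Nr diag(1)[OF B] vol(2)[OF k.symplectic_Nr]] dS by simp
  finally have vol1: "vol W om' = (\<lambda>xs. complex_of_real r * vol W om xs)" .
  have vol2: "vol W om' = wedge (ext_map A W id (vol A om)) (ext_map C W id (vol C om))"
  proof -
    have "vol A om' = vol A om" by (rule vol_cong) (rule omA)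
    moreover have "vol C om' = vol C om" by (rule vol_cong) (rule omC)
    moreover have "vol W om' = wedge (ext_map A W id (vol A om')) (ext_map C W id (vol C om'))"
    proof (rule vol_orthogonal_sum[OF symW symA symC _ W_sum A_W C_W])
      show "om' a c = 0 \<and> om' c a = 0" if "a \<in> A" "c \<in> C" for a c using omAC[OF that] .
      show "cfun.dim A = 2 * (cfun.dim A div 2)" "cfun.dim C = 2 * (cfun.dim C div 2)"
        using symplectic_dim_even[OF symA] symplectic_dim_even[OF symC] by auto
      then show "cfun.dim W = 2 * (cfun.dim A div 2 + cfun.dim C div 2)" using dim_W by simp
    qed
    ultimately show ?thesis by simp
  qed
  have detM: "endo_det W M = complex_of_real (r\<^sup>2)"
  proof -
    have "endo_det W M = (\<Prod>b\<in>B. \<mu> b)" by (rule endo_det_diagonal[OF k.symplectic_Nr linM B \<mu>])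
    also have "\<dots> = (\<Prod>b\<in>B. complex_of_real (s b) * complex_of_real (s b))" using s(2) by simp
    also have "\<dots> = complex_of_real (r\<^sup>2)" by (simp add: r_def power2_eq_square prod.distrib)
    finally show ?thesis .
  qed
  have linPW: "lin W W P" and linQW: "lin W W Q"
    using lin_subset[OF PQ(1) order_refl A_W] lin_subset[OF PQ(2) order_refl C_W] .
  \<comment> \<open>The block sum of 1 - g on \<open>A\<close> and 1 - h on
    \<open>C\<close>.\<close>
  define Dg where "Dg w = (\<lambda>x. (P w - g (P w)) x + (Q w - h (Q w)) x)" for w
  have linDg: "lin W W Dg"
  proof -
    have "lin W W ((\<lambda>v. v - g v) \<circ> P)" "lin W W ((\<lambda>v. v - h v) \<circ> Q)"
      using lin_subset[OF lin_comp[OF PQ(1) g.lin_Nr] order_refl A_W] lin_subset[OF lin_comp[OF PQ(2) h.lin_Nr] order_refl C_W] .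
    from lin_add[OF this k.Nr_subspace] show ?thesis unfolding Dg_def o_def .
  qed
  \<comment> \<open>The determinant is evaluated on the volume element of \<open>om'\<close>, which
    by \<open>vol2\<close> is a product of elements of the two blocks.\<close>
  have detDg: "endo_det W Dg = endo_det A (\<lambda>v. v - g v) * endo_det C (\<lambda>v. v - h v)" (is "_ = ?a * ?c")
  proof (rule endo_det_eqI[OF symW linDg vol(2,1)[OF symW]])
    have iA: "lin A W id" and iC: "lin C W id" using A_W C_W by (auto simp: lin_def)
    have g0: "g (\<lambda>x. 0) = (\<lambda>x. 0)" "h (\<lambda>x. 0) = (\<lambda>x. 0)" using lin_zero[OF g.lin_g g.V(1)] lin_zero[OF h.lin_g g.V(1)] .
    have eA: "(Dg \<circ> id) v = (id \<circ> (\<lambda>v. v - g v)) v" if "v \<in> A" for v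
      using PA[OF that] g0 by (auto simp: Dg_def fun_diff_def)
    have eC: "(Dg \<circ> id) v = (id \<circ> (\<lambda>v. v - h v)) v" if "v \<in> C" for v
      using QC[OF that] g0 by (auto simp: Dg_def fun_diff_def)
    have 1: "ext_map W W Dg (ext_map A W id (vol A om)) = (\<lambda>xs. ?a * ext_map A W id (vol A om) xs)"
    proof -
      have "ext_map W W Dg (ext_map A W id (vol A om)) = ext_map A W (id \<circ> (\<lambda>v. v - g v)) (vol A om)"
        unfolding ext_map_ext_map[OF iA linDg k.Nr_subspace] by (rule ext_map_cong) (rule eA)
      also have "\<dots> = ext_map A W id (ext_map A A (\<lambda>v. v - g v) (vol A om))"
        by (rule ext_map_ext_map[OF g.lin_Nr iA g.Nr_subspace, symmetric])
      finally show ?thesis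
        unfolding endo_det[OF g.symplectic_Nr g.lin_Nr vol(2)[OF g.symplectic_Nr]] ext_map_scale .
    qed
    have 2: "ext_map W W Dg (ext_map C W id (vol C om)) = (\<lambda>xs. ?c * ext_map C W id (vol C om) xs)"
    proof -
      have "ext_map W W Dg (ext_map C W id (vol C om)) = ext_map C W (id \<circ> (\<lambda>v. v - h v)) (vol C om)"
        unfolding ext_map_ext_map[OF iC linDg k.Nr_subspace] by (rule ext_map_cong) (rule eC)
      also have "\<dots> = ext_map C W id (ext_map C C (\<lambda>v. v - h v) (vol C om))"
        by (rule ext_map_ext_map[OF h.lin_Nr iC h.Nr_subspace, symmetric])
      finally show ?thesis
        unfolding endo_det[OF h.symplectic_Nr h.lin_Nr vol(2)[OF h.symplectic_Nr]] ext_map_scale .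
    qed
    show "ext_map W W Dg (vol W om') = (\<lambda>xs. ?a * ?c * vol W om' xs)"
      unfolding vol2 ext_map_wedge 1 2 wedge_scale_left wedge_scale_right by (simp only: mult.assoc)
  qed
  \<comment> \<open>The off-diagonal part of 1 - gh: it maps \<open>C\<close> to \<open>A\<close>
    and depends only on the \<open>C\<close>-component.\<close>
  define X where "X w = Pr V g (Q w - h (Q w))" for w
  have linX: "lin W W X"
  proof -
    have "lin W C ((\<lambda>v. v - h v) \<circ> Q)" by (rule lin_comp[OF PQ(2) h.lin_Nr])
    then have "lin W V ((\<lambda>v. v - h v) \<circ> Q)" by (rule lin_subset[OF _ order_refl h.Nr_V])
    from lin_comp[OF this g.lin_Pr] have "lin W A X" unfolding X_def o_def .
    then show ?thesis by (rule lin_subset[OF _ order_refl A_W])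
  qed
  have XA: "X w \<in> A" if "w \<in> W" for w
    unfolding X_def using g.Pr(1) linD(1)[OF h.lin_Nr PW(2)[OF that]] h.Nr_V by blast
  have Xdep: "X v = X w" if "Q v = Q w" for v w by (simp add: X_def that)
  \<comment> \<open>A one-parameter group of unipotent maps, because \<open>X\<close> takes values
    in \<open>A\<close> and kills \<open>A\<close>.\<close>
  define U where "U c w = (\<lambda>x. w x + c * X w x)" for c w
  have linU: "lin W W (U c)" for c
  proof -
    have "lin W W (\<lambda>w. w)" by (simp add: lin_def)
    from lin_add[OF this lin_scale[OF linX k.Nr_subspace] k.Nr_subspace, of c] show ?thesis unfolding U_def .
  qed
  have PQU: "P (U c w) = (\<lambda>x. P w x + c * X w x)" "Q (U c w) = Q w" if w: "w \<in> W" for c w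
  proof -
    have "U c w = (\<lambda>x. (P w x + c * X w x) + Q w x)"
      using fun_cong[OF PQ_sum[OF w]] by (auto simp: U_def algebra_simps)
    moreover have "(\<lambda>x. P w x + c * X w x) \<in> A" using sA(2)[OF PW(1)[OF w] sA(3)[OF XA[OF w]]] .
    ultimately show "P (U c w) = (\<lambda>x. P w x + c * X w x)" "Q (U c w) = Q w"
      using P Q PW(2)[OF w] by auto
  qed
  have UU: "U c (U d w) = U (c + d) w" if "w \<in> W" for c d w
    using Xdep[OF PQU(2)[OF that, of d]] unfolding U_def[of c] U_def[of "c + d"] by (simp add: U_def algebra_simps)
  \<comment> \<open>Scaling of the summand \<open>A\<close> alone, introduced only to compute the
    determinant of \<open>U (-1)\<close>.\<close>
  define T where "T c w = (\<lambda>x. c * P w x + Q w x)" for c w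
  have linT: "lin W W (T c)" for c
    unfolding T_def by (rule lin_add[OF lin_scale[OF linPW k.Nr_subspace] linQW k.Nr_subspace])
  have PQT: "P (T c w) = (\<lambda>x. c * P w x)" "Q (T c w) = Q w" if w: "w \<in> W" for c w
    unfolding T_def using P Q sA(3)[OF PW(1)[OF w]] PW(2)[OF w] by auto
  have dT: "endo_det W (T 2) \<noteq> 0"
  proof -
    have "T 2 (T (1/2) w) = w" if "w \<in> W" for w
      using PQT[OF that] PQ_sum[OF that] unfolding T_def[of 2] by simp
    from endo_det_inverse[OF k.symplectic_Nr linT linT this] show ?thesis by auto
  qed
  have dU0: "endo_det W (U (-1)) \<noteq> 0"
  proof -
    have "U (-1) (U 1 w) = w" if "w \<in> W" for w using UU[OF that, of "-1" 1] by (simp add: U_def[of 0])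
    from endo_det_inverse[OF k.symplectic_Nr linU linU this] show ?thesis by auto
  qed
  \<comment> \<open>Conjugation by \<open>T 2\<close> turns \<open>U (-1)\<close> into its own
    square, so its determinant equals its square; being nonzero, it is 1.\<close>
  have detU: "endo_det W (U (-1)) = 1"
  proof -
    have "(T 2 \<circ> U (-1)) w = (U (-1) \<circ> (U (-1) \<circ> T 2)) w" if w: "w \<in> W" for w
    proof -
      have "X (T 2 w) = X w" using Xdep PQT(2)[OF w] by blast
      moreover have "U (-1) (U (-1) (T 2 w)) = U (-2) (T 2 w)"
        using UU[OF linD(1)[OF linT[of 2] w], of "-1" "-1"] by simp
      ultimately have "U (-1) (U (-1) (T 2 w)) = (\<lambda>x. T 2 w x - 2 * X w x)"
        by (simp add: U_def[of "-2"])
      moreover have "T 2 (U (-1) w) = (\<lambda>x. T 2 w x - 2 * X w x)"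
        unfolding T_def[of 2] using PQU[OF w, of "-1"] by (simp add: algebra_simps)
      ultimately show ?thesis by simp
    qed
    then have "endo_det W (T 2 \<circ> U (-1)) = endo_det W (U (-1) \<circ> (U (-1) \<circ> T 2))" by (rule endo_det_cong)
    then have "endo_det W (T 2) * endo_det W (U (-1)) = endo_det W (U (-1)) * (endo_det W (U (-1)) * endo_det W (T 2))"
      by (simp only: endo_det_comp[OF k.symplectic_Nr] linU linT lin_comp[OF linT linU])
    then show ?thesis using dT dU0 by simp
  qed
  \<comment> \<open>The \<open>C\<close>-component of \<open>U (-1) (M v)\<close> is the projection
    of \<open>v\<close>; its \<open>A\<close>-component is corrected by \<open>X\<close> to the
    projection of \<open>h v\<close>, on which 1 - g gives the summand (1 - g)(h v).\<close>
  have fac: "v - k v = (Dg \<circ> (U (-1) \<circ> M)) v" if v: "v \<in> W" for v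
  proof -
    have vV: "v \<in> V" and hv: "h v \<in> V" using WV[OF v] h.g(1) by auto
    have Mv: "M v \<in> W" using linD(1)[OF linM v] .
    have q: "Q (U (-1) (M v)) = Pr V h v" using PQU(2)[OF Mv] PM(2)[OF v] by simp
    have hq: "Pr V h v - h (Pr V h v) = (\<lambda>x. v x - h v x)"
      using h.one_minus_Pr[OF vV] by (simp add: fun_diff_def)
    have X: "X (M v) = Pr V g (\<lambda>x. v x - h v x)" unfolding X_def PM(2)[OF v] hq ..
    have "(\<lambda>x. (v x - h v x) + h v x) = v" by simp
    then have "Pr V g v = (\<lambda>x. Pr V g (\<lambda>x. v x - h v x) x + Pr V g (h v) x)"
      using linD(2)[OF g.lin_Pr g.sub(4)[OF vV hv] hv] by simp
    then have p: "P (U (-1) (M v)) = Pr V g (h v)"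
      unfolding PQU(1)[OF Mv] PM(1)[OF v] X by (simp add: fun_eq_iff)
    have "Pr V g (h v) - g (Pr V g (h v)) = (\<lambda>x. h v x - g (h v) x)"
      using g.one_minus_Pr[OF hv] by (simp add: fun_diff_def)
    then have "Dg (U (-1) (M v)) = (\<lambda>x. v x - g (h v) x)" unfolding Dg_def p q hq by simp
    then show ?thesis using k[OF vV] by (simp add: fun_diff_def)
  qed
  have "endo_det W (\<lambda>v. v - k v) = endo_det W (Dg \<circ> (U (-1) \<circ> M))" by (rule endo_det_cong) (rule fac)
  also have "\<dots> = endo_det W Dg * (endo_det W (U (-1)) * endo_det W M)"
    by (simp only: endo_det_comp[OF k.symplectic_Nr] linDg linU linM lin_comp[OF linM linU])
  finally have "endo_det W (\<lambda>v. v - k v) = complex_of_real (r\<^sup>2) * endo_det A (\<lambda>v. v - g v) * endo_det C (\<lambda>v. v - h v)"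
    unfolding detDg detU detM by simp
  with r vol1 vol2 show ?thesis using that by metis
qed

end

subsection \<open>Points and homogeneous polynomials\<close>

lemma line_cases:
  assumes "v \<in> hcoords p"
  shows "line p = vec.span {v}" "v \<noteq> 0"
proof -
  have p: "vec.subspace (line p)" "vec.dim (line p) = 1" using line[of p] by auto
  have v: "v \<in> line p" "v \<noteq> 0" using assms by (auto simp: hcoords_def)
  have "line p \<subseteq> vec.span {v}"
    using v p by (intro vec.card_ge_dim_independent) auto
  moreover have "vec.span {v} \<subseteq> line p" using v p by (intro vec.span_minimal) auto
  ultimately show "line p = vec.span {v}" "v \<noteq> 0" using v by auto
qed

lemma hcoords_ex: "\<exists>v. v \<in> hcoords p"
proof -
  have "vec.dim (line p) = 1" "vec.subspace (line p)" using line[of p] by auto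
  then have "\<not> line p \<subseteq> {0}" using vec.dim_eq_0[of "line p"] by auto
  then show ?thesis by (auto simp: hcoords_def)
qed

lemma hcoords_iff:
  assumes "v \<in> hcoords p"
  shows "w \<in> hcoords p \<longleftrightarrow> (\<exists>c. c \<noteq> 0 \<and> w = c *s v)"
  using line_cases[OF assms] by (auto simp: hcoords_def vec.span_singleton)

definition pt :: "complex ^ 'n \<Rightarrow> ('n::finite) proj" where
  "pt v = Abs_proj (vec.span {v})"

lemma pt:
  assumes "v \<noteq> 0"
  shows "v \<in> hcoords (pt v)"
proof -
  have "vec.dim (vec.span {v}) = 1"
    using assms vec.dim_eq_card_independent[of "{v}"] by (simp add: vec.dim_span)
  then have "line (pt v) = vec.span {v}"
    unfolding pt_def by (intro Abs_proj_inverse) (simp add: vec.subspace_span)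
  then show ?thesis using assms by (simp add: hcoords_def vec.span_base)
qed

lemma pt_hcoords: "v \<in> hcoords p \<Longrightarrow> pt v = p"
  using line_cases[of v p] by (metis line_inverse pt_def)

lemma homogeneous_scale: "homogeneous d F \<Longrightarrow> F (c *s v) = c ^ d * F v"
  by (induction rule: homogeneous.induct) (auto simp: algebra_simps power_add)

text \<open>The rule \<open>const\<close> yields the zero function in degree 0 only; a factor of
  degree \<open>d\<close> moves it to any degree, as required for empty sums and vanishing
  derivatives.\<close>

lemma homogeneous_zero: "homogeneous d (\<lambda>v. 0)"
proof -
  have pow: "homogeneous d (\<lambda>v. (v $ i) ^ d)" for i :: "'n::finite" and d
  proof (induction d)
    case (Suc d)
    from homogeneous.mult[OF homogeneous.coord Suc] show ?case by simp
  qed (use homogeneous.const[of 1] in simp)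
  from homogeneous.mult[OF homogeneous.const[of 0] pow[of d]] show ?thesis by simp
qed

lemma homogeneous_coord_power: "homogeneous d (\<lambda>v. (v $ i) ^ d)"
proof (induction d)
  case (Suc d)
  from homogeneous.mult[OF homogeneous.coord Suc] show ?case by simp
qed (use homogeneous.const[of 1] in simp)

lemma homogeneous_cmult: "homogeneous d F \<Longrightarrow> homogeneous d (\<lambda>v. c * F v)"
  using homogeneous.mult[OF homogeneous.const[of c]] by fastforce

lemma homogeneous_diff: "homogeneous d F \<Longrightarrow> homogeneous d H \<Longrightarrow> homogeneous d (\<lambda>v. F v - H v)"
  using homogeneous.add[OF _ homogeneous_cmult[of d H "-1"]] by fastforce

lemma homogeneous_sum: "(\<And>i. i \<in> I \<Longrightarrow> homogeneous d (F i)) \<Longrightarrow> homogeneous d (\<lambda>v. \<Sum>i\<in>I. F i v)"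
  by (induction I rule: infinite_finite_induct) (auto intro: homogeneous_zero homogeneous.add)

lemma homogeneous_prod:
  "(\<And>i. i \<in> I \<Longrightarrow> homogeneous (d i) (F i)) \<Longrightarrow> homogeneous (\<Sum>i\<in>I. d i) (\<lambda>v. \<Prod>i\<in>I. F i v)"
  by (induction I rule: infinite_finite_induct) (auto intro: homogeneous.const homogeneous.mult)

text \<open>The subtraction in \<open>d - 1\<close> is truncated. The clause for
  \<open>d = 0\<close> strengthens the induction, so that in the product rule a factor of degree 0
  contributes zero instead of a term of the wrong degree.\<close>

lemma homogeneous_derivative:
  fixes F :: "complex ^ 'n::finite \<Rightarrow> complex"
  assumes "homogeneous d F"
  shows "\<exists>R. (\<forall>i. homogeneous (d - 1) (R i)) \<and> (d = 0 \<longrightarrow> (\<forall>i v. R i v = 0)) \<and>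
    (\<forall>v. (F has_derivative (\<lambda>u. \<Sum>i\<in>UNIV. R i v * u $ i)) (at v))"
  using assms
proof (induction rule: homogeneous.induct)
  case (const c)
  show ?case by (rule exI[of _ "\<lambda>i v. 0"]) (auto intro: homogeneous_zero)
next
  case (coord j)
  have "((\<lambda>v. v $ j) has_derivative (\<lambda>u. \<Sum>i\<in>UNIV. (if i = j then 1 else 0) * u $ i)) (at v)" for v :: "complex ^ 'n"
  proof -
    have "(\<lambda>u. \<Sum>i\<in>UNIV. (if i = j then 1 else 0) * u $ i) = (\<lambda>u :: complex ^ 'n. u $ j)"
      by (auto simp: if_distrib[of "\<lambda>c. c * _"] cong: if_cong)
    then show ?thesis by (simp only:) (rule bounded_linear_imp_has_derivative[OF bounded_linear_vec_nth])
  qed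
  then show ?case by (intro exI[of _ "\<lambda>i v. if i = j then 1 else 0"]) (auto intro: homogeneous.const)
next
  case (add d F H)
  obtain R where R: "\<forall>i. homogeneous (d - 1) (R i)" "d = 0 \<longrightarrow> (\<forall>i v. R i v = 0)"
    "\<And>v. (F has_derivative (\<lambda>u. \<Sum>i\<in>UNIV. R i v * u $ i)) (at v)" using add.IH(1) by blast
  obtain S where S: "\<forall>i. homogeneous (d - 1) (S i)" "d = 0 \<longrightarrow> (\<forall>i v. S i v = 0)"
    "\<And>v. (H has_derivative (\<lambda>u. \<Sum>i\<in>UNIV. S i v * u $ i)) (at v)" using add.IH(2) by blast
  have "((\<lambda>v. F v + H v) has_derivative (\<lambda>u. \<Sum>i\<in>UNIV. (R i v + S i v) * u $ i)) (at v)" for v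
    using has_derivative_add[OF R(3)[of v] S(3)[of v]] by (simp add: algebra_simps sum.distrib)
  then show ?case using R S by (intro exI[of _ "\<lambda>i v. R i v + S i v"]) (auto intro: homogeneous.add)
next
  case (mult d F e H)
  obtain R where R: "\<forall>i. homogeneous (d - 1) (R i)" "d = 0 \<longrightarrow> (\<forall>i v. R i v = 0)"
    "\<And>v. (F has_derivative (\<lambda>u. \<Sum>i\<in>UNIV. R i v * u $ i)) (at v)" using mult.IH(1) by blast
  obtain S where S: "\<forall>i. homogeneous (e - 1) (S i)" "e = 0 \<longrightarrow> (\<forall>i v. S i v = 0)"
    "\<And>v. (H has_derivative (\<lambda>u. \<Sum>i\<in>UNIV. S i v * u $ i)) (at v)" using mult.IH(2) by blast
  have "((\<lambda>v. F v * H v) has_derivative (\<lambda>u. \<Sum>i\<in>UNIV. (F v * S i v + R i v * H v) * u $ i)) (at v)" for v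
    using has_derivative_mult[OF R(3)[of v] S(3)[of v]]
    by (simp add: algebra_simps sum.distrib sum_distrib_left)
  moreover have "homogeneous (d + e - 1) (\<lambda>v. F v * S i v)" for i
  proof (cases "e = 0")
    case True
    then show ?thesis using S(2) homogeneous_zero by simp
  next
    case False
    then have "d + (e - 1) = d + e - 1" by simp
    then show ?thesis using homogeneous.mult[OF mult.hyps(1) S(1)[rule_format, of i]] by simp
  qed
  moreover have "homogeneous (d + e - 1) (\<lambda>v. R i v * H v)" for i
  proof (cases "d = 0")
    case True
    then show ?thesis using R(2) homogeneous_zero by simp
  next
    case False
    then have "d - 1 + e = d + e - 1" by simp
    then show ?thesis using homogeneous.mult[OF R(1)[rule_format, of i] mult.hyps(2)] by simp
  qed
  ultimately show ?case using R S by (intro exI[of _ "\<lambda>i v. F v * S i v + R i v * H v"]) (auto intro: homogeneous.add)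
qed

definition grad :: "(complex ^ ('n::finite) \<Rightarrow> complex) \<Rightarrow> complex ^ 'n \<Rightarrow> complex ^ 'n" where
  "grad F v = (\<chi> i. partial i F v)"

text \<open>Complex bilinear, without conjugation: the pairing of a covector with a vector.\<close>

definition dot :: "complex ^ ('n::finite) \<Rightarrow> complex ^ 'n \<Rightarrow> complex" where
  "dot r u = (\<Sum>i\<in>UNIV. r $ i * u $ i)"

text \<open>\<open>partial\<close> is a complex derivative along a coordinate line, while the second
  claim is a real Frechet derivative; restricting the latter to that line identifies the
  coefficients.\<close>

lemma homogeneous_grad:
  assumes "homogeneous d F"
  shows "homogeneous (d - 1) (\<lambda>v. grad F v $ i)" "(F has_derivative dot (grad F v)) (at v)"
proof -
  obtain R where R: "\<And>i. homogeneous (d - 1) (R i)" "\<And>v. (F has_derivative (\<lambda>u. \<Sum>i\<in>UNIV. R i v * u $ i)) (at v)"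
    using homogeneous_derivative[OF assms] by blast
  have "partial i F v = R i v" for i v
  proof -
    have 1: "((\<lambda>t. v + t *s axis i 1) has_derivative (\<lambda>t. t *s axis i 1)) (at (0::complex))"
    proof -
      have "bounded_linear (\<lambda>t::complex. t *s (axis i 1 :: complex ^ 'a))"
        unfolding linear_conv_bounded_linear[symmetric]
        by (rule linearI) (simp_all add: vec_eq_iff algebra_simps)
      then have "((\<lambda>t::complex. t *s (axis i 1 :: complex ^ 'a)) has_derivative (\<lambda>t. t *s axis i 1)) (at 0)"
        by (rule bounded_linear_imp_has_derivative)
      from has_derivative_add[OF has_derivative_const[of v] this] show ?thesis by simp
    qed
    have "((\<lambda>t. F (v + t *s axis i 1)) has_derivative (\<lambda>t. \<Sum>j\<in>UNIV. R j v * (t *s axis i 1) $ j)) (at 0)"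
      using has_derivative_compose[OF 1, of F "\<lambda>u. \<Sum>i\<in>UNIV. R i v * u $ i"] R(2)[of v] by simp
    moreover have "(\<lambda>t. \<Sum>j\<in>UNIV. R j v * (t *s axis i 1) $ j) = (*) (R i v)"
    proof
      fix t
      have "(\<Sum>j\<in>UNIV. R j v * (t *s axis i 1) $ j) = (\<Sum>j\<in>UNIV. if j = i then R i v * t else 0)"
        by (intro sum.cong) (auto simp: axis_def)
      then show "(\<Sum>j\<in>UNIV. R j v * (t *s axis i 1) $ j) = R i v * t" by simp
    qed
    ultimately have "((\<lambda>t. F (v + t *s axis i 1)) has_field_derivative R i v) (at 0)"
      by (simp add: has_field_derivative_def)
    then show ?thesis unfolding partial_def by (rule DERIV_imp_deriv)
  qed
  then have g: "grad F v $ i = R i v" for v i by (simp add: grad_def)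
  show "homogeneous (d - 1) (\<lambda>v. grad F v $ i)" using R(1) by (simp add: g)
  show "(F has_derivative dot (grad F v)) (at v)" using R(2)[of v] by (simp add: dot_def[abs_def] g)
qed

lemma homogeneous_continuous: "homogeneous d F \<Longrightarrow> continuous_on UNIV F"
  by (induction rule: homogeneous.induct) (auto intro!: continuous_intros)

lemma dot_lin: "dot r (u + v) = dot r u + dot r v" "dot r (c *s u) = c * dot r u"
  "dot (r + s) u = dot r u + dot s u" "dot (c *s r) u = c * dot r u"
  by (simp_all add: dot_def algebra_simps sum.distrib sum_distrib_left)

lemma dot_axis:
  fixes u :: "complex ^ 'a::finite"
  shows "dot (axis i 1) u = u $ i" "dot r (axis i 1) = r $ i"
proof -
  have "(\<Sum>j\<in>UNIV. (axis i 1 :: complex ^ 'a) $ j * u $ j) = (\<Sum>j\<in>UNIV. if j = i then u $ i else 0)"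
    "(\<Sum>j\<in>UNIV. r $ j * (axis i 1 :: complex ^ 'a) $ j) = (\<Sum>j\<in>UNIV. if j = i then r $ i else 0)"
    by (intro sum.cong refl, simp add: axis_def)+
  then show "dot (axis i 1) u = u $ i" "dot r (axis i 1) = r $ i"
    by (simp_all only: dot_def sum.delta finite UNIV_I if_True)
qed

text \<open>The function vanishes along the ray through \<open>v\<close>, so its derivative in the
  direction of \<open>v\<close> is zero.\<close>

lemma euler_zero:
  assumes "homogeneous d F" "F v = 0"
  shows "dot (grad F v) v = 0"
proof -
  have 1: "((\<lambda>t::real. v + t *\<^sub>R v) has_derivative (\<lambda>t. t *\<^sub>R v)) (at 0)"
    by (auto intro!: derivative_eq_intros)
  have "((\<lambda>t. F (v + t *\<^sub>R v)) has_derivative (\<lambda>t. dot (grad F v) (t *\<^sub>R v))) (at (0::real))"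
    using has_derivative_compose[OF 1, of F "dot (grad F v)"] homogeneous_grad(2)[OF assms(1), of v] by simp
  moreover have "F (v + t *\<^sub>R v) = 0" for t :: real
  proof -
    have "v + t *\<^sub>R v = complex_of_real (1 + t) *s v" by (simp add: vec_eq_iff scaleR_conv_of_real[where 'a = complex] algebra_simps)
    then show ?thesis using homogeneous_scale[OF assms(1), of "complex_of_real (1 + t)" v] assms(2) by simp
  qed
  ultimately have "((\<lambda>t::real. 0) has_derivative (\<lambda>t. dot (grad F v) (t *\<^sub>R v))) (at 0)" by simp
  then have "(\<lambda>t::real. dot (grad F v) (t *\<^sub>R v)) = (\<lambda>t. 0)"
    by (rule has_derivative_unique) (rule has_derivative_const)
  then show ?thesis by (metis scaleR_one)
qed

subsection \<open>The Zariski topology\<close>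

lemma zariski_nonvanishing:
  "homogeneous d F \<Longrightarrow> openin zariski {p. \<forall>v\<in>hcoords p. F v \<noteq> 0}"
  unfolding zariski_def by (rule topology_generated_by_Basis) blast

lemma topspace_zariski [simp]: "topspace zariski = UNIV"
proof -
  have "openin zariski (UNIV :: 'a proj set)"
    using zariski_nonvanishing[OF homogeneous.const[of 1]] by simp
  then show ?thesis using openin_subset by blast
qed

lemma nonvanishing_iff:
  assumes "homogeneous d F" "v \<in> hcoords p"
  shows "(\<forall>w\<in>hcoords p. F w \<noteq> 0) \<longleftrightarrow> F v \<noteq> 0" "(\<forall>w\<in>hcoords p. F w = 0) \<longleftrightarrow> F v = 0"
  using hcoords_iff[OF assms(2)] homogeneous_scale[OF assms(1)] assms(2) by auto

text \<open>The bridge to analysis: cones over Zariski open sets are open in the Euclidean topology,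
  so a continuous curve remains over such a set for small times.\<close>

lemma zariski_open_cone:
  assumes "openin zariski U"
  shows "open {v. v \<noteq> 0 \<and> pt v \<in> U}"
proof -
  have *: "open {v. v \<noteq> 0 \<and> pt v \<in> U}"
    if "generate_topology_on {{p. \<forall>v\<in>hcoords p. F v \<noteq> 0} | F. \<exists>d. homogeneous d F} U" for U :: "'a proj set"
    using that
  proof (induction rule: generate_topology_on.induct)
    case (Int a b)
    then have "open ({v. v \<noteq> 0 \<and> pt v \<in> a} \<inter> {v. v \<noteq> 0 \<and> pt v \<in> b})" by blast
    moreover have "{v. v \<noteq> 0 \<and> pt v \<in> a} \<inter> {v. v \<noteq> 0 \<and> pt v \<in> b} = {v. v \<noteq> 0 \<and> pt v \<in> a \<inter> b}" by auto
    ultimately show ?case by simp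
  next
    case (UN K)
    then have "open (\<Union>k\<in>K. {v. v \<noteq> 0 \<and> pt v \<in> k})" by blast
    moreover have "(\<Union>k\<in>K. {v. v \<noteq> 0 \<and> pt v \<in> k}) = {v. v \<noteq> 0 \<and> pt v \<in> \<Union>K}" by auto
    ultimately show ?case by simp
  next
    case (Basis s)
    then obtain d F where F: "s = {p. \<forall>v\<in>hcoords p. F v \<noteq> 0}" "homogeneous d F" by blast
    have "{v. v \<noteq> 0 \<and> pt v \<in> s} = {v. v \<noteq> 0} \<inter> {v. F v \<noteq> 0}"
      using nonvanishing_iff(1)[OF F(2) pt] by (auto simp: F(1))
    moreover have "open {v. F v \<noteq> 0}" "open {v :: complex ^ 'a. v \<noteq> 0}"
      using homogeneous_continuous[OF F(2)] by (auto intro!: open_Collect_neq continuous_intros)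
    ultimately show ?case by auto
  qed auto
  show ?thesis using assms unfolding zariski_def openin_topology_generated_by_iff by (rule *)
qed

subsection \<open>Curves in complete intersections\<close>

lemma has_derivative_vec_lambda:
  fixes f :: "'a::real_normed_vector \<Rightarrow> 'b::euclidean_space ^ 'n::finite"
  assumes "\<And>i. ((\<lambda>x. f x $ i) has_derivative (\<lambda>u. f' u $ i)) (at a)"
  shows "(f has_derivative f') (at a)"
  unfolding has_derivative_componentwise_within[of f f' a UNIV]
proof
  fix b :: "'b ^ 'n" assume "b \<in> Basis"
  then obtain i c where b: "b = axis i c" by (auto simp: Basis_vec_def)
  have "((\<lambda>x. f x $ i \<bullet> c) has_derivative (\<lambda>x. f' x $ i \<bullet> c)) (at a)"
    by (rule has_derivative_inner_left[OF assms])
  then show "((\<lambda>x. f x \<bullet> b) has_derivative (\<lambda>x. f' x \<bullet> b)) (at a)"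
    by (simp add: b inner_axis)
qed

lemma isCont_eventually:
  assumes "isCont f x" "open S" "f x \<in> S"
  shows "\<forall>\<^sub>F t in nhds x. f t \<in> S"
proof -
  obtain s where "open s" "x \<in> s" "\<forall>t\<in>s. f t \<in> S"
    using assms unfolding continuous_at_open by blast
  then show ?thesis unfolding eventually_nhds by blast
qed

lemma linear_dot: "linear (dot r)"
  by (rule linearI) (simp_all add: dot_def algebra_simps sum.distrib scaleR_sum_right)

text \<open>The functions \<open>F\<close>, completed by linear forms, are local coordinates at
  \<open>v\<close> by the inverse function theorem. The preimage of a straight line has velocity
  \<open>u\<close> and leaves constant every coordinate whose differential kills
  \<open>u\<close>.\<close>

lemma curve_exists:
  fixes K :: "'n::finite \<Rightarrow> (complex ^ 'n \<Rightarrow> complex) option" and r :: "'n \<Rightarrow> complex ^ 'n" and v u :: "complex ^ 'n"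
  assumes K: "\<And>i F. K i = Some F \<Longrightarrow> \<exists>d. homogeneous d F" "\<And>i F. K i = Some F \<Longrightarrow> r i = grad F v"
    and inj: "\<And>w. (\<And>i. dot (r i) w = 0) \<Longrightarrow> w = 0"
  obtains \<gamma> :: "real \<Rightarrow> complex ^ 'n" where "\<gamma> 0 = v" "(\<gamma> has_vector_derivative u) (at 0)"
    "\<And>i F. K i = Some F \<Longrightarrow> dot (r i) u = 0 \<Longrightarrow> \<forall>\<^sub>F t in nhds 0. F (\<gamma> t) = F v"
proof -
  define \<Phi> where "\<Phi> x = (\<chi> i. case K i of Some F \<Rightarrow> F x | None \<Rightarrow> dot (r i) x)" for x
  define D where "D x u = (\<chi> i. dot (case K i of Some F \<Rightarrow> grad F x | None \<Rightarrow> r i) u)" for x u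
  have der: "(\<Phi> has_derivative D x) (at x)" for x
  proof (rule has_derivative_vec_lambda)
    fix i
    show "((\<lambda>x. \<Phi> x $ i) has_derivative (\<lambda>u. D x u $ i)) (at x)"
    proof (cases "K i")
      case None
      then show ?thesis
        using linear_imp_has_derivative[OF linear_dot[of "r i"]] by (simp add: \<Phi>_def D_def)
    next
      case (Some F)
      then obtain d where "homogeneous d F" using K(1) by blast
      from homogeneous_grad(2)[OF this, of x] show ?thesis using Some by (simp add: \<Phi>_def D_def eta_contract_eq)
    qed
  qed
  have D: "blinfun_apply (Blinfun (D x)) = D x" for x
    by (rule bounded_linear_Blinfun_apply[OF has_derivative_bounded_linear[OF der]])
  have cont: "continuous_on UNIV (\<lambda>x. Blinfun (D x))"
  proof (rule continuous_on_blinfun_componentwise)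
    fix b :: "complex ^ 'n"
    have "continuous_on UNIV (\<lambda>x. dot (case K i of Some F \<Rightarrow> grad F x | None \<Rightarrow> r i) b)" for i
    proof (cases "K i")
      case (Some F)
      then obtain d where "homogeneous d F" using K(1) by blast
      then have "continuous_on UNIV (\<lambda>x. grad F x $ j)" for j using homogeneous_continuous homogeneous_grad(1) by blast
      then have "continuous_on UNIV (\<lambda>x. dot (grad F x) b)"
        unfolding dot_def by (intro continuous_on_sum continuous_on_mult continuous_on_const)
      then show ?thesis using Some by simp
    qed simp
    then show "continuous_on UNIV (\<lambda>x. blinfun_apply (Blinfun (D x)) b)"
      unfolding D D_def by (rule continuous_on_vec_lambda)
  qed
  have Dv: "D v u $ i = dot (r i) u" for u i
    using K(2)[of i] by (simp add: D_def split: option.splits)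
  have "linear (D v)" using has_derivative_linear[OF der] .
  moreover have "inj (D v)"
    unfolding linear_injective_0[OF \<open>linear (D v)\<close>] using inj Dv by (metis zero_index)
  \<comment> \<open>The derivative is an injective endomorphism of a finite-dimensional space, so it
    has the inverse that the inverse function theorem asks for.\<close>
  ultimately obtain E where E: "linear E" "\<And>x. E (D v x) = x" 
    using linear_injective_isomorphism[of "D v"] by auto
  then have "blinfun_apply (Blinfun E) = E" by (intro bounded_linear_Blinfun_apply) (simp add: linear_conv_bounded_linear)
  then have inv: "Blinfun E o\<^sub>L Blinfun (D v) = id_blinfun"
    by (intro blinfun_eqI) (simp add: D E)
  obtain U' V g g' where g: "open V" "\<Phi> v \<in> V" "homeomorphism U' V \<Phi> g" "v \<in> U'"
    "\<And>y. y \<in> V \<Longrightarrow> (g has_derivative g' y) (at y)"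
    "\<And>y. y \<in> V \<Longrightarrow> g' y = inv_into UNIV (blinfun_apply (Blinfun (D (g y))))"
    "\<And>y. y \<in> V \<Longrightarrow> bij (blinfun_apply (Blinfun (D (g y))))"
    using inverse_function_theorem[OF open_UNIV _ cont UNIV_I inv, of \<Phi>] der unfolding D by metis
  have gv: "g (\<Phi> v) = v" using g(3,4) by (simp add: homeomorphism_def)
  define \<gamma> where "\<gamma> t = g (\<Phi> v + t *\<^sub>R D v u)" for t :: real
  have "\<gamma> 0 = v" by (simp add: \<gamma>_def gv)
  moreover have "(\<gamma> has_vector_derivative u) (at 0)"
  proof -
    have 1: "((\<lambda>t::real. \<Phi> v + t *\<^sub>R D v u) has_derivative (\<lambda>t. t *\<^sub>R D v u)) (at 0)"
      by (auto intro!: derivative_eq_intros)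
    have 2: "(g has_derivative g' (\<Phi> v)) (at (\<Phi> v))" using g(2,5) by blast
    have "(\<gamma> has_derivative (\<lambda>t. g' (\<Phi> v) (t *\<^sub>R D v u))) (at 0)"
      unfolding \<gamma>_def using has_derivative_compose[OF 1, of g "g' (\<Phi> v)"] 2 by simp
    moreover have "g' (\<Phi> v) (t *\<^sub>R D v u) = t *\<^sub>R u" for t
    proof -
      have "g' (\<Phi> v) (D v u) = u"
        using g(6)[OF g(2)] g(7)[OF g(2)] unfolding gv D by (simp add: bij_is_inj)
      then show ?thesis using has_derivative_linear[OF 2] by (simp add: linear_scale)
    qed
    ultimately show ?thesis by (simp add: has_vector_derivative_def)
  qed
  moreover have "\<forall>\<^sub>F t in nhds 0. F (\<gamma> t) = F v" if i: "K i = Some F" "dot (r i) u = 0" for i F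
  proof -
    have "isCont (\<lambda>t::real. \<Phi> v + t *\<^sub>R D v u) 0" by (intro continuous_intros)
    then have "\<forall>\<^sub>F t in nhds 0. \<Phi> v + t *\<^sub>R D v u \<in> V"
      using g(1,2) by (intro isCont_eventually) simp_all
    then show ?thesis
    proof eventually_elim
      case (elim t)
      then have "\<Phi> (\<gamma> t) = \<Phi> v + t *\<^sub>R D v u" using g(3) by (simp add: \<gamma>_def homeomorphism_def)
      then have "\<Phi> (\<gamma> t) $ i = \<Phi> v $ i + t *\<^sub>R D v u $ i" by simp
      then show ?case using i Dv by (simp add: \<Phi>_def)
    qed
  qed
  ultimately show ?thesis by (rule that)
qed

subsection \<open>Tangent spaces in coordinates\<close>

text \<open>A presentation of the germ of \<open>f\<close> at \<open>q\<close> as a quotient of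
  forms of equal degree; both forms are explicit because derivatives are computed from them.\<close>

definition rep :: "('n::finite) proj set \<Rightarrow> 'n proj \<Rightarrow> ('n proj \<Rightarrow> complex) \<Rightarrow> nat \<Rightarrow>
    (complex ^ 'n \<Rightarrow> complex) \<Rightarrow> (complex ^ 'n \<Rightarrow> complex) \<Rightarrow> bool" where
  "rep X q f d A B \<longleftrightarrow> homogeneous d A \<and> homogeneous d B \<and>
     (\<exists>V. openin zariski V \<and> q \<in> V \<and> (\<forall>p\<in>V \<inter> X. \<forall>w\<in>hcoords p. B w \<noteq> 0 \<and> f p = A w / B w))"

lemma repI:
  assumes "homogeneous d A" "homogeneous d B" "openin zariski V" "q \<in> V"
    "\<And>p w. p \<in> V \<Longrightarrow> p \<in> X \<Longrightarrow> w \<in> hcoords p \<Longrightarrow> B w \<noteq> 0" "\<And>p w. p \<in> V \<Longrightarrow> p \<in> X \<Longrightarrow> w \<in> hcoords p \<Longrightarrow> f p = A w / B w"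
  shows "rep X q f d A B"
  using assms unfolding rep_def by blast

lemma repE:
  assumes "rep X q f d A B"
  obtains V where "homogeneous d A" "homogeneous d B" "openin zariski V" "q \<in> V"
    "\<And>p w. p \<in> V \<Longrightarrow> p \<in> X \<Longrightarrow> w \<in> hcoords p \<Longrightarrow> B w \<noteq> 0" "\<And>p w. p \<in> V \<Longrightarrow> p \<in> X \<Longrightarrow> w \<in> hcoords p \<Longrightarrow> f p = A w / B w"
  using assms unfolding rep_def by blast

lemma regular_at_iff:
  assumes "q \<in> X"
  shows "regular_at X q f \<longleftrightarrow> (\<exists>d A B. rep X q f d A B)"
proof
  assume "regular_at X q f"
  then obtain U where U: "openin (zariski_on X) U" "q \<in> U" "regular_on U f" unfolding regular_at_def by blast
  then obtain V' where V': "openin zariski V'" "U = V' \<inter> X" by (auto simp: openin_subtopology)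
  obtain V d A B where V: "openin zariski V" "q \<in> V" "homogeneous d A" "homogeneous d B"
    "\<forall>p\<in>V \<inter> U. \<forall>w\<in>hcoords p. B w \<noteq> 0 \<and> f p = A w / B w"
    using bspec[OF U(3)[unfolded regular_on_def] U(2)] by blast
  have "rep X q f d A B"
    using V V' U(2) by (intro repI[OF V(3,4) openin_Int[OF V(1) V'(1)]]) auto
  then show "\<exists>d A B. rep X q f d A B" by blast
next
  assume "\<exists>d A B. rep X q f d A B"
  then obtain d A B where "rep X q f d A B" by blast
  then obtain V where V: "homogeneous d A" "homogeneous d B" "openin zariski V" "q \<in> V"
    "\<And>p w. p \<in> V \<Longrightarrow> p \<in> X \<Longrightarrow> w \<in> hcoords p \<Longrightarrow> B w \<noteq> 0" "\<And>p w. p \<in> V \<Longrightarrow> p \<in> X \<Longrightarrow> w \<in> hcoords p \<Longrightarrow> f p = A w / B w"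
    by (rule repE) blast
  have "openin (zariski_on X) (V \<inter> X)" using V(3) by (auto simp: openin_subtopology)
  moreover have "regular_on (V \<inter> X) f"
    unfolding regular_on_def
  proof
    fix p assume p: "p \<in> V \<inter> X"
    have "\<forall>q\<in>V \<inter> (V \<inter> X). \<forall>v\<in>hcoords q. B v \<noteq> 0 \<and> f q = A v / B v" using V(5,6) by blast
    then show "\<exists>V' d F H. openin zariski V' \<and> p \<in> V' \<and> homogeneous d F \<and> homogeneous d H \<and>
        (\<forall>q\<in>V' \<inter> (V \<inter> X). \<forall>v\<in>hcoords q. H v \<noteq> 0 \<and> f q = F v / H v)"
      using V(1-3) p by (intro exI[of _ V] exI[of _ d] exI[of _ A] exI[of _ B]) simp
  qed
  ultimately show "regular_at X q f" unfolding regular_at_def using V(4) assms by blast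
qed

lemma tangentD:
  assumes "D \<in> tangent_space X q"
  shows "\<not> regular_at X q f \<Longrightarrow> D f = 0"
    "regular_at X q f \<Longrightarrow> regular_at X q h \<Longrightarrow> same_germ X q f h \<Longrightarrow> D f = D h"
    "regular_at X q f \<Longrightarrow> regular_at X q h \<Longrightarrow> D (\<lambda>p. f p + h p) = D f + D h"
    "regular_at X q f \<Longrightarrow> regular_at X q h \<Longrightarrow> D (\<lambda>p. f p * h p) = f q * D h + h q * D f"
    "regular_at X q f \<Longrightarrow> D (\<lambda>p. c * f p) = c * D f"
  using assms unfolding tangent_space_def by blast+

lemma tangent_local:
  assumes "q \<in> X" "openin zariski V" "q \<in> V" "\<And>p. p \<in> V \<Longrightarrow> p \<in> X \<Longrightarrow> f p = h p"
  shows "regular_at X q f \<longleftrightarrow> regular_at X q h" "D \<in> tangent_space X q \<Longrightarrow> D f = D h"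
proof -
  have *: "regular_at X q h" if r: "regular_at X q f" and eq: "\<And>p. p \<in> V \<Longrightarrow> p \<in> X \<Longrightarrow> f p = h p" for f h
  proof -
    obtain d A B where "rep X q f d A B" using r regular_at_iff[OF assms(1)] by blast
    then obtain V' where V': "homogeneous d A" "homogeneous d B" "openin zariski V'" "q \<in> V'"
      "\<And>p w. p \<in> V' \<Longrightarrow> p \<in> X \<Longrightarrow> w \<in> hcoords p \<Longrightarrow> B w \<noteq> 0" "\<And>p w. p \<in> V' \<Longrightarrow> p \<in> X \<Longrightarrow> w \<in> hcoords p \<Longrightarrow> f p = A w / B w"
      by (rule repE) blast
    have "rep X q h d A B"
    proof (rule repI[OF V'(1,2) openin_Int[OF V'(3) assms(2)]])
      fix p w assume *: "p \<in> V' \<inter> V" "p \<in> X" "w \<in> hcoords p"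
      then show "B w \<noteq> 0" using V'(5) by blast
      show "h p = A w / B w" using V'(6)[of p w] eq[of p] * by auto
    qed (use V'(4) assms(3) in simp)
    then show ?thesis using regular_at_iff[OF assms(1)] by blast
  qed
  show iff: "regular_at X q f \<longleftrightarrow> regular_at X q h" using * assms(4) by metis
  have "same_germ X q f h"
    unfolding same_germ_def using assms by (intro exI[of _ "V \<inter> X"]) (auto simp: openin_subtopology)
  then show "D f = D h" if "D \<in> tangent_space X q"
    using tangentD(1,2)[OF that] iff by metis
qed

lemma tangent_subspace: "cfun.subspace (tangent_space X q)"
  unfolding cfun.subspace_def tangent_space_def by (auto simp: algebra_simps)

lemma regular_const: "q \<in> X \<Longrightarrow> regular_at X q (\<lambda>_. c)"
  using repI[OF homogeneous.const[of c] homogeneous.const[of 1] openin_topspace[of zariski], of q X "\<lambda>_. c"]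
  by (auto simp: regular_at_iff)

lemma regular_add:
  assumes "q \<in> X" "regular_at X q f" "regular_at X q h"
  shows "regular_at X q (\<lambda>p. f p + h p)" "regular_at X q (\<lambda>p. f p * h p)"
proof -
  obtain d A B where "rep X q f d A B" using assms regular_at_iff by blast
  then obtain V where V: "homogeneous d A" "homogeneous d B" "openin zariski V" "q \<in> V"
    "\<And>p w. p \<in> V \<Longrightarrow> p \<in> X \<Longrightarrow> w \<in> hcoords p \<Longrightarrow> B w \<noteq> 0" "\<And>p w. p \<in> V \<Longrightarrow> p \<in> X \<Longrightarrow> w \<in> hcoords p \<Longrightarrow> f p = A w / B w"
    by (rule repE) blast
  obtain e A' B' where "rep X q h e A' B'" using assms regular_at_iff by blast
  then obtain V' where V': "homogeneous e A'" "homogeneous e B'" "openin zariski V'" "q \<in> V'"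
    "\<And>p w. p \<in> V' \<Longrightarrow> p \<in> X \<Longrightarrow> w \<in> hcoords p \<Longrightarrow> B' w \<noteq> 0" "\<And>p w. p \<in> V' \<Longrightarrow> p \<in> X \<Longrightarrow> w \<in> hcoords p \<Longrightarrow> h p = A' w / B' w"
    by (rule repE) blast
  have B: "homogeneous (d + e) (\<lambda>w. B w * B' w)" using homogeneous.mult[OF V(2) V'(2)] .
  have "homogeneous (d + e) (\<lambda>w. A w * B' w)" "homogeneous (d + e) (\<lambda>w. B w * A' w)"
    using homogeneous.mult[OF V(1) V'(2)] homogeneous.mult[OF V(2) V'(1)] .
  from homogeneous.add[OF this] have A: "homogeneous (d + e) (\<lambda>w. A w * B' w + B w * A' w)" .
  have "rep X q (\<lambda>p. f p + h p) (d + e) (\<lambda>w. A w * B' w + B w * A' w) (\<lambda>w. B w * B' w)"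
  proof (rule repI[OF A B openin_Int[OF V(3) V'(3)]])
    fix p w assume *: "p \<in> V \<inter> V'" "p \<in> X" "w \<in> hcoords p"
    then have p: "B w \<noteq> 0" "B' w \<noteq> 0" "f p = A w / B w" "h p = A' w / B' w"
      using V(5,6)[of p w] V'(5,6)[of p w] by auto
    then show "B w * B' w \<noteq> 0" by simp
    show "f p + h p = (A w * B' w + B w * A' w) / (B w * B' w)" using p(1,2) by (simp add: p(3,4) field_simps)
  qed (use V(4) V'(4) in simp)
  then show "regular_at X q (\<lambda>p. f p + h p)" using regular_at_iff[OF assms(1)] by blast
  have "rep X q (\<lambda>p. f p * h p) (d + e) (\<lambda>w. A w * A' w) (\<lambda>w. B w * B' w)"
  proof (rule repI[OF homogeneous.mult[OF V(1) V'(1)] B openin_Int[OF V(3) V'(3)]])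
    fix p w assume *: "p \<in> V \<inter> V'" "p \<in> X" "w \<in> hcoords p"
    then have p: "B w \<noteq> 0" "B' w \<noteq> 0" "f p = A w / B w" "h p = A' w / B' w"
      using V(5,6)[of p w] V'(5,6)[of p w] by auto
    then show "B w * B' w \<noteq> 0" "f p * h p = A w * A' w / (B w * B' w)" by simp_all
  qed (use V(4) V'(4) in simp)
  then show "regular_at X q (\<lambda>p. f p * h p)" using regular_at_iff[OF assms(1)] by blast
qed

lemma regular_scale: "q \<in> X \<Longrightarrow> regular_at X q f \<Longrightarrow> regular_at X q (\<lambda>p. c * f p)"
  using regular_add(2)[OF _ regular_const] by blast

text \<open>For forms of equal degree the quotient does not depend on the chosen vector, by
  \<open>rat_eq\<close>.\<close>

definition rat :: "(complex ^ ('n::finite) \<Rightarrow> complex) \<Rightarrow> (complex ^ 'n \<Rightarrow> complex) \<Rightarrow> 'n proj \<Rightarrow> complex" where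
  "rat A B p = A (SOME v. v \<in> hcoords p) / B (SOME v. v \<in> hcoords p)"

lemma rat_eq:
  assumes "homogeneous d A" "homogeneous d B" "v \<in> hcoords p"
  shows "rat A B p = A v / B v"
proof -
  have "(SOME v. v \<in> hcoords p) \<in> hcoords p" using hcoords_ex[of p] by (rule someI_ex)
  then obtain c where "c \<noteq> 0" "(SOME v. v \<in> hcoords p) = c *s v" using hcoords_iff[OF assms(3)] by blast
  then show ?thesis by (simp add: rat_def homogeneous_scale[OF assms(1)] homogeneous_scale[OF assms(2)])
qed

lemma rat_rep:
  assumes "homogeneous d A" "homogeneous d B" "v \<in> hcoords q" "B v \<noteq> 0"
  shows "rep X q (rat A B) d A B"
  using nonvanishing_iff(1)[OF assms(2,3)] assms(4)
  by (intro repI[OF assms(1,2) zariski_nonvanishing[OF assms(2)]]) (auto simp: rat_eq[OF assms(1,2)])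

lemma grad_eqI: "homogeneous d F \<Longrightarrow> (F has_derivative h) (at v) \<Longrightarrow> dot (grad F v) u = h u"
  using has_derivative_unique[OF homogeneous_grad(2)] by metis

lemma grad_simps:
  "dot (grad (\<lambda>v. c) v) u = 0" "dot (grad (\<lambda>v. v $ i) v) u = u $ i"
  "homogeneous d F \<Longrightarrow> homogeneous d H \<Longrightarrow> dot (grad (\<lambda>v. F v + H v) v) u = dot (grad F v) u + dot (grad H v) u"
  "homogeneous d F \<Longrightarrow> homogeneous e H \<Longrightarrow> dot (grad (\<lambda>v. F v * H v) v) u = F v * dot (grad H v) u + dot (grad F v) u * H v"
proof -
  show "dot (grad (\<lambda>v. c) v) u = 0"
    by (rule grad_eqI[OF homogeneous.const]) simp
  show "dot (grad (\<lambda>v. v $ i) v) u = u $ i"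
    by (rule grad_eqI[OF homogeneous.coord]) (rule bounded_linear_imp_has_derivative[OF bounded_linear_vec_nth])
  show "dot (grad (\<lambda>v. F v + H v) v) u = dot (grad F v) u + dot (grad H v) u" if "homogeneous d F" "homogeneous d H"
    by (rule grad_eqI[OF homogeneous.add[OF that]]) (intro has_derivative_add homogeneous_grad(2)[OF that(1)] homogeneous_grad(2)[OF that(2)])
  show "dot (grad (\<lambda>v. F v * H v) v) u = F v * dot (grad H v) u + dot (grad F v) u * H v" if "homogeneous d F" "homogeneous e H"
    by (rule grad_eqI[OF homogeneous.mult[OF that]]) (intro has_derivative_mult homogeneous_grad(2)[OF that(1)] homogeneous_grad(2)[OF that(2)])
qed

text \<open>A tangent vector is described by its affine coordinates in the chart \<open>v $ k \<noteq> 0\<close>, scaled so that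
  it becomes a tangent vector to the cone at \<open>v\<close>.\<close>

definition cone_vec :: "'n::finite \<Rightarrow> complex ^ 'n \<Rightarrow> 'n tangent \<Rightarrow> complex ^ 'n" where
  "cone_vec k v D = (\<chi> i. v $ k * D (rat (\<lambda>w. w $ i) (\<lambda>w. w $ k)))"

context
  fixes X :: "('n::finite) proj set" and q v k
  assumes q: "q \<in> X" and v: "v \<in> hcoords q" and vk: "v $ k \<noteq> 0"
begin

lemma rat_power_regular: "homogeneous d A \<Longrightarrow> regular_at X q (rat A (\<lambda>w. (w $ k) ^ d))"
  using rat_rep[OF _ homogeneous_coord_power v, of d A k X] vk q by (auto simp: regular_at_iff)

text \<open>The Leibniz rule for 1 = 1 * 1 gives \<open>D 1 = 2 * D 1\<close>.\<close>

lemma tangent_const: "D \<in> tangent_space X q \<Longrightarrow> D (\<lambda>_. c) = 0"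
proof -
  assume D: "D \<in> tangent_space X q"
  have "D (\<lambda>_. 1) = D (\<lambda>_. 1 * 1)" by simp
  also have "\<dots> = 1 * D (\<lambda>_. 1) + 1 * D (\<lambda>_. 1)"
    by (rule tangentD(4)[OF D]) (rule regular_const[OF q])+
  finally have "D (\<lambda>_. 1) = 0" by simp
  then show ?thesis using tangentD(5)[OF D regular_const[OF q, of 1], of c] by simp
qed

text \<open>A derivation is determined by its values on affine coordinates. With a power of one
  coordinate as denominator, the induction over \<open>homogeneous\<close> needs only the sum and
  product rules.\<close>

lemma tangent_rat_power:
  assumes D: "D \<in> tangent_space X q" and A: "homogeneous d A"
  shows "D (rat A (\<lambda>w. (w $ k) ^ d)) = dot (grad A v) (cone_vec k v D) / (v $ k) ^ d"
  using A
proof (induction rule: homogeneous.induct)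
  case (const c)
  have "rat (\<lambda>v. c) (\<lambda>w. (w $ k) ^ 0) = (\<lambda>_. c)" by (auto simp: rat_def)
  then show ?case by (simp add: tangent_const[OF D] grad_simps)
next
  case (coord i)
  then show ?case using vk by (simp add: grad_simps cone_vec_def)
next
  case (add d F H)
  have "rat (\<lambda>v. F v + H v) (\<lambda>w. (w $ k) ^ d) = (\<lambda>p. rat F (\<lambda>w. (w $ k) ^ d) p + rat H (\<lambda>w. (w $ k) ^ d) p)"
    by (rule ext) (simp add: rat_def add_divide_distrib)
  then show ?case
    using add by (simp add: tangentD(3)[OF D] rat_power_regular grad_simps(3)[OF add.hyps] add_divide_distrib)
next
  case (mult d F e H)
  have "rat (\<lambda>v. F v * H v) (\<lambda>w. (w $ k) ^ (d + e)) = (\<lambda>p. rat F (\<lambda>w. (w $ k) ^ d) p * rat H (\<lambda>w. (w $ k) ^ e) p)"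
    by (rule ext) (simp add: rat_def power_add)
  then show ?case
    using mult vk by (simp add: tangentD(4)[OF D] rat_power_regular grad_simps(4)[OF mult.hyps]
        rat_eq[OF mult.hyps(1) homogeneous_coord_power v] rat_eq[OF mult.hyps(2) homogeneous_coord_power v]
        power_add add_divide_distrib algebra_simps)
qed

text \<open>The quotient rule, obtained by applying the Leibniz rule to
  \<open>f * (B / x_k^d) = A / x_k^d\<close>, where x_k is the coordinate of index
  \<open>k\<close>.\<close>

lemma tangent_rep:
  assumes D: "D \<in> tangent_space X q" and f: "rep X q f d A B"
  shows "D f = (dot (grad A v) (cone_vec k v D) * B v - A v * dot (grad B v) (cone_vec k v D)) / (B v)\<^sup>2"
proof -
  obtain V where V: "homogeneous d A" "homogeneous d B" "openin zariski V" "q \<in> V"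
    "\<And>p w. p \<in> V \<Longrightarrow> p \<in> X \<Longrightarrow> w \<in> hcoords p \<Longrightarrow> B w \<noteq> 0" "\<And>p w. p \<in> V \<Longrightarrow> p \<in> X \<Longrightarrow> w \<in> hcoords p \<Longrightarrow> f p = A w / B w"
    using f by (rule repE) blast
  let ?a = "rat A (\<lambda>w. (w $ k) ^ d)" and ?b = "rat B (\<lambda>w. (w $ k) ^ d)"
  have reg: "regular_at X q f" "regular_at X q ?a" "regular_at X q ?b"
    using f regular_at_iff[OF q] rat_power_regular V(1,2) by auto
  have eq: "f p * ?b p = ?a p" if "p \<in> V" "p \<in> X" for p
  proof -
    obtain w where w: "w \<in> hcoords p" using hcoords_ex by blast
    then show ?thesis
      using V(5,6)[OF that w] by (simp add: rat_eq[OF V(1) homogeneous_coord_power w] rat_eq[OF V(2) homogeneous_coord_power w])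
  qed
  have "D (\<lambda>p. f p * ?b p) = D ?a" by (rule tangent_local(2)[OF q V(3,4) eq D])
  then have "f q * D ?b + ?b q * D f = D ?a" using tangentD(4)[OF D reg(1,3)] by simp
  then have "(A v / B v * dot (grad B v) (cone_vec k v D) + B v * D f) / (v $ k) ^ d = dot (grad A v) (cone_vec k v D) / (v $ k) ^ d"
    using V(6)[OF V(4) q v] by (simp add: tangent_rat_power[OF D V(1)] tangent_rat_power[OF D V(2)]
        rat_eq[OF V(2) homogeneous_coord_power v] add_divide_distrib)
  then have "A v / B v * dot (grad B v) (cone_vec k v D) + B v * D f = dot (grad A v) (cone_vec k v D)"
    using vk by simp
  then show ?thesis using V(5)[OF V(4) q v] by (simp add: field_simps power2_eq_square)
qed

lemma cone_vec_k: "D \<in> tangent_space X q \<Longrightarrow> cone_vec k v D $ k = 0"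
proof -
  assume D: "D \<in> tangent_space X q"
  have "D (rat (\<lambda>w. w $ k) (\<lambda>w. w $ k)) = D (\<lambda>_. 1)"
  proof (rule tangent_local(2)[OF q zariski_nonvanishing[OF homogeneous.coord[of k]] _ _ D])
    show "q \<in> {p. \<forall>v\<in>hcoords p. v $ k \<noteq> 0}" using nonvanishing_iff(1)[OF homogeneous.coord v, of k] vk by simp
    fix p assume "p \<in> {p. \<forall>v\<in>hcoords p. v $ k \<noteq> 0}"
    moreover obtain w where "w \<in> hcoords p" using hcoords_ex by blast
    ultimately show "rat (\<lambda>w. w $ k) (\<lambda>w. w $ k) p = 1"
      using rat_eq[OF homogeneous.coord homogeneous.coord, of w p k k] by auto
  qed
  then show ?thesis by (simp add: cone_vec_def tangent_const[OF D])
qed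

lemma cone_vec_vanishing:
  assumes D: "D \<in> tangent_space X q" and F: "homogeneous d F"
    and V: "openin zariski V" "q \<in> V" "\<And>p w. p \<in> V \<Longrightarrow> p \<in> X \<Longrightarrow> w \<in> hcoords p \<Longrightarrow> F w = 0"
  shows "dot (grad F v) (cone_vec k v D) = 0"
proof -
  have "D (rat F (\<lambda>w. (w $ k) ^ d)) = D (\<lambda>_. 0)"
  proof (rule tangent_local(2)[OF q V(1,2) _ D])
    fix p assume p: "p \<in> V" "p \<in> X"
    obtain w where w: "w \<in> hcoords p" using hcoords_ex by blast
    then show "rat F (\<lambda>w. (w $ k) ^ d) p = 0" using rat_eq[OF F homogeneous_coord_power w] V(3)[OF p w] by simp
  qed
  then show ?thesis using tangent_rat_power[OF D F] tangent_const[OF D] vk by simp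
qed

lemma cone_vec_inj: "D \<in> tangent_space X q \<Longrightarrow> cone_vec k v D = 0 \<Longrightarrow> D = (\<lambda>f. 0)"
proof
  fix f assume D: "D \<in> tangent_space X q" "cone_vec k v D = 0"
  show "D f = 0"
  proof (cases "regular_at X q f")
    case True
    then obtain d A B where "rep X q f d A B" using regular_at_iff[OF q] by blast
    then show ?thesis using tangent_rep[OF D(1)] D(2) by (simp add: dot_def)
  qed (use tangentD(1)[OF D(1)] in blast)
qed

text \<open>A vector annihilated by the differentials of the equations is the velocity of a curve in the
  cone over \<open>X\<close>, and differentiation along that curve is a tangent vector.\<close>

lemma tangent_exists:
  fixes K :: "'n \<Rightarrow> (complex ^ 'n \<Rightarrow> complex) option"
  assumes U: "openin zariski U" "q \<in> U" "X \<inter> U = {q \<in> U. \<forall>F\<in>set Fs. \<forall>v\<in>hcoords q. F v = 0}"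
    and Fs: "\<And>F. F \<in> set Fs \<Longrightarrow> \<exists>d. homogeneous d F" "\<And>F. F \<in> set Fs \<Longrightarrow> \<exists>i. K i = Some F"
    and K: "\<And>i F. K i = Some F \<Longrightarrow> F \<in> set Fs" "\<And>i F. K i = Some F \<Longrightarrow> r i = grad F v"
    and inj: "\<And>w. (\<And>i. dot (r i) w = 0) \<Longrightarrow> w = 0"
    and u: "u $ k = 0" "\<And>F. F \<in> set Fs \<Longrightarrow> dot (grad F v) u = 0"
  shows "\<exists>D\<in>tangent_space X q. cone_vec k v D = u"
proof -
  obtain \<gamma> :: "real \<Rightarrow> complex ^ 'n" where \<gamma>: "\<gamma> 0 = v" "(\<gamma> has_vector_derivative u) (at 0)"
    "\<And>i F. K i = Some F \<Longrightarrow> dot (r i) u = 0 \<Longrightarrow> \<forall>\<^sub>F t in nhds 0. F (\<gamma> t) = F v"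
  proof (rule curve_exists[of K r v u])
    show "\<exists>d. homogeneous d F" if "K i = Some F" for i F using Fs(1) K(1) that by blast
  qed (use K(2) inj in auto)
  have cont: "isCont \<gamma> 0" using \<gamma>(2) by (rule has_vector_derivative_continuous)
  have F0: "F v = 0" if "F \<in> set Fs" for F using U(2,3) q v that by blast
  have evV: "\<forall>\<^sub>F t in nhds 0. \<gamma> t \<noteq> 0 \<and> pt (\<gamma> t) \<in> V" if "openin zariski V" "q \<in> V" for V
  proof -
    have "open {v. v \<noteq> 0 \<and> pt v \<in> V}" using zariski_open_cone[OF that(1)] .
    moreover have "\<gamma> 0 \<in> {v. v \<noteq> 0 \<and> pt v \<in> V}" using \<gamma>(1) line_cases(2)[OF v] pt_hcoords[OF v] that by simp
    ultimately have "\<forall>\<^sub>F t in nhds 0. \<gamma> t \<in> {v. v \<noteq> 0 \<and> pt v \<in> V}"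
      by (intro isCont_eventually[OF cont])
    then show ?thesis by (simp only: mem_Collect_eq)
  qed
  have evF: "\<forall>\<^sub>F t in nhds 0. \<forall>F\<in>set Fs. F (\<gamma> t) = 0"
  proof (rule eventually_ball_finite, simp, intro ballI)
    fix F assume F: "F \<in> set Fs"
    then obtain i where "K i = Some F" using Fs(2) by blast
    then show "\<forall>\<^sub>F t in nhds 0. F (\<gamma> t) = 0" using \<gamma>(3)[of i F] K(2) u(2)[OF F] F0[OF F] by simp
  qed
  \<comment> \<open>Near time 0 the curve lies over \<open>U\<close>, where the equations
    \<open>Fs\<close> cut out \<open>X\<close>, and these equations hold along it.\<close>
  have evX: "\<forall>\<^sub>F t in nhds 0. \<gamma> t \<in> hcoords (pt (\<gamma> t)) \<and> pt (\<gamma> t) \<in> V \<inter> X" if V: "openin zariski V" "q \<in> V" for V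
    using evV[OF V] evV[OF U(1,2)] evF
  proof eventually_elim
    case (elim t)
    then have h: "\<gamma> t \<in> hcoords (pt (\<gamma> t))" by (intro pt) auto
    have "\<forall>v\<in>hcoords (pt (\<gamma> t)). F v = 0" if F: "F \<in> set Fs" for F
    proof -
      obtain d where "homogeneous d F" using Fs(1)[OF F] by blast
      then show ?thesis using nonvanishing_iff(2)[OF _ h] elim(3) F by blast
    qed
    then show ?case using h elim U(3) by blast
  qed
  \<comment> \<open>Differentiation along the curve, set to 0 on nonregular functions as
    \<open>tangent_space\<close> requires.\<close>
  define D where "D f = (if regular_at X q f then vector_derivative (\<lambda>t. f (pt (\<gamma> t))) (at 0) else 0)" for f
  have der: "((\<lambda>t. f (pt (\<gamma> t))) has_vector_derivative (dot (grad A v) u * B v - A v * dot (grad B v) u) / (B v)\<^sup>2) (at 0)"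
    if f: "rep X q f d A B" for f d A B
  proof -
    obtain V where V: "homogeneous d A" "homogeneous d B" "openin zariski V" "q \<in> V"
      "\<And>p w. p \<in> V \<Longrightarrow> p \<in> X \<Longrightarrow> w \<in> hcoords p \<Longrightarrow> B w \<noteq> 0" "\<And>p w. p \<in> V \<Longrightarrow> p \<in> X \<Longrightarrow> w \<in> hcoords p \<Longrightarrow> f p = A w / B w"
      using f by (rule repE) blast
    have Bv: "B v \<noteq> 0" using V(5)[OF V(4) q v] .
    have comp: "((\<lambda>t. F (\<gamma> t)) has_derivative (\<lambda>t. t *\<^sub>R dot (grad F v) u)) (at 0)" if "homogeneous d F" for F d
    proof -
      have "((\<lambda>t. F (\<gamma> t)) has_derivative (\<lambda>t. dot (grad F v) (t *\<^sub>R u))) (at 0)"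
        using has_derivative_compose[OF \<gamma>(2)[unfolded has_vector_derivative_def], of F "dot (grad F v)"]
          homogeneous_grad(2)[OF that, of v] by (simp add: \<gamma>(1))
      then show ?thesis using linear_dot[of "grad F v"] by (simp add: linear_scale)
    qed
    have "((\<lambda>t. A (\<gamma> t) / B (\<gamma> t)) has_derivative
        (\<lambda>t. (t *\<^sub>R dot (grad A v) u * B (\<gamma> 0) - A (\<gamma> 0) * (t *\<^sub>R dot (grad B v) u)) / (B (\<gamma> 0) * B (\<gamma> 0)))) (at 0)"
      by (rule has_derivative_divide'[OF comp[OF V(1)] comp[OF V(2)]]) (simp add: \<gamma>(1) Bv)
    then have 1: "((\<lambda>t. A (\<gamma> t) / B (\<gamma> t)) has_vector_derivative (dot (grad A v) u * B v - A v * dot (grad B v) u) / (B v)\<^sup>2) (at 0)"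
      unfolding has_vector_derivative_def \<gamma>(1)
      by (simp add: power2_eq_square scaleR_conv_of_real algebra_simps)
    have "\<forall>\<^sub>F t in nhds 0. f (pt (\<gamma> t)) = A (\<gamma> t) / B (\<gamma> t)"
      using evX[OF V(3,4)] by eventually_elim (use V(6) in blast)
    then have "\<forall>\<^sub>F t in nhds 0. t \<in> UNIV \<longrightarrow> f (pt (\<gamma> t)) = A (\<gamma> t) / B (\<gamma> t)" "f (pt (\<gamma> 0)) = A (\<gamma> 0) / B (\<gamma> 0)"
      using eventually_nhds_x_imp_x by (auto intro: eventually_mono)
    from has_vector_derivative_cong_ev[OF this] 1 show ?thesis by simp
  qed
  have dd: "((\<lambda>t. f (pt (\<gamma> t))) has_vector_derivative D f) (at 0)" if r: "regular_at X q f" for f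
  proof -
    obtain d A B where "rep X q f d A B" using r regular_at_iff[OF q] by blast
    from der[OF this] show ?thesis using r by (simp add: D_def vector_derivative_at)
  qed
  have D_eq: "D f = c" if "regular_at X q f" "((\<lambda>t. f (pt (\<gamma> t))) has_vector_derivative c) (at 0)" for f c
    using vector_derivative_unique_at[OF dd[OF that(1)] that(2)] .
  have f0: "f (pt (\<gamma> 0)) = f q" for f :: "'n proj \<Rightarrow> complex" using \<gamma>(1) pt_hcoords[OF v] by simp
  have DT: "D \<in> tangent_space X q"
    unfolding tangent_space_def
  proof (intro CollectI conjI allI impI)
    fix f h
    show "D f = 0" if "\<not> regular_at X q f" using that by (simp add: D_def)
    show "D (\<lambda>q. c * f q) = c * D f" if "regular_at X q f" for c
      using dd[OF that] by (intro D_eq regular_scale[OF q that] has_vector_derivative_mult_right)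
    assume r: "regular_at X q f \<and> regular_at X q h"
    then show "D (\<lambda>q. f q + h q) = D f + D h"
      using dd by (intro D_eq regular_add(1)[OF q] has_vector_derivative_add) auto
    have "((\<lambda>t. f (pt (\<gamma> t)) * h (pt (\<gamma> t))) has_vector_derivative f (pt (\<gamma> 0)) * D h + D f * h (pt (\<gamma> 0))) (at 0)"
      using dd r by (intro has_vector_derivative_mult) auto
    then show "D (\<lambda>q. f q * h q) = f q * D h + h q * D f"
      using r by (intro D_eq regular_add(2)[OF q]) (auto simp: f0 mult.commute)
  next
    fix f h assume r: "regular_at X q f \<and> regular_at X q h \<and> same_germ X q f h"
    then obtain U' where "openin (zariski_on X) U'" "q \<in> U'" "\<forall>p\<in>U'. f p = h p" unfolding same_germ_def by blast
    then obtain V where V: "openin zariski V" "q \<in> V" "\<forall>p\<in>V \<inter> X. f p = h p" by (auto simp: openin_subtopology)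
    have "\<forall>\<^sub>F t in nhds 0. t \<in> UNIV \<longrightarrow> h (pt (\<gamma> t)) = f (pt (\<gamma> t))"
      using evX[OF V(1,2)] by eventually_elim (use V(3) in auto)
    moreover have "f q = h q" using V q by blast
    then have "h (pt (\<gamma> 0)) = f (pt (\<gamma> 0))" by (simp only: f0)
    ultimately have "((\<lambda>t. f (pt (\<gamma> t))) has_vector_derivative D h) (at 0)"
      using has_vector_derivative_cong_ev[of UNIV "\<lambda>t. h (pt (\<gamma> t))" "\<lambda>t. f (pt (\<gamma> t))" 0 "D h"] dd r by blast
    then show "D f = D h" using r by (intro D_eq) auto
  qed
  moreover have "cone_vec k v D = u"
  proof -
    have "cone_vec k v D $ i = u $ i" for i
    proof -
      have rp: "rep X q (rat (\<lambda>w. w $ i) (\<lambda>w. w $ k)) 1 (\<lambda>w. w $ i) (\<lambda>w. w $ k)"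
        by (rule rat_rep[OF homogeneous.coord homogeneous.coord v vk])
      then have "regular_at X q (rat (\<lambda>w. w $ i) (\<lambda>w. w $ k))" using regular_at_iff[OF q] by blast
      from D_eq[OF this der[OF rp]] show ?thesis
        using vk u(1) by (simp add: cone_vec_def grad_simps power2_eq_square)
    qed
    then show ?thesis by (simp add: vec_eq_iff)
  qed
  ultimately show ?thesis by blast
qed

end

subsection \<open>Charts\<close>

lemma dot_matrix: "(\<chi> i. r i) *v w = (\<chi> i. dot (r i) w)"
  by (simp add: matrix_vector_mult_def dot_def vec_eq_iff)

definition independent_rows :: "('n::finite \<Rightarrow> complex ^ 'n) \<Rightarrow> bool" where
  "independent_rows r \<longleftrightarrow> (\<forall>w. (\<forall>i. dot (r i) w = 0) \<longrightarrow> w = 0)"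

lemma independent_rowsD: "independent_rows r \<Longrightarrow> (\<And>i. dot (r i) w = 0) \<Longrightarrow> w = 0"
  unfolding independent_rows_def by blast

lemma independent_rows_iff_ker: "independent_rows r \<longleftrightarrow> (\<forall>w. (\<chi> i. r i) *v w = 0 \<longrightarrow> w = 0)"
  by (simp add: independent_rows_def dot_matrix vec_eq_iff)

lemma independent_rows_iff_det: "independent_rows r \<longleftrightarrow> det (\<chi> i. r i) \<noteq> 0"
  by (simp only: independent_rows_iff_ker matrix_left_invertible_ker[symmetric] invertible_left_inverse[symmetric] invertible_det_nz)

text \<open>A square matrix with trivial kernel is also surjective.\<close>

lemma rows_solve:
  assumes "independent_rows r"
  shows "\<exists>w. \<forall>i. dot (r i) w = c i"
proof -
  have "surj (\<lambda>w. (\<chi> i. r i) *v w)"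
    using assms
    by (simp only: independent_rows_iff_ker matrix_left_invertible_ker[symmetric] invertible_left_inverse[symmetric]
        invertible_right_inverse matrix_right_invertible_surjective[symmetric])
  then obtain w where "(\<chi> i. r i) *v w = (\<chi> i. c i)" by (metis surjD)
  then have "\<forall>i. dot (r i) w = c i" by (simp add: dot_matrix vec_eq_iff)
  then show ?thesis by blast
qed

lemma cone_vec_lin:
  "cone_vec k v (\<lambda>f. D f + E f) = cone_vec k v D + cone_vec k v E"
  "cone_vec k v (\<lambda>f. c * D f) = c *s cone_vec k v D"
  "cone_vec k v (\<lambda>f. 0) = 0"
  by (simp_all add: cone_vec_def vec_eq_iff distrib_left mult.left_commute)

lemma dot_zero: "dot r 0 = 0"
  by (simp add: dot_def)

lemma dot_cone_vec_sum:
  "dot r (cone_vec k v (\<lambda>f. \<Sum>i\<in>I. c i * D i f)) = (\<Sum>i\<in>I. c i * dot r (cone_vec k v (D i)))"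
proof (induction I rule: infinite_finite_induct)
  case (insert i I)
  have "(\<lambda>f. \<Sum>j\<in>insert i I. c j * D j f) = (\<lambda>f. (\<lambda>f. c i * D i f) f + (\<lambda>f. \<Sum>j\<in>I. c j * D j f) f)"
    using insert by simp
  then show ?case
    using insert by (simp only: cone_vec_lin(1) cone_vec_lin(2)[of k v "c i" "D i"] dot_lin sum.insert not_False_eq_True)
qed (simp_all add: cone_vec_lin(3) dot_zero)

text \<open>The Jacobian matrix of the equations (\<open>K i = Some F\<close>) is completed to a square matrix by a row
  fixing the scaling of the cone (\<open>i = k0\<close>) and by complementary linear forms, which are coordinates
  on the tangent space.\<close>

definition chart :: "('n::finite) proj set \<Rightarrow> 'n proj set \<Rightarrow> (complex ^ 'n \<Rightarrow> complex) list \<Rightarrow> 'n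
    \<Rightarrow> ('n \<Rightarrow> (complex ^ 'n \<Rightarrow> complex) option) \<Rightarrow> 'n \<Rightarrow> bool" where
  "chart X U Fs k K k0 \<longleftrightarrow> openin zariski U \<and> X \<inter> U = {q \<in> U. \<forall>F\<in>set Fs. \<forall>v\<in>hcoords q. F v = 0} \<and>
     (\<forall>F\<in>set Fs. (\<exists>d. homogeneous d F) \<and> (\<exists>i. K i = Some F)) \<and> (\<forall>i F. K i = Some F \<longrightarrow> F \<in> set Fs) \<and> K k0 = None"

definition chart_row :: "'n \<Rightarrow> ('n \<Rightarrow> (complex ^ 'n::finite \<Rightarrow> complex) option) \<Rightarrow> 'n \<Rightarrow> ('n \<Rightarrow> complex ^ 'n) \<Rightarrow> complex ^ 'n \<Rightarrow> 'n \<Rightarrow> complex ^ 'n" where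
  "chart_row k K k0 l v i = (case K i of Some F \<Rightarrow> grad F v | None \<Rightarrow> if i = k0 then axis k 1 else l i)"

abbreviation free_rows :: "('n \<Rightarrow> (complex ^ 'n::finite \<Rightarrow> complex) option) \<Rightarrow> 'n \<Rightarrow> 'n set" where
  "free_rows K k0 \<equiv> {i. K i = None \<and> i \<noteq> k0}"

lemma chart_tangent_exists:
  assumes ch: "chart X U Fs k K k0" and q: "q \<in> X" "q \<in> U" and v: "v \<in> hcoords q" "v $ k \<noteq> 0"
    and inj: "independent_rows (chart_row k K k0 l v)"
    and u: "u $ k = 0" "\<And>i F. K i = Some F \<Longrightarrow> dot (grad F v) u = 0"
  shows "\<exists>D\<in>tangent_space X q. cone_vec k v D = u"
proof (rule tangent_exists[OF q(1) v, of U Fs K "chart_row k K k0 l v"])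
  show "openin zariski U" "q \<in> U" "X \<inter> U = {q \<in> U. \<forall>F\<in>set Fs. \<forall>v\<in>hcoords q. F v = 0}"
    using ch q by (auto simp: chart_def)
  show "\<exists>d. homogeneous d F" "\<exists>i. K i = Some F" if "F \<in> set Fs" for F using ch that by (auto simp: chart_def)
  then show "dot (grad F v) u = 0" if "F \<in> set Fs" for F using u(2) that by blast
  show "F \<in> set Fs" "chart_row k K k0 l v i = grad F v" if "K i = Some F" for i F using ch that by (auto simp: chart_def chart_row_def)
  show "w = 0" if "\<And>i. dot (chart_row k K k0 l v i) w = 0" for w by (rule independent_rowsD[OF inj that])
qed (rule u(1))

lemma chart_cone_vec:
  assumes ch: "chart X U Fs k K k0" and q: "q \<in> X" "q \<in> U" and v: "v \<in> hcoords q" "v $ k \<noteq> 0"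
    and D: "D \<in> tangent_space X q"
  shows "K i = Some F \<Longrightarrow> dot (grad F v) (cone_vec k v D) = 0" "cone_vec k v D $ k = 0"
proof -
  assume "K i = Some F"
  then have "F \<in> set Fs" using ch unfolding chart_def by blast
  moreover from this obtain d where "homogeneous d F" using ch unfolding chart_def by blast
  ultimately have F: "F \<in> set Fs" "homogeneous d F" .
  show "dot (grad F v) (cone_vec k v D) = 0"
  proof (rule cone_vec_vanishing[OF q(1) v D F(2)])
    show "openin zariski U" "q \<in> U" using ch q by (auto simp: chart_def)
    show "F w = 0" if "p \<in> U" "p \<in> X" "w \<in> hcoords p" for p w
    proof -
      have "p \<in> {q \<in> U. \<forall>F\<in>set Fs. \<forall>v\<in>hcoords q. F v = 0}" using ch that unfolding chart_def by blast
      then show ?thesis using F(1) that(3) by blast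
    qed
  qed
qed (rule cone_vec_k[OF q(1) v D])

lemma chart_zero:
  assumes ch: "chart X U Fs k K k0" and q: "q \<in> X" "q \<in> U" and v: "v \<in> hcoords q" "v $ k \<noteq> 0"
    and inj: "independent_rows (chart_row k K k0 l v)"
    and D: "D \<in> tangent_space X q" "\<And>i. i \<in> free_rows K k0 \<Longrightarrow> dot (l i) (cone_vec k v D) = 0"
  shows "D = (\<lambda>f. 0)"
proof (rule cone_vec_inj[OF q(1) v D(1)], rule independent_rowsD[OF inj])
  fix i
  show "dot (chart_row k K k0 l v i) (cone_vec k v D) = 0"
    using chart_cone_vec[OF ch q v D(1)] D(2) by (auto simp: chart_row_def dot_axis split: option.splits)
qed

text \<open>Solving the square system with a unit vector placed in a free row gives tangent vectors
  dual to the forms \<open>l i\<close>. Point and forms are arbitrary here, so the lemma applies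
  near the centre of the chart with forms that vary from point to point.\<close>

lemma chart_basis:
  assumes ch: "chart X U Fs k K k0" and q: "q \<in> X" "q \<in> U" and v: "v \<in> hcoords q" "v $ k \<noteq> 0"
    and inj: "independent_rows (chart_row k K k0 l v)"
  obtains D where "\<And>i. i \<in> free_rows K k0 \<Longrightarrow> D i \<in> tangent_space X q"
    "\<And>i j. i \<in> free_rows K k0 \<Longrightarrow> j \<in> free_rows K k0 \<Longrightarrow> dot (l j) (cone_vec k v (D i)) = (if j = i then 1 else 0)"
    "inj_on D (free_rows K k0)" "cbasis (D ` free_rows K k0) (tangent_space X q)"
proof -
  let ?L = "free_rows K k0"
  have "\<exists>D\<in>tangent_space X q. \<forall>j\<in>?L. dot (l j) (cone_vec k v D) = (if j = i then 1 else 0)" if i: "i \<in> ?L" for i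
  proof -
    obtain u where u: "\<And>j. dot (chart_row k K k0 l v j) u = (if j = i then 1 else 0)" using rows_solve[OF inj, of "\<lambda>j. if j = i then 1 else 0"] by blast
    have "u $ k = 0" using u[of k0] ch i by (auto simp: chart_row_def chart_def dot_axis)
    moreover have "dot (grad F v) u = 0" if "K j = Some F" for j F
      using u[of j] that i by (auto simp: chart_row_def)
    ultimately obtain D where D: "D \<in> tangent_space X q" "cone_vec k v D = u"
      using chart_tangent_exists[OF ch q v inj] by blast
    have "dot (l j) u = (if j = i then 1 else 0)" if "j \<in> ?L" for j using u[of j] that by (auto simp: chart_row_def)
    then show ?thesis using D by blast
  qed
  then have "\<forall>i\<in>?L. \<exists>D. D \<in> tangent_space X q \<and> (\<forall>j\<in>?L. dot (l j) (cone_vec k v D) = (if j = i then 1 else 0))"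
    by blast
  from bchoice[OF this] obtain D where D': "\<forall>i\<in>?L. D i \<in> tangent_space X q \<and>
      (\<forall>j\<in>?L. dot (l j) (cone_vec k v (D i)) = (if j = i then 1 else 0))" ..
  have D: "D i \<in> tangent_space X q" if "i \<in> ?L" for i using bspec[OF D' that] by blast
  have D2: "dot (l j) (cone_vec k v (D i)) = (if j = i then 1 else 0)" if "i \<in> ?L" "j \<in> ?L" for i j
    using bspec[OF conjunct2[OF bspec[OF D' that(1)]] that(2)] .
  have inj: "inj_on D ?L"
  proof (rule inj_onI)
    fix i j assume ij: "i \<in> ?L" "j \<in> ?L" "D i = D j"
    have "(if j = i then 1 else 0) = dot (l j) (cone_vec k v (D i))" by (rule D2[OF ij(1,2), symmetric])
    also have "\<dots> = 1" unfolding ij(3) using D2[OF ij(2,2)] by simp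
    finally show "i = j" by (simp split: if_splits)
  qed
  have coef: "dot (l j) (cone_vec k v (\<lambda>f. \<Sum>i\<in>?L. c i * D i f)) = c j" if j: "j \<in> ?L" for c j
  proof -
    have "dot (l j) (cone_vec k v (\<lambda>f. \<Sum>i\<in>?L. c i * D i f)) = (\<Sum>i\<in>?L. if i = j then c j else 0)"
      unfolding dot_cone_vec_sum using D2 j by (intro sum.cong) auto
    then show ?thesis using j by simp
  qed
  have "cbasis (D ` ?L) (tangent_space X q)"
  proof (rule cbasisI[OF _ inj])
    fix c i assume "(\<lambda>x. \<Sum>j\<in>?L. c j * D j x) = (\<lambda>x. 0)" "i \<in> ?L"
    then show "c i = 0" using coef[of i c] by (simp add: cone_vec_lin dot_def)
  next
    fix E assume E: "E \<in> tangent_space X q"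
    define c where "c i = dot (l i) (cone_vec k v E)" for i
    define S where "S = (\<lambda>f. \<Sum>i\<in>?L. c i * D i f)"
    have S: "S \<in> tangent_space X q" unfolding S_def using D by (intro subspace_sum[OF tangent_subspace])
    have "(\<lambda>f. E f + -1 * S f) = (\<lambda>f. 0)"
    proof (rule chart_zero[OF ch q v assms(6)])
      show "(\<lambda>f. E f + -1 * S f) \<in> tangent_space X q"
        by (rule csubspaceD(2)[OF tangent_subspace E csubspaceD(3)[OF tangent_subspace S]])
      show "dot (l i) (cone_vec k v (\<lambda>f. E f + -1 * S f)) = 0" if "i \<in> ?L" for i
      proof -
        have "dot (l i) (cone_vec k v S) = c i" unfolding S_def by (rule coef[OF that])
        then show ?thesis
          unfolding cone_vec_lin(1)[of k v E "\<lambda>f. -1 * S f"] cone_vec_lin(2)[of k v "-1" S] dot_lin by (simp add: c_def)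
      qed
    qed
    then have "E f + -1 * S f = 0" for f by (rule fun_cong)
    then have "E f = S f" for f by (simp add: add_eq_0_iff)
    then show "\<exists>c. E = (\<lambda>x. \<Sum>j\<in>?L. c j * D j x)" unfolding S_def by blast
  qed (use D tangent_subspace in auto)
  with D D2 inj show ?thesis by (rule that)
qed

text \<open>The gradients of the equations vanish on \<open>v\<close> by Euler's formula, whereas
  the row \<open>axis k 1\<close> does not; so together they are independent and extend to a basis
  of all covectors, which fills the square matrix.\<close>

lemma smooth_chart:
  assumes "smooth X" "p \<in> X" "v \<in> hcoords p"
  obtains U Fs k K k0 l where "chart X U Fs k K k0" "p \<in> U" "v $ k \<noteq> 0"
    "independent_rows (chart_row k K k0 l v)"
proof -
  obtain U Fs where U: "openin zariski U" "p \<in> U" "\<forall>F\<in>set Fs. \<exists>d. homogeneous d F"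
    "X \<inter> U = {q \<in> U. \<forall>F\<in>set Fs. \<forall>v\<in>hcoords q. F v = 0}"
    "\<forall>v\<in>hcoords p. \<forall>c. (\<forall>i. (\<Sum>j<length Fs. c j * partial i (Fs ! j) v) = 0) \<longrightarrow> (\<forall>j<length Fs. c j = 0)"
    using bspec[OF assms(1)[unfolded smooth_def] assms(2)] by blast
  obtain k where k: "v $ k \<noteq> 0" using line_cases(2)[OF assms(3)] by (metis vec_eq_iff zero_index)
  let ?G = "\<lambda>j. grad (Fs ! j) v"
  have ind: "c j = 0" if "(\<Sum>j<length Fs. c j *s ?G j) = 0" "j < length Fs" for c j
  proof -
    have "(\<Sum>j<length Fs. c j * partial i (Fs ! j) v) = 0" for i
      using arg_cong[OF that(1), of "\<lambda>w. w $ i"] by (simp add: grad_def)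
    then show ?thesis using U(5) assms(3) that(2) by blast
  qed
  have injG: "inj_on ?G {..<length Fs}"
  proof (rule inj_onI)
    fix i j assume ij: "i \<in> {..<length Fs}" "j \<in> {..<length Fs}" "?G i = ?G j"
    show "i = j"
    proof (rule ccontr)
      assume "i \<noteq> j"
      have "(\<Sum>m<length Fs. ((if m = i then 1 else 0) - (if m = j then 1 else 0)) *s ?G m) =
          (\<Sum>m<length Fs. if m = i then ?G i else 0) - (\<Sum>m<length Fs. if m = j then ?G j else 0)"
        unfolding sum_subtractf[symmetric] by (intro sum.cong) (auto simp: vec_eq_iff)
      also have "\<dots> = 0" using ij by simp
      finally show False using ind[of "\<lambda>m. (if m = i then 1 else 0) - (if m = j then 1 else 0)" i] ij \<open>i \<noteq> j\<close> by simp
    qed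
  qed
  have euler: "dot (?G j) v = 0" if "j < length Fs" for j
  proof -
    have "Fs ! j \<in> set Fs" using that by simp
    moreover from this obtain d where "homogeneous d (Fs ! j)" using U(3) by blast
    moreover have "p \<in> {q \<in> U. \<forall>F\<in>set Fs. \<forall>v\<in>hcoords q. F v = 0}" using U(2,4) assms(2) by blast
    ultimately show ?thesis using euler_zero assms(3) by blast
  qed
  have ax: "axis k 1 \<notin> ?G ` {..<length Fs}"
  proof
    assume "axis k 1 \<in> ?G ` {..<length Fs}"
    then obtain j where "j < length Fs" "axis k 1 = ?G j" by auto
    then have "dot (axis k 1) v = 0" using euler by simp
    then show False using k by (simp add: dot_axis)
  qed
  define S where "S = insert (axis k 1) (?G ` {..<length Fs})"
  have "vec.independent S"
  proof (rule vec.independent_if_scalars_zero)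
    show "finite S" by (simp add: S_def)
    fix f x assume *: "(\<Sum>x\<in>S. f x *s x) = 0" "x \<in> S"
    have e: "f (axis k 1) *s axis k 1 + (\<Sum>j<length Fs. f (?G j) *s ?G j) = 0"
      using *(1) ax injG by (simp add: S_def sum.reindex)
    have "dot (\<Sum>j<length Fs. f (?G j) *s ?G j) v = (\<Sum>j<length Fs. f (?G j) * dot (?G j) v)"
    proof -
      have "dot (\<Sum>j\<in>J. f (?G j) *s ?G j) v = (\<Sum>j\<in>J. f (?G j) * dot (?G j) v)" if "finite J" for J
        using that by (induction J rule: finite_induct) (simp_all add: dot_lin, simp add: dot_def)
      then show ?thesis by simp
    qed
    then have "f (axis k 1) * v $ k = 0"
      using arg_cong[OF e, of "\<lambda>w. dot w v"] euler by (simp add: dot_lin dot_axis) (simp add: dot_def)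
    then have 1: "f (axis k 1) = 0" using k by simp
    then have "f (?G j) = 0" if "j < length Fs" for j using ind[of "\<lambda>j. f (?G j)" j] e that by simp
    then show "f x = 0" using 1 *(2) by (auto simp: S_def)
  qed
  then obtain B where B: "S \<subseteq> B" "vec.independent B" "UNIV \<subseteq> vec.span B"
    using vec.maximal_independent_subset_extend[of S UNIV] by auto
  have "card B = vec.dim (UNIV :: (complex ^ 'a) set)"
    using B by (intro vec.basis_card_eq_dim) auto
  then have "card B = CARD('a)" by (simp add: card_cart_basis)
  moreover have "finite B" using B(2) vec.finiteI_independent by blast
  \<comment> \<open>The basis has as many elements as the index type, so it can be indexed by the
    coordinates and read as the rows of a matrix.\<close>
  ultimately obtain \<beta> :: "'a \<Rightarrow> complex ^ 'a" where \<beta>: "bij_betw \<beta> UNIV B"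
    using finite_same_card_bij[of "UNIV :: 'a set" B] by auto
  have inj: "w = 0" if "\<And>i. dot (\<beta> i) w = 0" for w
  proof -
    have "B \<subseteq> {b. dot b w = 0}" using that \<beta> by (auto simp: bij_betw_def)
    moreover have "vec.subspace {b. dot b w = 0}" by (auto simp: vec.subspace_def dot_lin) (simp add: dot_def)
    ultimately have "vec.span B \<subseteq> {b. dot b w = 0}" by (rule vec.span_minimal)
    then have "dot (axis i 1) w = 0" for i using B(3) by auto
    then show ?thesis by (simp add: dot_axis vec_eq_iff)
  qed
  define K where "K i = (if \<exists>F\<in>set Fs. grad F v = \<beta> i then Some (SOME F. F \<in> set Fs \<and> grad F v = \<beta> i) else None)" for i
  have K: "F \<in> set Fs \<and> grad F v = \<beta> i" if "K i = Some F" for i F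
    using that someI_ex[of "\<lambda>F. F \<in> set Fs \<and> grad F v = \<beta> i"] by (auto simp: K_def split: if_splits)
  have Kex: "\<exists>i. K i = Some F" if F: "F \<in> set Fs" for F
  proof -
    obtain j where j: "j < length Fs" "F = Fs ! j" using F by (metis in_set_conv_nth)
    then have "grad F v \<in> B" using B(1) by (auto simp: S_def)
    then obtain i where i: "\<beta> i = grad F v" using \<beta> by (metis bij_betw_imp_surj_on imageE)
    then have "K i \<noteq> None" using F unfolding K_def by auto
    then obtain F' where F': "K i = Some F'" by auto
    then obtain j' where "j' < length Fs" "F' = Fs ! j'" "?G j' = ?G j" using K[OF F'] i j by (metis in_set_conv_nth)
    then have "F' = F" using injG j by (auto simp: inj_on_def)
    then show ?thesis using F' by blast
  qed
  obtain k0 where k0: "\<beta> k0 = axis k 1" using B(1) \<beta> unfolding S_def by (metis bij_betw_imp_surj_on imageE insert_subset)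
  have Kk0: "K k0 = None"
  proof (rule ccontr)
    assume "K k0 \<noteq> None"
    then obtain F where "K k0 = Some F" by auto
    then have F: "F \<in> set Fs" "grad F v = axis k 1" using K k0 by auto
    then obtain j where "j < length Fs" "Fs ! j = F" by (auto simp: in_set_conv_nth)
    then show False using ax F(2) by force
  qed
  have row: "chart_row k K k0 \<beta> v = \<beta>"
    using K k0 by (auto simp: chart_row_def split: option.splits)
  have "chart X U Fs k K k0" using U Kex K Kk0 by (auto simp: chart_def)
  from that[OF this U(2) k, of \<beta>] show ?thesis using inj row by (simp add: independent_rows_def)
qed

subsection \<open>Differentials of automorphisms\<close>

lemma topspace_zariski_on [simp]: "topspace (zariski_on S) = S"
  by simp

lemma regular_comp:
  assumes "regular_map X s" "p \<in> X" "regular_at X (s p) f"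
  shows "regular_at X p (f \<circ> s)"
proof -
  obtain U where U: "openin (zariski_on X) U" "s p \<in> U" "regular_on U f"
    using assms(3) unfolding regular_at_def by blast
  have "openin (zariski_on X) {x \<in> topspace (zariski_on X). s x \<in> U}"
    using assms(1) U(1) unfolding regular_map_def by (intro openin_continuous_map_preimage) auto
  moreover have "regular_on {p \<in> X. s p \<in> U} (f \<circ> s)" using assms(1) U unfolding regular_map_def by blast
  ultimately show ?thesis unfolding regular_at_def using U(2) assms(2) by auto
qed

lemma tangent_eq_on:
  assumes "q \<in> X" "D \<in> tangent_space X q" "\<And>p. p \<in> X \<Longrightarrow> f p = h p"
  shows "D f = D h"
  using tangent_local(2)[OF assms(1) openin_topspace[of zariski] _ _ assms(2), of f h] assms(3) by simp

text \<open>Composition with \<open>s\<close> must neither create nor destroy regularity, as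
  \<open>r\<close> states: otherwise the normalisation of derivations on nonregular functions would
  not carry over.\<close>

lemma differential_tangent:
  assumes s: "regular_map X s" and p: "p \<in> X" and D: "D \<in> tangent_space X p"
    and r: "\<And>f. regular_at X p (f \<circ> s) \<longleftrightarrow> regular_at X (s p) f"
  shows "differential s D \<in> tangent_space X (s p)"
  unfolding tangent_space_def
proof (intro CollectI conjI allI impI)
  fix f h
  show "differential s D f = 0" if "\<not> regular_at X (s p) f"
    using that tangentD(1)[OF D] r by (simp add: differential_def)
  show "differential s D (\<lambda>q. c * f q) = c * differential s D f" if "regular_at X (s p) f" for c
    using tangentD(5)[OF D, of "f \<circ> s" c] that r by (simp add: differential_def o_def)
  assume *: "regular_at X (s p) f \<and> regular_at X (s p) h"
  show "differential s D (\<lambda>q. f q + h q) = differential s D f + differential s D h"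
    using tangentD(3)[OF D, of "f \<circ> s" "h \<circ> s"] * r by (simp add: differential_def o_def)
  show "differential s D (\<lambda>q. f q * h q) = f (s p) * differential s D h + h (s p) * differential s D f"
    using tangentD(4)[OF D, of "f \<circ> s" "h \<circ> s"] * r by (simp add: differential_def o_def)
next
  fix f h assume *: "regular_at X (s p) f \<and> regular_at X (s p) h \<and> same_germ X (s p) f h"
  then obtain U where U: "openin (zariski_on X) U" "s p \<in> U" "\<forall>q\<in>U. f q = h q" unfolding same_germ_def by blast
  have "openin (zariski_on X) {x \<in> topspace (zariski_on X). s x \<in> U}"
    using s U(1) unfolding regular_map_def by (intro openin_continuous_map_preimage) auto
  then have "same_germ X p (f \<circ> s) (h \<circ> s)"
    unfolding same_germ_def using U p by (intro exI[of _ "{x \<in> X. s x \<in> U}"]) auto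
  then show "differential s D f = differential s D h"
    using tangentD(2)[OF D] * r by (simp add: differential_def)
qed

locale automorphism =
  fixes X :: "('n::finite) proj set" and s
  assumes aut: "algebraic_automorphism X s"
begin

lemma s_X: "p \<in> X \<Longrightarrow> s p \<in> X"
  using aut unfolding algebraic_automorphism_def by (auto dest: bij_betwE)

lemma inv_X: "p \<in> X \<Longrightarrow> inv_into X s p \<in> X" "p \<in> X \<Longrightarrow> s (inv_into X s p) = p" "p \<in> X \<Longrightarrow> inv_into X s (s p) = p"
  using aut unfolding algebraic_automorphism_def
  by (auto simp: bij_betw_def f_inv_into_f inv_into_into)

lemma reg: "regular_map X s" "regular_map X (inv_into X s)"
  using aut unfolding algebraic_automorphism_def by auto

lemma regular_at_comp:
  assumes "p \<in> X"
  shows "regular_at X p (f \<circ> s) \<longleftrightarrow> regular_at X (s p) f"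
proof
  assume "regular_at X p (f \<circ> s)"
  then have "regular_at X (s p) ((f \<circ> s) \<circ> inv_into X s)"
    using assms by (intro regular_comp[OF reg(2)]) (auto simp: s_X inv_X)
  then show "regular_at X (s p) f"
    using tangent_local(1)[OF s_X[OF assms] openin_topspace[of zariski], of "(f \<circ> s) \<circ> inv_into X s" f] by (simp add: inv_X)
qed (rule regular_comp[OF reg(1) assms])

lemma differential_in: "p \<in> X \<Longrightarrow> D \<in> tangent_space X p \<Longrightarrow> differential s D \<in> tangent_space X (s p)"
  by (rule differential_tangent[OF reg(1) _ _ regular_at_comp])

lemma differential_image:
  assumes p: "p \<in> X"
  shows "differential s ` tangent_space X p = tangent_space X (s p)"
proof
  show "differential s ` tangent_space X p \<subseteq> tangent_space X (s p)" using differential_in[OF p] by blast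
  show "tangent_space X (s p) \<subseteq> differential s ` tangent_space X p"
  proof
    fix E assume E: "E \<in> tangent_space X (s p)"
    have "regular_at X (s p) (f \<circ> inv_into X s) \<longleftrightarrow> regular_at X p f" for f
      using regular_at_comp[OF p, of "f \<circ> inv_into X s"]
        tangent_local(1)[OF p openin_topspace[of zariski], of "(f \<circ> inv_into X s) \<circ> s" f] by (simp add: inv_X)
    then have "differential (inv_into X s) E \<in> tangent_space X p"
      using differential_tangent[OF reg(2) s_X[OF p] E] by (simp add: inv_X p)
    moreover have "differential s (differential (inv_into X s) E) = E"
    proof
      fix f
      show "differential s (differential (inv_into X s) E) f = E f"
        unfolding differential_def by (rule tangent_eq_on[OF s_X[OF p] E]) (simp add: inv_X)
    qed
    ultimately show "E \<in> differential s ` tangent_space X p" by (metis imageI)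
  qed
qed

lemma differential_lin: "p \<in> X \<Longrightarrow> lin (tangent_space X p) (tangent_space X (s p)) (differential s)"
  unfolding lin_def using differential_in by (auto simp: differential_def)

end

subsection \<open>Finite groups of symplectic automorphisms\<close>

lemma bilin_cong:
  assumes "bilin W om" "cfun.subspace W" "\<And>v w. v \<in> W \<Longrightarrow> w \<in> W \<Longrightarrow> om' v w = om v w"
  shows "bilin W om'"
  using assms(1,3) csubspaceD(2,3)[OF assms(2)] unfolding bilin_def by simp

lemma bilin_local_form:
  fixes fgh :: "(('n::finite proj \<Rightarrow> complex) \<times> ('n proj \<Rightarrow> complex) \<times> ('n proj \<Rightarrow> complex)) list"
  shows "bilin W (\<lambda>D E. \<Sum>(f, g, h)\<leftarrow>fgh. f q * (D g * E h - D h * E g))"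
proof (induction fgh)
  case Nil
  then show ?case by (simp add: bilin_def)
next
  case (Cons a fgh)
  obtain f g h where a: "a = (f, g, h)" by (cases a)
  have "bilin W (\<lambda>D E. f q * (D g * E h - D h * E g))" by (simp add: bilin_def algebra_simps)
  from bilin_add[OF this Cons] show ?case by (simp add: a)
qed

locale symplectic_action =
  fixes X :: "('n::finite) proj set" and \<omega> :: "'n two_form"
    and G :: "('g, 'm) monoid_scheme" and \<phi> :: "'g \<Rightarrow> 'n proj \<Rightarrow> 'n proj"
  assumes X: "symplectic_variety X \<omega>"
    and action: "group_action G X \<phi>"
    and finite_G: "finite (carrier G)"
    and symplectic_\<phi>: "\<And>g. g \<in> carrier G \<Longrightarrow> symplectic_automorphism X \<omega> (\<phi> g)"
begin

abbreviation "T \<equiv> tangent_space X"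
abbreviation "d g \<equiv> differential (\<phi> g)"

lemma group_G: "Group.group G"
  using action unfolding group_action_def group_hom_def by blast

lemmas G_simps = group.is_monoid[OF group_G, THEN monoid.m_closed] group.inv_closed[OF group_G]
  monoid.one_closed[OF group.is_monoid[OF group_G]]

lemma automorphism_\<phi>: "g \<in> carrier G \<Longrightarrow> automorphism X (\<phi> g)"
  using symplectic_\<phi> unfolding symplectic_automorphism_def automorphism_def by blast

lemma \<phi>_mult: "p \<in> X \<Longrightarrow> g \<in> carrier G \<Longrightarrow> h \<in> carrier G \<Longrightarrow> \<phi> (g \<otimes>\<^bsub>G\<^esub> h) p = \<phi> g (\<phi> h p)"
  using group_action.composition_rule[OF action] by blast

lemma \<phi>_one: "p \<in> X \<Longrightarrow> \<phi> \<one>\<^bsub>G\<^esub> p = p"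
  using group_action.id_eq_one[OF action] by (metis restrict_apply')

lemma \<phi>_X: "g \<in> carrier G \<Longrightarrow> p \<in> X \<Longrightarrow> \<phi> g p \<in> X"
  using automorphism.s_X[OF automorphism_\<phi>] .

lemma d_mult:
  assumes "p \<in> X" "g \<in> carrier G" "h \<in> carrier G" "D \<in> T p"
  shows "d (g \<otimes>\<^bsub>G\<^esub> h) D = d g (d h D)"
proof
  fix f
  show "d (g \<otimes>\<^bsub>G\<^esub> h) D f = d g (d h D) f"
    unfolding differential_def
    by (rule tangent_eq_on[OF assms(1,4)]) (simp add: \<phi>_mult[OF _ assms(2,3)])
qed

lemma d_one:
  assumes "p \<in> X" "D \<in> T p"
  shows "d \<one>\<^bsub>G\<^esub> D = D"
proof
  fix f
  show "d \<one>\<^bsub>G\<^esub> D f = D f"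
    unfolding differential_def by (rule tangent_eq_on[OF assms]) (simp add: \<phi>_one)
qed

lemma d_lin: "g \<in> carrier G \<Longrightarrow> p \<in> X \<Longrightarrow> lin (T p) (T (\<phi> g p)) (d g)"
  using automorphism.differential_lin[OF automorphism_\<phi>] .

lemma \<omega>_d: "g \<in> carrier G \<Longrightarrow> p \<in> X \<Longrightarrow> D \<in> T p \<Longrightarrow> E \<in> T p \<Longrightarrow> \<omega> (\<phi> g p) (d g D) (d g E) = \<omega> p D E"
  using symplectic_\<phi> unfolding symplectic_automorphism_def by blast

lemma smooth_X: "smooth X"
  using X unfolding symplectic_variety_def by blast

lemma T_basis:
  assumes p: "p \<in> X"
  shows "\<exists>B. cbasis B (T p)"
proof -
  obtain v where v: "v \<in> hcoords p" using hcoords_ex by blast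
  obtain U Fs k K k0 l where
    c: "chart X U Fs k K k0" "p \<in> U" "v $ k \<noteq> 0" "independent_rows (chart_row k K k0 l v)"
    by (rule smooth_chart[OF smooth_X p v])
  show ?thesis by (rule chart_basis[OF c(1) p c(2) v c(3,4)]) (rule exI)
qed

text \<open>Bilinearity and alternation are visible from the local expression of the form as a sum
  of terms \<open>f dg \<and> dh\<close>.\<close>

lemma T_symplectic:
  assumes p: "p \<in> X"
  shows "symplectic (T p) (\<omega> p)"
proof -
  have cl: "closed_algebraic_form X \<omega>" using X unfolding symplectic_variety_def by blast
  obtain U fgh where U: "p \<in> U"
    "\<forall>q\<in>U. \<forall>D\<in>T q. \<forall>E\<in>T q. \<omega> q D E = (\<Sum>(f, g, h)\<leftarrow>fgh. f q * (D g * E h - D h * E g))"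
    using bspec[OF cl[unfolded closed_algebraic_form_def] p] by (elim exE conjE) (rule that, assumption, assumption)
  have form: "\<omega> p D E = (\<Sum>(f, g, h)\<leftarrow>fgh. f p * (D g * E h - D h * E g))" if "D \<in> T p" "E \<in> T p" for D E
    by (rule bspec[OF bspec[OF bspec[OF U(2,1)] that(1)] that(2)])
  show ?thesis
    unfolding symplectic_def
  proof (intro conjI ballI impI)
    show "\<exists>B. cbasis B (T p)" using T_basis[OF p] .
    show "bilin (T p) (\<omega> p)" by (rule bilin_cong[OF bilin_local_form tangent_subspace]) (rule form)
    fix D assume D: "D \<in> T p"
    have "(\<Sum>(f, g, h)\<leftarrow>l. f p * (D g * D h - D h * D g)) = 0" for l :: "(('n proj \<Rightarrow> complex) \<times> ('n proj \<Rightarrow> complex) \<times> ('n proj \<Rightarrow> complex)) list"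
      by (induction l) (auto simp: mult.commute)
    then show "\<omega> p D D = 0" using form[OF D D] by simp
    assume "\<forall>E\<in>T p. \<omega> p D E = 0"
    then have "D = 0" using X p D unfolding symplectic_variety_def nondegenerate_def by blast
    then show "D = (\<lambda>x. 0)" by (simp add: zero_fun_def)
  qed
qed

definition stab :: "'n proj \<Rightarrow> 'g set" where
  "stab p = {k \<in> carrier G. \<phi> k p = p}"

definition tbasis :: "'n proj \<Rightarrow> 'n tangent set" where
  "tbasis p = (SOME B. cbasis B (T p))"

lemma tbasis: "p \<in> X \<Longrightarrow> cbasis (tbasis p) (T p)"
  unfolding tbasis_def using T_basis by (rule someI_ex)

text \<open>The average runs over the stabiliser of \<open>p\<close>, since other group elements
  leave the tangent space at \<open>p\<close>; the form averaged is the standard one in an arbitrary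
  basis.\<close>

definition herm :: "'n proj \<Rightarrow> 'n tangent \<Rightarrow> 'n tangent \<Rightarrow> complex" where
  "herm p v w = (\<Sum>k\<in>stab p. \<Sum>b\<in>tbasis p. cnj (crd (tbasis p) b (d k v)) * crd (tbasis p) b (d k w))"

lemma stab_lin: "k \<in> stab p \<Longrightarrow> p \<in> X \<Longrightarrow> lin (T p) (T p) (d k)"
  using d_lin[of k p] by (auto simp: stab_def)

lemma hermitian_herm:
  assumes p: "p \<in> X"
  shows "hermitian (T p) (herm p)"
proof -
  note B = tbasis[OF p] note c = dualD[OF crd_dual[OF B]]
  have fin: "finite (stab p)" using finite_G by (simp add: stab_def)
  have l: "d k v \<in> T p" if "k \<in> stab p" "v \<in> T p" for k v using linD(1)[OF stab_lin[OF that(1) p] that(2)] .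
  show ?thesis
    unfolding hermitian_def
  proof (intro conjI ballI allI impI)
    fix v assume v: "v \<in> T p"
    show "herm p u (\<lambda>x. v x + w x) = herm p u v + herm p u w" if "u \<in> T p" "w \<in> T p" for u w
      unfolding herm_def sum.distrib[symmetric]
      by (intro sum.cong refl) (simp add: linD(2)[OF stab_lin[OF _ p] v that(2)] c(1)[OF l l] v that(2) algebra_simps)
    show "herm p w (\<lambda>x. z * v x) = z * herm p w v" if "w \<in> T p" for w z
      unfolding herm_def sum_distrib_left
      by (intro sum.cong refl) (simp add: linD(3)[OF stab_lin[OF _ p] v] c(2)[OF l] v algebra_simps)
    show "herm p w v = cnj (herm p v w)" if "w \<in> T p" for w
      by (simp add: herm_def mult.commute)
    assume nz: "v \<noteq> (\<lambda>x. 0)"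
    have "\<exists>b\<in>tbasis p. crd (tbasis p) b v \<noteq> 0"
    proof (rule ccontr)
      assume "\<not> (\<exists>b\<in>tbasis p. crd (tbasis p) b v \<noteq> 0)"
      then have "v = (\<lambda>x. 0)" using crd_expand[OF B v] by simp
      then show False using nz by simp
    qed
    then obtain b where b: "b \<in> tbasis p" "crd (tbasis p) b v \<noteq> 0" by blast
    \<comment> \<open>The summand of the identity element is already positive, and all others are
      nonnegative.\<close>
    have one: "\<one>\<^bsub>G\<^esub> \<in> stab p" using \<phi>_one[OF p] G_simps(3) by (simp add: stab_def)
    have re: "Re (herm p v v) = (\<Sum>k\<in>stab p. \<Sum>b\<in>tbasis p. (cmod (crd (tbasis p) b (d k v)))\<^sup>2)"
      by (simp add: herm_def cmod_power2) (simp add: power2_eq_square)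
    have "0 < (\<Sum>b\<in>tbasis p. (cmod (crd (tbasis p) b (d \<one>\<^bsub>G\<^esub> v)))\<^sup>2)"
      using b cbasisD(1)[OF B] d_one[OF p v] by (intro sum_pos2[of _ b]) auto
    then show "0 < Re (herm p v v)"
      unfolding re using fin one by (intro sum_pos2[of _ "\<one>\<^bsub>G\<^esub>"]) (auto intro: sum_nonneg)
  qed
qed

lemma stab_mult: "p \<in> X \<Longrightarrow> k \<in> stab p \<Longrightarrow> g \<in> stab p \<Longrightarrow> k \<otimes>\<^bsub>G\<^esub> g \<in> stab p"
  using \<phi>_mult G_simps(1) by (simp add: stab_def)

lemma stab_inv:
  assumes "p \<in> X" "g \<in> stab p"
  shows "inv\<^bsub>G\<^esub> g \<in> stab p"
proof -
  have g: "g \<in> carrier G" "\<phi> g p = p" using assms(2) by (auto simp: stab_def)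
  have "\<phi> (inv\<^bsub>G\<^esub> g) p = p"
    using group_action.orbit_sym_aux[OF action g(1) assms(1) g(2)] .
  then show ?thesis using g G_simps(2) by (simp add: stab_def)
qed

lemma herm_invariant:
  assumes p: "p \<in> X" and g: "g \<in> stab p" and v: "v \<in> T p" and w: "w \<in> T p"
  shows "herm p (d g v) (d g w) = herm p v w"
proof -
  interpret G: group G by (rule group_G)
  let ?F = "\<lambda>k. \<Sum>b\<in>tbasis p. cnj (crd (tbasis p) b (d k v)) * crd (tbasis p) b (d k w)"
  have gc: "g \<in> carrier G" using g by (simp add: stab_def)
  have sub: "k \<in> carrier G" if "k \<in> stab p" for k using that by (simp add: stab_def)
  have "herm p (d g v) (d g w) = (\<Sum>k\<in>stab p. ?F (k \<otimes>\<^bsub>G\<^esub> g))"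
    unfolding herm_def using d_mult[OF p _ gc] v w sub by (intro sum.cong refl) simp
  also have "\<dots> = (\<Sum>k\<in>stab p. ?F k)"
  proof (rule sum.reindex_bij_witness[of _ "\<lambda>k. k \<otimes>\<^bsub>G\<^esub> inv\<^bsub>G\<^esub> g" "\<lambda>k. k \<otimes>\<^bsub>G\<^esub> g"])
    show "k \<otimes>\<^bsub>G\<^esub> g \<otimes>\<^bsub>G\<^esub> inv\<^bsub>G\<^esub> g = k" "k \<otimes>\<^bsub>G\<^esub> inv\<^bsub>G\<^esub> g \<otimes>\<^bsub>G\<^esub> g = k" if "k \<in> stab p" for k
      using sub[OF that] gc by (simp_all add: G.m_assoc)
  qed (use stab_mult[OF p] stab_inv[OF p] g in auto)
  finally show ?thesis by (simp add: herm_def)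
qed

lemma isometry_at:
  assumes "p \<in> X" "g \<in> stab p"
  shows "isometry (T p) (\<omega> p) (herm p) (d g)"
proof
  have g: "g \<in> carrier G" "\<phi> g p = p" using assms(2) by (auto simp: stab_def)
  show "symplectic (T p) (\<omega> p)" by (rule T_symplectic[OF assms(1)])
  show "hermitian (T p) (herm p)" by (rule hermitian_herm[OF assms(1)])
  show "lin (T p) (T p) (d g)" by (rule stab_lin[OF assms(2,1)])
  fix v w assume vw: "v \<in> T p" "w \<in> T p"
  show "\<omega> p (d g v) (d g w) = \<omega> p v w" using \<omega>_d[OF g(1) assms(1) vw] g(2) by simp
  show "herm p (d g v) (d g w) = herm p v w" by (rule herm_invariant[OF assms vw])
qed

lemma fixed_stab: "p \<in> fixed_locus X (\<phi> g) \<Longrightarrow> g \<in> carrier G \<Longrightarrow> g \<in> stab p \<and> p \<in> X"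
  by (simp add: fixed_locus_def stab_def)

lemma normal_space_Nr: "normal_space X (\<phi> g) p = Nr (T p) (d g)"
  by (simp add: normal_space_def Nr_def)

lemma normal_det_Nr: "normal_det X (\<phi> g) p = endo_det (Nr (T p) (d g)) (\<lambda>D. D - d g D)"
  by (simp add: normal_det_def normal_space_Nr)

lemma finite_order:
  assumes "g \<in> carrier G"
  obtains m where "m > 0" "\<And>q. q \<in> X \<Longrightarrow> (\<phi> g ^^ m) q = q"
proof -
  interpret G: group G by (rule group_G)
  have pow: "(\<phi> g ^^ k) q = \<phi> (g [^]\<^bsub>G\<^esub> k) q" if "q \<in> X" for k q
  proof (induction k)
    case 0
    show ?case using \<phi>_one[OF that] by simp
  next
    case (Suc k)
    have "\<phi> (g [^]\<^bsub>G\<^esub> Suc k) q = \<phi> (g \<otimes>\<^bsub>G\<^esub> g [^]\<^bsub>G\<^esub> k) q"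
      using assms by (simp only: G.nat_pow_Suc2)
    also have "\<dots> = \<phi> g (\<phi> (g [^]\<^bsub>G\<^esub> k) q)" by (rule \<phi>_mult[OF that assms]) (simp add: assms)
    finally show ?case using Suc by simp
  qed
  have "\<not> inj (\<lambda>k. g [^]\<^bsub>G\<^esub> (k :: nat))"
  proof
    assume inj: "inj (\<lambda>k. g [^]\<^bsub>G\<^esub> (k :: nat))"
    have "range (\<lambda>k. g [^]\<^bsub>G\<^esub> (k :: nat)) \<subseteq> carrier G" using assms by auto
    then have "finite (UNIV :: nat set)" using finite_imageD[OF _ inj] finite_subset finite_G by blast
    then show False by simp
  qed
  then obtain i j :: nat where ij: "g [^]\<^bsub>G\<^esub> i = g [^]\<^bsub>G\<^esub> j" "i < j"
    unfolding inj_def by (metis linorder_neqE_nat)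
  then have "g [^]\<^bsub>G\<^esub> (j - i) = \<one>\<^bsub>G\<^esub>"
    using G.pow_eq_div2[OF assms, of j i] by simp
  then have "(\<phi> g ^^ (j - i)) q = q" if "q \<in> X" for q
    using pow[OF that] \<phi>_one[OF that] by simp
  with that[of "j - i"] ij(2) show ?thesis by simp
qed

end

section \<open>Local coordinates and the lifting of covectors to functions\<close>

lemma homogeneous_det:
  fixes R :: "'n::finite \<Rightarrow> complex ^ 'm::finite \<Rightarrow> complex ^ 'n"
  assumes "\<And>i j. homogeneous (e i) (\<lambda>w. R i w $ j)"
  shows "homogeneous (\<Sum>i\<in>UNIV. e i) (\<lambda>w. det (\<chi> i. R i w))"
proof -
  have "homogeneous (\<Sum>i\<in>UNIV. e i) (\<lambda>w. \<Prod>i\<in>UNIV. R i w $ p i)" for p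
    by (rule homogeneous_prod) (rule assms)
  then have "homogeneous (\<Sum>i\<in>UNIV. e i) (\<lambda>w. \<Sum>p | p permutes UNIV. of_int (sign p) * (\<Prod>i\<in>UNIV. R i w $ p i))"
    by (intro homogeneous_sum homogeneous_cmult)
  then show ?thesis by (simp add: det_def)
qed

text \<open>The numerator in the quotient rule for A/B, hence a multiple of the differential with
  polynomial entries.\<close>

definition rep_row :: "(complex ^ ('n::finite) \<Rightarrow> complex) \<Rightarrow> (complex ^ 'n \<Rightarrow> complex) \<Rightarrow> complex ^ 'n \<Rightarrow> complex ^ 'n" where
  "rep_row A B w = B w *s grad A w - A w *s grad B w"

lemma homogeneous_rep_row:
  assumes "homogeneous d A" "homogeneous d B"
  shows "homogeneous (d + (d - 1)) (\<lambda>w. rep_row A B w $ j)"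
  using homogeneous_diff[OF homogeneous.mult[OF assms(2) homogeneous_grad(1)[OF assms(1), of j]]
      homogeneous.mult[OF assms(1) homogeneous_grad(1)[OF assms(2), of j]]]
  by (simp add: rep_row_def)

lemma dot_rep_row: "dot (rep_row A B w) u = B w * dot (grad A w) u - A w * dot (grad B w) u"
  by (simp add: rep_row_def dot_def algebra_simps sum_subtractf sum_distrib_left)

lemma tangent_rep_row:
  assumes "q \<in> X" "v \<in> hcoords q" "v $ k \<noteq> 0" "D \<in> tangent_space X q" "rep X q f d A B"
  shows "D f = dot (rep_row A B v) (cone_vec k v D) / (B v)\<^sup>2"
  using tangent_rep[OF assms] by (simp add: dot_rep_row mult.commute)

text \<open>That the differentials of the \<open>f i\<close> form a basis of the cotangent space is an open condition, being
  the nonvanishing of a determinant whose rows include multiples of these differentials.\<close>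

lemma local_coordinates:
  assumes ch: "chart X U Fs k K k0" and p: "p \<in> X" "p \<in> U" and v: "v \<in> hcoords p" "v $ k \<noteq> 0"
    and ind: "independent_rows (chart_row k K k0 l v)"
    and reg: "\<forall>i\<in>free_rows K k0. regular_at X p (f i)"
    and zero: "\<forall>E\<in>tangent_space X p. (\<forall>i\<in>free_rows K k0. E (f i) = 0) \<longrightarrow> E = (\<lambda>f. 0)"
  obtains N where "openin zariski N" "p \<in> N"
    "\<forall>q\<in>N \<inter> X. \<exists>D. (\<forall>i\<in>free_rows K k0. D i \<in> tangent_space X q) \<and>
       (\<forall>i\<in>free_rows K k0. \<forall>j\<in>free_rows K k0. i \<noteq> j \<longrightarrow> D i (f j) = 0) \<and>
       inj_on D (free_rows K k0) \<and> cbasis (D ` free_rows K k0) (tangent_space X q) \<and>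
       (\<forall>E\<in>tangent_space X q. (\<forall>i\<in>free_rows K k0. E (f i) = 0) \<longrightarrow> E = (\<lambda>f. 0))"
proof -
  let ?L = "free_rows K k0"
  have "\<forall>i. \<exists>r. i \<in> ?L \<longrightarrow> rep X p (f i) (fst r) (fst (snd r)) (snd (snd r))"
    using reg regular_at_iff[OF p(1)] by fastforce
  from choice[OF this] obtain r where r: "\<forall>i. i \<in> ?L \<longrightarrow> rep X p (f i) (fst (r i)) (fst (snd (r i))) (snd (snd (r i)))" ..
  define d where "d i = fst (r i)" for i
  define A where "A i = fst (snd (r i))" for i
  define B where "B i = snd (snd (r i))" for i
  have rep: "rep X p (f i) (d i) (A i) (B i)" if "i \<in> ?L" for i using r that by (simp add: d_def A_def B_def)
  have hom: "homogeneous (d i) (A i)" "homogeneous (d i) (B i)" if "i \<in> ?L" for i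
    using rep[OF that] unfolding rep_def by blast+
  have "\<forall>i. \<exists>V. i \<in> ?L \<longrightarrow> openin zariski V \<and> p \<in> V \<and> (\<forall>q\<in>V \<inter> X. \<forall>w\<in>hcoords q. B i w \<noteq> 0 \<and> f i q = A i w / B i w)"
    using rep unfolding rep_def by blast
  from choice[OF this] obtain V where V: "\<forall>i. i \<in> ?L \<longrightarrow> openin zariski (V i) \<and> p \<in> V i \<and>
    (\<forall>q\<in>V i \<inter> X. \<forall>w\<in>hcoords q. B i w \<noteq> 0 \<and> f i q = A i w / B i w)" ..
  have rep_near: "rep X q (f i) (d i) (A i) (B i)" if "i \<in> ?L" "q \<in> V i" for i q
    unfolding rep_def using hom[OF that(1)] V that by blast
  have B_nz: "B i w \<noteq> 0" if "i \<in> ?L" "q \<in> V i" "q \<in> X" "w \<in> hcoords q" for i q w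
    using V that by blast
  define R where "R w i = rep_row (A i) (B i) w" for w i
  let ?M = "\<lambda>w. chart_row k K k0 (R w) w"
  have "\<forall>F. \<exists>d. F \<in> set Fs \<longrightarrow> homogeneous d F" using ch unfolding chart_def by blast
  from choice[OF this] obtain dF where dF: "\<forall>F. F \<in> set Fs \<longrightarrow> homogeneous (dF F) F" ..
  \<comment> \<open>Row degrees: gradients of the equations, the constant scaling row, and the
    numerators of the differentials.\<close>
  define e where "e i = (case K i of Some F \<Rightarrow> dF F - 1 | None \<Rightarrow> if i = k0 then 0 else d i + (d i - 1))" for i
  have "homogeneous (e i) (\<lambda>w. ?M w i $ j)" for i j
  proof (cases "K i")
    case (Some F)
    then have "F \<in> set Fs" using ch unfolding chart_def by blast
    then show ?thesis using Some homogeneous_grad(1)[of "dF F" F j] dF by (simp add: e_def chart_row_def)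
  next
    case None
    show ?thesis
    proof (cases "i = k0")
      case True
      then show ?thesis using None homogeneous.const by (simp add: e_def chart_row_def)
    next
      case False
      then have "i \<in> ?L" using None by simp
      then show ?thesis using homogeneous_rep_row[OF hom] None False by (simp add: e_def chart_row_def R_def)
    qed
  qed
  then have det_hom: "homogeneous (\<Sum>i\<in>UNIV. e i) (\<lambda>w. det (\<chi> i. ?M w i))" by (rule homogeneous_det)
  have row: "E (f i) = dot (R w i) (cone_vec k w E) / (B i w)\<^sup>2"
    if "i \<in> ?L" "q \<in> V i" "q \<in> X" "w \<in> hcoords q" "w $ k \<noteq> 0" "E \<in> tangent_space X q" for i q w E
    unfolding R_def by (rule tangent_rep_row[OF that(3-6) rep_near[OF that(1,2)]])
  \<comment> \<open>A vector in the kernel of the matrix satisfies the linearised equations, so it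
    comes from a tangent vector; the remaining rows say that this vector kills all
    \<open>f i\<close>.\<close>
  have ind_v: "independent_rows (?M v)"
    unfolding independent_rows_def
  proof (intro allI impI)
    fix w assume w: "\<forall>i. dot (?M v i) w = 0"
    have Kk0: "K k0 = None" using ch unfolding chart_def by blast
    have "w $ k = 0" using spec[OF w, of k0] Kk0 by (simp add: chart_row_def dot_axis)
    moreover have "dot (grad F v) w = 0" if "K i = Some F" for i F
      using spec[OF w, of i] that by (simp add: chart_row_def)
    ultimately obtain E where E: "E \<in> tangent_space X p" "cone_vec k v E = w"
      using chart_tangent_exists[OF ch p v ind] by blast
    have "E (f i) = 0" if i: "i \<in> ?L" for i
    proof -
      have "dot (R v i) w = 0" using spec[OF w, of i] i by (simp add: chart_row_def)
      moreover have "p \<in> V i" using V i by blast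
      ultimately show ?thesis using row[OF i _ p(1) v E(1)] E(2) by simp
    qed
    then have "E = (\<lambda>f. 0)" using zero E(1) by blast
    then show "w = 0" using E(2) cone_vec_lin(3)[of k v] by simp
  qed
  define N where "N = U \<inter> {q. \<forall>w\<in>hcoords q. w $ k \<noteq> 0} \<inter> {q. \<forall>w\<in>hcoords q. det (\<chi> i. ?M w i) \<noteq> 0} \<inter> (\<Inter>i\<in>?L. V i)"
  have fin: "openin zariski (\<Inter>i\<in>J. V i)" if "J \<subseteq> ?L" for J
  proof (cases "J = {}")
    case True
    then show ?thesis using openin_topspace[of "zariski :: 'a proj topology"] by simp
  next
    case False
    then show ?thesis using that V by (intro openin_INT2) auto
  qed
  show ?thesis
  proof (rule that[of N])
    show "openin zariski N" unfolding N_def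
      using ch zariski_nonvanishing[OF homogeneous.coord[of k]] zariski_nonvanishing[OF det_hom] fin[of ?L]
      by (intro openin_Int) (auto simp: chart_def)
    show "p \<in> N"
      unfolding N_def using p(2) V nonvanishing_iff(1)[OF homogeneous.coord v(1), of k] v(2)
        nonvanishing_iff(1)[OF det_hom v(1)] ind_v independent_rows_iff_det by blast
    show "\<forall>q\<in>N \<inter> X. \<exists>D. (\<forall>i\<in>?L. D i \<in> tangent_space X q) \<and> (\<forall>i\<in>?L. \<forall>j\<in>?L. i \<noteq> j \<longrightarrow> D i (f j) = 0) \<and>
       inj_on D ?L \<and> cbasis (D ` ?L) (tangent_space X q) \<and> (\<forall>E\<in>tangent_space X q. (\<forall>i\<in>?L. E (f i) = 0) \<longrightarrow> E = (\<lambda>f. 0))"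
    proof
    fix q assume qN: "q \<in> N \<inter> X"
    then have q: "q \<in> N" "q \<in> X" by auto
    obtain w where w: "w \<in> hcoords q" using hcoords_ex by blast
    have q': "q \<in> U" "w $ k \<noteq> 0" "det (\<chi> i. ?M w i) \<noteq> 0" "i \<in> ?L \<Longrightarrow> q \<in> V i" for i
      using q w unfolding N_def by blast+
    have indw: "independent_rows (?M w)" using q'(3) independent_rows_iff_det by blast
    obtain D where D: "\<And>i. i \<in> ?L \<Longrightarrow> D i \<in> tangent_space X q"
      "\<And>i j. i \<in> ?L \<Longrightarrow> j \<in> ?L \<Longrightarrow> dot (R w j) (cone_vec k w (D i)) = (if j = i then 1 else 0)"
      "inj_on D ?L" "cbasis (D ` ?L) (tangent_space X q)"
      by (rule chart_basis[OF ch q(2) q'(1) w q'(2) indw]) (rule that; blast)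
    have D0: "D i (f j) = 0" if "i \<in> ?L" "j \<in> ?L" "i \<noteq> j" for i j
      using row[OF that(2) q'(4)[OF that(2)] q(2) w q'(2) D(1)[OF that(1)]] D(2)[OF that(1,2)] that(3) by simp
    have E0: "E = (\<lambda>f. 0)" if E: "E \<in> tangent_space X q" "\<forall>i\<in>?L. E (f i) = 0" for E
    proof (rule chart_zero[OF ch q(2) q'(1) w q'(2) indw E(1)])
      fix i assume i: "i \<in> ?L"
      show "dot (R w i) (cone_vec k w E) = 0"
        using row[OF i q'(4)[OF i] q(2) w q'(2) E(1)] bspec[OF E(2) i] B_nz[OF i q'(4)[OF i] q(2) w] by simp
    qed
    show "\<exists>D. (\<forall>i\<in>?L. D i \<in> tangent_space X q) \<and> (\<forall>i\<in>?L. \<forall>j\<in>?L. i \<noteq> j \<longrightarrow> D i (f j) = 0) \<and>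
       inj_on D ?L \<and> cbasis (D ` ?L) (tangent_space X q) \<and> (\<forall>E\<in>tangent_space X q. (\<forall>i\<in>?L. E (f i) = 0) \<longrightarrow> E = (\<lambda>f. 0))"
      by (rule exI[of _ D], intro conjI ballI impI) (rule D(1) D0 D(3) D(4) E0; assumption)+
    qed
  qed
qed

lemma tangent_linear_combination:
  assumes "q \<in> X" "finite I" "\<And>i. i \<in> I \<Longrightarrow> regular_at X q (f i)"
  shows "regular_at X q (\<lambda>p. \<Sum>i\<in>I. c i * f i p)"
    and "D \<in> tangent_space X q \<Longrightarrow> D (\<lambda>p. \<Sum>i\<in>I. c i * f i p) = (\<Sum>i\<in>I. c i * D (f i))"
proof -
  have "regular_at X q (\<lambda>p. \<Sum>i\<in>I. c i * f i p) \<and>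
      (D \<in> tangent_space X q \<longrightarrow> D (\<lambda>p. \<Sum>i\<in>I. c i * f i p) = (\<Sum>i\<in>I. c i * D (f i)))"
    using assms(2,3)
  proof (induction I rule: finite_induct)
    case empty
    show ?case using regular_const[OF assms(1), of 0] tangentD(5)[OF _ regular_const[OF assms(1), of 0], of D 0] by simp
  next
    case (insert i I)
    have r: "regular_at X q (\<lambda>p. c i * f i p)" "regular_at X q (\<lambda>p. \<Sum>i\<in>I. c i * f i p)"
      using insert regular_scale[OF assms(1)] by simp_all
    have "D (\<lambda>p. c i * f i p + (\<Sum>i\<in>I. c i * f i p)) = c i * D (f i) + D (\<lambda>p. \<Sum>i\<in>I. c i * f i p)" if "D \<in> tangent_space X q"
      using tangentD(3)[OF that r] tangentD(5)[OF that, of "f i" "c i"] insert by simp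
    then show ?case using insert regular_add(1)[OF assms(1) r] by simp
  qed
  then show "regular_at X q (\<lambda>p. \<Sum>i\<in>I. c i * f i p)"
    and "D \<in> tangent_space X q \<Longrightarrow> D (\<lambda>p. \<Sum>i\<in>I. c i * f i p) = (\<Sum>i\<in>I. c i * D (f i))" by blast+
qed

lemma homogeneous_dot: "homogeneous 1 (dot r)"
proof -
  have "homogeneous 1 (\<lambda>w. \<Sum>i\<in>UNIV. r $ i * w $ i)"
    by (intro homogeneous_sum homogeneous_cmult homogeneous.coord)
  then show ?thesis by (simp add: dot_def[abs_def])
qed

lemma grad_dot: "dot (grad (dot r) v) u = dot r u"
  by (rule grad_eqI[OF homogeneous_dot]) (rule linear_imp_has_derivative[OF linear_dot])

text \<open>The quotients of the complementary linear forms \<open>l i\<close> by a coordinate have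
  differentials proportional to the dual basis of the tangent space, so their combinations realise
  every covector.\<close>

lemma covector_lift:
  assumes "smooth X" "p \<in> X" "\<xi> \<in> dual (tangent_space X p)"
  obtains f where "regular_at X p f" "\<And>D. D \<in> tangent_space X p \<Longrightarrow> D f = \<xi> D"
proof -
  obtain v where v: "v \<in> hcoords p" using hcoords_ex by blast
  obtain U Fs k K k0 l where
    c: "chart X U Fs k K k0" "p \<in> U" "v $ k \<noteq> 0" "independent_rows (chart_row k K k0 l v)"
    by (rule smooth_chart[OF assms(1,2) v])
  let ?L = "free_rows K k0"
  obtain D where D: "\<And>i. i \<in> ?L \<Longrightarrow> D i \<in> tangent_space X p"
    "\<And>i j. i \<in> ?L \<Longrightarrow> j \<in> ?L \<Longrightarrow> dot (l j) (cone_vec k v (D i)) = (if j = i then 1 else 0)"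
    "inj_on D ?L" "cbasis (D ` ?L) (tangent_space X p)"
    by (rule chart_basis[OF c(1) assms(2) c(2) v c(3,4)]) (rule that; blast)
  define F where "F i = rat (dot (l i)) (\<lambda>w. w $ k)" for i
  have rep: "rep X p (F i) 1 (dot (l i)) (\<lambda>w. w $ k)" for i
    unfolding F_def by (rule rat_rep[OF homogeneous_dot homogeneous.coord v c(3)])
  then have reg: "regular_at X p (F i)" for i using regular_at_iff[OF assms(2)] by blast
  have DF: "E (F i) = dot (l i) (cone_vec k v E) / v $ k" if "E \<in> tangent_space X p" for E i
    using tangent_rep[OF assms(2) v c(3) that rep] cone_vec_k[OF assms(2) v c(3) that] c(3)
    by (simp add: grad_dot grad_simps power2_eq_square)
  \<comment> \<open>The factor \<open>v $ k\<close> compensates the division by this coordinate in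
    the differential of \<open>F i\<close>.\<close>
  define f where "f = (\<lambda>q. \<Sum>i\<in>?L. (\<xi> (D i) * v $ k) * F i q)"
  have Ef: "E f = (\<Sum>i\<in>?L. \<xi> (D i) * v $ k * E (F i))" if "E \<in> tangent_space X p" for E
    unfolding f_def by (rule tangent_linear_combination(2)[OF assms(2) _ reg that]) simp
  define \<eta> where "\<eta> E = (if E \<in> tangent_space X p then E f else 0)" for E
  note sub = csubspaceD[OF tangent_subspace[of X p]]
  have \<eta>: "\<eta> \<in> dual (tangent_space X p)"
    by (rule dualI) (simp_all add: \<eta>_def sub(2,3))
  have eq: "\<eta> b = \<xi> b" if b: "b \<in> D ` ?L" for b
  proof -
    obtain j where j: "j \<in> ?L" "b = D j" using b by blast
    have "(\<Sum>i\<in>?L. \<xi> (D i) * v $ k * D j (F i)) = (\<Sum>i\<in>?L. if i = j then \<xi> (D j) else 0)"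
      using DF[OF D(1)[OF j(1)]] D(2)[OF j(1)] c(3) by (intro sum.cong) auto
    then show ?thesis using Ef[OF D(1)[OF j(1)]] j D(1) by (simp add: \<eta>_def)
  qed
  have "\<eta> = \<xi>"
    by (subst dual_expand[OF D(4) \<eta>], subst dual_expand[OF D(4) assms(3)]) (simp add: eq)
  show ?thesis
  proof (rule that[of f])
    show "regular_at X p f" unfolding f_def by (rule tangent_linear_combination(1)[OF assms(2) _ reg]) simp
    fix E assume "E \<in> tangent_space X p"
    then show "E f = \<xi> E" using fun_cong[OF \<open>\<eta> = \<xi>\<close>, of E] by (simp add: \<eta>_def)
  qed
qed

subsection \<open>Normal determinants are locally constant\<close>

lemma (in isometry) crd_eigenbasis:
  assumes B: "cbasis B V" and eig: "\<And>b. b \<in> B \<Longrightarrow> g b = (\<lambda>x. \<zeta> b * b x)" and v: "v \<in> V" and b: "b \<in> B"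
  shows "crd B b (g v) = \<zeta> b * crd B b v"
proof -
  have "g v = g (\<lambda>x. \<Sum>c\<in>B. crd B c v * c x)" by (rule arg_cong[OF crd_expand[OF B v]])
  also have "\<dots> = (\<lambda>x. \<Sum>c\<in>B. crd B c v * g c x)"
    by (rule lin_sum[OF lin_g V(1) cbasisD(1)[OF B] cbasisD(5)[OF B]])
  also have "\<dots> = diag B \<zeta> v" unfolding diag_def by (intro ext sum.cong refl) (simp add: eig)
  finally show ?thesis using crd_diag[OF B v b] by simp
qed

text \<open>Regularity is insensitive to a nonzero factor, so for irregular functions both sides are
  0. The coordinates are applied at nearby points where their regularity has not been
  recorded.\<close>

lemma tangent_scale:
  assumes "q \<in> X" "D \<in> tangent_space X q" "c \<noteq> 0"
  shows "D (\<lambda>p. c * f p) = c * D f"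
proof (cases "regular_at X q f")
  case False
  have "regular_at X q f" if r: "regular_at X q (\<lambda>p. c * f p)"
    using regular_scale[OF assms(1) r, of "inverse c"] assms(3) by (simp add: mult.assoc[symmetric])
  then have "\<not> regular_at X q (\<lambda>p. c * f p)" using False by blast
  then show ?thesis using tangentD(1)[OF assms(2)] False by simp
qed (use tangentD(5)[OF assms(2)] in blast)

lemma locally_constant_connectedin:
  assumes "connectedin \<tau> Z" "\<And>x. x \<in> topspace \<tau> \<Longrightarrow> \<exists>N. openin \<tau> N \<and> x \<in> N \<and> (\<forall>y\<in>N. F y = F x)"
    and "p \<in> Z" "q \<in> Z"
  shows "F q = F p"
proof (rule ccontr)
  assume ne: "F q \<noteq> F p"
  have "openin \<tau> {x \<in> topspace \<tau>. P (F x)}" for P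
  proof (subst openin_subopen, intro ballI)
    fix x assume x: "x \<in> {x \<in> topspace \<tau>. P (F x)}"
    then obtain N where N: "openin \<tau> N" "x \<in> N" "\<forall>y\<in>N. F y = F x" using assms(2) by blast
    then have "N \<subseteq> {x \<in> topspace \<tau>. P (F x)}" using x openin_subset by fastforce
    then show "\<exists>N. openin \<tau> N \<and> x \<in> N \<and> N \<subseteq> {x \<in> topspace \<tau>. P (F x)}" using N by blast
  qed
  from this[of "\<lambda>y. y = F p"] this[of "\<lambda>y. y \<noteq> F p"] show False
    using assms(1,3,4) ne unfolding connectedin by blast
qed

context symplectic_action begin

text \<open>Lift the covector to some function and apply the projector of the finite cyclic group
  onto the eigenvalue \<open>\<zeta> b\<close>; the differential at \<open>p\<close>, already an
  eigenvector, is unchanged.\<close>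

lemma eigenfunction:
  assumes g: "g \<in> carrier G" and p: "p \<in> fixed_locus X (\<phi> g)"
    and B: "cbasis B (T p)" and eig: "\<And>b. b \<in> B \<Longrightarrow> d g b = (\<lambda>x. \<zeta> b * b x)" and b: "b \<in> B"
  shows "\<zeta> b \<noteq> 0"
    and "\<exists>f. regular_at X p f \<and> (\<forall>D\<in>T p. D f = crd B b D) \<and> (\<forall>q\<in>X. f (\<phi> g q) = \<zeta> b * f q)"
proof -
  let ?s = "\<phi> g" and ?z = "\<zeta> b"
  have pX: "p \<in> X" "?s p = p" and stab: "g \<in> stab p" using p fixed_stab[OF p g] by (auto simp: fixed_locus_def)
  note iso = isometry_at[OF pX(1) stab]
  have bT: "b \<in> T p" using cbasisD(5)[OF B b] .
  obtain m where m: "m > 0" "\<And>q. q \<in> X \<Longrightarrow> (?s ^^ m) q = q" by (rule finite_order[OF g]) (rule that; blast)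
  obtain h where h: "regular_at X p h" "\<And>D. D \<in> T p \<Longrightarrow> D h = crd B b D"
    by (rule covector_lift[OF smooth_X pX(1) crd_dual[OF B, of b]]) (rule that; blast)
  have s: "regular_map X ?s" using automorphism.reg(1)[OF automorphism_\<phi>[OF g]] .
  have reg: "regular_at X p (h \<circ> ?s ^^ j)" for j
  proof (induction j)
    case 0
    show ?case using h(1) by simp
  next
    case (Suc j)
    have "regular_at X p ((h \<circ> ?s ^^ j) \<circ> ?s)" by (rule regular_comp[OF s pX(1)]) (simp add: pX(2) Suc)
    then show ?case by (simp only: funpow_Suc_right o_assoc)
  qed
  have Dj: "D (h \<circ> ?s ^^ j) = ?z ^ j * crd B b D" if "D \<in> T p" for D j
    using that
  proof (induction j arbitrary: D)
    case 0
    then show ?case using h(2) by simp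
  next
    case (Suc j)
    have "D (h \<circ> ?s ^^ Suc j) = d g D (h \<circ> ?s ^^ j)"
      unfolding differential_def by (simp only: funpow_Suc_right o_assoc)
    also have "\<dots> = ?z ^ j * crd B b (d g D)"
      using Suc.IH linD(1)[OF isometry.lin_g[OF iso] Suc.prems] .
    also have "crd B b (d g D) = ?z * crd B b D"
      by (rule isometry.crd_eigenbasis[OF iso B eig Suc.prems b])
    finally show ?case by simp
  qed
  have "b (h \<circ> ?s ^^ m) = b h" by (rule tangent_eq_on[OF pX(1) bT]) (simp add: m(2))
  then have zm: "?z ^ m = 1" using Dj[OF bT, of m] h(2)[OF bT] crd_basis[OF B b, of b] by simp
  then show z0: "?z \<noteq> 0" using m(1) by (auto simp: power_0_left)
  \<comment> \<open>The twist by inverse powers of the eigenvalue cancels the powers produced by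
    \<open>Dj\<close>, and dividing by \<open>m\<close> restores the covector.\<close>
  define f where "f = (\<lambda>q. \<Sum>j<m. (inverse (of_nat m) * inverse ?z ^ j) * (h \<circ> ?s ^^ j) q)"
  have "D f = crd B b D" if D: "D \<in> T p" for D
  proof -
    have "D f = (\<Sum>j<m. (inverse (of_nat m) * inverse ?z ^ j) * D (h \<circ> ?s ^^ j))"
      unfolding f_def by (rule tangent_linear_combination(2)[OF pX(1) _ reg D]) simp
    also have "\<dots> = (\<Sum>j<m. inverse (of_nat m) * crd B b D)"
    proof (rule sum.cong[OF refl])
      fix j
      have "inverse ?z ^ j * ?z ^ j = 1" using z0 by (simp add: power_mult_distrib[symmetric])
      then show "(inverse (of_nat m) * inverse ?z ^ j) * D (h \<circ> ?s ^^ j) = inverse (of_nat m) * crd B b D"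
        unfolding Dj[OF D] by (metis mult.assoc mult.commute mult_1)
    qed
    also have "\<dots> = crd B b D" using m(1) by simp
    finally show ?thesis .
  qed
  moreover have "regular_at X p f"
    unfolding f_def by (rule tangent_linear_combination(1)[OF pX(1) _ reg]) simp
  moreover have "f (?s q) = ?z * f q" if q: "q \<in> X" for q
  proof -
    let ?a = "\<lambda>j. inverse (of_nat m) * inverse ?z ^ j * h ((?s ^^ j) q)"
    have "f (?s q) = (\<Sum>j<m. ?z * ?a (Suc j))"
      unfolding f_def using z0 by (intro sum.cong refl) (simp add: funpow_swap1)
    also have "\<dots> = ?z * (\<Sum>j<m. ?a (Suc j))" by (simp add: sum_distrib_left)
    \<comment> \<open>The shifted sum wraps around: the terms for \<open>m\<close> and 0 agree, as
      both the map and the eigenvalue have \<open>m\<close>-th power 1.\<close>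
    also have "(\<Sum>j<m. ?a (Suc j)) = (\<Sum>j<m. ?a j)"
      using sum.lessThan_Suc_shift[of ?a m] sum.lessThan_Suc[of ?a m] m(2)[OF q] zm by (simp add: power_inverse)
    also have "\<dots> = f q" by (simp add: f_def)
    finally show ?thesis .
  qed
  ultimately show "\<exists>f. regular_at X p f \<and> (\<forall>D\<in>T p. D f = crd B b D) \<and> (\<forall>q\<in>X. f (\<phi> g q) = \<zeta> b * f q)" by blast
qed

text \<open>Indexing the eigenvectors by a fixed set \<open>L\<close>, with factors 1 for the
  eigenvalue 1, yields an expression that can be compared between different points.\<close>

lemma normal_det_family:
  assumes g: "g \<in> carrier G" and q: "q \<in> fixed_locus X (\<phi> g)" and D: "finite L" "inj_on D L" "cbasis (D ` L) (T q)"
    and eig: "\<And>i. i \<in> L \<Longrightarrow> d g (D i) = (\<lambda>f. z i * D i f)"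
  shows "normal_det X (\<phi> g) q = (\<Prod>i\<in>L. if z i \<noteq> 1 then 1 - z i else 1)"
proof -
  have qX: "q \<in> X" and stab: "g \<in> stab q" using fixed_stab[OF q g] by auto
  let ?z = "\<lambda>x. z (inv_into L D x)"
  have inv: "inv_into L D (D i) = i" if "i \<in> L" for i using inv_into_f_f[OF D(2) that] .
  have "normal_det X (\<phi> g) q = (\<Prod>b\<in>{b \<in> D ` L. ?z b \<noteq> 1}. 1 - ?z b)"
    unfolding normal_det_Nr
  proof (rule isometry.normal_det_eigenbasis[OF isometry_at[OF qX stab] D(3)])
    fix b assume "b \<in> D ` L"
    then obtain i where i: "i \<in> L" "b = D i" by blast
    show "d g b = (\<lambda>x. ?z b * b x)" unfolding i(2) inv[OF i(1)] by (rule eig[OF i(1)])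
  qed
  also have "\<dots> = (\<Prod>b\<in>D ` L. if ?z b \<noteq> 1 then 1 - ?z b else 1)"
    by (rule prod.inter_filter) (simp add: D(1))
  also have "\<dots> = (\<Prod>i\<in>L. if z i \<noteq> 1 then 1 - z i else 1)"
    unfolding prod.reindex[OF D(2)] by (rule prod.cong[OF refl]) (simp add: inv)
  finally show ?thesis .
qed

text \<open>Averaging local coordinates over the powers of \<open>\<phi> g\<close> gives coordinates which are eigenfunctions,
  so that the eigenvalues on the tangent spaces at nearby fixed points are the same.\<close>

lemma normal_det_locally_constant:
  assumes g: "g \<in> carrier G" and p: "p \<in> fixed_locus X (\<phi> g)"
  obtains N where "openin zariski N" "p \<in> N"
    "\<forall>q\<in>N \<inter> fixed_locus X (\<phi> g). normal_det X (\<phi> g) q = normal_det X (\<phi> g) p"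
proof -
  have pX: "p \<in> X" "\<phi> g p = p" and stab: "g \<in> stab p" using p fixed_stab[OF p g] by (auto simp: fixed_locus_def)
  obtain B \<zeta> where B: "cbasis B (T p)" and eig: "\<And>b. b \<in> B \<Longrightarrow> d g b = (\<lambda>x. \<zeta> b * b x)"
    using isometry.g_eigenbasis[OF isometry_at[OF pX(1) stab]] by metis
  obtain v where v: "v \<in> hcoords p" using hcoords_ex by blast
  obtain U Fs k K k0 l where
    c: "chart X U Fs k K k0" "p \<in> U" "v $ k \<noteq> 0" "independent_rows (chart_row k K k0 l v)"
    by (rule smooth_chart[OF smooth_X pX(1) v])
  let ?L = "free_rows K k0"
  obtain D' where D': "inj_on D' ?L" "cbasis (D' ` ?L) (T p)"
    by (rule chart_basis[OF c(1) pX(1) c(2) v c(3,4)]) (rule that; blast)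
  \<comment> \<open>Both count the dimension of the tangent space, so the coordinate functions of
    the chart can be matched with eigenvectors.\<close>
  have "card ?L = card B"
    using card_image[OF D'(1)] cbasisD(6)[OF D'(2)] cbasisD(6)[OF B] by simp
  then obtain \<theta> where \<theta>: "bij_betw \<theta> ?L B"
    using finite_same_card_bij[of ?L B] cbasisD(1)[OF B] by auto
  then have \<theta>B: "\<theta> i \<in> B" if "i \<in> ?L" for i using that by (auto dest: bij_betwE)
  define z where "z i = \<zeta> (\<theta> i)" for i
  have z0: "z i \<noteq> 0" if "i \<in> ?L" for i
    unfolding z_def by (rule eigenfunction(1)[OF g p B eig \<theta>B[OF that]])
  have "\<forall>i. \<exists>f. i \<in> ?L \<longrightarrow> regular_at X p f \<and> (\<forall>D\<in>T p. D f = crd B (\<theta> i) D) \<and> (\<forall>q\<in>X. f (\<phi> g q) = z i * f q)"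
    unfolding z_def using eigenfunction(2)[OF g p B eig \<theta>B] by blast
  from choice[OF this] obtain f where
    f: "\<forall>i. i \<in> ?L \<longrightarrow> regular_at X p (f i) \<and> (\<forall>D\<in>T p. D (f i) = crd B (\<theta> i) D) \<and> (\<forall>q\<in>X. f i (\<phi> g q) = z i * f i q)" ..
  have zero: "\<forall>E\<in>T p. (\<forall>i\<in>?L. E (f i) = 0) \<longrightarrow> E = (\<lambda>f. 0)"
  proof (intro ballI impI)
    fix E assume E: "E \<in> T p" "\<forall>i\<in>?L. E (f i) = 0"
    have "crd B b E = 0" if "b \<in> B" for b
    proof -
      have "b \<in> \<theta> ` ?L" using \<open>b \<in> B\<close> \<theta> by (simp add: bij_betw_imp_surj_on)
      then obtain i where i: "i \<in> ?L" "b = \<theta> i" by blast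
      have "E (f i) = crd B (\<theta> i) E" using f i(1) E(1) by blast
      then show ?thesis using bspec[OF E(2) i(1)] i(2) by simp
    qed
    then have "(\<lambda>x. \<Sum>b\<in>B. crd B b E * b x) = (\<lambda>f. 0)" by (intro ext sum.neutral) simp
    with crd_expand[OF B E(1)] show "E = (\<lambda>f. 0)" by (rule trans)
  qed
  have reg: "\<forall>i\<in>?L. regular_at X p (f i)" using f by blast
  obtain N where N: "openin zariski N" "p \<in> N"
    and near: "\<forall>q\<in>N \<inter> X. \<exists>D. (\<forall>i\<in>?L. D i \<in> T q) \<and> (\<forall>i\<in>?L. \<forall>j\<in>?L. i \<noteq> j \<longrightarrow> D i (f j) = 0) \<and>
       inj_on D ?L \<and> cbasis (D ` ?L) (T q) \<and> (\<forall>E\<in>T q. (\<forall>i\<in>?L. E (f i) = 0) \<longrightarrow> E = (\<lambda>f. 0))"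
    by (rule local_coordinates[OF c(1) pX(1) c(2) v c(3,4) reg zero])
  show ?thesis
  proof (rule that[OF N], rule ballI)
    fix q assume "q \<in> N \<inter> fixed_locus X (\<phi> g)"
    then have q: "q \<in> N" "q \<in> fixed_locus X (\<phi> g)" by auto
    have qX: "q \<in> X" "\<phi> g q = q" using q by (auto simp: fixed_locus_def)
    obtain D where DT: "\<forall>i\<in>?L. D i \<in> T q" and D0: "\<forall>i\<in>?L. \<forall>j\<in>?L. i \<noteq> j \<longrightarrow> D i (f j) = 0"
      and Dinj: "inj_on D ?L" and Dbas: "cbasis (D ` ?L) (T q)"
      and Dzero: "\<forall>E\<in>T q. (\<forall>i\<in>?L. E (f i) = 0) \<longrightarrow> E = (\<lambda>f. 0)"
      using bspec[OF near IntI[OF q(1) qX(1)]] by (elim exE conjE) (rule that)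
    note sub = csubspaceD[OF tangent_subspace[of X q]]
    have "d g (D i) = (\<lambda>f. z i * D i f)" if i: "i \<in> ?L" for i
    proof -
      \<comment> \<open>\<open>D i\<close> pairs with the eigenfunction \<open>f i\<close> alone, so
        this difference annihilates all coordinate functions and must vanish.\<close>
      let ?E = "\<lambda>f. d g (D i) f - z i * D i f"
      have Di: "D i \<in> T q" using DT i by blast
      have "d g (D i) \<in> T q" using linD(1)[OF d_lin[OF g qX(1)] Di] qX(2) by simp
      then have ET: "?E \<in> T q" by (rule sub(4)[OF _ sub(3)[OF Di]])
      have E0: "?E (f j) = 0" if j: "j \<in> ?L" for j
      proof -
        have "d g (D i) (f j) = D i (\<lambda>q. z j * f j q)"
          unfolding differential_def by (rule tangent_eq_on[OF qX(1) Di]) (use f j in simp)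
        also have "\<dots> = z j * D i (f j)" by (rule tangent_scale[OF qX(1) Di z0[OF j]])
        also have "\<dots> = z i * D i (f j)" using D0 i j by (cases "i = j") auto
        finally show ?thesis by simp
      qed
      have "?E = (\<lambda>f. 0)" by (rule mp[OF bspec[OF Dzero ET]]) (rule ballI, rule E0)
      then have "?E f = 0" for f by (rule fun_cong)
      then show ?thesis by (intro ext) simp
    qed
    then have 1: "normal_det X (\<phi> g) q = (\<Prod>i\<in>?L. if z i \<noteq> 1 then 1 - z i else 1)"
      by (intro normal_det_family[OF g q(2) _ Dinj Dbas]) auto
    have "normal_det X (\<phi> g) p = (\<Prod>i\<in>?L. if z i \<noteq> 1 then 1 - z i else 1)"
    proof (rule normal_det_family[OF g p _ bij_betw_imp_inj_on[OF \<theta>]])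
      show "cbasis (\<theta> ` ?L) (T p)" using B \<theta> by (simp add: bij_betw_imp_surj_on)
      show "d g (\<theta> i) = (\<lambda>f. z i * \<theta> i f)" if "i \<in> ?L" for i unfolding z_def by (rule eig[OF \<theta>B[OF that]])
    qed simp
    with 1 show "normal_det X (\<phi> g) q = normal_det X (\<phi> g) p" by simp
  qed
qed

lemma normal_det_component:
  assumes g: "g \<in> carrier G" and Z: "Z \<in> zariski_components (fixed_locus X (\<phi> g))" and pq: "p \<in> Z" "q \<in> Z"
  shows "normal_det X (\<phi> g) q = normal_det X (\<phi> g) p"
proof (rule locally_constant_connectedin[OF _ _ pq])
  let ?S = "fixed_locus X (\<phi> g)"
  show "connectedin (zariski_on ?S) Z"
    using Z unfolding zariski_components_def by (rule connectedin_connected_components_of)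
  fix x assume "x \<in> topspace (zariski_on ?S)"
  then have x: "x \<in> ?S" by simp
  obtain N where N: "openin zariski N" "x \<in> N"
    "\<forall>q\<in>N \<inter> ?S. normal_det X (\<phi> g) q = normal_det X (\<phi> g) x"
    by (rule normal_det_locally_constant[OF g x])
  show "\<exists>N. openin (zariski_on ?S) N \<and> x \<in> N \<and> (\<forall>y\<in>N. normal_det X (\<phi> g) y = normal_det X (\<phi> g) x)"
  proof (intro exI conjI ballI)
    show "openin (zariski_on ?S) (?S \<inter> N)" by (rule openin_subtopology_Int2[OF N(1)])
    show "x \<in> ?S \<inter> N" using x N(2) by (rule IntI)
    show "normal_det X (\<phi> g) y = normal_det X (\<phi> g) x" if "y \<in> ?S \<inter> N" for y
      by (rule bspec[OF N(3)]) (use that in blast)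
  qed
qed

text \<open>Positivity of the determinant at one point and its constancy along \<open>Z\<close> make
  the definite description in \<open>lam\<close> meaningful.\<close>

lemma lam:
  assumes g: "g \<in> carrier G" and Z: "Z \<in> zariski_components (fixed_locus X (\<phi> g))"
  obtains r where "0 < r" "lam X (\<phi> g) Z = complex_of_real r" "\<And>p. p \<in> Z \<Longrightarrow> normal_det X (\<phi> g) p = complex_of_real (r\<^sup>2)"
proof -
  let ?S = "fixed_locus X (\<phi> g)"
  have "Z \<noteq> {}" "Z \<subseteq> ?S"
    using Z nonempty_connected_components_of connected_components_of_subset unfolding zariski_components_def by fastforce+
  then obtain p where p: "p \<in> Z" "p \<in> ?S" by blast
  have pX: "p \<in> X" and stab: "g \<in> stab p" using fixed_stab[OF p(2) g] by auto
  obtain r0 where r0: "0 < r0" "normal_det X (\<phi> g) p = complex_of_real r0"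
    unfolding normal_det_Nr by (rule isometry.normal_det_positive[OF isometry_at[OF pX stab]])
  define r where "r = sqrt r0"
  have r: "0 < r" "r\<^sup>2 = r0" using r0(1) by (simp_all add: r_def)
  have det: "normal_det X (\<phi> g) q = complex_of_real (r\<^sup>2)" if "q \<in> Z" for q
    using normal_det_component[OF g Z p(1) that] r0(2) r(2) by simp
  have "(THE r. 0 < r \<and> (\<forall>p\<in>Z. (complex_of_real r)\<^sup>2 = normal_det X (\<phi> g) p)) = r"
  proof (rule the_equality)
    show "0 < r \<and> (\<forall>p\<in>Z. (complex_of_real r)\<^sup>2 = normal_det X (\<phi> g) p)" using r(1) det by simp
    fix t assume t: "0 < t \<and> (\<forall>p\<in>Z. (complex_of_real t)\<^sup>2 = normal_det X (\<phi> g) p)"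
    then have "complex_of_real (t\<^sup>2) = complex_of_real (r\<^sup>2)" using det[OF p(1)] p(1) by simp
    then have "t\<^sup>2 = r\<^sup>2" by (simp only: of_real_eq_iff)
    then show "t = r" using t r(1) by (simp add: power2_eq_iff)
  qed
  then show ?thesis using that[OF r(1) _ det] by (simp add: lam_def)
qed

end

subsection \<open>The generators of the determinants of the normal bundles\<close>

text \<open>By adjointness of \<open>Pr\<close>, the vector representing a covector of the normal
  space is the projection of the vector representing its pullback to \<open>V\<close>.\<close>

lemma (in isometry) ext_map_Pr_poi: "ext_map V (Nr V g) (Pr V g) (poi V om) = poi (Nr V g) om"
proof (rule multivector2_eqI)
  fix \<xi> \<eta>
  show "ext_map V (Nr V g) (Pr V g) (poi V om) [\<xi>, \<eta>] = poi (Nr V g) om [\<xi>, \<eta>]"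
  proof (cases "\<xi> \<in> dual (Nr V g) \<and> \<eta> \<in> dual (Nr V g)")
    case True
    then have d: "pull V (Pr V g) \<xi> \<in> dual V" "pull V (Pr V g) \<eta> \<in> dual V"
      using pull_dual[OF lin_Pr V(1)] by auto
    let ?s = "sharp V om (pull V (Pr V g) \<xi>)"
    have s: "?s \<in> V" using sharp(1)[OF symplectic d(1)] .
    have "sharp (Nr V g) om \<xi> = Pr V g ?s"
    proof (rule sharp_eq[OF symplectic_Nr Pr(1)[OF s]])
      fix w assume w: "w \<in> Nr V g"
      then have "w \<in> V" using Nr_V by blast
      then show "om (Pr V g ?s) w = \<xi> w"
        using Pr_adjoint(1)[OF s w] sharp(2)[OF symplectic d(1)] Pr_Nr[OF w] by (simp add: pull_def)
    qed
    then show ?thesis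
      using True d s by (simp add: ext_map_pull poi_simps) (simp add: pull_def)
  qed (auto simp: ext_map_pull poi_simps)
qed (simp_all add: ext_map_degree2 poi_degree2)

lemma lin_bij_dim:
  assumes f: "lin V W f" "f ` V = W" "\<And>v. v \<in> V \<Longrightarrow> f v = (\<lambda>x. 0) \<Longrightarrow> v = (\<lambda>x. 0)"
    and B: "cbasis B V" and W: "cfun.subspace W"
  shows "cfun.dim V = cfun.dim W"
proof -
  note B' = cbasisD[OF B]
  have inj: "inj_on f B"
  proof (rule inj_onI)
    fix b c assume bc: "b \<in> B" "c \<in> B" "f b = f c"
    have V: "b \<in> V" "c \<in> V" using bc B'(5) by auto
    have "f (\<lambda>x. b x + -1 * c x) = (\<lambda>x. f b x + -1 * f c x)"
      using linD(2)[OF f(1) V(1) csubspaceD(3)[OF B'(4) V(2)], of "-1"] linD(3)[OF f(1) V(2), of "-1"] by (simp only:)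
    then have "(\<lambda>x. b x + -1 * c x) = (\<lambda>x. 0)"
      using f(3)[OF csubspaceD(2)[OF B'(4) V(1) csubspaceD(3)[OF B'(4) V(2)]], of "-1"] bc(3) by simp
    then have "b x + -1 * c x = 0" for x by (rule fun_cong)
    then show "b = c" by (intro ext) (simp add: add_eq_0_iff)
  qed
  have fsum: "f (\<lambda>x. \<Sum>b\<in>B. c b * b x) = (\<lambda>x. \<Sum>b\<in>B. c b * f b x)" for c
    by (rule lin_sum[OF f(1) B'(4,1,5)])
  have "cbasis (f ` B) W"
  proof (rule cbasisI[OF B'(1) inj _ _ W])
    fix c b assume *: "(\<lambda>x. \<Sum>b\<in>B. c b * f b x) = (\<lambda>x. 0)" "b \<in> B"
    have "(\<lambda>x. \<Sum>b\<in>B. c b * b x) = (\<lambda>x. 0)"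
      by (rule f(3)[OF subspace_sum[OF B'(4,5)]]) (use fsum *(1) in simp_all)
    then show "c b = 0" using cbasis_coeff_zero[OF B _ *(2)] by blast
  next
    fix w assume "w \<in> W"
    then obtain v where v: "v \<in> V" "w = f v" using f(2) by blast
    have "f v = f (\<lambda>x. \<Sum>b\<in>B. crd B b v * b x)" by (rule arg_cong[OF crd_expand[OF B v(1)]])
    then show "\<exists>c. w = (\<lambda>x. \<Sum>b\<in>B. c b * f b x)" unfolding v(2) fsum by (intro exI)
  next
    show "f b \<in> W" if "b \<in> B" for b using linD(1)[OF f(1) B'(5)[OF that]] .
  qed
  then show ?thesis using cbasisD(6) B'(6) card_image[OF inj] by metis
qed

lemma restrict_section_eq:
  assumes "Z \<in> zariski_components S" "Y \<subseteq> Z" "Y \<noteq> {}"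
  shows "restrict_section S c Y = c Z"
proof -
  have "(THE Z. Z \<in> zariski_components S \<and> Y \<subseteq> Z) = Z"
  proof (rule the_equality)
    fix Z' assume Z': "Z' \<in> zariski_components S \<and> Y \<subseteq> Z'"
    then have "Z' \<inter> Z \<noteq> {}" using assms by blast
    then show "Z' = Z"
      using connected_components_of_overlap[of Z' "zariski_on S" Z] Z' assms(1) unfolding zariski_components_def by blast
  qed (use assms in simp)
  then show ?thesis by (simp add: restrict_section_def)
qed

text \<open>A shared component need not be a component of either fixed locus of the factors; it has
  to be enlarged to one before \<open>lam\<close> can be evaluated.\<close>

lemma component_superset:
  assumes "connectedin zariski Y" "Y \<noteq> {}" "Y \<subseteq> S"
  obtains Z where "Z \<in> zariski_components S" "Y \<subseteq> Z"
proof -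
  have "connectedin (zariski_on S) Y" using assms by (simp add: connectedin_subtopology)
  moreover have "zariski_on S \<noteq> trivial_topology"
    using assms null_topspace_iff_trivial[of "zariski_on S"] topspace_zariski_on[of S] by blast
  ultimately show ?thesis
    using exists_connected_component_of_superset that unfolding zariski_components_def by blast
qed

lemma component_nonempty: "Z \<in> zariski_components S \<Longrightarrow> Z \<noteq> {}"
  unfolding zariski_components_def by (rule nonempty_connected_components_of)

lemma component_subset: "Z \<in> zariski_components S \<Longrightarrow> Z \<subseteq> S"
  unfolding zariski_components_def using connected_components_of_subset by fastforce

context symplectic_action begin

lemma fixed_tangent_Fx: "fixed_tangent X (\<phi> g) p = Fx (T p) (d g)"
  by (simp add: fixed_tangent_def Fx_def)

lemma normal_proj_Pr: "normal_proj X (\<phi> g) p = Pr (T p) (d g)"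
  by (rule ext) (simp add: normal_proj_def Pr_def normal_space_Nr fixed_tangent_Fx)

lemma poisson_poi: "poisson X \<omega> p = poi (T p) (\<omega> p)"
  unfolding poisson_def poi_def sharp_def ..

lemma psi_vol:
  assumes "g \<in> carrier G" "p \<in> fixed_locus X (\<phi> g)"
  shows "psi X \<omega> (\<phi> g) p = vol (Nr (T p) (d g)) (\<omega> p)"
proof -
  interpret isometry "T p" "\<omega> p" "herm p" "d g" using isometry_at fixed_stab[OF assms(2,1)] by blast
  have "half_codim X (\<phi> g) p = cfun.dim (Nr (T p) (d g)) div 2"
    using dim_split by (simp add: half_codim_def fixed_tangent_Fx)
  then show ?thesis
    by (simp add: psi_def vol_def wedge_power_def normal_poisson_def normal_proj_Pr normal_space_Nr poisson_poi ext_map_Pr_poi)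
qed

text \<open>Both normal spaces lie inside that of the product, so the projection in
  \<open>cup\<close> restricts to the inclusion on each, and \<open>vol_product\<close>
  applies.\<close>

lemma cup_transverse:
  assumes g: "g \<in> carrier G" and h: "h \<in> carrier G" and Y: "Y \<in> shared_components X G \<phi> g h"
    and tr: "transverse_along X (\<phi> g) (\<phi> h) Y" and p: "p \<in> Y"
  obtains r where "0 < r"
    "cup X G \<phi> g h (psi X \<omega> (\<phi> g)) (psi X \<omega> (\<phi> h)) p = (\<lambda>xs. complex_of_real r * psi X \<omega> (\<phi> (g \<otimes>\<^bsub>G\<^esub> h)) p xs)"
    "normal_det X (\<phi> (g \<otimes>\<^bsub>G\<^esub> h)) p = complex_of_real (r\<^sup>2) * normal_det X (\<phi> g) p * normal_det X (\<phi> h) p"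
    "psi X \<omega> (\<phi> (g \<otimes>\<^bsub>G\<^esub> h)) p \<noteq> 0"
proof -
  let ?k = "g \<otimes>\<^bsub>G\<^esub> h"
  have k: "?k \<in> carrier G" using G_simps(1)[OF g h] .
  have F: "p \<in> fixed_locus X (\<phi> g)" "p \<in> fixed_locus X (\<phi> h)" "p \<in> fixed_locus X (\<phi> ?k)"
    using Y p component_subset unfolding shared_components_def by blast+
  have pX: "p \<in> X" and st: "g \<in> stab p" "h \<in> stab p" "?k \<in> stab p"
    using fixed_stab[OF F(1) g] fixed_stab[OF F(2) h] fixed_stab[OF F(3) k] by auto
  have "T p = {D + E | D E. D \<in> Fx (T p) (d g) \<and> E \<in> Fx (T p) (d h)}"
    using tr p unfolding transverse_along_def fixed_tangent_Fx by blast
  then have V: "T p = {\<lambda>x. v x + w x | v w. v \<in> Fx (T p) (d g) \<and> w \<in> Fx (T p) (d h)}"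
    by (simp only: plus_fun_def)
  have ti: "transverse_isometries (T p) (\<omega> p) (herm p) (d g) (d h) (d ?k)"
    by (intro transverse_isometries.intro transverse_isometries_axioms.intro isometry_at[OF pX st(1)]
        isometry_at[OF pX st(2)] isometry_at[OF pX st(3)] V d_mult[OF pX g h])
  let ?A = "Nr (T p) (d g)" and ?C = "Nr (T p) (d h)" and ?W = "Nr (T p) (d ?k)"
  obtain r where r: "0 < r"
    "wedge (ext_map ?A ?W id (vol ?A (\<omega> p))) (ext_map ?C ?W id (vol ?C (\<omega> p))) = (\<lambda>xs. complex_of_real r * vol ?W (\<omega> p) xs)"
    "endo_det ?W (\<lambda>v. v - d ?k v) = complex_of_real (r\<^sup>2) * endo_det ?A (\<lambda>v. v - d g v) * endo_det ?C (\<lambda>v. v - d h v)"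
    by (rule transverse_isometries.vol_product[OF ti])
  have id: "ext_map ?A ?W (Pr (T p) (d ?k)) \<alpha> = ext_map ?A ?W id \<alpha>" "ext_map ?C ?W (Pr (T p) (d ?k)) \<alpha> = ext_map ?C ?W id \<alpha>" for \<alpha>
    using transverse_isometries.A_W[OF ti] transverse_isometries.C_W[OF ti] isometry.Pr_Nr[OF isometry_at[OF pX st(3)]]
    by (auto intro!: ext_map_cong)
  have ex: "\<exists>Y\<in>shared_components X G \<phi> g h. p \<in> Y \<and> transverse_along X (\<phi> g) (\<phi> h) Y" using Y tr p by blast
  show ?thesis
  proof (rule that[OF r(1)])
    show "cup X G \<phi> g h (psi X \<omega> (\<phi> g)) (psi X \<omega> (\<phi> h)) p = (\<lambda>xs. complex_of_real r * psi X \<omega> (\<phi> ?k) p xs)"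
      unfolding cup_def Let_def if_P[OF ex] normal_space_Nr normal_proj_Pr psi_vol[OF g F(1)] psi_vol[OF h F(2)]
        psi_vol[OF k F(3)] id r(2) ..
    show "normal_det X (\<phi> ?k) p = complex_of_real (r\<^sup>2) * normal_det X (\<phi> g) p * normal_det X (\<phi> h) p"
      unfolding normal_det_Nr by (rule r(3))
    show "psi X \<omega> (\<phi> ?k) p \<noteq> 0"
      unfolding psi_vol[OF k F(3)] by (rule vol(1)[OF isometry.symplectic_Nr[OF isometry_at[OF pX st(3)]]])
  qed
qed

text \<open>At each point the positive factor \<open>r\<close> of \<open>cup_transverse\<close> is
  forced to be the quotient of the positive square roots. These are constant along \<open>Y\<close>,
  so a single coefficient serves all points.\<close>

theorem cup_coeff_lam:
  assumes g: "g \<in> carrier G" and h: "h \<in> carrier G" and Y: "Y \<in> shared_components X G \<phi> g h"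
    and tr: "transverse_along X (\<phi> g) (\<phi> h) Y"
  shows "inverse (restrict_section (fixed_locus X (\<phi> g)) (lam X (\<phi> g)) Y *
             restrict_section (fixed_locus X (\<phi> h)) (lam X (\<phi> h)) Y) *
         restrict_section (fixed_locus X (\<phi> (g \<otimes>\<^bsub>G\<^esub> h))) (lam X (\<phi> (g \<otimes>\<^bsub>G\<^esub> h))) Y =
         cup_coeff X \<omega> G \<phi> g h Y"
proof -
  let ?k = "g \<otimes>\<^bsub>G\<^esub> h"
  let ?F = "\<lambda>g. fixed_locus X (\<phi> g)"
  have k: "?k \<in> carrier G" using G_simps(1)[OF g h] .
  have comp: "Y \<in> zariski_components (?F g \<inter> ?F h)" "Y \<in> zariski_components (?F ?k)"
    using Y unfolding shared_components_def by auto
  have Y0: "Y \<noteq> {}" and sub: "Y \<subseteq> ?F g" "Y \<subseteq> ?F h"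
    using component_nonempty[OF comp(1)] component_subset[OF comp(1)] by auto
  have "connectedin (zariski_on (?F g \<inter> ?F h)) Y"
    using comp(1) unfolding zariski_components_def by (rule connectedin_connected_components_of)
  then have conn: "connectedin zariski Y" by (simp add: connectedin_subtopology)
  obtain Zg where Zg: "Zg \<in> zariski_components (?F g)" "Y \<subseteq> Zg" by (rule component_superset[OF conn Y0 sub(1)])
  obtain Zh where Zh: "Zh \<in> zariski_components (?F h)" "Y \<subseteq> Zh" by (rule component_superset[OF conn Y0 sub(2)])
  obtain rg where rg: "0 < rg" "lam X (\<phi> g) Zg = complex_of_real rg" "\<forall>p\<in>Zg. normal_det X (\<phi> g) p = complex_of_real (rg\<^sup>2)"
    by (rule lam[OF g Zg(1)]) (rule that; blast)
  obtain rh where rh: "0 < rh" "lam X (\<phi> h) Zh = complex_of_real rh" "\<forall>p\<in>Zh. normal_det X (\<phi> h) p = complex_of_real (rh\<^sup>2)"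
    by (rule lam[OF h Zh(1)]) (rule that; blast)
  obtain rk where rk: "0 < rk" "lam X (\<phi> ?k) Y = complex_of_real rk" "\<forall>p\<in>Y. normal_det X (\<phi> ?k) p = complex_of_real (rk\<^sup>2)"
    by (rule lam[OF k comp(2)]) (rule that; blast)
  let ?c = "rk / (rg * rh)"
  let ?P = "\<lambda>c p. cup X G \<phi> g h (psi X \<omega> (\<phi> g)) (psi X \<omega> (\<phi> h)) p = (\<lambda>xs. c * psi X \<omega> (\<phi> ?k) p xs)"
  have cup: "?P (complex_of_real ?c) p \<and> psi X \<omega> (\<phi> ?k) p \<noteq> 0" if p: "p \<in> Y" for p
  proof -
    obtain r where r: "0 < r" "?P (complex_of_real r) p"
      "normal_det X (\<phi> ?k) p = complex_of_real (r\<^sup>2) * normal_det X (\<phi> g) p * normal_det X (\<phi> h) p"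
      "psi X \<omega> (\<phi> ?k) p \<noteq> 0"
      by (rule cup_transverse[OF g h Y tr p])
    have "normal_det X (\<phi> g) p = complex_of_real (rg\<^sup>2)" "normal_det X (\<phi> h) p = complex_of_real (rh\<^sup>2)"
      "normal_det X (\<phi> ?k) p = complex_of_real (rk\<^sup>2)"
      using rg(3) rh(3) rk(3) p Zg(2) Zh(2) by blast+
    then have "complex_of_real (rk\<^sup>2) = complex_of_real (r\<^sup>2 * rg\<^sup>2 * rh\<^sup>2)" using r(3) by (simp only: of_real_mult)
    then have "rk\<^sup>2 = (r * rg * rh)\<^sup>2" by (simp only: of_real_eq_iff power_mult_distrib)
    moreover have "0 < r * rg * rh" using r(1) rg(1) rh(1) by simp
    \<comment> \<open>The squares agree by the determinant identity; positivity of both sides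
      removes the sign ambiguity.\<close>
    ultimately have "rk = r * rg * rh" using rk(1) by (metis less_eq_real_def power2_eq_imp_eq)
    then have "r = ?c" using rg(1) rh(1) by (simp add: field_simps)
    then show ?thesis using r(2,4) by simp
  qed
  have "cup_coeff X \<omega> G \<phi> g h Y = complex_of_real ?c"
    unfolding cup_coeff_def
  proof (rule the_equality)
    show "\<forall>p\<in>Y. ?P (complex_of_real ?c) p" using cup by blast
    fix c assume c: "\<forall>p\<in>Y. ?P c p"
    obtain p where p: "p \<in> Y" using Y0 by blast
    obtain xs where xs: "psi X \<omega> (\<phi> ?k) p xs \<noteq> 0" using cup[OF p] by (metis ext zero_fun_apply)
    have "(\<lambda>xs. c * psi X \<omega> (\<phi> ?k) p xs) = (\<lambda>xs. complex_of_real ?c * psi X \<omega> (\<phi> ?k) p xs)"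
      using bspec[OF c p] conjunct1[OF cup[OF p]] by (rule trans[OF sym])
    from fun_cong[OF this, of xs] show "c = complex_of_real ?c" using xs by (simp only: mult_right_cancel[OF xs])
  qed
  moreover have "restrict_section (?F g) (lam X (\<phi> g)) Y = complex_of_real rg"
    "restrict_section (?F h) (lam X (\<phi> h)) Y = complex_of_real rh"
    "restrict_section (?F ?k) (lam X (\<phi> ?k)) Y = complex_of_real rk"
    using restrict_section_eq[OF Zg Y0] restrict_section_eq[OF Zh Y0] restrict_section_eq[OF comp(2) order_refl Y0] rg(2) rh(2) rk(2)
    by simp_all
  ultimately show ?thesis by (simp add: field_simps)
qed

text \<open>The differential of \<open>\<phi> h\<close> is a symplectic isomorphism between the two
  normal spaces that intertwines \<open>1 - g\<close> with the corresponding operator of the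
  conjugate.\<close>

lemma normal_det_conjugate:
  assumes g: "g \<in> carrier G" and h: "h \<in> carrier G" and p: "p \<in> fixed_locus X (\<phi> g)"
  shows "normal_det X (\<phi> (h \<otimes>\<^bsub>G\<^esub> g \<otimes>\<^bsub>G\<^esub> inv\<^bsub>G\<^esub> h)) (\<phi> h p) = normal_det X (\<phi> g) p"
proof -
  interpret G: group G by (rule group_G)
  let ?g = "h \<otimes>\<^bsub>G\<^esub> g \<otimes>\<^bsub>G\<^esub> inv\<^bsub>G\<^esub> h"
  have c: "?g \<in> carrier G" "inv\<^bsub>G\<^esub> h \<in> carrier G" using g h by simp_all
  have eq: "?g \<otimes>\<^bsub>G\<^esub> h = h \<otimes>\<^bsub>G\<^esub> g" "inv\<^bsub>G\<^esub> h \<otimes>\<^bsub>G\<^esub> h = \<one>\<^bsub>G\<^esub>" using g h by (simp_all add: G.m_assoc)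
  have pX: "p \<in> X" "\<phi> g p = p" and st: "g \<in> stab p" using p fixed_stab[OF p g] by (auto simp: fixed_locus_def)
  have hX: "\<phi> h p \<in> X" by (rule \<phi>_X[OF h pX(1)])
  have "\<phi> ?g (\<phi> h p) = \<phi> h p" using \<phi>_mult[OF pX(1) c(1) h] \<phi>_mult[OF pX(1) h g] pX(2) eq by simp
  then have st': "?g \<in> stab (\<phi> h p)" using c(1) by (simp add: stab_def)
  note i = isometry_at[OF pX(1) st] and i' = isometry_at[OF hX st']
  have com: "d ?g (d h v) = d h (d g v)" if "v \<in> T p" for v
    using d_mult[OF pX(1) c(1) h that] d_mult[OF pX(1) h g that] unfolding eq(1) by simp
  have dT: "d h v \<in> T (\<phi> h p)" if "v \<in> T p" for v using linD(1)[OF d_lin[OF h pX(1)] that] .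
  have diff: "d h (v - w) = d h v - d h w" for v w by (rule ext) (simp add: differential_def)
  let ?V = "Nr (T p) (d g)" and ?V' = "Nr (T (\<phi> h p)) (d ?g)"
  have VT: "v \<in> T p" if "v \<in> ?V" for v using isometry.Nr_V[OF i] that by blast
  have image: "d h ` ?V = ?V'"
  proof -
    have "d h ` ?V = (\<lambda>v. d h v - d ?g (d h v)) ` T p"
      unfolding Nr_def image_image diff using com by (intro image_cong refl) simp
    also have "\<dots> = (\<lambda>v. v - d ?g v) ` (d h ` T p)" by (simp only: image_image)
    finally show ?thesis unfolding automorphism.differential_image[OF automorphism_\<phi>[OF h] pX(1)] Nr_def .
  qed
  have lin: "lin ?V ?V' (d h)"
    unfolding lin_def using image d_lin[OF h pX(1)] VT by (auto simp: differential_def)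
  obtain B where B: "cbasis B ?V" using symplectic_basis[OF isometry.symplectic_Nr[OF i]] .
  have dim: "cfun.dim ?V = cfun.dim ?V'"
  proof (rule lin_bij_dim[OF lin image _ B isometry.Nr_subspace[OF i']])
    fix v assume v: "v \<in> ?V" "d h v = (\<lambda>x. 0)"
    have "v = d (inv\<^bsub>G\<^esub> h) (d h v)"
      using d_mult[OF pX(1) c(2) h VT[OF v(1)]] d_one[OF pX(1) VT[OF v(1)]] unfolding eq(2) by simp
    also have "\<dots> = (\<lambda>x. 0)" by (simp only: v(2)) (simp add: differential_def)
    finally show "v = (\<lambda>x. 0)" .
  qed
  show ?thesis
    unfolding normal_det_Nr
  proof (rule endo_det_transport[OF isometry.symplectic_Nr[OF i] isometry.symplectic_Nr[OF i'] lin image dim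
        _ isometry.lin_Nr[OF i] isometry.lin_Nr[OF i']])
    show "\<omega> (\<phi> h p) (d h v) (d h w) = \<omega> p v w" if "v \<in> ?V" "w \<in> ?V" for v w
      using \<omega>_d[OF h pX(1)] VT that by blast
    show "d h v - d ?g (d h v) = d h (v - d g v)" if "v \<in> ?V" for v
      unfolding diff com[OF VT[OF that]] ..
  qed
qed

text \<open>\<open>lam\<close> depends on its set argument only through the values of
  \<open>normal_det\<close> there, so the pointwise equality at \<open>p\<close> and
  \<open>\<phi> h p\<close> suffices.\<close>

theorem lam_conjugate:
  assumes "g \<in> carrier G" "h \<in> carrier G" "Z \<in> zariski_components (fixed_locus X (\<phi> g))"
  shows "lam X (\<phi> g) Z = lam X (\<phi> (h \<otimes>\<^bsub>G\<^esub> g \<otimes>\<^bsub>G\<^esub> inv\<^bsub>G\<^esub> h)) (\<phi> h ` Z)"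
  unfolding lam_def using normal_det_conjugate[OF assms(1,2)] component_subset[OF assms(3)]
  by (simp add: subset_iff cong: ball_cong)

end

theorem proposition9p3:
  fixes X :: "('n::finite) proj set" and \<omega> :: "'n two_form"
    and G :: "('g, 'm) monoid_scheme" and \<phi> :: "'g \<Rightarrow> 'n proj \<Rightarrow> 'n proj"
  assumes "symplectic_variety X \<omega>"
    and "group_action G X \<phi>"
    and "finite (carrier G)"
    and "\<forall>g\<in>carrier G. symplectic_automorphism X \<omega> (\<phi> g)"
  shows "(\<forall>g\<in>carrier G. \<forall>h\<in>carrier G. \<forall>Y\<in>shared_components X G \<phi> g h.
            transverse_along X (\<phi> g) (\<phi> h) Y \<longrightarrow>
            inverse (restrict_section (fixed_locus X (\<phi> g)) (lam X (\<phi> g)) Y *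
                     restrict_section (fixed_locus X (\<phi> h)) (lam X (\<phi> h)) Y) *
            restrict_section (fixed_locus X (\<phi> (g \<otimes>\<^bsub>G\<^esub> h))) (lam X (\<phi> (g \<otimes>\<^bsub>G\<^esub> h))) Y =
            cup_coeff X \<omega> G \<phi> g h Y) \<and>
         (\<forall>g\<in>carrier G. \<forall>h\<in>carrier G. \<forall>Z\<in>zariski_components (fixed_locus X (\<phi> g)).
            lam X (\<phi> g) Z = lam X (\<phi> (h \<otimes>\<^bsub>G\<^esub> g \<otimes>\<^bsub>G\<^esub> inv\<^bsub>G\<^esub> h)) (\<phi> h ` Z))"
proof -
  have "symplectic_action X \<omega> G \<phi>"
    using assms unfolding symplectic_action_def by blast
  then interpret symplectic_action X \<omega> G \<phi> .
  show ?thesis using cup_coeff_lam lam_conjugate by blast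
qed

end
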